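(* Let $k$ be a field of characteristic zero, $R=k[x_1,x_2,x_3]$, $S=k[y_1,y_2,y_3]$. For a positive integer $e$, let $\mathcal F_e$ be the family of algebras $R/\mathrm{Ann}(M)$, where $M=(F,G)\subset S$ is the $R$-submodule generated by two forms $F,G$ with $\deg F=\deg G=e$ such that $l_1\circ F=0$ and $(l_1l_2)\circ G=0$ for some (not necessarily distinct) nonzero linear forms $l_1,l_2\in R$. Let $h^{(e)}=(h_0,h_1,\dots,h_e)$ be defined by $$h_d=\min\{2d+1,\ e+2,\ 3(e-d)+2\},\qquad d=0,1,\dots,e.$$ Then: (1) The generic element of $\mathcal F_e$ has $h$-vector $h^{(e)}$. (2) For $e\ge 6$, every artinian level algebra with $h$-vector $h^{(e)}$ (presented as a quotient of $R$) belongs to $\mathcal F_e$, and $\mathcal F_e$ is an irreducible variety of dimension $3(e+1)$. (3) For every odd $e\ge 9$ and every even $e\ge 12$, no artinian level algebra with $h$-vector $h^{(e)}$ satisfies the Weak Lefschetz Property.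
   Context: All algebras are standard graded quotients $A=R/I$ of a polynomial ring $R=k[x_1,\dots,x_r]$ by a homogeneous ideal $I$. If $A$ is artinian, its $h$-vector is $(h_0,\dots,h_e)$ with $h_i=\dim_k A_i$, where $e$ (the socle degree) is the last index with $A_e\neq 0$. The socle of $A$ is the annihilator in $A$ of the maximal homogeneous ideal; $A$ is level (of type $t$) if its socle is concentrated in degree $e$ (and has dimension $t=h_e$ there). $A$ has the Weak Lefschetz Property if there is a linear form $l\in R$ such that for all $i=0,\dots,e-1$ the multiplication map $\cdot l:A_i\to A_{i+1}$ has maximal rank (i.e. is injective or surjective). Inverse systems: $S=k[y_1,\dots,y_r]$ is a graded $R$-module, $x_i$ acting as $\partial/\partial y_i$; the action is written $\circ$. For a finitely generated graded $R$-submodule $M\subset S$, $\mathrm{Ann}(M)\subset R$ is its annihilator. The correspondence $M\leftrightarrow R/\mathrm{Ann}(M)$ is a bijection between finitely generated graded $R$-submodules of $S$ and graded artinian quotients of $R$; level algebras of type $t$ and socle degree $e$ correspond to submodules minimally generated by $t$ forms of degree $e$. Variety structure: an algebra $R/\mathrm{Ann}(F,G)$ in $\mathcal F_e$ (with $F,G$ linearly independent, i.e. of type two) is identified with the two-dimensional subspace $\langle F,G\rangle\subset S_e$, so $\mathcal F_e$ is regarded as a subset of the Grassmannian of two-dimensional subspaces of $S_e$, with the Zariski topology. "The generic element" means every element of some nonempty Zariski-open subset of $\mathcal F_e$.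
   Formalization: Irreducibility and dimension 3(e+1) of F_e are proved for every k, but that F_e is a subvariety (locally closed in the Grassmannian) is claimed only for algebraically closed k, since for the set of k-points it fails e.g. over the real numbers. *)

theory Defs
  imports
    "HOL-Algebra.Algebraic_Closure_Type"
    "HOL-Algebra.Embedded_Algebras"
    "HOL-Algebra.QuotRing"
    "HOL-Library.Poly_Mapping"
    "HOL-Library.Extended_Nat"
    "HOL-Library.Numeral_Type"
    "HOL-Analysis.Function_Topology"
begin

section \<open>Polynomials\<close>

text \<open>Monomials are exponent vectors and polynomials are finitely supported coefficient
  functions on monomials, with the convolution product of \<^theory>\<open>HOL-Library.Poly_Mapping\<close>.
  Both \<open>R = k[x\<^sub>1,x\<^sub>2,x\<^sub>3]\<close> and \<open>S = k[y\<^sub>1,y\<^sub>2,y\<^sub>3]\<close> are the type \<open>'k poly3\<close>; the three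
  variables are indexed by the three elements \<open>0, 1, 2\<close> of the numeral type \<open>3\<close>.\<close>

type_synonym 'i mon = "'i \<Rightarrow>\<^sub>0 nat"
type_synonym ('i, 'k) mpoly = "'i mon \<Rightarrow>\<^sub>0 'k"
type_synonym 'k poly3 = "(3, 'k) mpoly"

definition mdeg :: "'i mon \<Rightarrow> nat" where
  "mdeg m = (\<Sum>i\<in>Poly_Mapping.keys m. Poly_Mapping.lookup m i)"

definition forms :: "nat \<Rightarrow> ('i, 'k::zero) mpoly set" where
  "forms d = {f. \<forall>m\<in>Poly_Mapping.keys f. mdeg m = d}"

definition hom_component :: "nat \<Rightarrow> ('i, 'k::comm_monoid_add) mpoly \<Rightarrow> ('i, 'k) mpoly" where
  "hom_component d f =
     (\<Sum>m\<in>{m \<in> Poly_Mapping.keys f. mdeg m = d}. Poly_Mapping.single m (Poly_Mapping.lookup f m))"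

definition const :: "'k::zero \<Rightarrow> ('i, 'k) mpoly" where
  "const c = Poly_Mapping.single 0 c"

definition scale :: "'k::comm_semiring_1 \<Rightarrow> ('i, 'k) mpoly \<Rightarrow> ('i, 'k) mpoly" where
  "scale c f = const c * f"

definition eval_mpoly :: "('i \<Rightarrow> 'k::comm_semiring_1) \<Rightarrow> ('i, 'k) mpoly \<Rightarrow> 'k" where
  "eval_mpoly a p = (\<Sum>m\<in>Poly_Mapping.keys p. Poly_Mapping.lookup p m *
     (\<Prod>i\<in>Poly_Mapping.keys m. a i ^ Poly_Mapping.lookup m i))"


section \<open>Graded quotients \<open>A = R/I\<close>\<close>

abbreviation polyring :: "'k::comm_ring_1 poly3 ring" where
  "polyring \<equiv> ring_of_type_algebra"

definition homogeneous_ideal :: "'k::comm_ring_1 poly3 set \<Rightarrow> bool" where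
  "homogeneous_ideal I \<longleftrightarrow> ideal I polyring \<and> (\<forall>f\<in>I. \<forall>d. hom_component d f \<in> I)"

abbreviation quotient_alg :: "'k::comm_ring_1 poly3 set \<Rightarrow> 'k poly3 set ring" where
  "quotient_alg I \<equiv> polyring Quot I"

abbreviation residue :: "'k::comm_ring_1 poly3 set \<Rightarrow> 'k poly3 \<Rightarrow> 'k poly3 set" where
  "residue I f \<equiv> I +>\<^bsub>polyring\<^esub> f"

definition graded_piece :: "'k::comm_ring_1 poly3 set \<Rightarrow> nat \<Rightarrow> 'k poly3 set set" where
  "graded_piece I d = residue I ` forms d"

text \<open>The image of \<open>k\<close> in \<open>A\<close>, over which dimensions are taken.\<close>

definition scalars :: "'k::comm_ring_1 poly3 set \<Rightarrow> 'k poly3 set set" where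
  "scalars I = range (\<lambda>c. residue I (const c))"

definition artinian_ring :: "('a, 'b) ring_scheme \<Rightarrow> bool" where
  "artinian_ring A \<longleftrightarrow>
     (\<forall>J :: nat \<Rightarrow> 'a set. (\<forall>n. ideal (J n) A \<and> J (Suc n) \<subseteq> J n) \<longrightarrow> (\<exists>N. \<forall>n\<ge>N. J n = J N))"

definition has_socle_degree :: "'k::comm_ring_1 poly3 set \<Rightarrow> nat \<Rightarrow> bool" where
  "has_socle_degree I e \<longleftrightarrow> graded_piece I e \<noteq> {\<zero>\<^bsub>quotient_alg I\<^esub>} \<and>
     (\<forall>d>e. graded_piece I d = {\<zero>\<^bsub>quotient_alg I\<^esub>})"

definition has_hvector :: "'k::comm_ring_1 poly3 set \<Rightarrow> nat \<Rightarrow> (nat \<Rightarrow> nat) \<Rightarrow> bool" where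
  "has_hvector I e h \<longleftrightarrow> has_socle_degree I e \<and>
     (\<forall>d\<le>e. ring.dimension (quotient_alg I) (h d) (scalars I) (graded_piece I d))"

definition max_hom_ideal :: "'k::comm_ring_1 poly3 set \<Rightarrow> 'k poly3 set set" where
  "max_hom_ideal I = residue I ` {f. Poly_Mapping.lookup f 0 = 0}"

definition socle :: "'k::comm_ring_1 poly3 set \<Rightarrow> 'k poly3 set set" where
  "socle I = {a \<in> carrier (quotient_alg I).
     \<forall>x\<in>max_hom_ideal I. x \<otimes>\<^bsub>quotient_alg I\<^esub> a = \<zero>\<^bsub>quotient_alg I\<^esub>}"

definition artinian_level :: "'k::comm_ring_1 poly3 set \<Rightarrow> bool" where
  "artinian_level I \<longleftrightarrow> homogeneous_ideal I \<and> artinian_ring (quotient_alg I) \<and>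
     (\<exists>e. has_socle_degree I e \<and> socle I \<subseteq> graded_piece I e)"

definition weak_Lefschetz :: "'k::comm_ring_1 poly3 set \<Rightarrow> bool" where
  "weak_Lefschetz I \<longleftrightarrow> (\<exists>e. has_socle_degree I e \<and> (\<exists>l\<in>forms 1. \<forall>i<e.
     let mult_l = (\<lambda>a. residue I l \<otimes>\<^bsub>quotient_alg I\<^esub> a)
     in inj_on mult_l (graded_piece I i) \<or> mult_l ` graded_piece I i = graded_piece I (Suc i)))"


section \<open>Inverse systems\<close>

definition pd :: "3 \<Rightarrow> 'k::comm_semiring_1 poly3 \<Rightarrow> 'k poly3" where
  "pd i G = (\<Sum>m\<in>Poly_Mapping.keys G. Poly_Mapping.single (m - Poly_Mapping.single i 1)
     (of_nat (Poly_Mapping.lookup m i) * Poly_Mapping.lookup G m))"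

definition act :: "'k::comm_semiring_1 poly3 \<Rightarrow> 'k poly3 \<Rightarrow> 'k poly3" (infixr \<open>\<circ>\<^sub>d\<close> 75) where
  "f \<circ>\<^sub>d G = (\<Sum>m\<in>Poly_Mapping.keys f. scale (Poly_Mapping.lookup f m)
     ((pd 0 ^^ Poly_Mapping.lookup m 0) ((pd 1 ^^ Poly_Mapping.lookup m 1)
       ((pd 2 ^^ Poly_Mapping.lookup m 2) G))))"

definition Ann :: "'k::comm_semiring_1 poly3 set \<Rightarrow> 'k poly3 set" where
  "Ann M = {f. \<forall>G\<in>M. f \<circ>\<^sub>d G = 0}"

text \<open>The ideal \<open>Ann(M)\<close>, where \<open>M\<close> is the \<open>R\<close>-submodule of \<open>S\<close> generated by \<open>W\<close>;
  for \<open>W = \<langle>F,G\<rangle>\<close> this is the submodule \<open>(F,G)\<close>.\<close>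

definition inverse_system_ideal :: "'k::comm_ring_1 poly3 set \<Rightarrow> 'k poly3 set" where
  "inverse_system_ideal W = Ann (module.span act W)"


section \<open>The Zariski topology on the Grassmannian\<close>

definition grassmannian :: "nat \<Rightarrow> 'k::field poly3 set set" where
  "grassmannian e = {W. W \<subseteq> forms e \<and> module.subspace scale W \<and> vector_space.dim scale W = 2}"

definition plucker :: "'k::comm_ring_1 poly3 \<Rightarrow> 'k poly3 \<Rightarrow> 3 mon \<times> 3 mon \<Rightarrow> 'k" where
  "plucker F G = (\<lambda>(m, n). Poly_Mapping.lookup F m * Poly_Mapping.lookup G n
     - Poly_Mapping.lookup F n * Poly_Mapping.lookup G m)"

text \<open>Complement of the hypersurface \<open>p = 0\<close> in the Pluecker embedding. For homogeneous \<open>p\<close> the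
  condition does not depend on the basis \<open>F, G\<close>, since a change of basis multiplies all
  Pluecker coordinates by its determinant.\<close>

definition basic_open :: "nat \<Rightarrow> (3 mon \<times> 3 mon, 'k::field) mpoly \<Rightarrow> 'k poly3 set set" where
  "basic_open e p = {W \<in> grassmannian e.
     \<exists>F G. W = module.span scale {F, G} \<and> eval_mpoly (plucker F G) p \<noteq> 0}"

definition zariski :: "nat \<Rightarrow> 'k::field poly3 set topology" where
  "zariski e = topology_generated_by {basic_open e p | p d. p \<in> forms d}"

definition irreducible_space :: "'a topology \<Rightarrow> bool" where
  "irreducible_space T \<longleftrightarrow> topspace T \<noteq> {} \<and>
     (\<forall>C D. closedin T C \<and> closedin T D \<and> C \<union> D = topspace T \<longrightarrow>
        C = topspace T \<or> D = topspace T)"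

definition krull_dim :: "'a topology \<Rightarrow> enat" where
  "krull_dim T = Sup {enat n | n.
     \<exists>Z :: nat \<Rightarrow> 'a set. (\<forall>i\<le>n. closedin T (Z i) \<and> irreducible_space (subtopology T (Z i))) \<and>
       (\<forall>i<n. Z i \<subset> Z (Suc i))}"

definition locally_closed_in :: "'a topology \<Rightarrow> 'a set \<Rightarrow> bool" where
  "locally_closed_in T V \<longleftrightarrow> (\<exists>U C. openin T U \<and> closedin T C \<and> V = U \<inter> C)"


section \<open>The family \<open>\<F>\<^sub>e\<close>\<close>

text \<open>An algebra \<open>R/Ann(F,G)\<close> with \<open>F, G\<close> linearly independent is identified with the plane
  \<open>W = \<langle>F,G\<rangle>\<close>; the algebra is recovered as \<open>R/inverse_system_ideal W\<close>.\<close>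

definition family :: "nat \<Rightarrow> 'k::field poly3 set set" where
  "family e = {W \<in> grassmannian e. \<exists>F\<in>forms e. \<exists>G\<in>forms e. W = module.span scale {F, G} \<and>
     (\<exists>l1\<in>forms 1 - {0}. \<exists>l2\<in>forms 1 - {0}. l1 \<circ>\<^sub>d F = 0 \<and> (l1 * l2) \<circ>\<^sub>d G = 0)}"

definition hvec :: "nat \<Rightarrow> nat \<Rightarrow> nat" where
  "hvec e d = Min {2 * d + 1, e + 2, 3 * (e - d) + 2}"

text \<open>Over a field that is not algebraically closed the set of \<open>k\<close>-rational members of the family
  is in general not locally closed in the Grassmannian (limits of planes spanned by a form and
  its conjugate over a quadratic extension), so being a subvariety is asked for only over an
  algebraically closed \<open>k\<close>; irreducibility and dimension refer to the Zariski topology on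
  \<open>family e\<close> for every \<open>k\<close>.\<close>

definition irreducible_variety_of_dim ::
    "nat \<Rightarrow> 'k::field poly3 set set \<Rightarrow> nat \<Rightarrow> bool" where
  "irreducible_variety_of_dim e V n \<longleftrightarrow>
     irreducible_space (subtopology (zariski e) V) \<and>
     krull_dim (subtopology (zariski e) V) = enat n \<and>
     ((\<forall>p :: 'k poly. Polynomial.degree p > 0 \<longrightarrow> (\<exists>x. poly p x = 0)) \<longrightarrow>
        locally_closed_in (zariski e) V)"

end

theory Submission imports Defs begin

text \<open>If a level algebra has the given h-vector, its inverse system is generated by two forms \<open>F, G\<close>.
  Counting dimensions in degree \<open>e - 1\<close> gives a linear relation \<open>a \<circ> F + b \<circ> G = 0\<close>, and in degree
  \<open>2\<close> a quadric \<open>Q\<close> killing \<open>F\<close> and \<open>G\<close>. The products of the relation with the variables and the two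
  relations coming from \<open>Q\<close> exceed by one the number of quadratic relations that the h-vector permits;
  the resulting dependency factors \<open>Q\<close> and makes one factor kill a combination of \<open>F\<close> and \<open>G\<close>.
  Such an algebra fails the weak Lefschetz property in the flat part of its h-vector: multiplication by
  a linear form is not injective on the ideal generated by \<open>l\<^sub>1\<close>, and its cokernel modulo \<open>l\<^sub>1\<close> is
  nonzero.

  The family is dominated by an affine space of dimension \<open>3 e + 3\<close>, because forms killed by a linear form
  monic in \<open>x\<^sub>3\<close> are freely determined by their coefficients on the monomials without \<open>y\<^sub>3\<close>. This gives
  irreducibility; the upper bound for the dimension counts monomials in algebraically independent
  functions, and the lower bound comes from the images of a flag of coordinate subspaces. The generic
  h-vector follows from one example, since linear independence is an open condition. Closedness
  over an algebraically closed field is elimination of \<open>l\<^sub>1\<close> and \<open>l\<^sub>2\<close>.\<close>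

subsection \<open>Monomials\<close>

text \<open>The field need not be algebraically closed, so varieties occur only as sets of rational
  points, and their ideals only through vanishing of homogeneous functions. Characteristic zero
  makes k infinite, so lines and polynomial curves can replace generic points, and makes factorials
  invertible, so that differentiation becomes contraction. The three terms of the h-vector are three
  separate bounds: \<open>2 * d + 1\<close> because a quadric kills F and G, \<open>e + 2\<close>
  because the derivatives of \<open>l1 \<circ>\<^sub>d G\<close> are killed by \<open>l2\<close>,
  and \<open>3 * (e - d) + 2\<close> by counting derivatives. For \<open>e \<ge> 6\<close> the
  minimum is 5, 5 and 8 in degrees 2, e - 1 and e - 2, just what the syzygy count uses. The numbers
  9 and 12 are the least odd and the least even e for which two consecutive degrees lie on the
  plateau of value e + 2. The dimension is e + e + (e - 1) + 2 + 2: free coefficients of F, G,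
  \<open>l1 \<circ>\<^sub>d G\<close> and the two linear forms after normalization.\<close>

lemma UNIV_3_eq: "(UNIV :: 3 set) = {0, 1, 2}"
  by (rule card_subset_eq[symmetric]) simp_all

lemma distinct_3: "(0::3) \<noteq> 1" "(0::3) \<noteq> 2" "(1::3) \<noteq> 2" "(1::3) \<noteq> 0" "(2::3) \<noteq> 0" "(2::3) \<noteq> 1"
  by simp_all

lemma sum_3: "(\<Sum>i\<in>UNIV. f (i::3)) = f 0 + f 1 + (f 2 :: 'a::comm_monoid_add)"
  unfolding UNIV_3_eq by (simp add: add.assoc)

definition mon3 :: "nat \<Rightarrow> nat \<Rightarrow> nat \<Rightarrow> 3 mon" where
  "mon3 i j k = Poly_Mapping.single 0 i + Poly_Mapping.single 1 j + Poly_Mapping.single 2 k"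

lemma lookup_mon3 [simp]:
  "Poly_Mapping.lookup (mon3 i j k) 0 = i"
  "Poly_Mapping.lookup (mon3 i j k) 1 = j"
  "Poly_Mapping.lookup (mon3 i j k) 2 = k"
  by (simp_all add: mon3_def lookup_add lookup_single when_def)

lemma mon_eq_iff:
  "m = n \<longleftrightarrow> Poly_Mapping.lookup m 0 = Poly_Mapping.lookup n 0 \<and>
    Poly_Mapping.lookup m 1 = Poly_Mapping.lookup n 1 \<and>
    Poly_Mapping.lookup m 2 = Poly_Mapping.lookup n (2::3)" for m n :: "3 mon"
proof -
  have "(\<forall>i. Poly_Mapping.lookup m i = Poly_Mapping.lookup n i) \<longleftrightarrow>
    (\<forall>i\<in>{0,1,2}. Poly_Mapping.lookup m i = Poly_Mapping.lookup n i)"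
    unfolding UNIV_3_eq[symmetric] by simp
  then show ?thesis by (auto simp: poly_mapping_eq_iff fun_eq_iff)
qed

lemma mon3_eta: "mon3 (Poly_Mapping.lookup m 0) (Poly_Mapping.lookup m 1) (Poly_Mapping.lookup m 2) = m"
  by (simp add: mon_eq_iff)

lemma mon3_cases: obtains i j k where "m = mon3 i j k"
  using mon3_eta by metis

lemma mon3_add: "mon3 i j k + mon3 i' j' k' = mon3 (i + i') (j + j') (k + k')"
  by (simp add: mon_eq_iff lookup_add)

lemma mon3_inject [simp]: "mon3 i j k = mon3 i' j' k' \<longleftrightarrow> i = i' \<and> j = j' \<and> k = k'"
  by (simp add: mon_eq_iff)

lemma mdeg_3: "mdeg m = Poly_Mapping.lookup m 0 + Poly_Mapping.lookup m 1 + Poly_Mapping.lookup m (2::3)"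
proof -
  have "mdeg m = (\<Sum>i\<in>UNIV. Poly_Mapping.lookup m i)"
    unfolding mdeg_def by (rule sum.mono_neutral_left) (auto simp: in_keys_iff)
  then show ?thesis by (simp add: sum_3)
qed

lemma mdeg_mon3 [simp]: "mdeg (mon3 i j k) = i + j + k"
  by (simp add: mdeg_3)

lemma mdeg_eq_sum: "finite A \<Longrightarrow> Poly_Mapping.keys m \<subseteq> A \<Longrightarrow> mdeg m = (\<Sum>i\<in>A. Poly_Mapping.lookup m i)"
  unfolding mdeg_def by (rule sum.mono_neutral_left) (auto simp: in_keys_iff)

lemma mdeg_add [simp]: "mdeg (m + n) = mdeg m + mdeg n"
proof -
  let ?A = "Poly_Mapping.keys m \<union> Poly_Mapping.keys n"
  have "mdeg (m + n) = (\<Sum>i\<in>?A. Poly_Mapping.lookup (m + n) i)"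
    by (rule mdeg_eq_sum) (use keys_add[of m n] in auto)
  also have "\<dots> = mdeg m + mdeg n"
    by (simp add: lookup_add sum.distrib mdeg_eq_sum[of ?A m] mdeg_eq_sum[of ?A n])
  finally show ?thesis .
qed

lemma mdeg_zero [simp]: "mdeg 0 = 0"
  by (simp add: mdeg_def)

lemma mdeg_single [simp]: "mdeg (Poly_Mapping.single i k) = k"
  by (simp add: mdeg_def)

lemma mdeg_eq_0_iff [simp]: "mdeg m = 0 \<longleftrightarrow> m = 0"
proof
  assume "mdeg m = 0"
  then have "\<forall>i\<in>Poly_Mapping.keys m. Poly_Mapping.lookup m i = 0" by (simp add: mdeg_def)
  then show "m = 0" by (auto simp: in_keys_iff poly_mapping_eq_iff fun_eq_iff)
qed simp

definition mons :: "nat \<Rightarrow> 3 mon set" where "mons d = {m. mdeg m = d}"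

lemma mons_iff [simp]: "m \<in> mons d \<longleftrightarrow> mdeg m = d"
  by (simp add: mons_def)

lemma mons_eq: "mons d = (\<lambda>(i, j). mon3 i j (d - i - j)) ` (SIGMA i:{..d}. {..d - i})"
proof (rule Set.set_eqI, rule iffI)
  fix m assume "m \<in> mons d"
  obtain i j k where m: "m = mon3 i j k" by (rule mon3_cases)
  have "i + j + k = d" using \<open>m \<in> mons d\<close> m by simp
  then show "m \<in> (\<lambda>(i, j). mon3 i j (d - i - j)) ` (SIGMA i:{..d}. {..d - i})"
    unfolding m by (intro image_eqI[of _ _ "(i, j)"]) auto
qed auto

lemma finite_mons [simp, intro]: "finite (mons d)"
  unfolding mons_eq by auto

lemma card_mons: "card (mons d) = (d + 2) choose 2"
proof -
  have "card (mons d) = card (SIGMA i:{..d}. {..d - i})"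
    unfolding mons_eq by (rule card_image) (auto simp: inj_on_def)
  also have "\<dots> = (\<Sum>i\<le>d. Suc (d - i))" by simp
  also have "\<dots> = (\<Sum>i\<le>d. Suc i)"
    by (rule sum.reindex_bij_witness[of _ "\<lambda>i. d - i" "\<lambda>i. d - i"]) auto
  also have "\<dots> = (d + 2) choose 2"
  proof (induction d)
    case 0 show ?case by (simp add: choose_two)
  next
    case (Suc d)
    then show ?case by (simp add: numeral_2_eq_2)
  qed
  finally show ?thesis .
qed

section \<open>Scalar multiplication and linear functionals on polynomials\<close>

lemma lookup_scale [simp]: "Poly_Mapping.lookup (scale c f) m = c * Poly_Mapping.lookup f m"
proof -
  have "scale c f = Poly_Mapping.map ((*) c) f"
    unfolding scale_def const_def by (rule mult_map_scale_conv_mult[symmetric])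
  then show ?thesis by (simp add: Poly_Mapping.map.rep_eq when_def)
qed

interpretation sc: vector_space "scale :: 'k::field \<Rightarrow> ('i, 'k) mpoly \<Rightarrow> ('i, 'k) mpoly"
  by unfold_locales (auto intro!: poly_mapping_eqI simp: lookup_add algebra_simps)

lemma scale_mult_left: "scale c f * g = scale c (f * g)"
  by (simp add: scale_def mult.assoc)

lemma scale_mult_right: "f * scale c g = scale c (f * g)"
  by (simp add: scale_def mult.left_commute)

lemma poly_mapping_sum_single:
  "finite A \<Longrightarrow> Poly_Mapping.keys f \<subseteq> A \<Longrightarrow>
    f = (\<Sum>m\<in>A. Poly_Mapping.single m (Poly_Mapping.lookup f m))"
proof (rule poly_mapping_eqI)
  fix k assume A: "finite A" "Poly_Mapping.keys f \<subseteq> A"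
  have "Poly_Mapping.lookup (\<Sum>m\<in>A. Poly_Mapping.single m (Poly_Mapping.lookup f m)) k
    = (\<Sum>m\<in>A. if m = k then Poly_Mapping.lookup f k else 0)"
    unfolding lookup_sum by (intro sum.cong) (auto simp: lookup_single when_def)
  also have "\<dots> = Poly_Mapping.lookup f k"
    using A by (auto simp: in_keys_iff)
  finally show "Poly_Mapping.lookup f k
    = Poly_Mapping.lookup (\<Sum>m\<in>A. Poly_Mapping.single m (Poly_Mapping.lookup f m)) k" by simp
qed

text \<open>A function \<open>\<phi>\<close> on monomials is the same as a linear functional on polynomials; \<open>pair f \<phi>\<close> is its
  value at \<open>f\<close>.\<close>

definition pair :: "('a \<Rightarrow>\<^sub>0 'k::comm_semiring_1) \<Rightarrow> ('a \<Rightarrow> 'k) \<Rightarrow> 'k" where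
  "pair f \<phi> = (\<Sum>m\<in>Poly_Mapping.keys f. Poly_Mapping.lookup f m * \<phi> m)"

lemma pair_eq_sum:
  "finite A \<Longrightarrow> Poly_Mapping.keys f \<subseteq> A \<Longrightarrow> pair f \<phi> = (\<Sum>m\<in>A. Poly_Mapping.lookup f m * \<phi> m)"
  unfolding pair_def by (rule sum.mono_neutral_left) (auto simp: in_keys_iff)

lemma pair_zero [simp]: "pair 0 \<phi> = 0"
  by (simp add: pair_def)

lemma pair_single [simp]: "pair (Poly_Mapping.single m c) \<phi> = c * \<phi> m"
  using pair_eq_sum[of "{m}" "Poly_Mapping.single m c" \<phi>] by simp

lemma pair_add: "pair (f + g) \<phi> = pair f \<phi> + pair g \<phi>"
proof -
  let ?A = "Poly_Mapping.keys f \<union> Poly_Mapping.keys g"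
  have "pair (f + g) \<phi> = (\<Sum>m\<in>?A. Poly_Mapping.lookup (f + g) m * \<phi> m)"
    by (rule pair_eq_sum) (use keys_add[of f g] in auto)
  then show ?thesis
    by (simp add: lookup_add distrib_right sum.distrib pair_eq_sum[of ?A f] pair_eq_sum[of ?A g])
qed

lemma pair_sum: "pair (\<Sum>x\<in>A. f x) \<phi> = (\<Sum>x\<in>A. pair (f x) \<phi>)"
  by (induction A rule: infinite_finite_induct) (auto simp: pair_add)

lemma pair_scale: "pair (scale c f) \<phi> = c * pair f \<phi>"
proof -
  have "Poly_Mapping.keys (scale c f) \<subseteq> Poly_Mapping.keys f"
    by (auto simp: in_keys_iff)
  then have "pair (scale c f) \<phi> = (\<Sum>m\<in>Poly_Mapping.keys f. Poly_Mapping.lookup (scale c f) m * \<phi> m)"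
    by (intro pair_eq_sum) auto
  then show ?thesis by (simp add: pair_def sum_distrib_left mult.assoc)
qed

lemma pair_add_right: "pair f (\<lambda>m. \<phi> m + \<psi> m) = pair f \<phi> + pair f \<psi>"
  by (simp add: pair_def distrib_left sum.distrib)

lemma pair_mult_right: "pair f (\<lambda>m. c * \<phi> m) = c * pair f \<phi>"
  by (simp add: pair_def sum_distrib_left mult.left_commute)

lemma pair_zero_right [simp]: "pair f (\<lambda>m. 0) = 0"
  by (simp add: pair_def)

lemma pair_cong: "(\<And>m. m \<in> Poly_Mapping.keys f \<Longrightarrow> \<phi> m = \<psi> m) \<Longrightarrow> pair f \<phi> = pair f \<psi>"
  by (simp add: pair_def)

text \<open>Multiplication by a monomial shifts the functional. With \<open>hat G\<close> as
  functional this becomes the module law \<open>act_mult\<close>.\<close>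

lemma pair_mult: "pair (f * g) \<phi> = pair f (\<lambda>m. pair g (\<lambda>n. \<phi> (m + n)))"
proof -
  have f: "f = (\<Sum>m\<in>Poly_Mapping.keys f. Poly_Mapping.single m (Poly_Mapping.lookup f m))"
    and g: "g = (\<Sum>m\<in>Poly_Mapping.keys g. Poly_Mapping.single m (Poly_Mapping.lookup g m))"
    by (rule poly_mapping_sum_single; simp)+
  have "pair (f * g) \<phi> = pair ((\<Sum>m\<in>Poly_Mapping.keys f. Poly_Mapping.single m (Poly_Mapping.lookup f m)) *
     (\<Sum>m\<in>Poly_Mapping.keys g. Poly_Mapping.single m (Poly_Mapping.lookup g m))) \<phi>"
    using f g by simp
  also have "\<dots> = (\<Sum>m\<in>Poly_Mapping.keys f. \<Sum>n\<in>Poly_Mapping.keys g.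
      Poly_Mapping.lookup f m * Poly_Mapping.lookup g n * \<phi> (m + n))"
    unfolding sum_product pair_sum mult_single pair_single ..
  also have "\<dots> = pair f (\<lambda>m. pair g (\<lambda>n. \<phi> (m + n)))"
    by (simp add: pair_def sum_distrib_left mult.assoc)
  finally show ?thesis .
qed

lemma pair_1 [simp]: "pair 1 \<phi> = \<phi> 0"
  unfolding single_one[symmetric] pair_single by simp

subsection \<open>Divided power coefficients and the action\<close>

definition mfact :: "3 mon \<Rightarrow> 'k::field_char_0" where
  "mfact m = (\<Prod>i\<in>UNIV. fact (Poly_Mapping.lookup m i))"

lemma mfact_nonzero [simp]: "mfact m \<noteq> 0"
  by (simp add: mfact_def)

text \<open>In the coordinates \<open>hat F\<close> the derivative action becomes contraction, that is, a shift.\<close>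

definition hat :: "'k::field_char_0 poly3 \<Rightarrow> 3 mon \<Rightarrow> 'k" where
  "hat F m = mfact m * Poly_Mapping.lookup F m"

lemma hat_zero [simp]: "hat 0 m = 0"
  by (simp add: hat_def)

lemma hat_add: "hat (F + G) m = hat F m + hat G m"
  by (simp add: hat_def lookup_add distrib_left)

lemma hat_scale: "hat (scale c F) m = c * hat F m"
  by (simp add: hat_def)

lemma hat_sum: "hat (\<Sum>x\<in>A. f x) m = (\<Sum>x\<in>A. hat (f x) m)"
  by (induction A rule: infinite_finite_induct) (auto simp: hat_add)

lemma hat_inject: "F = G \<longleftrightarrow> (\<forall>m. hat F m = hat G m)"
  by (auto simp: hat_def poly_mapping_eq_iff fun_eq_iff)

lemma lookup_pd:
  "Poly_Mapping.lookup (pd i G) m = of_nat (Suc (Poly_Mapping.lookup m i)) *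
     Poly_Mapping.lookup G (m + Poly_Mapping.single i 1)"
proof -
  let ?s = "Poly_Mapping.single i (1::nat)"
  \<comment> \<open>Exponent subtraction is truncated, so a monomial without the variable i may also
    be sent to m; its factor \<open>of_nat 0\<close> removes it.\<close>
  have eq: "(of_nat (Poly_Mapping.lookup n i) * Poly_Mapping.lookup G n when n - ?s = m)
     = (if n = m + ?s then of_nat (Suc (Poly_Mapping.lookup m i)) * Poly_Mapping.lookup G (m + ?s) else 0)" for n
  proof (cases "n = m + ?s")
    case True
    then show ?thesis by (simp add: lookup_add)
  next
    case False
    have "Poly_Mapping.lookup n i = 0" if "n - ?s = m"
    proof (rule ccontr)
      assume "Poly_Mapping.lookup n i \<noteq> 0"
      then have "n = (n - ?s) + ?s"
        by (intro poly_mapping_eqI) (auto simp: lookup_add lookup_minus lookup_single when_def)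
      then show False using that False by simp
    qed
    then show ?thesis using False by (auto simp: when_def)
  qed
  have "Poly_Mapping.lookup (pd i G) m =
    (\<Sum>n\<in>Poly_Mapping.keys G. (of_nat (Poly_Mapping.lookup n i) * Poly_Mapping.lookup G n when n - ?s = m))"
    unfolding pd_def lookup_sum by (simp add: lookup_single)
  also have "\<dots> = of_nat (Suc (Poly_Mapping.lookup m i)) * Poly_Mapping.lookup G (m + ?s)"
    unfolding eq by (auto simp: in_keys_iff)
  finally show ?thesis .
qed

text \<open>The extra factor is the one that differentiation produces in \<open>lookup_pd\<close>,
  so it cancels in \<open>hat_pd\<close>.\<close>

lemma mfact_add_single:
  "mfact (m + Poly_Mapping.single i 1) = of_nat (Suc (Poly_Mapping.lookup m i)) * mfact m"
proof -
  have "mfact (m + Poly_Mapping.single i 1) =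
    (\<Prod>j\<in>UNIV. (if j = i then of_nat (Suc (Poly_Mapping.lookup m i)) else 1) * fact (Poly_Mapping.lookup m j) :: 'a)"
    unfolding mfact_def
    by (rule prod.cong) (auto simp: lookup_add lookup_single when_def fact_Suc)
  then show ?thesis
    by (simp add: prod.distrib mfact_def)
qed

lemma hat_pd: "hat (pd i G) m = hat G (m + Poly_Mapping.single i 1)"
  unfolding hat_def lookup_pd mfact_add_single by (simp add: mult_ac)

lemma hat_pd_funpow: "hat ((pd i ^^ k) G) m = hat G (m + Poly_Mapping.single i k)"
proof (induction k arbitrary: m)
  case (Suc k)
  have "Poly_Mapping.single i (Suc k) = Poly_Mapping.single i 1 + Poly_Mapping.single i k"
    by (simp add: single_add[symmetric])
  then show ?case by (simp add: hat_pd Suc add.assoc)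
qed simp

text \<open>Contraction formula: an operator is evaluated, as a polynomial, on the shifted
  coefficient table. The module laws of \<open>act\<close> reduce through it to laws of
  \<open>pair\<close>.\<close>

lemma hat_act: "hat (f \<circ>\<^sub>d G) n = pair f (\<lambda>m. hat G (m + n))"
proof -
  have "n + Poly_Mapping.single 0 (Poly_Mapping.lookup m 0) + Poly_Mapping.single 1 (Poly_Mapping.lookup m 1) +
     Poly_Mapping.single 2 (Poly_Mapping.lookup m 2) = m + n" for m :: "3 mon"
    using mon3_eta[of m] by (simp add: mon3_def add_ac)
  then show ?thesis
    unfolding act_def hat_sum hat_scale hat_pd_funpow pair_def by simp
qed

lemma act_mult: "(f * g) \<circ>\<^sub>d H = f \<circ>\<^sub>d (g \<circ>\<^sub>d H)"
  for H :: "'k::field_char_0 poly3"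
  by (auto simp: hat_inject hat_act pair_mult add.assoc add.left_commute intro!: pair_cong)

lemma act_add_left: "(f + g) \<circ>\<^sub>d H = f \<circ>\<^sub>d H + g \<circ>\<^sub>d H"
  for H :: "'k::field_char_0 poly3"
  by (simp add: hat_inject hat_act hat_add pair_add)

lemma act_add_right: "f \<circ>\<^sub>d (G + H) = f \<circ>\<^sub>d G + f \<circ>\<^sub>d H"
  for H :: "'k::field_char_0 poly3"
  by (simp add: hat_inject hat_act hat_add pair_add_right)

lemma act_one [simp]: "1 \<circ>\<^sub>d G = G"
  for G :: "'k::field_char_0 poly3"
  by (simp add: hat_inject hat_act)

lemma act_scale_left: "scale c f \<circ>\<^sub>d G = scale c (f \<circ>\<^sub>d G)"
  for G :: "'k::field_char_0 poly3"
  by (simp add: hat_inject hat_act hat_scale pair_scale)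

lemma act_scale_right: "f \<circ>\<^sub>d scale c G = scale c (f \<circ>\<^sub>d G)"
  for G :: "'k::field_char_0 poly3"
  by (simp add: hat_inject hat_act hat_scale pair_mult_right)

lemma act_zero_left [simp]: "0 \<circ>\<^sub>d G = 0"
  for G :: "'k::field_char_0 poly3"
  by (simp add: hat_inject hat_act)

lemma act_zero_right [simp]: "f \<circ>\<^sub>d 0 = 0"
  for f :: "'k::field_char_0 poly3"
  by (simp add: hat_inject hat_act)

lemma act_commute: "f \<circ>\<^sub>d g \<circ>\<^sub>d H = g \<circ>\<^sub>d f \<circ>\<^sub>d H"
  for H :: "'k::field_char_0 poly3"
  by (simp add: act_mult[symmetric] mult.commute)

interpretation actm: Modules.module "act :: 'k::field_char_0 poly3 \<Rightarrow> 'k poly3 \<Rightarrow> 'k poly3"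
  by unfold_locales (simp_all add: act_add_left act_add_right act_mult)

subsection \<open>Forms\<close>

lemma forms_lookup: "f \<in> forms d \<longleftrightarrow> (\<forall>m. mdeg m \<noteq> d \<longrightarrow> Poly_Mapping.lookup f m = 0)"
  by (auto simp: forms_def in_keys_iff)

lemma forms_hat: "f \<in> forms d \<longleftrightarrow> (\<forall>m. mdeg m \<noteq> d \<longrightarrow> hat f m = 0)"
  by (simp add: forms_lookup hat_def)

lemma forms_keys: "f \<in> forms d \<Longrightarrow> m \<in> Poly_Mapping.keys f \<Longrightarrow> mdeg m = d"
  by (simp add: forms_def)

lemma subspace_forms: "sc.subspace (forms d :: ('i, 'k::field) mpoly set)"
  by (auto simp: sc.subspace_def forms_lookup lookup_add)

lemma zero_in_forms [simp]: "0 \<in> forms d"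
  by (simp add: forms_lookup)

lemma forms_add: "f \<in> forms d \<Longrightarrow> g \<in> forms d \<Longrightarrow> f + g \<in> forms d"
  by (simp add: forms_lookup lookup_add)

lemma forms_scale: "f \<in> forms d \<Longrightarrow> scale c f \<in> forms d"
  by (simp add: forms_lookup)

lemma forms_diff: "f \<in> forms d \<Longrightarrow> g \<in> forms d \<Longrightarrow> f - g \<in> forms d"
  for f :: "('i, 'k::ab_group_add) mpoly"
  by (simp add: forms_lookup lookup_minus)

lemma forms_sum: "(\<And>x. x \<in> A \<Longrightarrow> f x \<in> forms d) \<Longrightarrow> (\<Sum>x\<in>A. f x) \<in> forms d"
  by (induction A rule: infinite_finite_induct) (auto intro: forms_add)

lemma single_in_forms [simp]: "mdeg m = d \<Longrightarrow> Poly_Mapping.single m c \<in> forms d"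
  by (auto simp: forms_lookup lookup_single when_def)

lemma forms_mult: "f \<in> forms d \<Longrightarrow> g \<in> forms d' \<Longrightarrow> f * g \<in> forms (d + d')"
  unfolding forms_def using keys_mult[of f g] by fastforce

lemma one_in_forms [simp]: "1 \<in> forms 0"
  unfolding single_one[symmetric] by (rule single_in_forms) simp

lemma forms_power: "f \<in> forms d \<Longrightarrow> f ^ n \<in> forms (n * d)"
  by (induction n) (auto intro: forms_mult)

text \<open>Subtraction is truncated: for \<open>e < d\<close> the difference is 0, and the sharper
  fact is \<open>act_forms_eq_0\<close>.\<close>

lemma act_forms:
  fixes G :: "'k::field_char_0 poly3"
  assumes "f \<in> forms d" "G \<in> forms e"
  shows "f \<circ>\<^sub>d G \<in> forms (e - d)"
proof -
  have "hat (f \<circ>\<^sub>d G) n = 0" if "mdeg n \<noteq> e - d" for n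
    unfolding hat_act pair_def
  proof (rule sum.neutral, rule ballI)
    fix m assume "m \<in> Poly_Mapping.keys f"
    then have "mdeg (m + n) \<noteq> e" using forms_keys[OF assms(1)] that by auto
    then show "Poly_Mapping.lookup f m * hat G (m + n) = 0" using assms(2) by (simp add: forms_hat)
  qed
  then show ?thesis by (simp add: forms_hat)
qed

lemma act_forms_eq_0:
  fixes G :: "'k::field_char_0 poly3"
  assumes "f \<in> forms d" "G \<in> forms e" "e < d"
  shows "f \<circ>\<^sub>d G = 0"
proof -
  have "hat (f \<circ>\<^sub>d G) n = 0" for n
    unfolding hat_act pair_def
  proof (rule sum.neutral, rule ballI)
    fix m assume "m \<in> Poly_Mapping.keys f"
    then have "mdeg (m + n) \<noteq> e" using forms_keys[OF assms(1)] assms(3) by auto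
    then show "Poly_Mapping.lookup f m * hat G (m + n) = 0" using assms(2) by (simp add: forms_hat)
  qed
  then show ?thesis by (simp add: hat_inject)
qed

lemma forms_eq_sum:
  fixes f :: "'k::comm_monoid_add poly3"
  assumes "f \<in> forms d"
  shows "f = (\<Sum>m\<in>mons d. Poly_Mapping.single m (Poly_Mapping.lookup f m))"
  by (rule poly_mapping_sum_single) (use forms_keys[OF assms] in auto)

section \<open>The monomial basis of the space of forms\<close>

definition monf :: "3 mon \<Rightarrow> 'k::field poly3" where
  "monf m = Poly_Mapping.single m 1"

lemma lookup_monf: "Poly_Mapping.lookup (monf m) n = (if m = n then 1 else 0)"
  by (simp add: monf_def lookup_single when_def)

lemma inj_monf: "inj monf"
  by (rule injI) (metis lookup_monf zero_neq_one)

lemma monf_in_forms [simp]: "mdeg m = d \<Longrightarrow> monf m \<in> forms d"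
  by (simp add: monf_def)

lemma monf_mult: "monf m * monf n = monf (m + n)"
  by (simp add: monf_def mult_single)

lemma scale_monf: "scale c (monf m) = Poly_Mapping.single m c"
  by (rule poly_mapping_eqI) (simp add: lookup_monf lookup_single when_def)

lemma forms_eq_span: "forms d = sc.span (monf ` mons d :: 'k::field poly3 set)"
proof
  show "forms d \<subseteq> sc.span (monf ` mons d :: 'k poly3 set)"
  proof
    fix f :: "'k poly3" assume "f \<in> forms d"
    then have "f = (\<Sum>m\<in>mons d. scale (Poly_Mapping.lookup f m) (monf m))"
      using forms_eq_sum by (simp add: scale_monf)
    also have "\<dots> \<in> sc.span (monf ` mons d)"
      by (intro sc.span_sum sc.span_scale sc.span_base) auto
    finally show "f \<in> sc.span (monf ` mons d)" .
  qed
  show "sc.span (monf ` mons d :: 'k poly3 set) \<subseteq> forms d"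
    by (rule sc.span_minimal) (auto simp: subspace_forms)
qed

lemma lookup_scale_sum_monf:
  assumes "finite A"
  shows "Poly_Mapping.lookup (\<Sum>m\<in>A. scale (c m) (monf m)) n = (if n \<in> A then c n else 0)"
proof -
  have "Poly_Mapping.lookup (\<Sum>m\<in>A. scale (c m) (monf m)) n = (\<Sum>m\<in>A. if m = n then c m else 0)"
    by (auto simp: lookup_sum lookup_monf intro!: sum.cong)
  then show ?thesis using assms by simp
qed

lemma independent_monf:
  assumes "finite A" shows "sc.independent (monf ` A :: 'k::field poly3 set)"
proof (rule sc.independent_if_scalars_zero)
  fix g :: "'k poly3 \<Rightarrow> 'k" and x :: "'k poly3" assume *: "(\<Sum>x\<in>monf ` A. scale (g x) x) = 0" and "x \<in> monf ` A"
  then obtain n where n: "n \<in> A" "x = monf n" by blast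
  have "0 = Poly_Mapping.lookup (\<Sum>x\<in>monf ` A. scale (g x) x) n" using * by simp
  also have "\<dots> = Poly_Mapping.lookup (\<Sum>m\<in>A. scale (g (monf m)) (monf m)) n"
    using inj_monf by (subst sum.reindex) (auto simp: inj_on_def inj_def)
  also have "\<dots> = g x" using n assms by (simp add: lookup_scale_sum_monf)
  finally show "g x = 0" by simp
qed (use assms in auto)

lemma dim_forms: "sc.dim (forms d :: 'k::field poly3 set) = (d + 2) choose 2"
proof -
  have "sc.dim (forms d :: 'k poly3 set) = card (monf ` mons d :: 'k poly3 set)"
    unfolding forms_eq_span by (rule sc.dim_span_eq_card_independent) (simp add: independent_monf)
  also have "\<dots> = card (mons d)" using inj_monf by (intro card_image) (auto simp: inj_on_def inj_def)
  finally show ?thesis by (simp add: card_mons)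
qed

subsection \<open>Finite-dimensional subspaces\<close>

context vector_space begin

text \<open>The ambient space of polynomials is infinite-dimensional, so finiteness is carried along
  as a finite set S whose span contains the subspace at hand.\<close>

lemma finite_basis_exists:
  assumes "V \<subseteq> span S" "finite S"
  obtains B where "B \<subseteq> V" "independent B" "V \<subseteq> span B" "finite B" "card B = dim V"
proof -
  obtain B where B: "B \<subseteq> V" "independent B" "V \<subseteq> span B" "card B = dim V"
    using basis_exists by blast
  moreover have "finite B"
    using independent_span_bound[of S B] assms B by blast
  ultimately show ?thesis using that by blast
qed

lemma finite_basis_extend:
  assumes "V \<subseteq> span S" "finite S" "C \<subseteq> V" "independent C"
  obtains B where "C \<subseteq> B" "B \<subseteq> V" "independent B" "V \<subseteq> span B" "finite B" "card B = dim V"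
proof -
  obtain B where B: "C \<subseteq> B" "B \<subseteq> V" "independent B" "V \<subseteq> span B"
    using maximal_independent_subset_extend[OF assms(3,4)] by blast
  moreover have "finite B"
    using independent_span_bound[of S B] assms B by blast
  moreover have "card B = dim V"
    using basis_card_eq_dim B by blast
  ultimately show ?thesis using that by blast
qed

lemma dim_mono_finite:
  assumes "U \<subseteq> V" "V \<subseteq> span S" "finite S"
  shows "dim U \<le> dim V"
proof -
  obtain B where B: "B \<subseteq> V" "independent B" "V \<subseteq> span B" "finite B" "card B = dim V"
    using finite_basis_exists assms by blast
  then show ?thesis using dim_le_card[of U B] assms(1) by auto
qed

lemma subspace_eq_if_dim_le:
  assumes "subspace U" "U \<subseteq> V" "V \<subseteq> span S" "finite S" "dim V \<le> dim U"
  shows "U = V"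
proof -
  obtain C where C: "C \<subseteq> U" "independent C" "U \<subseteq> span C" "finite C" "card C = dim U"
    using finite_basis_exists[of U S] assms by blast
  obtain B where B: "C \<subseteq> B" "B \<subseteq> V" "independent B" "V \<subseteq> span B" "finite B" "card B = dim V"
    using finite_basis_extend[of V S C] assms C by blast
  have "B = C" using card_subset_eq[of B C] B C assms(5) card_mono[of B C] by simp
  then have "V \<subseteq> U" using B(4) span_minimal[OF C(1) assms(1)] by blast
  then show ?thesis using assms(2) by blast
qed

text \<open>Families are used instead of sets so that counting arguments need no injectivity: two
  indices with the same vector already give a relation, with coefficients 1 and -1.\<close>

lemma nontrivial_relation:
  assumes "finite I" "card I > dim (v ` I)"
  obtains c where "\<exists>i\<in>I. c i \<noteq> 0" "(\<Sum>i\<in>I. scale (c i) (v i)) = 0"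
proof (cases "inj_on v I")
  case True
  have "card (v ` I) = card I" by (rule card_image[OF True])
  then have "\<not> independent (v ` I)"
    using dim_eq_card_independent assms(2) by fastforce
  then obtain u w where u: "w \<in> v ` I" "u w \<noteq> 0" "(\<Sum>x\<in>v ` I. scale (u x) x) = 0"
    using dependent_finite[of "v ` I"] assms(1) by auto
  have "(\<Sum>i\<in>I. scale (u (v i)) (v i)) = 0"
    using u(3) by (simp add: sum.reindex[OF True])
  then show ?thesis using that[of "\<lambda>i. u (v i)"] u by auto
next
  case False
  then obtain i j where ij: "i \<in> I" "j \<in> I" "i \<noteq> j" "v i = v j" by (auto simp: inj_on_def)
  define c where "c k = (if k = i then 1 else if k = j then -1 else 0 :: 'a)" for k
  have "(\<Sum>k\<in>I. scale (c k) (v k)) = (\<Sum>k\<in>{i, j}. scale (c k) (v k))"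
    by (rule sum.mono_neutral_right) (use ij assms(1) in \<open>auto simp: c_def\<close>)
  also have "\<dots> = 0" using ij by (simp add: c_def)
  finally have "(\<Sum>k\<in>I. scale (c k) (v k)) = 0" .
  moreover have "\<exists>i\<in>I. c i \<noteq> 0" using ij by (auto simp: c_def)
  ultimately show ?thesis using that by blast
qed

lemma independent_span_Int:
  assumes "finite A" "finite C" "independent (A \<union> C)" "A \<inter> C = {}" "x \<in> span A" "x \<in> span C"
  shows "x = 0"
proof -
  obtain a where a: "x = (\<Sum>v\<in>A. scale (a v) v)" using assms(1,5) span_finite[of A] by auto
  obtain c where c: "x = (\<Sum>v\<in>C. scale (c v) v)" using assms(2,6) span_finite[of C] by auto
  define u where "u v = (if v \<in> A then a v else - c v)" for v
  have "(\<Sum>v\<in>A \<union> C. scale (u v) v) = (\<Sum>v\<in>A. scale (u v) v) + (\<Sum>v\<in>C. scale (u v) v)"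
    by (rule sum.union_disjoint) (use assms in auto)
  also have "(\<Sum>v\<in>A. scale (u v) v) = x" unfolding a by (rule sum.cong) (auto simp: u_def)
  also have "(\<Sum>v\<in>C. scale (u v) v) = (\<Sum>v\<in>C. - scale (c v) v)"
    by (rule sum.cong) (use assms(4) in \<open>auto simp: u_def\<close>)
  also have "\<dots> = - x" unfolding c by (simp add: sum_negf)
  finally have "(\<Sum>v\<in>A \<union> C. scale (u v) v) = 0" by simp
  then have "u v = 0" if "v \<in> A" for v
    using independentD[OF assms(3), of "A \<union> C" u v] assms(1,2) that by auto
  then have "a v = 0" if "v \<in> A" for v using that by (auto simp: u_def)
  then show ?thesis unfolding a by simp
qed

end

context vector_space_pair begin

text \<open>A basis B0 of the kernel is extended to a basis of V; T is injective on the span of the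
  added vectors C and maps them to a basis of the image.\<close>

lemma rank_nullity_subspace:
  assumes T: "Vector_Spaces.linear s1 s2 T" and V: "vs1.subspace V" "V \<subseteq> vs1.span S" "finite S"
  shows "vs1.dim V = vs2.dim (T ` V) + vs1.dim {v \<in> V. T v = 0}"
proof -
  interpret T: Vector_Spaces.linear s1 s2 T by fact
  let ?K = "{v \<in> V. T v = 0}"
  have K: "vs1.subspace ?K"
    using V(1) by (auto simp: vs1.subspace_def T.add T.scale)
  have KS: "?K \<subseteq> vs1.span S" using V by auto
  obtain B0 where B0: "B0 \<subseteq> ?K" "vs1.independent B0" "?K \<subseteq> vs1.span B0" "finite B0" "card B0 = vs1.dim ?K"
    by (rule vs1.finite_basis_exists[OF KS V(3)])
  have "B0 \<subseteq> V" using B0 by blast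
  then obtain B where B: "B0 \<subseteq> B" "B \<subseteq> V" "vs1.independent B" "V \<subseteq> vs1.span B" "finite B" "card B = vs1.dim V"
    using vs1.finite_basis_extend[OF V(2,3) _ B0(2)] by blast
  define C where "C = B - B0"
  have indC: "vs1.independent C"
    using B(3) vs1.independent_mono unfolding C_def by blast
  have CV: "vs1.span C \<subseteq> V" using vs1.span_minimal[of C V] V(1) B(2) by (auto simp: C_def)
  have CsubV: "C \<subseteq> V" using B(2) by (auto simp: C_def)
  have KC: "v = 0" if v: "v \<in> vs1.span C" "T v = 0" for v
  proof -
    have "v \<in> vs1.span B0" using v CV B0(3) by blast
    then show ?thesis
      using vs1.independent_span_Int[of B0 C v] v(1) B0(4) B(1,3,5) by (simp add: C_def Un_absorb1)
  qed
  have inj: "inj_on T (vs1.span C)"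
  proof (rule inj_onI)
    fix x y assume "x \<in> vs1.span C" "y \<in> vs1.span C" "T x = T y"
    then have "x - y = 0" by (intro KC) (auto simp: vs1.span_diff T.diff)
    then show "x = y" by simp
  qed
  have ind: "vs2.independent (T ` C)"
    by (rule T.independent_injective_image[OF indC inj])
  have TV: "T ` V \<subseteq> vs2.span (T ` C)"
  proof
    fix w assume "w \<in> T ` V"
    then have "w \<in> T ` vs1.span B" using B(4) by blast
    then have "w \<in> vs2.span (T ` B)" by (simp add: T.span_image)
    moreover have "T ` B \<subseteq> vs2.span (T ` C)"
    proof
      fix y assume "y \<in> T ` B"
      then obtain b where b: "b \<in> B" "y = T b" by blast
      show "y \<in> vs2.span (T ` C)"
      proof (cases "b \<in> B0")
        case True then show ?thesis using B0(1) b by (auto simp: vs2.span_zero)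
      next
        case False then show ?thesis using b by (auto simp: C_def intro: vs2.span_base)
      qed
    qed
    ultimately show "w \<in> vs2.span (T ` C)"
      using vs2.span_minimal[OF _ vs2.subspace_span] by blast
  qed
  have "vs2.dim (T ` V) = card (T ` C)"
    using vs2.basis_card_eq_dim[OF image_mono[OF CsubV] TV ind] by simp
  also have "\<dots> = card C"
    by (rule card_image) (use inj vs1.span_superset inj_on_subset in blast)
  also have "\<dots> = card B - card B0"
    unfolding C_def by (rule card_Diff_subset) (use B0 B in auto)
  finally show ?thesis using B(1,5,6) B0(5) card_mono[of B B0] by simp
qed

end

text \<open>A bilinear pairing of \<open>V\<close> with the span of an independent set \<open>B\<close>, nondegenerate on the side of
  \<open>B\<close>, admits a family in \<open>V\<close> dual to \<open>B\<close>.\<close>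

locale bilinear_pairing = vector_space_pair s1 s2
  for s1 :: "'a::field \<Rightarrow> 'b::ab_group_add \<Rightarrow> 'b" and s2 :: "'a \<Rightarrow> 'c::ab_group_add \<Rightarrow> 'c" +
  fixes \<beta> :: "'b \<Rightarrow> 'c \<Rightarrow> 'a"
  assumes add_left: "\<beta> (u + v) x = \<beta> u x + \<beta> v x"
    and add_right: "\<beta> u (x + y) = \<beta> u x + \<beta> u y"
    and scale_left: "\<beta> (s1 c u) x = c * \<beta> u x"
    and scale_right: "\<beta> u (s2 c x) = c * \<beta> u x"
begin

lemma zero_left [simp]: "\<beta> 0 x = 0" using scale_left[of 0 0 x] by simp
lemma zero_right [simp]: "\<beta> u 0 = 0" using scale_right[of u 0 0] by simp
lemma sum_left: "\<beta> (sum f A) x = (\<Sum>a\<in>A. \<beta> (f a) x)"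
  by (induction A rule: infinite_finite_induct) (auto simp: add_left)
lemma sum_right: "\<beta> u (sum f A) = (\<Sum>a\<in>A. \<beta> u (f a))"
  by (induction A rule: infinite_finite_induct) (auto simp: add_right)
lemma diff_left: "\<beta> (u - v) x = \<beta> u x - \<beta> v x"
  using add_left[of "u - v" v x] by simp
lemma diff_right: "\<beta> u (x - y) = \<beta> u x - \<beta> u y"
  using add_right[of u "x - y" y] by simp

lemma dual_family:
  assumes "finite B" "vs2.independent B" "vs1.subspace V"
    and "\<And>x. x \<in> vs2.span B \<Longrightarrow> \<forall>v\<in>V. \<beta> v x = 0 \<Longrightarrow> x = 0"
  shows "\<exists>d. \<forall>b\<in>B. d b \<in> V \<and> (\<forall>c\<in>B. \<beta> (d b) c = (if b = c then 1 else 0))"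
  using assms(1,2,4)
proof (induction B rule: finite_induct)
  case (insert x B)
  have indB: "vs2.independent B" using insert.prems(1) vs2.independent_mono by blast
  have nd: "y = 0" if "y \<in> vs2.span B" "\<forall>v\<in>V. \<beta> v y = 0" for y
    using insert.prems(2) that vs2.span_mono[of B "insert x B"] by blast
  obtain d where d: "\<And>b. b \<in> B \<Longrightarrow> d b \<in> V" "\<And>b c. b \<in> B \<Longrightarrow> c \<in> B \<Longrightarrow> \<beta> (d b) c = (if b = c then 1 else 0)"
    using insert.IH[OF indB nd] by blast
  \<comment> \<open>Removing from x the part seen by the earlier dual vectors makes x' invisible to
    them; nondegeneracy then supplies a v that does see x'.\<close>
  define x' where "x' = x - (\<Sum>b\<in>B. s2 (\<beta> (d b) x) b)"
  have xB: "x \<notin> vs2.span B"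
    using insert.prems(1) insert.hyps vs2.independent_insert by metis
  have "x' \<noteq> 0"
  proof
    assume "x' = 0"
    then have "x = (\<Sum>b\<in>B. s2 (\<beta> (d b) x) b)" by (simp add: x'_def)
    also have "\<dots> \<in> vs2.span B" by (intro vs2.span_sum vs2.span_scale vs2.span_base)
    finally show False using xB by simp
  qed
  moreover have "x' \<in> vs2.span (insert x B)"
    unfolding x'_def by (intro vs2.span_diff vs2.span_sum vs2.span_scale vs2.span_base) auto
  ultimately obtain v where v: "v \<in> V" "\<beta> v x' \<noteq> 0" using insert.prems(2) by blast
  have dx': "\<beta> (d c) x' = 0" if "c \<in> B" for c
  proof -
    have "\<beta> (d c) x' = \<beta> (d c) x - (\<Sum>b\<in>B. if b = c then \<beta> (d b) x else 0)"
      unfolding x'_def diff_right sum_right scale_right using d(2) that by (auto intro!: sum.cong)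
    then show ?thesis using that insert.hyps(1) by simp
  qed
  \<comment> \<open>The mirror correction: w vanishes on B and keeps the value of v on x'.\<close>
  define w where "w = v - (\<Sum>b\<in>B. s1 (\<beta> v b) (d b))"
  have wV: "w \<in> V" unfolding w_def
    using assms(3) v(1) d(1) by (intro vs1.subspace_diff vs1.subspace_sum vs1.subspace_scale) auto
  have wB: "\<beta> w c = 0" if "c \<in> B" for c
  proof -
    have "\<beta> w c = \<beta> v c - (\<Sum>b\<in>B. if b = c then \<beta> v b else 0)"
      unfolding w_def diff_left sum_left scale_left using d(2) that by (auto intro!: sum.cong)
    then show ?thesis using that insert.hyps(1) by simp
  qed
  have wx': "\<beta> w x' = \<beta> v x'"
    unfolding w_def diff_left sum_left scale_left using dx' by simp
  have wx: "\<beta> w x = \<beta> v x'"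
  proof -
    have "\<beta> w x' = \<beta> w x - (\<Sum>b\<in>B. \<beta> (d b) x * \<beta> w b)"
      unfolding x'_def by (simp add: diff_right sum_right scale_right)
    then show ?thesis using wB wx' by simp
  qed
  define dx where "dx = s1 (1 / \<beta> w x) w"
  \<comment> \<open>\<open>dx\<close> is dual to x; multiples of it are subtracted from the earlier
    dual vectors so that they vanish on x.\<close>
  define D where "D b = (if b = x then dx else d b - s1 (\<beta> (d b) x) dx)" for b
  have dxV: "dx \<in> V" using wV assms(3) by (simp add: dx_def vs1.subspace_scale)
  have dx1: "\<beta> dx x = 1" using v(2) by (simp add: dx_def scale_left wx)
  have dxB: "\<beta> dx c = 0" if "c \<in> B" for c using wB[OF that] by (simp add: dx_def scale_left)
  have "D b \<in> V \<and> (\<forall>c\<in>insert x B. \<beta> (D b) c = (if b = c then 1 else 0))" if b: "b \<in> insert x B" for b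
  proof (cases "b = x")
    case True
    then show ?thesis using dxV dx1 dxB insert.hyps(2) by (auto simp: D_def)
  next
    case False
    then have "b \<in> B" using b by simp
    then show ?thesis
      using False dxV dx1 dxB d insert.hyps(2) assms(3)
      by (auto simp: D_def diff_left scale_left vs1.subspace_diff vs1.subspace_scale)
  qed
  then show ?case by blast
qed auto

lemma dim_annihilator:
  assumes "finite B" "vs2.independent B" "vs1.subspace V" "V \<subseteq> vs1.span S" "finite S"
    and nd: "\<And>x. x \<in> vs2.span B \<Longrightarrow> \<forall>v\<in>V. \<beta> v x = 0 \<Longrightarrow> x = 0"
  shows "vs1.dim V = card B + vs1.dim {v \<in> V. \<forall>b\<in>B. \<beta> v b = 0}"
proof -
  obtain d where d: "\<And>b. b \<in> B \<Longrightarrow> d b \<in> V" "\<And>b c. b \<in> B \<Longrightarrow> c \<in> B \<Longrightarrow> \<beta> (d b) c = (if b = c then 1 else 0)"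
    using dual_family[OF assms(1-3) nd] by blast
  \<comment> \<open>T records the values of v on B as a vector of \<open>span B\<close>: the dual
    family makes it surjective, and its kernel is the annihilator of B.\<close>
  define T where "T v = (\<Sum>b\<in>B. s2 (\<beta> v b) b)" for v
  have T: "Vector_Spaces.linear s1 s2 T"
    unfolding Vector_Spaces.linear_iff
    by (auto simp: T_def add_left scale_left vs2.scale_left_distrib sum.distrib vs2.scale_sum_right
        vs1.vector_space_axioms vs2.vector_space_axioms)
  have img: "vs2.span B = T ` V"
  proof
    show "T ` V \<subseteq> vs2.span B"
      by (auto simp: T_def intro: vs2.span_sum vs2.span_scale vs2.span_base)
    show "vs2.span B \<subseteq> T ` V"
    proof
      fix x assume "x \<in> vs2.span B"
      then obtain u where u: "x = (\<Sum>b\<in>B. s2 (u b) b)" using assms(1) vs2.span_finite[of B] by auto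
      define v where "v = (\<Sum>b\<in>B. s1 (u b) (d b))"
      have "\<beta> v c = u c" if "c \<in> B" for c
      proof -
        have "\<beta> v c = (\<Sum>b\<in>B. if b = c then u b else 0)"
          unfolding v_def sum_left scale_left using d(2) that by (auto intro!: sum.cong)
        then show ?thesis using that assms(1) by simp
      qed
      then have "T v = x" by (simp add: T_def u)
      moreover have "v \<in> V" unfolding v_def
        using assms(3) d(1) by (intro vs1.subspace_sum vs1.subspace_scale) auto
      ultimately show "x \<in> T ` V" by blast
    qed
  qed
  have "T v = 0 \<longleftrightarrow> (\<forall>b\<in>B. \<beta> v b = 0)" for v
  proof
    assume "T v = 0"
    then show "\<forall>b\<in>B. \<beta> v b = 0"
      using vs2.independentD[OF assms(2), of B "\<beta> v"] assms(1) by (auto simp: T_def)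
  qed (simp add: T_def)
  then have "{v \<in> V. \<forall>b\<in>B. \<beta> v b = 0} = {v \<in> V. T v = 0}" by auto
  moreover have "vs2.dim (T ` V) = card B"
    using img vs2.dim_span_eq_card_independent[OF assms(2)] by simp
  ultimately show ?thesis using rank_nullity_subspace[OF T assms(3-5)] by simp
qed

end

subsection \<open>Apolarity\<close>

definition apol :: "'k::field_char_0 poly3 \<Rightarrow> 'k poly3 \<Rightarrow> 'k" where
  "apol f G = pair f (hat G)"

interpretation sc2: vector_space_pair "scale :: 'k::field \<Rightarrow> ('i, 'k) mpoly \<Rightarrow> ('i, 'k) mpoly"
  "scale :: 'k::field \<Rightarrow> ('j, 'k) mpoly \<Rightarrow> ('j, 'k) mpoly"
  by unfold_locales

lemma apol_add_right: "apol f (G + H) = apol f G + apol f H"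
  by (simp add: apol_def hat_add[abs_def] pair_add_right)

lemma apol_scale_right: "apol f (scale c G) = c * apol f G"
  by (simp add: apol_def hat_scale[abs_def] pair_mult_right)

interpretation ap: bilinear_pairing "scale :: 'k::field_char_0 \<Rightarrow> 'k poly3 \<Rightarrow> 'k poly3" scale apol
  by unfold_locales
    (simp_all add: apol_add_right apol_scale_right, simp_all add: apol_def pair_add pair_scale)

interpretation pa: bilinear_pairing "scale :: 'k::field_char_0 \<Rightarrow> 'k poly3 \<Rightarrow> 'k poly3" scale "\<lambda>G f. apol f G"
  by unfold_locales (simp_all add: ap.add_left ap.add_right ap.scale_left ap.scale_right)

text \<open>Adjointness: multiplying operators is dual to letting them act on forms, so annihilators
  become orthogonal complements.\<close>

lemma apol_mult: "apol (f * g) H = apol f (g \<circ>\<^sub>d H)"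
  unfolding apol_def pair_mult by (rule pair_cong) (simp add: hat_act add.commute)

lemma apol_monf: "apol (monf m) G = hat G m"
  by (simp add: apol_def monf_def)

lemma apol_monf_right: "apol f (monf m) = mfact m * Poly_Mapping.lookup f m"
proof -
  have "apol f (monf m) = (\<Sum>n\<in>Poly_Mapping.keys f. if n = m then Poly_Mapping.lookup f m * mfact m else 0)"
    unfolding apol_def pair_def by (rule sum.cong) (auto simp: hat_def lookup_monf)
  also have "\<dots> = mfact m * Poly_Mapping.lookup f m"
    by (auto simp: in_keys_iff)
  finally show ?thesis .
qed

text \<open>Pairing with monomials reads off the coefficients up to the factor
  \<open>mfact m\<close>, which is invertible in characteristic zero; the same holds on the other
  side.\<close>

lemma apol_nondegenerate_right: "G \<in> forms d \<Longrightarrow> \<forall>f\<in>forms d. apol f G = 0 \<Longrightarrow> G = 0"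
  by (metis apol_monf forms_hat hat_inject hat_zero monf_in_forms)

lemma apol_nondegenerate_left: "f \<in> forms d \<Longrightarrow> \<forall>G\<in>forms d. apol f G = 0 \<Longrightarrow> f = 0"
  by (rule poly_mapping_eqI)
    (metis apol_monf_right forms_lookup lookup_zero mfact_nonzero monf_in_forms mult_eq_0_iff)

lemma forms_finite_span: "forms d \<subseteq> sc.span (monf ` mons d :: 'k::field poly3 set)" "finite (monf ` mons d)"
  by (auto simp: forms_eq_span)

lemma dim_forms_subset:
  assumes "Y \<subseteq> forms d"
  shows "sc.dim (Y :: 'k::field poly3 set) \<le> (d + 2) choose 2"
  using sc.dim_mono_finite[OF assms forms_finite_span] by (simp add: dim_forms)

lemma finite_basis_forms:
  assumes "Y \<subseteq> forms d"
  obtains B where "B \<subseteq> (Y :: 'k::field poly3 set)" "sc.independent B" "Y \<subseteq> sc.span B" "finite B" "card B = sc.dim Y"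
  using sc.finite_basis_exists[of Y, OF order_trans[OF assms forms_finite_span(1)] forms_finite_span(2)] by blast

lemma annihilator_span_right: "(\<forall>b\<in>B. apol f b = 0) \<Longrightarrow> x \<in> sc.span B \<Longrightarrow> apol f x = 0"
proof -
  assume *: "\<forall>b\<in>B. apol f b = 0" and x: "x \<in> sc.span B"
  have "sc.subspace {x. apol f x = 0}"
    by (auto simp: sc.subspace_def ap.add_right ap.scale_right)
  then show "apol f x = 0" using sc.span_minimal[of B "{x. apol f x = 0}"] * x by blast
qed

lemma annihilator_span_left: "(\<forall>b\<in>B. apol b G = 0) \<Longrightarrow> x \<in> sc.span B \<Longrightarrow> apol x G = 0"
proof -
  assume *: "\<forall>b\<in>B. apol b G = 0" and x: "x \<in> sc.span B"
  have "sc.subspace {x. apol x G = 0}"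
    by (auto simp: sc.subspace_def ap.add_left ap.scale_left)
  then show "apol x G = 0" using sc.span_minimal[of B "{x. apol x G = 0}"] * x by blast
qed

section \<open>Dimensions of orthogonal complements and of kernels\<close>

lemma dim_annihilator_right:
  fixes Y :: "'k::field_char_0 poly3 set"
  assumes "sc.subspace Y" "Y \<subseteq> forms d"
  shows "sc.dim {G \<in> forms d. \<forall>f\<in>Y. apol f G = 0} + sc.dim Y = (d + 2) choose 2"
proof -
  obtain B where B: "B \<subseteq> Y" "sc.independent B" "Y \<subseteq> sc.span B" "finite B" "card B = sc.dim Y"
    using finite_basis_forms[OF assms(2)] by blast
  have XB: "sc.span B = Y" using B sc.span_minimal[OF B(1) assms(1)] by blast
  have "sc.dim (forms d :: 'k poly3 set) = card B + sc.dim {G \<in> forms d. \<forall>b\<in>B. apol b G = 0}"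
  proof (rule pa.dim_annihilator[OF B(4,2) subspace_forms forms_finite_span])
    fix x assume "x \<in> sc.span B" "\<forall>v\<in>forms d. apol x v = 0"
    then show "x = 0" using apol_nondegenerate_left assms(2) XB by blast
  qed
  moreover have "{G \<in> forms d. \<forall>b\<in>B. apol b G = 0} = {G \<in> forms d. \<forall>f\<in>Y. apol f G = 0}"
    using annihilator_span_left[of B] B by blast
  ultimately show ?thesis using B(5) by (simp add: dim_forms)
qed

lemma dim_annihilator_left:
  fixes Y :: "'k::field_char_0 poly3 set"
  assumes "sc.subspace Y" "Y \<subseteq> forms d"
  shows "sc.dim {f \<in> forms d. \<forall>G\<in>Y. apol f G = 0} + sc.dim Y = (d + 2) choose 2"
proof -
  obtain B where B: "B \<subseteq> Y" "sc.independent B" "Y \<subseteq> sc.span B" "finite B" "card B = sc.dim Y"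
    using finite_basis_forms[OF assms(2)] by blast
  have XB: "sc.span B = Y" using B sc.span_minimal[OF B(1) assms(1)] by blast
  have "sc.dim (forms d :: 'k poly3 set) = card B + sc.dim {f \<in> forms d. \<forall>b\<in>B. apol f b = 0}"
  proof (rule ap.dim_annihilator[OF B(4,2) subspace_forms forms_finite_span])
    fix x assume "x \<in> sc.span B" "\<forall>v\<in>forms d. apol v x = 0"
    then show "x = 0" using apol_nondegenerate_right assms(2) XB by blast
  qed
  moreover have "{f \<in> forms d. \<forall>b\<in>B. apol f b = 0} = {f \<in> forms d. \<forall>G\<in>Y. apol f G = 0}"
    using annihilator_span_right[of B] B by blast
  ultimately show ?thesis using B(5) by (simp add: dim_forms)
qed

text \<open>\<open>f \<circ>\<^sub>d G\<close> is a form of degree e - d, hence zero as soon as it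
  pairs to zero with all forms of that degree.\<close>

lemma act_eq_0_iff_apol:
  assumes "f \<in> forms d" "G \<in> forms e" "d \<le> e"
  shows "f \<circ>\<^sub>d G = 0 \<longleftrightarrow> (\<forall>g\<in>forms (e - d). apol (g * f) G = 0)"
  using apol_nondegenerate_right[OF act_forms[OF assms(1,2)]] by (auto simp: apol_mult)

lemma linear_mult: "Vector_Spaces.linear scale scale ((*) (Q :: ('i, 'k::field) mpoly))"
  unfolding Vector_Spaces.linear_iff
  by (auto simp: distrib_left scale_mult_right sc.vector_space_axioms)

lemma dim_mult_image:
  assumes "Q \<noteq> (0 :: 'k::field poly3)"
  shows "sc.dim ((*) Q ` forms d) = (d + 2) choose 2"
proof -
  have *: "{v \<in> forms d. Q * v = 0} = {0}"
  proof (rule Set.set_eqI)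
    fix v :: "'k poly3"
    show "v \<in> {v \<in> forms d. Q * v = 0} \<longleftrightarrow> v \<in> {0}"
      using assms by (cases "v = 0") simp_all
  qed
  have "sc.dim {0 :: 'k poly3} \<le> card ({} :: 'k poly3 set)"
    by (rule sc.dim_le_card) simp_all
  then have **: "sc.dim {0 :: 'k poly3} = 0" by simp
  show ?thesis
    using sc2.rank_nullity_subspace[OF linear_mult[of Q] subspace_forms forms_finite_span, of d]
    unfolding * ** dim_forms by (simp only: add_0_right)
qed

lemma subspace_mult_image:
  fixes Q :: "('i, 'k::field) mpoly"
  assumes "sc.subspace V" shows "sc.subspace ((*) Q ` V)"
  unfolding sc.subspace_def
proof (intro conjI ballI allI)
  show "0 \<in> (*) Q ` V" using sc.subspace_0[OF assms] by (intro image_eqI[of _ _ 0]) simp_all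
next
  fix x y assume "x \<in> (*) Q ` V" "y \<in> (*) Q ` V"
  then obtain v w where "x = Q * v" "y = Q * w" "v \<in> V" "w \<in> V" by blast
  then show "x + y \<in> (*) Q ` V"
    using sc.subspace_add[OF assms] by (intro image_eqI[of _ _ "v + w"]) (simp_all add: distrib_left)
next
  fix c x assume "x \<in> (*) Q ` V"
  then obtain v where "x = Q * v" "v \<in> V" by blast
  then show "scale c x \<in> (*) Q ` V"
    using sc.subspace_scale[OF assms] by (intro image_eqI[of _ _ "scale c v"]) (simp_all add: scale_mult_right)
qed

text \<open>The kernel is the orthogonal complement of the multiples of Q in degree j, and
  multiplication by Q is injective.\<close>

lemma dim_kernel:
  fixes Q :: "'k::field_char_0 poly3"
  assumes "Q \<in> forms q" "Q \<noteq> 0" "q \<le> j"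
  shows "sc.dim {G \<in> forms j. Q \<circ>\<^sub>d G = 0} + ((j - q + 2) choose 2) = (j + 2) choose 2"
proof -
  let ?Y = "(*) Q ` forms (j - q)"
  have Y: "?Y \<subseteq> forms j" using forms_mult[OF assms(1)] assms(3) by fastforce
  have *: "{G \<in> forms j. Q \<circ>\<^sub>d G = 0} = {G \<in> forms j. \<forall>f\<in>?Y. apol f G = 0}"
    using act_eq_0_iff_apol[OF assms(1) _ assms(3)] by (auto simp: mult.commute)
  show ?thesis
    using dim_annihilator_right[OF subspace_mult_image[OF subspace_forms] Y]
    unfolding * dim_mult_image[OF assms(2)] .
qed

lemma choose_two_Suc: "Suc n choose 2 = (n choose 2) + n"
  unfolding numeral_2_eq_2 binomial_Suc_Suc by simp

lemma choose_two_diff1: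
  assumes "1 \<le> j" shows "(j + 2) choose 2 = ((j - 1 + 2) choose 2) + (j + 1)"
proof -
  have "j + 2 = Suc (j + 1)" "j - 1 + 2 = j + 1" using assms by simp_all
  then show ?thesis by (simp only: choose_two_Suc)
qed

lemma choose_two_diff2:
  assumes "2 \<le> j" shows "(j + 2) choose 2 = ((j - 2 + 2) choose 2) + (2 * j + 1)"
proof -
  have "j + 2 = Suc (Suc j)" "j - 2 + 2 = j" using assms by simp_all
  then show ?thesis by (simp only: choose_two_Suc)
qed

text \<open>In suitable coordinates these are the binary forms of degree j; degree 0, outside the
  scope of \<open>dim_kernel\<close>, is counted directly.\<close>

lemma dim_kernel_linear:
  fixes l :: "'k::field_char_0 poly3"
  assumes "l \<in> forms 1" "l \<noteq> 0"
  shows "sc.dim {G \<in> forms j. l \<circ>\<^sub>d G = 0} \<le> j + 1"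
proof (cases "1 \<le> j")
  case True then show ?thesis using dim_kernel[OF assms True] choose_two_diff1[OF True] by simp
next
  case False
  then have j: "j = 0" by simp
  have "sc.dim {G \<in> forms j. l \<circ>\<^sub>d G = 0} \<le> (j + 2) choose 2" by (rule dim_forms_subset) auto
  then show ?thesis unfolding j by (simp add: choose_two)
qed

text \<open>The degree \<open>e - j\<close> part of the inverse system generated by \<open>F, G\<close>.\<close>

definition derivs :: "nat \<Rightarrow> 'k::field_char_0 poly3 \<Rightarrow> 'k poly3 \<Rightarrow> 'k poly3 set" where
  "derivs j F G = {f \<circ>\<^sub>d F + g \<circ>\<^sub>d G | f g. f \<in> forms j \<and> g \<in> forms j}"

lemma subspace_derivs: "sc.subspace (derivs j F G)"
  unfolding sc.subspace_def
proof (intro conjI ballI allI)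
  show "0 \<in> derivs j F G" unfolding derivs_def by (force intro: exI[of _ 0])
next
  fix x y assume "x \<in> derivs j F G" "y \<in> derivs j F G"
  then obtain f g f' g' where "x = f \<circ>\<^sub>d F + g \<circ>\<^sub>d G" "y = f' \<circ>\<^sub>d F + g' \<circ>\<^sub>d G"
    "f \<in> forms j" "g \<in> forms j" "f' \<in> forms j" "g' \<in> forms j" unfolding derivs_def by blast
  then have "x + y = (f + f') \<circ>\<^sub>d F + (g + g') \<circ>\<^sub>d G" "f + f' \<in> forms j" "g + g' \<in> forms j"
    by (simp_all add: act_add_left forms_add)
  then show "x + y \<in> derivs j F G" unfolding derivs_def by blast
next
  fix c x assume "x \<in> derivs j F G"
  then obtain f g where "x = f \<circ>\<^sub>d F + g \<circ>\<^sub>d G" "f \<in> forms j" "g \<in> forms j"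
    unfolding derivs_def by blast
  then have "scale c x = scale c f \<circ>\<^sub>d F + scale c g \<circ>\<^sub>d G" "scale c f \<in> forms j" "scale c g \<in> forms j"
    by (simp_all add: act_scale_left forms_scale sc.scale_right_distrib)
  then show "scale c x \<in> derivs j F G" unfolding derivs_def by blast
qed

lemma derivs_subset: "F \<in> forms e \<Longrightarrow> G \<in> forms e \<Longrightarrow> derivs j F G \<subseteq> forms (e - j)"
proof
  fix x assume F: "F \<in> forms e" "G \<in> forms e" and "x \<in> derivs j F G"
  then obtain f g where x: "x = f \<circ>\<^sub>d F + g \<circ>\<^sub>d G" and fg: "f \<in> forms j" "g \<in> forms j"
    unfolding derivs_def by blast
  show "x \<in> forms (e - j)"
    unfolding x by (rule forms_add[OF act_forms[OF fg(1) F(1)] act_forms[OF fg(2) F(2)]])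
qed

text \<open>Macaulay duality: the annihilator in degree d is the orthogonal complement of the degree
  d part of the inverse system, whose dimension is therefore the value of the Hilbert
  function.\<close>

lemma dim_derivs:
  assumes "F \<in> forms e" "G \<in> forms e" "d \<le> e"
  shows "sc.dim {f \<in> forms d. f \<circ>\<^sub>d F = 0 \<and> f \<circ>\<^sub>d G = 0} + sc.dim (derivs (e - d) F G) = (d + 2) choose 2"
proof -
  have eq: "{f \<in> forms d. f \<circ>\<^sub>d F = 0 \<and> f \<circ>\<^sub>d G = 0} = {f \<in> forms d. \<forall>H\<in>derivs (e - d) F G. apol f H = 0}"
  proof (safe, goal_cases)
    case (1 f H)
    then obtain g h where "H = g \<circ>\<^sub>d F + h \<circ>\<^sub>d G" by (auto simp: derivs_def)
    moreover have "apol f (g \<circ>\<^sub>d F) = apol g (f \<circ>\<^sub>d F)" for g F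
      by (simp add: apol_mult[symmetric] mult.commute)
    ultimately show ?case using 1 by (simp add: ap.add_right)
  next
    case (2 f)
    have "apol (g * f) F = 0" if "g \<in> forms (e - d)" for g
    proof -
      have "g \<circ>\<^sub>d F + 0 \<circ>\<^sub>d G \<in> derivs (e - d) F G" using that zero_in_forms unfolding derivs_def by blast
      then have "apol f (g \<circ>\<^sub>d F) = 0" using 2 by simp
      then show ?thesis by (simp add: apol_mult[symmetric] mult.commute)
    qed
    then show ?case using act_eq_0_iff_apol[OF 2(1) assms(1,3)] by blast
  next
    case (3 f)
    have "apol (g * f) G = 0" if "g \<in> forms (e - d)" for g
    proof -
      have "0 \<circ>\<^sub>d F + g \<circ>\<^sub>d G \<in> derivs (e - d) F G" using that zero_in_forms unfolding derivs_def by blast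
      then have "apol f (g \<circ>\<^sub>d G) = 0" using 3 by simp
      then show ?thesis by (simp add: apol_mult[symmetric] mult.commute)
    qed
    then show ?case using act_eq_0_iff_apol[OF 3(1) assms(2,3)] by blast
  qed
  have "derivs (e - d) F G \<subseteq> forms d" using derivs_subset[OF assms(1,2), of "e - d"] assms(3) by simp
  then show ?thesis unfolding eq by (rule dim_annihilator_left[OF subspace_derivs])
qed

subsection \<open>Ideals and graded quotients\<close>

lemma polyring_simps [simp]:
  "carrier ring_of_type_algebra = UNIV" "\<zero>\<^bsub>ring_of_type_algebra\<^esub> = 0" "\<one>\<^bsub>ring_of_type_algebra\<^esub> = 1"
  "x \<oplus>\<^bsub>ring_of_type_algebra\<^esub> y = x + y" "x \<otimes>\<^bsub>ring_of_type_algebra\<^esub> y = x * y"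
  by (simp_all add: ring_of_type_algebra_def)

lemma polyring_a_inv [simp]: "\<ominus>\<^bsub>ring_of_type_algebra\<^esub> x = - (x :: 'a::comm_ring_1)"
proof -
  interpret ring "ring_of_type_algebra :: 'a ring" by (rule ring_from_type_algebra)
  show ?thesis by (rule minus_equality) simp_all
qed

lemma polyring_minus [simp]: "x \<ominus>\<^bsub>ring_of_type_algebra\<^esub> y = x - (y :: 'a::comm_ring_1)"
  by (simp add: a_minus_def)

lemma ideal_polyringI:
  assumes "0 \<in> I" "\<And>x y. x \<in> I \<Longrightarrow> y \<in> I \<Longrightarrow> x + y \<in> I" "\<And>r x. x \<in> I \<Longrightarrow> r * x \<in> I"
  shows "ideal I (ring_of_type_algebra :: 'a::comm_ring_1 ring)"
proof (rule idealI[OF ring_from_type_algebra])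
  have "- x \<in> I" if "x \<in> I" for x using assms(3)[OF that, of "-1"] by simp
  moreover have "inv\<^bsub>add_monoid ring_of_type_algebra\<^esub> x = - x" for x :: 'a
    using polyring_a_inv[of x] by (simp add: a_inv_def)
  ultimately show "subgroup I (add_monoid (ring_of_type_algebra :: 'a ring))"
    using assms by (intro subgroup.intro) auto
qed (use assms in \<open>auto simp: mult.commute\<close>)

context
  fixes I :: "'k::field_char_0 poly3 set"
  assumes I: "ideal I polyring"
begin

lemma ideal_zero: "0 \<in> I"
  using additive_subgroup.zero_closed[OF ideal.axioms(1)[OF I]] by simp

lemma ideal_add: "x \<in> I \<Longrightarrow> y \<in> I \<Longrightarrow> x + y \<in> I"
  using additive_subgroup.a_closed[OF ideal.axioms(1)[OF I]] by simp

lemma ideal_mult: "x \<in> I \<Longrightarrow> r * x \<in> I"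
  using ideal.I_l_closed[OF I, of x r] by simp

lemma ideal_scale: "x \<in> I \<Longrightarrow> scale c x \<in> I"
  by (simp add: scale_def ideal_mult)

lemma ideal_diff: "x \<in> I \<Longrightarrow> y \<in> I \<Longrightarrow> x - y \<in> I"
  using ideal_add[of x "scale (-1) y"] ideal_scale[of y "-1"] by simp

lemma ideal_sum: "(\<And>a. a \<in> A \<Longrightarrow> f a \<in> I) \<Longrightarrow> sum f A \<in> I"
  by (induction A rule: infinite_finite_induct) (auto simp: ideal_zero ideal_add)

lemma subspace_ideal: "sc.subspace I"
  by (auto simp: sc.subspace_def ideal_zero ideal_add ideal_scale)

lemma residue_eq_iff: "residue I f = residue I g \<longleftrightarrow> f - g \<in> I"
  using ring.quotient_eq_iff_same_a_r_cos[OF ring_from_type_algebra I, of f g] by simp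

lemma residue_hom: "ring_hom_ring polyring (quotient_alg I) (residue I)"
  using ideal.rcos_ring_hom_ring[OF I] by (simp add: comp_def)

lemma residue_add: "residue I f \<oplus>\<^bsub>quotient_alg I\<^esub> residue I g = residue I (f + g)"
  using ring_hom_add[OF ring_hom_ring.homh[OF residue_hom], of f g] by simp

lemma residue_mult: "residue I f \<otimes>\<^bsub>quotient_alg I\<^esub> residue I g = residue I (f * g)"
  using ring_hom_mult[OF ring_hom_ring.homh[OF residue_hom], of f g] by simp

lemma quotient_zero: "\<zero>\<^bsub>quotient_alg I\<^esub> = residue I 0"
  using ring_hom_zero[OF ring_hom_ring.homh[OF residue_hom] ring_from_type_algebra
    ideal.quotient_is_ring[OF I]] by simp

lemma residue_carrier: "residue I f \<in> carrier (quotient_alg I)"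
  using ring_hom_closed[OF ring_hom_ring.homh[OF residue_hom], of f] by simp

lemma residue_eq_zero: "residue I f = \<zero>\<^bsub>quotient_alg I\<^esub> \<longleftrightarrow> f \<in> I"
  by (simp add: quotient_zero residue_eq_iff)

text \<open>Dimension in HOL-Algebra is built up by line extensions; this matches one extension with
  inserting one polynomial into a spanning set.\<close>

lemma line_extension_residue:
  "ring.line_extension (quotient_alg I) (scalars I) (residue I v) (residue I ` sc.span C)
    = residue I ` sc.span (insert v C)"
proof -
  interpret Q: ring "quotient_alg I" by (rule ideal.quotient_is_ring[OF I])
  have A: "x \<in> Q.line_extension (scalars I) (residue I v) (residue I ` sc.span C) \<longleftrightarrow>
    (\<exists>c. \<exists>w\<in>sc.span C. x = residue I (scale c v + w))" for x
    unfolding Q.line_extension_mem_iff scalars_def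
    by (auto simp: residue_mult residue_add scale_def)
  have B: "x \<in> residue I ` sc.span (insert v C) \<longleftrightarrow>
    (\<exists>c. \<exists>w\<in>sc.span C. x = residue I (scale c v + w))" for x
  proof
    assume "x \<in> residue I ` sc.span (insert v C)"
    then obtain y c where "x = residue I y" "y - scale c v \<in> sc.span C"
      by (auto simp: sc.span_insert)
    then show "\<exists>c. \<exists>w\<in>sc.span C. x = residue I (scale c v + w)"
      by (intro exI[of _ c] bexI[of _ "y - scale c v"]) auto
  next
    assume "\<exists>c. \<exists>w\<in>sc.span C. x = residue I (scale c v + w)"
    then obtain c w where "w \<in> sc.span C" "x = residue I (scale c v + w)" by blast
    then show "x \<in> residue I ` sc.span (insert v C)"
      by (intro image_eqI[of _ _ "scale c v + w"]) (auto simp: sc.span_insert intro!: exI[of _ c])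
  qed
  show ?thesis by (rule Set.set_eqI) (rule trans[OF A B[symmetric]])
qed

lemma dimension_residue_span:
  assumes "finite C" "sc.independent C" "sc.span C \<inter> I = {0}"
  shows "ring.dimension (quotient_alg I) (card C) (scalars I) (residue I ` sc.span C)"
proof -
  interpret Q: ring "quotient_alg I" by (rule ideal.quotient_is_ring[OF I])
  show ?thesis
    using assms
  proof (induction C rule: finite_induct)
    case empty
    have "residue I ` {0} = {\<zero>\<^bsub>quotient_alg I\<^esub>}" by (simp add: quotient_zero)
    then show ?case using Q.zero_dim by simp
  next
    case (insert v C)
    have ind: "sc.independent C" "v \<notin> sc.span C"
      using insert.prems(1) insert.hyps(2) sc.independent_insert[of v C] by auto
    have sub: "sc.span C \<subseteq> sc.span (insert v C)" by (rule sc.span_mono) auto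
    have "Q.dimension (card C) (scalars I) (residue I ` sc.span C)"
      using insert.IH[OF ind(1)] insert.prems(2) sub sc.span_zero[of C] by blast
    moreover have "residue I v \<notin> residue I ` sc.span C"
    proof
      assume "residue I v \<in> residue I ` sc.span C"
      then obtain w where w: "w \<in> sc.span C" "v - w \<in> I" by (auto simp: residue_eq_iff)
      have "v - w \<in> sc.span (insert v C)"
        by (rule sc.span_diff[OF sc.span_base[OF insertI1] subsetD[OF sub w(1)]])
      then have "v - w \<in> sc.span (insert v C) \<inter> I" using w(2) by (rule IntI)
      then have "v - w \<in> {0}" unfolding insert.prems(2) .
      then have "v = w" by simp
      then show False using w ind by simp
    qed
    ultimately have "Q.dimension (Suc (card C)) (scalars I)
      (Q.line_extension (scalars I) (residue I v) (residue I ` sc.span C))"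
      by (intro Q.Suc_dim residue_carrier)
    then show ?case using insert.hyps by (simp add: line_extension_residue)
  qed
qed

lemma dimension_graded_piece:
  "ring.dimension (quotient_alg I) (sc.dim (forms d :: 'k poly3 set) - sc.dim (forms d \<inter> I)) (scalars I) (graded_piece I d)"
proof -
  obtain B0 where B0: "B0 \<subseteq> forms d \<inter> I" "sc.independent B0" "forms d \<inter> I \<subseteq> sc.span B0" "finite B0"
    "card B0 = sc.dim (forms d \<inter> I)"
    using finite_basis_forms[of "forms d \<inter> I" d] by blast
  obtain B where B: "B0 \<subseteq> B" "B \<subseteq> forms d" "sc.independent B" "forms d \<subseteq> sc.span B" "finite B"
    "card B = sc.dim (forms d :: 'k poly3 set)"
    using sc.finite_basis_extend[OF forms_finite_span _ B0(2), of d] B0 by blast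
  \<comment> \<open>C spans a complement of the degree d part of I in the forms of degree d, so
    residue classes identify its span with the graded piece.\<close>
  define C where "C = B - B0"
  have C: "finite C" "sc.independent C"
    using B(5) sc.independent_mono[OF B(3), of C] by (auto simp: C_def)
  have Cf: "sc.span C \<subseteq> forms d" 
    by (rule sc.span_minimal[OF _ subspace_forms]) (use B(2) in \<open>auto simp: C_def\<close>)
  have "x = 0" if "x \<in> sc.span C" "x \<in> I" for x
  proof -
    have "x \<in> sc.span B0" using that Cf B0 by blast
    then show ?thesis
      using sc.independent_span_Int[of B0 C x] that B0 B by (simp add: C_def Un_absorb1)
  qed
  then have "sc.span C \<inter> I = {0}" using ideal_zero sc.span_zero by blast
  then have "ring.dimension (quotient_alg I) (card C) (scalars I) (residue I ` sc.span C)"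
    by (rule dimension_residue_span[OF C])
  moreover have "card C = sc.dim (forms d :: 'k poly3 set) - sc.dim (forms d \<inter> I)"
    unfolding C_def using B B0 by (simp add: card_Diff_subset)
  moreover have "residue I ` sc.span C = graded_piece I d"
  proof
    show "residue I ` sc.span C \<subseteq> graded_piece I d" using Cf by (auto simp: graded_piece_def)
    show "graded_piece I d \<subseteq> residue I ` sc.span C"
    proof
      fix x assume "x \<in> graded_piece I d"
      then obtain f where f: "f \<in> forms d" "x = residue I f" by (auto simp: graded_piece_def)
      then have "f \<in> sc.span (B0 \<union> C)" using B by (auto simp: C_def Un_absorb1)
      then obtain a b where ab: "f = a + b" "a \<in> sc.span B0" "b \<in> sc.span C"
        by (auto simp: sc.span_Un)
      have "a \<in> I" using ab(2) sc.span_minimal[OF _ subspace_ideal, of B0] B0 by blast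
      then have "x = residue I b" using f ab by (simp add: residue_eq_iff)
      then show "x \<in> residue I ` sc.span C" using ab by blast
    qed
  qed
  ultimately show ?thesis by simp
qed

text \<open>Properness of I keeps the image of k a field. Over a field the dimension is unique,
  which turns one computed dimension into the equivalence that follows.\<close>

lemma subfield_scalars:
  assumes "1 \<notin> I"
  shows "subfield (scalars I) (quotient_alg I)"
proof -
  let ?k = "ring_of_type_algebra :: 'k ring"
  have k: "field ?k" by (rule field_from_type_algebra)
  have "const (c + c') = (const c + const c' :: 'k poly3)" for c c' :: 'k by (simp add: const_def single_add)
  moreover have "const (c * c') = (const c * const c' :: 'k poly3)" for c c' :: 'k by (simp add: const_def mult_single)
  moreover have "const 1 = (1 :: 'k poly3)" by (simp add: const_def)
  moreover have "residue I 1 = \<one>\<^bsub>quotient_alg I\<^esub>"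
    using ring_hom_one[OF ring_hom_ring.homh[OF residue_hom]] by simp
  ultimately have h: "ring_hom_ring ?k (quotient_alg I) (\<lambda>c. residue I (const c))"
    by (intro ring_hom_ringI[OF ring_from_type_algebra ideal.quotient_is_ring[OF I]])
      (simp_all add: residue_carrier residue_add residue_mult)
  have "\<one>\<^bsub>quotient_alg I\<^esub> \<noteq> \<zero>\<^bsub>quotient_alg I\<^esub>"
    using assms \<open>residue I 1 = \<one>\<^bsub>quotient_alg I\<^esub>\<close> residue_eq_zero by metis
  then have "subfield ((\<lambda>c. residue I (const c)) ` carrier ?k) (quotient_alg I)"
    by (rule ring_hom_ring.img_is_subfield(2)[OF h field.carrier_is_subfield[OF k]])
  then show ?thesis by (simp add: scalars_def)
qed

lemma dimension_graded_piece_iff: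
  assumes "1 \<notin> I"
  shows "ring.dimension (quotient_alg I) n (scalars I) (graded_piece I d) \<longleftrightarrow>
    n + sc.dim (forms d \<inter> I) = (d + 2) choose 2"
proof -
  have le: "sc.dim (forms d \<inter> I) \<le> (d + 2) choose 2" by (rule dim_forms_subset) auto
  let ?D = "\<lambda>n. ring.dimension (quotient_alg I) n (scalars I) (graded_piece I d)"
  have D: "?D (((d + 2) choose 2) - sc.dim (forms d \<inter> I))"
    using dimension_graded_piece[of d] by (simp add: dim_forms)
  show ?thesis
  proof
    assume "?D n"
    then have "n = ((d + 2) choose 2) - sc.dim (forms d \<inter> I)"
      using ring.dimension_is_inj[OF ideal.quotient_is_ring[OF I] subfield_scalars[OF assms] _ D] by blast
    then show "n + sc.dim (forms d \<inter> I) = (d + 2) choose 2" using le by simp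
  next
    assume "n + sc.dim (forms d \<inter> I) = (d + 2) choose 2"
    then have "n = ((d + 2) choose 2) - sc.dim (forms d \<inter> I)" by simp
    then show "?D n" using D by (simp only:)
  qed
qed

lemma graded_piece_zero_iff: "graded_piece I d = {\<zero>\<^bsub>quotient_alg I\<^esub>} \<longleftrightarrow> forms d \<subseteq> I"
proof -
  have "residue I 0 \<in> graded_piece I d" unfolding graded_piece_def by (rule imageI) simp
  then have "graded_piece I d = {z} \<longleftrightarrow> (\<forall>f\<in>forms d. residue I f = z)" for z
    unfolding graded_piece_def by (simp add: set_eq_iff image_iff) metis
  then show ?thesis by (simp only: residue_eq_zero subset_eq)
qed

lemma has_socle_degree_iff: "has_socle_degree I e \<longleftrightarrow> \<not> forms e \<subseteq> I \<and> (\<forall>d>e. forms d \<subseteq> I)"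
  by (simp add: has_socle_degree_def graded_piece_zero_iff)

lemma has_hvector_iff:
  "has_hvector I e h \<longleftrightarrow> \<not> forms e \<subseteq> I \<and> (\<forall>d>e. forms d \<subseteq> I) \<and>
    (\<forall>d\<le>e. h d + sc.dim (forms d \<inter> I) = (d + 2) choose 2)"
proof (cases "1 \<in> I")
  case True
  \<comment> \<open>Both sides fail for the unit ideal, since it contains all forms of degree
    e.\<close>
  then have "forms e \<subseteq> I" using ideal_mult[OF True] by auto
  then show ?thesis by (simp add: has_hvector_def has_socle_degree_iff)
next
  case False
  then show ?thesis
    by (simp add: has_hvector_def has_socle_degree_iff dimension_graded_piece_iff)
qed

end

declare actm.scale_scale [simp del]

subsection \<open>Hilbert functions in the family\<close>

definition annih :: "'k::field_char_0 poly3 \<Rightarrow> 'k poly3 \<Rightarrow> 'k poly3 set" where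
  "annih F G = {f. f \<circ>\<^sub>d F = 0 \<and> f \<circ>\<^sub>d G = 0}"

lemma subspace_kernel: "sc.subspace {G. f \<circ>\<^sub>d G = (0 :: 'k::field_char_0 poly3)}"
  by (auto simp: sc.subspace_def act_add_right act_scale_right)

text \<open>By commutativity the polynomials killed by f form a submodule, so testing f on the two
  generators is enough.\<close>

lemma inverse_system_ideal_span:
  "inverse_system_ideal (sc.span {F, G}) = annih F (G :: 'k::field_char_0 poly3)"
proof
  have sub: "sc.span {F, G} \<subseteq> actm.span (sc.span {F, G})" by (rule actm.span_superset)
  have "F \<in> sc.span {F, G}" "G \<in> sc.span {F, G}" by (simp_all add: sc.span_base)
  then show "inverse_system_ideal (sc.span {F, G}) \<subseteq> annih F G"
    using sub by (auto simp: inverse_system_ideal_def Ann_def annih_def)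
  show "annih F G \<subseteq> inverse_system_ideal (sc.span {F, G})"
  proof
    fix f assume "f \<in> annih F G"
    then have "{F, G} \<subseteq> {H. f \<circ>\<^sub>d H = 0}" by (auto simp: annih_def)
    then have "sc.span {F, G} \<subseteq> {H. f \<circ>\<^sub>d H = 0}"
      by (rule sc.span_minimal[OF _ subspace_kernel])
    moreover have "actm.subspace {H. f \<circ>\<^sub>d H = 0}"
      by (auto simp: actm.subspace_def act_add_right act_commute[of f])
    ultimately have "actm.span (sc.span {F, G}) \<subseteq> {H. f \<circ>\<^sub>d H = 0}"
      by (rule actm.span_minimal)
    then show "f \<in> inverse_system_ideal (sc.span {F, G})"
      by (auto simp: inverse_system_ideal_def Ann_def)
  qed
qed

lemma ideal_annih: "ideal (annih F G) polyring"
  by (rule ideal_polyringI) (simp_all add: annih_def act_add_left act_mult)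

lemma linear_act: "Vector_Spaces.linear scale scale (\<lambda>f. f \<circ>\<^sub>d (H :: 'k::field_char_0 poly3))"
  unfolding Vector_Spaces.linear_iff
  by (auto simp: act_add_left act_scale_left sc.vector_space_axioms)

lemma linear_act_right: "Vector_Spaces.linear scale scale (\<lambda>H. f \<circ>\<^sub>d (H :: 'k::field_char_0 poly3))"
  unfolding Vector_Spaces.linear_iff
  by (auto simp: act_add_right act_scale_right sc.vector_space_axioms)

lemma dim_mult_image_subspace:
  assumes "Q \<noteq> (0 :: 'k::field poly3)" "sc.subspace V" "V \<subseteq> forms d"
  shows "sc.dim ((*) Q ` V) = sc.dim V"
proof -
  have *: "{v \<in> V. Q * v = 0} = {0}"
  proof (rule Set.set_eqI)
    fix v :: "'k poly3"
    show "v \<in> {v \<in> V. Q * v = 0} \<longleftrightarrow> v \<in> {0}"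
      using assms(1) sc.subspace_0[OF assms(2)] by (cases "v = 0") simp_all
  qed
  have "sc.dim {0 :: 'k poly3} \<le> card ({} :: 'k poly3 set)"
    by (rule sc.dim_le_card) simp_all
  then have **: "sc.dim {0 :: 'k poly3} = 0" by simp
  show ?thesis
    using sc2.rank_nullity_subspace[OF linear_mult[of Q] assms(2) order_trans[OF assms(3) forms_finite_span(1)] forms_finite_span(2)]
    unfolding * ** by (simp only: add_0_right)
qed

lemma rank_nullity_act:
  fixes H :: "'k::field_char_0 poly3"
  shows "sc.dim ((\<lambda>f. f \<circ>\<^sub>d H) ` forms d) + sc.dim {f \<in> forms d. f \<circ>\<^sub>d H = 0} = (d + 2) choose 2"
  using sc2.rank_nullity_subspace[OF linear_act[of H] subspace_forms forms_finite_span, of d]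
  unfolding dim_forms by (simp only:)

lemma subspace_act_kernel: "sc.subspace {f \<in> forms d. f \<circ>\<^sub>d (H :: 'k::field_char_0 poly3) = 0}"
  by (auto simp: sc.subspace_def act_add_left act_scale_left intro: forms_add forms_scale)

text \<open>The form \<open>F\<close> is killed by \<open>l1\<close> and \<open>l1 \<circ> G\<close> by \<open>l2\<close>: in suitable coordinates both are binary
  forms, which bounds the dimensions of their spaces of derivatives.\<close>

locale family_data =
  fixes e :: nat and F G l1 l2 :: "'k::field_char_0 poly3"
  assumes F: "F \<in> forms e" and G: "G \<in> forms e"
    and l1: "l1 \<in> forms 1" "l1 \<noteq> 0" and l2: "l2 \<in> forms 1" "l2 \<noteq> 0"
    and F0: "l1 \<circ>\<^sub>d F = 0" and G0: "(l1 * l2) \<circ>\<^sub>d G = 0"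
begin

lemma l2H: "l2 \<circ>\<^sub>d l1 \<circ>\<^sub>d G = 0"
  using G0 by (simp add: act_mult act_commute)

lemma H: "l1 \<circ>\<^sub>d G \<in> forms (e - 1)"
  by (rule act_forms[OF l1(1) G])

lemma quadric: "l1 * l2 \<in> forms 2" "l1 * l2 \<noteq> 0" "(l1 * l2) \<circ>\<^sub>d F = 0"
  using forms_mult[OF l1(1) l2(1)] l1 l2 F0 act_commute[of l1 l2 F] by (auto simp: act_mult numeral_2_eq_2)

lemma H_image:
  assumes "1 \<le> d" "d \<le> e"
  shows "(\<lambda>g. g \<circ>\<^sub>d l1 \<circ>\<^sub>d G) ` forms (d - 1) \<subseteq> {K \<in> forms (e - d). l2 \<circ>\<^sub>d K = 0}"
proof
  fix K assume "K \<in> (\<lambda>g. g \<circ>\<^sub>d l1 \<circ>\<^sub>d G) ` forms (d - 1)"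
  then obtain g where g: "g \<in> forms (d - 1)" "K = g \<circ>\<^sub>d l1 \<circ>\<^sub>d G" by blast
  have "e - 1 - (d - 1) = e - d" using assms by simp
  then have "K \<in> forms (e - d)" using act_forms[OF g(1) H] g(2) by simp
  moreover have "l2 \<circ>\<^sub>d K = 0" using act_commute[of l2 g] l2H g(2) by simp
  ultimately show "K \<in> {K \<in> forms (e - d). l2 \<circ>\<^sub>d K = 0}" by simp
qed

text \<open>The derivatives of \<open>l1 \<circ>\<^sub>d G\<close> are killed by \<open>l2\<close>,
  hence are binary forms of degree e - d in suitable coordinates.\<close>

lemma rank_H_le:
  assumes "1 \<le> d" "d \<le> e"
  shows "sc.dim ((\<lambda>g. g \<circ>\<^sub>d l1 \<circ>\<^sub>d G) ` forms (d - 1)) \<le> e - d + 1"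
proof -
  have "sc.dim ((\<lambda>g. g \<circ>\<^sub>d l1 \<circ>\<^sub>d G) ` forms (d - 1)) \<le> sc.dim {K \<in> forms (e - d). l2 \<circ>\<^sub>d K = 0}"
    by (rule sc.dim_mono_finite[OF H_image[OF assms] _ forms_finite_span(2)])
      (use forms_finite_span(1) in blast)
  also have "\<dots> \<le> e - d + 1" by (rule dim_kernel_linear[OF l2])
  finally show ?thesis .
qed

lemma mult_kernel_subset:
  assumes "1 \<le> d"
  shows "(*) l1 ` {g \<in> forms (d - 1). g \<circ>\<^sub>d l1 \<circ>\<^sub>d G = 0} \<subseteq> forms d \<inter> annih F G"
proof
  fix f assume "f \<in> (*) l1 ` {g \<in> forms (d - 1). g \<circ>\<^sub>d l1 \<circ>\<^sub>d G = 0}"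
  then obtain g where g: "g \<in> forms (d - 1)" "g \<circ>\<^sub>d l1 \<circ>\<^sub>d G = 0" "f = l1 * g" by blast
  have "f \<in> forms d" using forms_mult[OF l1(1) g(1)] g(3) assms by simp
  moreover have "f \<circ>\<^sub>d F = 0" using F0 act_commute[of l1 g F] by (simp add: g(3) act_mult)
  moreover have "f \<circ>\<^sub>d G = 0" using g(2) act_commute[of l1 g G] by (simp add: g(3) act_mult)
  ultimately show "f \<in> forms d \<inter> annih F G" by (simp add: annih_def)
qed

text \<open>If g kills \<open>l1 \<circ>\<^sub>d G\<close>, then \<open>l1 * g\<close> kills both F
  and G. Only the rank of g acting on \<open>l1 \<circ>\<^sub>d G\<close> is lost.\<close>

lemma dim_annih_ge_rank_H:
  assumes "1 \<le> d"
  shows "(d - 1 + 2) choose 2 \<le> sc.dim (forms d \<inter> annih F G) + sc.dim ((\<lambda>g. g \<circ>\<^sub>d l1 \<circ>\<^sub>d G) ` forms (d - 1))"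
proof -
  let ?K = "{g \<in> forms (d - 1). g \<circ>\<^sub>d l1 \<circ>\<^sub>d G = 0}"
  have "sc.dim ?K = sc.dim ((*) l1 ` ?K)"
    by (rule dim_mult_image_subspace[OF l1(2) subspace_act_kernel, symmetric]) blast
  also have "\<dots> \<le> sc.dim (forms d \<inter> annih F G)"
    by (rule sc.dim_mono_finite[OF mult_kernel_subset[OF assms] _ forms_finite_span(2)])
      (use forms_finite_span(1) in blast)
  finally show ?thesis using rank_nullity_act[of "l1 \<circ>\<^sub>d G" "d - 1"] by linarith
qed

lemma dim_act_image_le:
  fixes K Q :: "'k poly3"
  assumes "Q \<in> forms q" "Q \<noteq> 0" "Q \<circ>\<^sub>d K = 0" "q \<le> j"
  shows "sc.dim ((\<lambda>f. f \<circ>\<^sub>d K) ` forms j) + ((j - q + 2) choose 2) \<le> (j + 2) choose 2"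
proof -
  have "(*) Q ` forms (j - q) \<subseteq> {f \<in> forms j. f \<circ>\<^sub>d K = 0}"
  proof
    fix f assume "f \<in> (*) Q ` forms (j - q)"
    then obtain g where g: "g \<in> forms (j - q)" "f = Q * g" by blast
    then show "f \<in> {f \<in> forms j. f \<circ>\<^sub>d K = 0}"
      using forms_mult[OF assms(1) g(1)] assms(3,4) act_commute[of Q g K] by (simp add: act_mult)
  qed
  then have "sc.dim ((*) Q ` forms (j - q)) \<le> sc.dim {f \<in> forms j. f \<circ>\<^sub>d K = 0}"
    by (rule sc.dim_mono_finite[OF _ _ forms_finite_span(2)]) (use forms_finite_span(1) in blast)
  then show ?thesis
    using rank_nullity_act[of K j] dim_mult_image[OF assms(2), of "j - q"] by linarith
qed

lemma dim_image_F: "sc.dim ((\<lambda>f. f \<circ>\<^sub>d F) ` forms j) \<le> j + 1"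
proof (cases "1 \<le> j")
  case True
  then show ?thesis using dim_act_image_le[OF l1 F0 True] choose_two_diff1[OF True] by linarith
next
  case False
  then have "j = 0" by simp
  moreover have "(0 + 2) choose 2 = (1::nat)" by (simp add: choose_two)
  ultimately show ?thesis using rank_nullity_act[of F 0] by simp
qed

lemma dim_image_G: "sc.dim ((\<lambda>f. f \<circ>\<^sub>d G) ` forms j) \<le> 2 * j + 1"
proof (cases "2 \<le> j")
  case True
  then show ?thesis using dim_act_image_le[OF quadric(1,2) G0 True] choose_two_diff2[OF True] by linarith
next
  case False
  then have "j = 0 \<or> j = 1" by auto
  moreover have "(0 + 2) choose 2 = (1::nat)" "(1 + 2) choose 2 = (3::nat)" by (simp_all add: choose_two)
  ultimately show ?thesis using rank_nullity_act[of G j] by auto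
qed

text \<open>The derivatives of F contribute at most j + 1 and those of G at most 2 j + 1, since a
  linear form kills F and a quadric kills G.\<close>

lemma dim_derivs_le: "sc.dim (derivs j F G) \<le> 3 * j + 2"
proof -
  let ?A = "(\<lambda>f. f \<circ>\<^sub>d F) ` forms j" and ?B = "(\<lambda>f. f \<circ>\<^sub>d G) ` forms j"
  have "?A \<subseteq> forms (e - j)" "?B \<subseteq> forms (e - j)" using act_forms[OF _ F] act_forms[OF _ G] by blast+
  then obtain A B where A: "A \<subseteq> ?A" "?A \<subseteq> sc.span A" "finite A" "card A = sc.dim ?A"
    and B: "B \<subseteq> ?B" "?B \<subseteq> sc.span B" "finite B" "card B = sc.dim ?B"
    by (metis finite_basis_forms)
  have "derivs j F G \<subseteq> sc.span (A \<union> B)"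
  proof
    fix x assume "x \<in> derivs j F G"
    then obtain f g where "x = f \<circ>\<^sub>d F + g \<circ>\<^sub>d G" "f \<in> forms j" "g \<in> forms j" unfolding derivs_def by blast
    moreover have "sc.span A \<subseteq> sc.span (A \<union> B)" "sc.span B \<subseteq> sc.span (A \<union> B)"
      by (auto intro: sc.span_mono[THEN subsetD])
    ultimately show "x \<in> sc.span (A \<union> B)" using A(2) B(2) by (blast intro: sc.span_add)
  qed
  then have "sc.dim (derivs j F G) \<le> card (A \<union> B)" by (rule sc.dim_le_card) (use A B in simp)
  also have "\<dots> \<le> card A + card B" by (rule card_Un_le)
  finally show ?thesis using A(4) B(4) dim_image_F[of j] dim_image_G[of j] by linarith
qed

lemma forms_Int_annih: "forms d \<inter> annih F G = {f \<in> forms d. f \<circ>\<^sub>d F = 0 \<and> f \<circ>\<^sub>d G = 0}"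
  by (auto simp: annih_def)

text \<open>One lower bound for the annihilator per term of the minimum: the multiples of
  \<open>l1 * l2\<close>; the multiples of \<open>l1\<close> from
  \<open>dim_annih_ge_rank_H\<close>, where (d + 1) + (e - d + 1) = e + 2; and by duality the count
  of derivatives.\<close>

lemma hvec_upper_bound:
  assumes "d \<le> e"
  shows "(d + 2) choose 2 \<le> sc.dim (forms d \<inter> annih F G) + hvec e d"
proof -
  let ?u = "sc.dim (forms d \<inter> annih F G)"
  have small: "(0 + 2) choose 2 = (1::nat)" "(1 + 2) choose 2 = (3::nat)" by (simp_all add: choose_two)
  have a: "(d + 2) choose 2 \<le> ?u + (2 * d + 1)"
  proof (cases "2 \<le> d")
    case True
    have "(*) (l1 * l2) ` forms (d - 2) \<subseteq> forms d \<inter> annih F G"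
    proof
      fix f assume "f \<in> (*) (l1 * l2) ` forms (d - 2)"
      then obtain g where g: "g \<in> forms (d - 2)" "f = (l1 * l2) * g" by blast
      have "f \<circ>\<^sub>d K = g \<circ>\<^sub>d (l1 * l2) \<circ>\<^sub>d K" for K
        by (simp only: g(2) act_mult[symmetric] mult.commute)
      moreover have "f \<in> forms d"
        using forms_mult[OF quadric(1) g(1)] unfolding g(2) le_add_diff_inverse[OF True] .
      ultimately show "f \<in> forms d \<inter> annih F G"
        using quadric(3) G0 by (simp add: annih_def)
    qed
    then have "sc.dim ((*) (l1 * l2) ` forms (d - 2)) \<le> ?u"
      by (rule sc.dim_mono_finite[OF _ _ forms_finite_span(2)]) (use forms_finite_span(1) in blast)
    then show ?thesis
      using dim_mult_image[OF quadric(2), of "d - 2"] choose_two_diff2[OF True] by linarith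
  next
    case False
    then have "d = 0 \<or> d = 1" by auto
    then show ?thesis using small by auto
  qed
  have b: "(d + 2) choose 2 \<le> ?u + (e + 2)"
  proof (cases "1 \<le> d")
    case True
    show ?thesis
      using dim_annih_ge_rank_H[OF True] rank_H_le[OF True assms] choose_two_diff1[OF True] assms by linarith
  next
    case False
    then have "d = 0" by simp
    then show ?thesis using small by simp
  qed
  have c: "(d + 2) choose 2 \<le> ?u + (3 * (e - d) + 2)"
    unfolding forms_Int_annih using dim_derivs[OF F G assms] dim_derivs_le[of "e - d"] by linarith
  have "hvec e d \<in> {2 * d + 1, e + 2, 3 * (e - d) + 2}" unfolding hvec_def by (rule Min_in) auto
  then show ?thesis using a b c by auto
qed

text \<open>Multiplication by l fails twice. On the ideal generated by \<open>l1\<close>, which is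
  seen through the derivatives of \<open>l1 \<circ>\<^sub>d G\<close>, the dimension drops from e -
  d + 1 to at most e - d, so l is not injective. Modulo \<open>l1\<close> degree d + 1 keeps its
  full dimension d + 2, which the at most d + 1 dimensions in degree d cannot fill, so l is not
  surjective.\<close>

lemma not_Lefschetz_degree:
  assumes "1 \<le> d" "d + 1 \<le> e" "l \<in> forms 1"
    and h: "e + 2 + sc.dim (forms d \<inter> annih F G) = (d + 2) choose 2"
    and h': "e + 2 + sc.dim (forms (d + 1) \<inter> annih F G) = (d + 1 + 2) choose 2"
  shows "\<exists>f\<in>forms d. f \<notin> annih F G \<and> l * f \<in> annih F G"
    and "\<exists>p\<in>forms (d + 1). \<forall>f\<in>forms d. p - l * f \<notin> annih F G"
proof -
  let ?V = "(\<lambda>g. g \<circ>\<^sub>d l1 \<circ>\<^sub>d G) ` forms (d - 1)"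
  have ch: "(d + 2) choose 2 = ((d - 1 + 2) choose 2) + (d + 1)" by (rule choose_two_diff1[OF assms(1)])
  \<comment> \<open>The assumed value of the Hilbert function leaves no slack in
    \<open>rank_H_le\<close>.\<close>
  have rV: "e - d + 1 \<le> sc.dim ?V"
    using dim_annih_ge_rank_H[OF assms(1)] h ch assms by linarith
  have Vsub: "?V \<subseteq> {K \<in> forms (e - d). l2 \<circ>\<^sub>d K = 0}" by (rule H_image) (use assms in auto)
  have Vs: "sc.subspace ?V"
    by (rule sc2.linear_subspace_image[OF linear_act[of "l1 \<circ>\<^sub>d G"] subspace_forms])
  have lV: "(\<lambda>K. l \<circ>\<^sub>d K) ` ?V \<subseteq> {K \<in> forms (e - d - 1). l2 \<circ>\<^sub>d K = 0}"
  proof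
    fix K' assume "K' \<in> (\<lambda>K. l \<circ>\<^sub>d K) ` ?V"
    then obtain K where K: "K' = l \<circ>\<^sub>d K" "K \<in> forms (e - d)" "l2 \<circ>\<^sub>d K = 0" using Vsub by blast
    then show "K' \<in> {K \<in> forms (e - d - 1). l2 \<circ>\<^sub>d K = 0}"
      using act_forms[OF assms(3) K(2)] act_commute[of l2 l K] by simp
  qed
  have "sc.dim ((\<lambda>K. l \<circ>\<^sub>d K) ` ?V) \<le> sc.dim {K \<in> forms (e - d - 1). l2 \<circ>\<^sub>d K = 0}"
    by (rule sc.dim_mono_finite[OF lV _ forms_finite_span(2)]) (use forms_finite_span(1) in blast)
  also have "\<dots> \<le> e - d" using dim_kernel_linear[OF l2, of "e - d - 1"] assms(2) by simp
  finally have "sc.dim ((\<lambda>K. l \<circ>\<^sub>d K) ` ?V) \<le> e - d" .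
  moreover have "sc.dim ?V = sc.dim ((\<lambda>K. l \<circ>\<^sub>d K) ` ?V) + sc.dim {K \<in> ?V. l \<circ>\<^sub>d K = 0}"
    by (rule sc2.rank_nullity_subspace[OF linear_act_right Vs _ forms_finite_span(2)])
      (use Vsub forms_finite_span(1) in blast)
  ultimately have "sc.dim {K \<in> ?V. l \<circ>\<^sub>d K = 0} \<noteq> 0" using rV by linarith
  moreover have "sc.dim {K \<in> ?V. l \<circ>\<^sub>d K = 0} \<le> card ({} :: 'k poly3 set)" if "{K \<in> ?V. l \<circ>\<^sub>d K = 0} \<subseteq> {0}"
    by (rule sc.dim_le_card) (use that in simp_all)
  ultimately have "\<not> {K \<in> ?V. l \<circ>\<^sub>d K = 0} \<subseteq> {0}" by auto
  then obtain g where g: "g \<in> forms (d - 1)" "l \<circ>\<^sub>d g \<circ>\<^sub>d l1 \<circ>\<^sub>d G = 0" "g \<circ>\<^sub>d l1 \<circ>\<^sub>d G \<noteq> 0" by blast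
  have 1: "l1 * g \<in> forms d" using forms_mult[OF l1(1) g(1)] assms(1) by simp
  have 2: "(l1 * g) \<circ>\<^sub>d G = g \<circ>\<^sub>d l1 \<circ>\<^sub>d G" by (simp only: act_mult act_commute)
  have 3: "(l1 * g) \<circ>\<^sub>d F = 0" using act_commute[of l1 g F] F0 by (simp add: act_mult)
  have "l * (l1 * g) \<in> annih F G"
    unfolding annih_def using g(2) 2 3 by (simp add: act_mult[of l])
  moreover have "l1 * g \<notin> annih F G" using g(3) 2 by (simp add: annih_def)
  ultimately show "\<exists>f\<in>forms d. f \<notin> annih F G \<and> l * f \<in> annih F G" using 1 by blast
next
  \<comment> \<open>In degree d + 1 the Hilbert function forces every annihilating form to be
    divisible by \<open>l1\<close>; the kernel here consists of the possible cofactors.\<close>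
  let ?K = "{g \<in> forms d. g \<circ>\<^sub>d l1 \<circ>\<^sub>d G = 0}"
  have "(*) l1 ` ?K = forms (d + 1) \<inter> annih F G"
  proof (rule sc.subspace_eq_if_dim_le[OF subspace_mult_image[OF subspace_act_kernel] _ _ forms_finite_span(2)])
    show "(*) l1 ` ?K \<subseteq> forms (d + 1) \<inter> annih F G" using mult_kernel_subset[of "d + 1"] by simp
    show "forms (d + 1) \<inter> annih F G \<subseteq> sc.span (monf ` mons (d + 1))" using forms_finite_span(1) by blast
    have "sc.dim ((*) l1 ` ?K) = sc.dim ?K"
      by (rule dim_mult_image_subspace[OF l1(2) subspace_act_kernel]) blast
    moreover have "sc.dim ((\<lambda>g. g \<circ>\<^sub>d l1 \<circ>\<^sub>d G) ` forms d) \<le> e - d"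
      using rank_H_le[of "d + 1"] assms(2) by simp
    ultimately show "sc.dim (forms (d + 1) \<inter> annih F G) \<le> sc.dim ((*) l1 ` ?K)"
      using rank_nullity_act[of "l1 \<circ>\<^sub>d G" d] h' choose_two_diff1[of "d + 1"] assms(2) by simp
  qed
  then have sub: "forms (d + 1) \<inter> annih F G \<subseteq> (*) l1 ` forms d" by blast
  let ?L = "{K \<in> forms (d + 1). l1 \<circ>\<^sub>d K = 0}"
  have Ls: "sc.subspace ?L"
    by (auto simp: sc.subspace_def act_add_right act_scale_right intro: forms_add forms_scale)
  have dL: "sc.dim ?L = d + 2"
    using dim_kernel[OF l1, of "d + 1"] choose_two_diff1[of "d + 1"] by simp
  have "(\<lambda>K. l \<circ>\<^sub>d K) ` ?L \<subseteq> {K \<in> forms d. l1 \<circ>\<^sub>d K = 0}"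
  proof
    fix K' assume "K' \<in> (\<lambda>K. l \<circ>\<^sub>d K) ` ?L"
    then obtain K where K: "K' = l \<circ>\<^sub>d K" "K \<in> forms (d + 1)" "l1 \<circ>\<^sub>d K = 0" by blast
    then show "K' \<in> {K \<in> forms d. l1 \<circ>\<^sub>d K = 0}"
      using act_forms[OF assms(3) K(2)] act_commute[of l1 l K] by simp
  qed
  then have "sc.dim ((\<lambda>K. l \<circ>\<^sub>d K) ` ?L) \<le> sc.dim {K \<in> forms d. l1 \<circ>\<^sub>d K = 0}"
    by (rule sc.dim_mono_finite[OF _ _ forms_finite_span(2)]) (use forms_finite_span(1) in blast)
  moreover have "\<dots> \<le> d + 1" by (rule dim_kernel_linear[OF l1])
  moreover have "sc.dim ?L = sc.dim ((\<lambda>K. l \<circ>\<^sub>d K) ` ?L) + sc.dim {K \<in> ?L. l \<circ>\<^sub>d K = 0}"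
    by (rule sc2.rank_nullity_subspace[OF linear_act_right Ls _ forms_finite_span(2)])
      (use forms_finite_span(1) in blast)
  ultimately have "sc.dim {K \<in> ?L. l \<circ>\<^sub>d K = 0} \<noteq> 0" using dL by linarith
  moreover have "sc.dim {K \<in> ?L. l \<circ>\<^sub>d K = 0} \<le> card ({} :: 'k poly3 set)" if "{K \<in> ?L. l \<circ>\<^sub>d K = 0} \<subseteq> {0}"
    by (rule sc.dim_le_card) (use that in simp_all)
  ultimately have "\<not> {K \<in> ?L. l \<circ>\<^sub>d K = 0} \<subseteq> {0}" by auto
  \<comment> \<open>K is killed by \<open>l1\<close> and by l, hence orthogonal to all
    \<open>l * f + l1 * g\<close>. A form p that pairs nontrivially with K is not of this
    shape.\<close>
  then obtain K where K: "K \<in> forms (d + 1)" "l1 \<circ>\<^sub>d K = 0" "l \<circ>\<^sub>d K = 0" "K \<noteq> 0" by blast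
  then obtain p where p: "p \<in> forms (d + 1)" "apol p K \<noteq> 0" using apol_nondegenerate_right by blast
  have "p - l * f \<notin> annih F G" if f: "f \<in> forms d" for f
  proof
    assume "p - l * f \<in> annih F G"
    moreover have "p - l * f \<in> forms (d + 1)"
      using forms_mult[OF assms(3) f] p(1) by (intro forms_diff) (simp_all add: add.commute)
    ultimately obtain g where "p - l * f = l1 * g" using sub by blast
    then have "p = f * l + g * l1" by (simp add: algebra_simps)
    then have "apol p K = 0" using K by (simp add: ap.add_left apol_mult)
    then show False using p by simp
  qed
  then show "\<exists>p\<in>forms (d + 1). \<forall>f\<in>forms d. p - l * f \<notin> annih F G" using p by blast
qed

end

subsection \<open>Level algebras with the given h-vector\<close>

lemma lookup_hom_component:
  "Poly_Mapping.lookup (hom_component d f) m = (if mdeg m = d then Poly_Mapping.lookup f m else 0)"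
proof -
  have "Poly_Mapping.lookup (hom_component d f) m =
    (\<Sum>n\<in>{n \<in> Poly_Mapping.keys f. mdeg n = d}. if n = m then Poly_Mapping.lookup f m else 0)"
    unfolding hom_component_def lookup_sum by (rule sum.cong) (auto simp: lookup_single when_def)
  also have "\<dots> = (if m \<in> {n \<in> Poly_Mapping.keys f. mdeg n = d} then Poly_Mapping.lookup f m else 0)"
    by (rule sum.delta) simp
  finally show ?thesis by (auto simp: in_keys_iff)
qed

lemma hom_component_forms: "hom_component d f \<in> forms d"
  by (simp add: forms_lookup lookup_hom_component)

lemma hom_component_diff: "hom_component d (f - g) = hom_component d f - hom_component d g"
  for f :: "('i, 'k::ab_group_add) mpoly"
  by (rule poly_mapping_eqI) (simp add: lookup_hom_component lookup_minus)

lemma hom_component_of_form: "f \<in> forms d \<Longrightarrow> hom_component c f = (if c = d then f else 0)"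
  by (rule poly_mapping_eqI) (auto simp: lookup_hom_component forms_lookup)

lemma sum_hom_components:
  obtains D where "finite D" "f = (\<Sum>d\<in>D. hom_component d f)"
proof -
  let ?D = "mdeg ` Poly_Mapping.keys f"
  have "f = (\<Sum>d\<in>?D. hom_component d f)"
  proof (rule poly_mapping_eqI)
    fix m
    have "Poly_Mapping.lookup (\<Sum>d\<in>?D. hom_component d f) m
      = (\<Sum>d\<in>?D. if d = mdeg m then Poly_Mapping.lookup f m else 0)"
      unfolding lookup_sum by (rule sum.cong) (auto simp: lookup_hom_component)
    also have "\<dots> = (if mdeg m \<in> ?D then Poly_Mapping.lookup f m else 0)"
      by (rule sum.delta) simp
    also have "\<dots> = Poly_Mapping.lookup f m" by (auto simp: in_keys_iff)
    finally show "Poly_Mapping.lookup f m = Poly_Mapping.lookup (\<Sum>d\<in>?D. hom_component d f) m" by simp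
  qed
  then show ?thesis using that[of ?D] by simp
qed

lemma hom_component_act:
  fixes F :: "'k::field_char_0 poly3"
  assumes "F \<in> forms e" "f \<circ>\<^sub>d F = 0"
  shows "hom_component d f \<circ>\<^sub>d F = 0"
proof -
  have "hat (hom_component d f \<circ>\<^sub>d F) n = 0" for n
  proof (cases "d + mdeg n = e")
    case True
    let ?K = "Poly_Mapping.keys f"
    have "hat (hom_component d f \<circ>\<^sub>d F) n = (\<Sum>m\<in>?K. Poly_Mapping.lookup (hom_component d f) m * hat F (m + n))"
      unfolding hat_act by (rule pair_eq_sum) (auto simp: in_keys_iff lookup_hom_component split: if_splits)
    also have "\<dots> = (\<Sum>m\<in>?K. Poly_Mapping.lookup f m * hat F (m + n))"
      using True assms(1) by (intro sum.cong) (auto simp: lookup_hom_component forms_hat)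
    also have "\<dots> = hat (f \<circ>\<^sub>d F) n" by (simp add: hat_act pair_def)
    finally show ?thesis using assms(2) by simp
  next
    case False
    show ?thesis unfolding hat_act pair_def
    proof (rule sum.neutral, rule ballI)
      fix m
      show "Poly_Mapping.lookup (hom_component d f) m * hat F (m + n) = 0"
        using False assms(1) by (cases "mdeg m = d") (simp_all add: lookup_hom_component forms_hat)
    qed
  qed
  then show ?thesis by (simp add: hat_inject)
qed

lemma one_notin_if_socle: "ideal I polyring \<Longrightarrow> has_socle_degree I e \<Longrightarrow> has_socle_degree I e' \<Longrightarrow> e = e'"
  for I :: "'k::field_char_0 poly3 set"
  by (metis has_socle_degree_iff linorder_neqE_nat)

text \<open>Every monomial of g contains a variable, to which the assumption on linear forms
  applies.\<close>

lemma mult_in_ideal_of_linear: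
  fixes I :: "'k::field_char_0 poly3 set"
  assumes I: "ideal I polyring" and lin: "\<And>g. g \<in> forms 1 \<Longrightarrow> g * f \<in> I" and g: "Poly_Mapping.lookup g 0 = 0"
  shows "g * f \<in> I"
proof -
  have "Poly_Mapping.single m c * f \<in> I" if "m \<in> Poly_Mapping.keys g" for m c
  proof -
    have "m \<noteq> 0" using that g by (auto simp: in_keys_iff)
    then obtain i where i: "Poly_Mapping.lookup m i \<noteq> 0" by (auto simp: poly_mapping_eq_iff fun_eq_iff)
    define n where "n = m - Poly_Mapping.single i 1"
    have "m = n + Poly_Mapping.single i 1"
      using i by (intro poly_mapping_eqI) (auto simp: n_def lookup_add lookup_minus lookup_single when_def)
    then have "Poly_Mapping.single m c * f = Poly_Mapping.single n c * (Poly_Mapping.single (Poly_Mapping.single i 1) 1 * f)"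
      by (simp add: mult.assoc[symmetric] mult_single)
    also have "\<dots> \<in> I" by (rule ideal_mult[OF I lin]) simp
    finally show ?thesis .
  qed
  then have "(\<Sum>m\<in>Poly_Mapping.keys g. Poly_Mapping.single m (Poly_Mapping.lookup g m) * f) \<in> I"
    by (intro ideal_sum[OF I]) auto
  also have "(\<Sum>m\<in>Poly_Mapping.keys g. Poly_Mapping.single m (Poly_Mapping.lookup g m) * f) = g * f"
    unfolding sum_distrib_right[symmetric]
    using poly_mapping_sum_single[of "Poly_Mapping.keys g" g] by simp
  finally show ?thesis .
qed

text \<open>Such an f represents a socle element, which by levelness is also the class of a form of
  degree e; comparing components of degree \<open>d < e\<close> leaves f alone.\<close>

lemma level_ideal_descend1:
  fixes I :: "'k::field_char_0 poly3 set"
  assumes I: "homogeneous_ideal I" "has_socle_degree I e" "socle I \<subseteq> graded_piece I e"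
    and f: "f \<in> forms d" "d < e" "\<And>g. g \<in> forms 1 \<Longrightarrow> g * f \<in> I"
  shows "f \<in> I"
proof -
  have id: "ideal I polyring" using I(1) by (simp add: homogeneous_ideal_def)
  have "x \<otimes>\<^bsub>quotient_alg I\<^esub> residue I f = \<zero>\<^bsub>quotient_alg I\<^esub>" if x: "x \<in> max_hom_ideal I" for x
  proof -
    obtain g where g: "x = residue I g" "Poly_Mapping.lookup g 0 = 0" using x unfolding max_hom_ideal_def by blast
    have "g * f \<in> I" by (rule mult_in_ideal_of_linear[OF id f(3) g(2)])
    then show ?thesis by (simp only: g(1) residue_mult[OF id] residue_eq_zero[OF id])
  qed
  then have "residue I f \<in> socle I"
    unfolding socle_def using residue_carrier[OF id, of f] by blast
  then obtain g where g: "g \<in> forms e" "f - g \<in> I"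
    using I(3) by (auto simp: graded_piece_def residue_eq_iff[OF id])
  then have "hom_component d (f - g) \<in> I" using I(1) by (simp add: homogeneous_ideal_def)
  then show ?thesis using f(1,2) g(1) by (simp add: hom_component_diff hom_component_of_form)
qed

text \<open>Iteration up to degree e: below degree e a level ideal is determined by its degree e
  part.\<close>

lemma level_ideal_descend:
  fixes I :: "'k::field_char_0 poly3 set"
  assumes I: "homogeneous_ideal I" "has_socle_degree I e" "socle I \<subseteq> graded_piece I e"
  shows "f \<in> forms d \<Longrightarrow> d + k = e \<Longrightarrow> (\<And>g. g \<in> forms k \<Longrightarrow> g * f \<in> I) \<Longrightarrow> f \<in> I"
proof (induction k arbitrary: d f)
  case 0
  then show ?case using 0(3)[of 1] by simp
next
  case (Suc k)
  show ?case
  proof (rule level_ideal_descend1[OF I Suc.prems(1)])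
    fix g :: "'k poly3" assume g: "g \<in> forms 1"
    show "g * f \<in> I"
    proof (rule Suc.IH[of _ "d + 1"])
      show "g * f \<in> forms (d + 1)" using forms_mult[OF g Suc.prems(1)] by (simp add: add.commute)
      fix h :: "'k poly3" assume "h \<in> forms k"
      then have "h * g \<in> forms (Suc k)" using forms_mult[OF _ g, of h k] by simp
      then show "h * (g * f) \<in> I" using Suc.prems(3)[of "h * g"] by (simp add: mult.assoc)
    qed (use Suc.prems in simp)
  qed (use Suc.prems in simp)
qed

lemma hvec_socle: "e > 0 \<Longrightarrow> hvec e e = 2"
  by (simp add: hvec_def min_def)

lemma level_ideal_eq_annih:
  fixes I :: "'k::field_char_0 poly3 set"
  assumes level: "artinian_level I" and h: "has_hvector I e (hvec e)" and e: "e > 0"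
  obtains F G where "F \<in> forms e" "G \<in> forms e" "sc.span {F, G} \<in> grassmannian e" "I = annih F G"
proof -
  have hom: "homogeneous_ideal I" using level by (simp add: artinian_level_def)
  then have id: "ideal I polyring" by (simp add: homogeneous_ideal_def)
  have sd: "has_socle_degree I e" using h by (simp add: has_hvector_def)
  have soc: "socle I \<subseteq> graded_piece I e"
    using level sd one_notin_if_socle[OF id] by (metis artinian_level_def)
  have h': "\<And>d. d > e \<Longrightarrow> forms d \<subseteq> I" "\<And>d. d \<le> e \<Longrightarrow> hvec e d + sc.dim (forms d \<inter> I) = (d + 2) choose 2"
    using h unfolding has_hvector_iff[OF id] by blast+
  let ?Ie = "forms e \<inter> I"
  have sIe: "sc.subspace ?Ie" by (rule sc.subspace_inter[OF subspace_forms subspace_ideal[OF id]])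
  \<comment> \<open>P is the top degree part of the inverse system; its dimension 2 is the last
    entry of the h-vector.\<close>
  define P where "P = {G \<in> forms e. \<forall>f\<in>?Ie. apol f G = 0}"
  have dP: "sc.dim P = 2"
    using dim_annihilator_right[OF sIe Int_lower1] h'(2)[of e] hvec_socle[OF e] by (simp add: P_def)
  have sP: "sc.subspace P"
    by (auto simp: P_def sc.subspace_def forms_add forms_scale ap.add_right ap.scale_right)
  have Pe: "P \<subseteq> forms e" by (auto simp: P_def)
  obtain B where B: "B \<subseteq> P" "sc.independent B" "P \<subseteq> sc.span B" "finite B" "card B = 2"
    using finite_basis_forms[OF Pe] dP by metis
  then obtain F G where FG: "B = {F, G}" by (auto simp: card_2_iff)
  have P: "P = sc.span {F, G}" using B sc.span_minimal[OF B(1) sP] by (auto simp: FG)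
  have F: "F \<in> forms e" and G: "G \<in> forms e" using B(1) Pe FG by auto
  have P_iff: "(\<forall>H\<in>P. apol f H = 0) \<longleftrightarrow> apol f F = 0 \<and> apol f G = 0" for f
  proof
    assume "\<forall>H\<in>P. apol f H = 0"
    then show "apol f F = 0 \<and> apol f G = 0" using B(1) by (simp add: FG)
  next
    assume "apol f F = 0 \<and> apol f G = 0"
    then have "\<forall>b\<in>{F, G}. apol f b = 0" by simp
    from annihilator_span_right[OF this] show "\<forall>H\<in>P. apol f H = 0" unfolding P by blast
  qed
  \<comment> \<open>The double orthogonal complement returns the original space, by a count of
    dimensions.\<close>
  have dbl: "?Ie = {f \<in> forms e. \<forall>H\<in>P. apol f H = 0}"
  proof (rule sc.subspace_eq_if_dim_le[OF sIe _ _ forms_finite_span(2)])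
    show "?Ie \<subseteq> {f \<in> forms e. \<forall>H\<in>P. apol f H = 0}" by (auto simp: P_def)
    show "{f \<in> forms e. \<forall>H\<in>P. apol f H = 0} \<subseteq> sc.span (monf ` mons e)"
      using forms_finite_span(1) by blast
    show "sc.dim {f \<in> forms e. \<forall>H\<in>P. apol f H = 0} \<le> sc.dim ?Ie"
      using dim_annihilator_left[OF sP Pe] dP h'(2)[of e] hvec_socle[OF e] by linarith
  qed
  have form: "f \<in> I \<longleftrightarrow> f \<in> annih F G" if f: "f \<in> forms d" for f d
  proof (cases "d \<le> e")
    case False
    then show ?thesis using h'(1)[of d] f act_forms_eq_0[OF f F] act_forms_eq_0[OF f G] by (auto simp: annih_def)
  next
    case True
    have gf: "g * f \<in> forms e" if "g \<in> forms (e - d)" for g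
      using forms_mult[OF that f] True by simp
    have "f \<in> I \<longleftrightarrow> (\<forall>g\<in>forms (e - d). g * f \<in> I)"
      using level_ideal_descend[OF hom sd soc f, of "e - d"] True ideal_mult[OF id] by auto
    also have "\<dots> \<longleftrightarrow> (\<forall>g\<in>forms (e - d). apol (g * f) F = 0 \<and> apol (g * f) G = 0)"
      using dbl gf P_iff by blast
    also have "\<dots> \<longleftrightarrow> f \<in> annih F G"
      using act_eq_0_iff_apol[OF f F True] act_eq_0_iff_apol[OF f G True] by (auto simp: annih_def)
    finally show ?thesis .
  qed
  \<comment> \<open>Agreement on forms suffices since both ideals are homogeneous, the first by
    assumption and the second by \<open>hom_component_act\<close>.\<close>
  have "I = annih F G"
  proof (rule Set.set_eqI)
    fix f :: "'k poly3"
    obtain D where D: "finite D" "f = (\<Sum>d\<in>D. hom_component d f)" by (rule sum_hom_components)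
    have sum_in: "f \<in> J" if "ideal J polyring" "\<And>d. hom_component d f \<in> J" for J
      by (subst D(2)) (rule ideal_sum[OF that])
    have "hom_component d f \<in> annih F G" if "f \<in> annih F G" for d
      using that hom_component_act[OF F] hom_component_act[OF G] by (simp add: annih_def)
    then have "f \<in> annih F G \<longleftrightarrow> (\<forall>d. hom_component d f \<in> annih F G)"
      using sum_in[OF ideal_annih] by blast
    also have "\<dots> \<longleftrightarrow> (\<forall>d. hom_component d f \<in> I)"
      using form[OF hom_component_forms] by blast
    also have "\<dots> \<longleftrightarrow> f \<in> I"
      using sum_in[OF id] hom unfolding homogeneous_ideal_def by blast
    finally show "f \<in> I \<longleftrightarrow> f \<in> annih F G" by (rule sym)
  qed
  moreover have "sc.span {F, G} \<in> grassmannian e"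
    using Pe sP dP unfolding P grassmannian_def by blast
  ultimately show ?thesis using that F G by blast
qed

subsection \<open>Linear relations between derivatives\<close>

text \<open>Two copies of the polynomials as one vector space, in which the syzygies (f, g) of F and
  G live.\<close>

definition scale2 :: "'k::field \<Rightarrow> 'k poly3 \<times> 'k poly3 \<Rightarrow> 'k poly3 \<times> 'k poly3" where
  "scale2 c v = (scale c (fst v), scale c (snd v))"

interpretation vp: vector_space scale2
  by unfold_locales (auto simp: scale2_def sc.scale_right_distrib sc.scale_left_distrib)

interpretation vpp: vector_space_pair scale2 "scale :: 'k::field \<Rightarrow> 'k poly3 \<Rightarrow> 'k poly3"
  by unfold_locales

text \<open>Rank-nullity for the action of pairs on (F, G). The second claim supplies the finite
  spanning set that comparisons of dimensions require.\<close>

lemma dim_relations: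
  fixes F G :: "'k::field_char_0 poly3"
  shows "vp.dim {v \<in> forms j \<times> forms j. fst v \<circ>\<^sub>d F + snd v \<circ>\<^sub>d G = 0} + sc.dim (derivs j F G)
    \<le> 2 * ((j + 2) choose 2)"
    and "\<exists>S. finite S \<and> {v \<in> forms j \<times> forms j. fst v \<circ>\<^sub>d F + snd v \<circ>\<^sub>d G = 0} \<subseteq> vp.span S"
proof -
  let ?T = "\<lambda>v. fst v \<circ>\<^sub>d F + snd v \<circ>\<^sub>d G"
  let ?B = "monf ` mons j :: 'k poly3 set"
  let ?S = "(\<lambda>f. (f, 0)) ` ?B \<union> (\<lambda>g. (0, g)) ` ?B"
  have T: "Vector_Spaces.linear scale2 scale ?T"
    unfolding Vector_Spaces.linear_iff
    by (auto simp: scale2_def act_add_left act_scale_left sc.scale_right_distrib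
        sc.vector_space_axioms vp.vector_space_axioms)
  have s: "vp.subspace (forms j \<times> forms j)"
    by (auto simp: vp.subspace_def scale2_def forms_add forms_scale zero_prod_def)
  have l1: "Vector_Spaces.linear scale scale2 (\<lambda>f. (f, 0))" "Vector_Spaces.linear scale scale2 (\<lambda>g. (0, g))"
    unfolding Vector_Spaces.linear_iff
    by (auto simp: scale2_def sc.vector_space_axioms vp.vector_space_axioms)
  have sp: "forms j \<times> forms j \<subseteq> vp.span ?S"
  proof
    fix v :: "'k poly3 \<times> 'k poly3" assume "v \<in> forms j \<times> forms j"
    then have v: "fst v \<in> sc.span ?B" "snd v \<in> sc.span ?B" by (auto simp: forms_eq_span)
    have "(\<lambda>f. (f, 0)) ` sc.span ?B = vp.span ((\<lambda>f. (f, 0)) ` ?B)" "(\<lambda>g. (0, g)) ` sc.span ?B = vp.span ((\<lambda>g. (0, g)) ` ?B)"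
      using vector_space_pair.linear_span_image[OF _ l1(1), of ?B] vector_space_pair.linear_span_image[OF _ l1(2), of ?B]
      by (simp_all add: vector_space_pair_def sc.vector_space_axioms vp.vector_space_axioms)
    then have "(fst v, 0) \<in> vp.span ((\<lambda>f. (f, 0)) ` ?B)" "(0, snd v) \<in> vp.span ((\<lambda>g. (0, g)) ` ?B)"
      using v by blast+
    then have "(fst v, 0) + (0, snd v) \<in> vp.span ?S"
      using vp.span_mono[of "(\<lambda>f. (f, 0)) ` ?B" ?S] vp.span_mono[of "(\<lambda>g. (0, g)) ` ?B" ?S]
      by (intro vp.span_add) blast+
    then show "v \<in> vp.span ?S" by simp
  qed
  have fin: "finite ?S" by simp
  have cB: "card ?B \<le> (j + 2) choose 2" unfolding card_mons[symmetric] by (rule card_image_le) simp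
  have "vp.dim (forms j \<times> forms j :: ('k poly3 \<times> 'k poly3) set) \<le> card ?S" by (rule vp.dim_le_card[OF sp fin])
  also have "\<dots> \<le> card ((\<lambda>f. (f, 0 :: 'k poly3)) ` ?B) + card ((\<lambda>g. (0 :: 'k poly3, g)) ` ?B)" by (rule card_Un_le)
  also have "\<dots> \<le> card ?B + card ?B" by (intro add_mono card_image_le) simp_all
  finally have le: "vp.dim (forms j \<times> forms j :: ('k poly3 \<times> 'k poly3) set) \<le> 2 * ((j + 2) choose 2)" using cB by linarith
  have img: "?T ` (forms j \<times> forms j) = derivs j F G" unfolding derivs_def by force
  then show "vp.dim {v \<in> forms j \<times> forms j. ?T v = 0} + sc.dim (derivs j F G) \<le> 2 * ((j + 2) choose 2)"
    using vpp.rank_nullity_subspace[OF T s sp fin] le unfolding img by linarith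
  show "\<exists>S. finite S \<and> {v \<in> forms j \<times> forms j. ?T v = 0} \<subseteq> vp.span S"
    using sp fin by blast
qed

lemma dim_derivs_hvec:
  assumes F: "F \<in> forms e" and G: "G \<in> forms e" and d: "d \<le> e"
    and h: "n + sc.dim (forms d \<inter> annih F G) = (d + 2) choose 2"
  shows "sc.dim (derivs (e - d) F G) = n"
proof -
  have "forms d \<inter> annih F G = {f \<in> forms d. f \<circ>\<^sub>d F = 0 \<and> f \<circ>\<^sub>d G = 0}" by (auto simp: annih_def)
  then show ?thesis using dim_derivs[OF F G d] h by simp
qed

text \<open>A linear syzygy \<open>a F + b G = 0\<close> and the quadric \<open>Q\<close> give five quadratic syzygies, but only
  four are linearly independent; the resulting dependency factors \<open>Q\<close>.\<close>

lemma factor_quadric: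
  fixes F G :: "'k::field_char_0 poly3"
  assumes F: "F \<in> forms e" and G: "G \<in> forms e" and e: "6 \<le> e"
    and h: "\<And>d. d \<le> e \<Longrightarrow> hvec e d + sc.dim (forms d \<inter> annih F G) = (d + 2) choose 2"
  shows "\<exists>a b l \<alpha> \<beta> Q. a \<in> forms 1 \<and> b \<in> forms 1 \<and> l \<in> forms 1 \<and> l \<noteq> 0 \<and> (a, b) \<noteq> (0, 0) \<and> (\<alpha>, \<beta>) \<noteq> (0, 0) \<and>
    Q \<noteq> 0 \<and> Q \<circ>\<^sub>d F = 0 \<and> Q \<circ>\<^sub>d G = 0 \<and>
    a \<circ>\<^sub>d F + b \<circ>\<^sub>d G = 0 \<and> l * a = scale \<alpha> Q \<and> l * b = scale \<beta> Q"
proof -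
  obtain k where k: "e = k + 6" using e le_Suc_ex[of 6 e] by (auto simp: add.commute)
  \<comment> \<open>Of the six dimensions of quadrics five survive in the quotient, so up to scalars
    exactly one quadric kills F and G.\<close>
  have "hvec e 2 = 5" using e by (simp add: hvec_def min_def)
  then have "sc.dim (forms 2 \<inter> annih F G) = 1" using h[of 2] e by (simp add: choose_two)
  moreover have "sc.dim (forms 2 \<inter> annih F G) \<le> card ({} :: 'k poly3 set)" if "forms 2 \<inter> annih F G \<subseteq> {0}"
    by (rule sc.dim_le_card) (use that in simp_all)
  ultimately have "\<not> forms 2 \<inter> annih F G \<subseteq> {0}" by auto
  then obtain Q where Q: "Q \<in> forms 2" "Q \<noteq> 0" "Q \<circ>\<^sub>d F = 0" "Q \<circ>\<^sub>d G = 0" by (auto simp: annih_def)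
  \<comment> \<open>Six first derivatives span only five dimensions; this yields the linear syzygy
    (a, b).\<close>
  have "hvec e (e - 1) = 5" by (simp add: k hvec_def min_def)
  then have d1: "sc.dim (derivs 1 F G) = 5"
    using dim_derivs_hvec[OF F G _ h, of "e - 1"] e by simp
  \<comment> \<open>The term e + 2 reaches 8 from e = 6 on, which is the origin of the bound on e.
    Twelve second derivatives of rank 8 leave a four-dimensional space of quadratic
    syzygies.\<close>
  have "hvec e (e - 2) = 8" by (simp add: k hvec_def min_def)
  then have d2: "sc.dim (derivs 2 F G) = 8"
    using dim_derivs_hvec[OF F G _ h, of "e - 2"] e by simp
  define v where "v p = (if fst p then monf (snd p) \<circ>\<^sub>d F else monf (snd p) \<circ>\<^sub>d G)" for p :: "bool \<times> 3 mon"
  let ?I = "UNIV \<times> mons 1 :: (bool \<times> 3 mon) set"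
  have cI: "card ?I = 6" by (simp add: card_cartesian_product card_mons choose_two)
  have "v ` ?I \<subseteq> derivs 1 F G"
  proof
    fix x assume "x \<in> v ` ?I"
    then obtain c m where "x = v (c, m)" "mdeg m = 1" by auto
    then have "x = (if c then monf m else 0) \<circ>\<^sub>d F + (if c then 0 else monf m) \<circ>\<^sub>d G" "monf m \<in> forms 1"
      by (auto simp: v_def)
    then show "x \<in> derivs 1 F G" unfolding derivs_def
      by (intro CollectI exI[of _ "if c then monf m else 0"] exI[of _ "if c then 0 else monf m"]) auto
  qed
  then have "sc.dim (v ` ?I) \<le> sc.dim (derivs 1 F G)"
    by (rule sc.dim_mono_finite[OF _ order_trans[OF derivs_subset[OF F G] forms_finite_span(1)] forms_finite_span(2)])
  then have lt: "sc.dim (v ` ?I) < card ?I" using cI d1 by linarith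
  obtain c where c: "\<exists>i\<in>?I. c i \<noteq> 0" "(\<Sum>i\<in>?I. scale (c i) (v i)) = 0"
    by (rule sc.nontrivial_relation[OF _ lt]) auto
  define a where "a = (\<Sum>m\<in>mons 1. scale (c (True, m)) (monf m))"
  define b where "b = (\<Sum>m\<in>mons 1. scale (c (False, m)) (monf m))"
  have a: "a \<in> forms 1" and b: "b \<in> forms 1"
    unfolding a_def b_def by (intro forms_sum forms_scale; simp)+
  have act_sum: "(\<Sum>m\<in>A. scale (u m) (monf m)) \<circ>\<^sub>d K = (\<Sum>m\<in>A. scale (u m) (monf m \<circ>\<^sub>d K))" for A u and K :: "'k poly3"
    by (induction A rule: infinite_finite_induct) (simp_all add: act_add_left act_scale_left)
  have "?I = {True} \<times> mons 1 \<union> {False} \<times> mons 1" by (auto simp: UNIV_bool)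
  then have "(\<Sum>i\<in>?I. scale (c i) (v i)) = (\<Sum>i\<in>{True} \<times> mons 1. scale (c i) (v i)) + (\<Sum>i\<in>{False} \<times> mons 1. scale (c i) (v i))"
    by (simp only:) (rule sum.union_disjoint, auto)
  also have "\<dots> = a \<circ>\<^sub>d F + b \<circ>\<^sub>d G"
    unfolding a_def b_def act_sum sum.cartesian_product[symmetric] by (simp add: v_def sum.cartesian_product')
  finally have ab: "a \<circ>\<^sub>d F + b \<circ>\<^sub>d G = 0" using c(2) by simp
  have ab0: "(a, b) \<noteq> (0, 0)"
  proof
    assume "(a, b) = (0, 0)"
    then have "Poly_Mapping.lookup a m = 0" "Poly_Mapping.lookup b m = 0" for m by simp_all
    then have "c (True, m) = 0" "c (False, m) = 0" if "m \<in> mons 1" for m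
      using that unfolding a_def b_def lookup_scale_sum_monf[OF finite_mons] by metis+
    then show False using c(1) by (metis (full_types) SigmaE)
  qed
  let ?R = "{v \<in> forms 2 \<times> forms 2. fst v \<circ>\<^sub>d F + snd v \<circ>\<^sub>d G = 0}"
  have "vp.dim ?R \<le> 4" using dim_relations(1)[of 2 F G] d2 by (simp add: choose_two)
  define x :: "3 \<Rightarrow> 'k poly3" where "x i = monf (Poly_Mapping.single i 1)" for i
  have x: "x i \<in> forms 1" for i by (simp add: x_def)
  \<comment> \<open>The three multiples of the linear syzygy by variables, followed by (Q, 0) and
    (0, Q).\<close>
  define w where "w = case_sum (\<lambda>i. (x i * a, x i * b)) (\<lambda>c. if c then (Q, 0) else (0, Q))"
  have "w p \<in> ?R" for p
  proof (cases p)
    case (Inl i)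
    have "x i * a \<in> forms 2" "x i * b \<in> forms 2"
      using forms_mult[OF x a] forms_mult[OF x b] by (simp_all add: numeral_2_eq_2)
    moreover have "(x i * a) \<circ>\<^sub>d F + (x i * b) \<circ>\<^sub>d G = 0"
      using ab by (simp add: act_mult act_add_right[symmetric])
    ultimately show ?thesis by (simp add: w_def Inl)
  next
    case (Inr c)
    then show ?thesis using Q by (simp add: w_def)
  qed
  then have "w ` UNIV \<subseteq> ?R" by (rule image_subsetI)
  moreover obtain S where "finite S" "?R \<subseteq> vp.span S" using dim_relations(2)[of 2 F G] by (elim exE conjE)
  ultimately have "vp.dim (w ` UNIV) \<le> vp.dim ?R" by (intro vp.dim_mono_finite)
  then have lt5: "vp.dim (w ` UNIV) < card (UNIV :: (3 + bool) set)" using \<open>vp.dim ?R \<le> 4\<close> by simp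
  obtain u where u: "\<exists>p\<in>UNIV. u p \<noteq> 0" "(\<Sum>p\<in>UNIV. scale2 (u p) (w p)) = 0"
    by (rule vp.nontrivial_relation[OF finite lt5])
  define l where "l = (\<Sum>i\<in>UNIV. scale (u (Inl i)) (x i))"
  have l: "l \<in> forms 1" unfolding l_def by (intro forms_sum forms_scale x)
  have fst_sum: "fst (\<Sum>p\<in>A. f p) = (\<Sum>p\<in>A. fst (f p))" and snd_sum: "snd (\<Sum>p\<in>A. f p) = (\<Sum>p\<in>A. snd (f p))"
    for A and f :: "3 + bool \<Rightarrow> 'k poly3 \<times> 'k poly3"
    by (induction A rule: infinite_finite_induct) simp_all
  have UN: "(\<Sum>p\<in>UNIV. f p) = (\<Sum>i\<in>UNIV. f (Inl i)) + (f (Inr False) + f (Inr True))"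
    for f :: "3 + bool \<Rightarrow> 'k poly3"
    unfolding UNIV_Plus_UNIV[symmetric] by (simp add: sum.Plus UNIV_bool)
  have eqs: "l * a + scale (u (Inr True)) Q = 0" "l * b + scale (u (Inr False)) Q = 0"
  proof -
    have "fst (\<Sum>p\<in>UNIV. scale2 (u p) (w p)) = l * a + scale (u (Inr True)) Q"
      "snd (\<Sum>p\<in>UNIV. scale2 (u p) (w p)) = l * b + scale (u (Inr False)) Q"
      unfolding l_def fst_sum snd_sum UN by (simp_all add: scale2_def w_def sum_distrib_right scale_mult_left)
    then show "l * a + scale (u (Inr True)) Q = 0" "l * b + scale (u (Inr False)) Q = 0" using u(2) by simp_all
  qed
  have sing: "Poly_Mapping.single i (1::nat) = Poly_Mapping.single j 1 \<longleftrightarrow> i = j" for i j :: 3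
    by (metis lookup_single_eq lookup_single_not_eq zero_neq_one)
  have lookup_l: "Poly_Mapping.lookup l (Poly_Mapping.single j 1) = u (Inl j)" for j
    unfolding l_def lookup_sum lookup_scale x_def lookup_monf sing by (simp add: if_distrib cong: if_cong)
  \<comment> \<open>Without l the relation would involve only (Q, 0) and (0, Q), which are
    independent.\<close>
  have l0: "l \<noteq> 0"
  proof
    assume "l = 0"
    have "scale (u (Inr True)) Q = 0" "scale (u (Inr False)) Q = 0"
      using eqs unfolding \<open>l = 0\<close> mult_zero_left add_0_left .
    then have "u (Inr c) = 0" for c using Q(2) by (cases c) simp_all
    moreover have "u (Inl j) = 0" for j using lookup_l[of j] \<open>l = 0\<close> by simp
    ultimately show False using u(1) by (metis sum.exhaust)
  qed
  have "l * a = scale (- u (Inr True)) Q" "l * b = scale (- u (Inr False)) Q"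
    using eqs by (simp_all only: sc.scale_minus_left eq_neg_iff_add_eq_0)
  moreover have "(- u (Inr True), - u (Inr False)) \<noteq> (0, 0)"
  proof
    assume "(- u (Inr True), - u (Inr False)) = (0, 0)"
    then have "u (Inr True) = 0" "u (Inr False) = 0" by simp_all
    then have "l * a = 0" "l * b = 0" using eqs by (simp_all only: sc.scale_zero_left add_0_right)
    then show False using l0 ab0 by simp
  qed
  ultimately show ?thesis using a b l l0 ab0 ab Q(2-4) by blast
qed

text \<open>Cancelling l shows that a and b are proportional, so the linear syzygy says that a kills
  a combination of F and G; the same a divides Q, which kills G.\<close>

lemma family_if_relation:
  fixes F G :: "'k::field_char_0 poly3"
  assumes F: "F \<in> forms e" and G: "G \<in> forms e" and W: "sc.span {F, G} \<in> grassmannian e"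
    and a: "a \<in> forms 1" and b: "b \<in> forms 1" and l: "l \<in> forms 1" "l \<noteq> 0" and Q: "Q \<noteq> 0" "Q \<circ>\<^sub>d G = 0"
    and rel: "a \<circ>\<^sub>d F + b \<circ>\<^sub>d G = 0" and la: "l * a = scale \<alpha> Q" and lb: "l * b = scale \<beta> Q" and \<alpha>: "\<alpha> \<noteq> 0"
  shows "sc.span {F, G} \<in> family e"
proof -
  have "l * (scale \<beta> a) = l * (scale \<alpha> b)" unfolding scale_mult_right la lb by (simp add: mult.commute)
  then have "scale \<beta> a = scale \<alpha> b" using l(2) by simp
  then have "b = scale (\<beta> / \<alpha>) a"
    using \<alpha> by (metis divide_inverse mult.commute sc.scale_scale left_inverse sc.scale_one)
  define F' where "F' = F + scale (\<beta> / \<alpha>) G"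
  have "a \<circ>\<^sub>d F' = 0" using rel by (simp add: F'_def \<open>b = _\<close> act_add_right act_scale_right act_scale_left)
  moreover have "(a * l) \<circ>\<^sub>d G = 0"
    using la Q(2) by (simp add: mult.commute[of a l] act_scale_left)
  moreover have "a \<noteq> 0" using la \<alpha> Q(1) by auto
  moreover have "sc.span {F, G} = sc.span {F', G}"
  proof (rule sc.span_eq[THEN iffD2], intro conjI)
    have "F = F' - scale (\<beta> / \<alpha>) G" by (simp add: F'_def)
    then have "F \<in> sc.span {F', G}" by (metis sc.span_diff sc.span_scale sc.span_base insertI1 insertI2 singletonI)
    then show "{F, G} \<subseteq> sc.span {F', G}" by (simp add: sc.span_base)
    have "F' \<in> sc.span {F, G}" unfolding F'_def
      by (intro sc.span_add sc.span_scale sc.span_base) auto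
    then show "{F', G} \<subseteq> sc.span {F, G}" by (simp add: sc.span_base)
  qed
  moreover have "F' \<in> forms e" using F G by (simp add: F'_def forms_add forms_scale)
  ultimately show ?thesis using W G a l unfolding family_def by blast
qed

lemma family_of_hvector:
  fixes F G :: "'k::field_char_0 poly3"
  assumes F: "F \<in> forms e" and G: "G \<in> forms e" and W: "sc.span {F, G} \<in> grassmannian e" and e: "6 \<le> e"
    and h: "\<And>d. d \<le> e \<Longrightarrow> hvec e d + sc.dim (forms d \<inter> annih F G) = (d + 2) choose 2"
  shows "sc.span {F, G} \<in> family e"
proof -
  obtain a b l \<alpha> \<beta> Q where *: "a \<in> forms 1" "b \<in> forms 1" "l \<in> forms 1" "l \<noteq> 0" "(\<alpha>, \<beta>) \<noteq> (0, 0)"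
    "Q \<noteq> 0" "Q \<circ>\<^sub>d F = 0" "Q \<circ>\<^sub>d G = 0"
    "a \<circ>\<^sub>d F + b \<circ>\<^sub>d G = 0" "l * a = scale \<alpha> Q" "l * b = scale \<beta> Q"
    using factor_quadric[OF F G e h] by blast
  show ?thesis
  proof (cases "\<alpha> = 0")
    case False
    then show ?thesis using family_if_relation[OF F G W *(1-4,6,8-11)] by blast
  next
    case True
    \<comment> \<open>Here F and G exchange their roles.\<close>
    then have "\<beta> \<noteq> 0" using *(5) by simp
    moreover have "{G, F} = {F, G}" by auto
    ultimately show ?thesis
      using family_if_relation[OF G F _ *(2,1,3,4,6,7) _ *(11,10)] W *(9) by (simp add: add.commute)
  qed
qed

lemma level_in_family:
  fixes I :: "'k::field_char_0 poly3 set"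
  assumes "artinian_level I" "has_hvector I e (hvec e)" "6 \<le> e"
  shows "\<exists>W\<in>family e. I = inverse_system_ideal W"
proof -
  obtain F G where FG: "F \<in> forms e" "G \<in> forms e" "sc.span {F, G} \<in> grassmannian e" "I = annih F G"
    by (rule level_ideal_eq_annih[OF assms(1,2)]) (use assms(3) in simp_all)
  have "hvec e d + sc.dim (forms d \<inter> annih F G) = (d + 2) choose 2" if "d \<le> e" for d
    using assms(2) that unfolding FG(4) has_hvector_iff[OF ideal_annih] by blast
  then show ?thesis
    using family_of_hvector[OF FG(1-3) assms(3)] unfolding FG(4) inverse_system_ideal_span[of F G, symmetric] by blast
qed

subsection \<open>Failure of the weak Lefschetz property\<close>

lemma hvec_plateau:
  assumes "e + 1 \<le> 2 * d" "3 * d \<le> 2 * e"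
  shows "hvec e d = e + 2"
  using assms by (simp add: hvec_def min_def)

lemma not_weak_Lefschetz:
  fixes I :: "'k::field_char_0 poly3 set"
  assumes "artinian_level I" "has_hvector I e (hvec e)" and e: "(odd e \<and> e \<ge> 9) \<or> (even e \<and> e \<ge> 12)"
  shows "\<not> weak_Lefschetz I"
proof
  assume wl: "weak_Lefschetz I"
  have "6 \<le> e" using e by auto
  then obtain W where "W \<in> family e" "I = inverse_system_ideal W" using level_in_family assms by blast
  then obtain F G l1 l2 where FG: "F \<in> forms e" "G \<in> forms e" "l1 \<in> forms 1" "l1 \<noteq> 0" "l2 \<in> forms 1" "l2 \<noteq> 0"
    "l1 \<circ>\<^sub>d F = 0" "(l1 * l2) \<circ>\<^sub>d G = 0" and I: "I = annih F G"
    unfolding family_def using inverse_system_ideal_span by blast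
  interpret family_data e F G l1 l2 using FG by unfold_locales
  have id: "ideal I polyring" unfolding I by (rule ideal_annih)
  have h: "hvec e d + sc.dim (forms d \<inter> annih F G) = (d + 2) choose 2" if "d \<le> e" for d
    using assms(2) that unfolding I has_hvector_iff[OF ideal_annih] by blast
  \<comment> \<open>The first degree of the plateau. That the next degree still lies on it,
    \<open>3 * (d + 1) \<le> 2 * e\<close>, is what the bounds 9 for odd and 12 for even e amount
    to.\<close>
  define d where "d = e div 2 + 1"
  have d: "e + 1 \<le> 2 * d" "3 * (d + 1) \<le> 2 * e" "1 \<le> d" "d + 1 \<le> e" "d < e"
    using e unfolding d_def by (auto elim!: oddE evenE)
  obtain e' l where e': "has_socle_degree I e'" and l: "l \<in> forms 1" and
    wl: "\<And>i. i < e' \<Longrightarrow> inj_on (\<lambda>a. residue I l \<otimes>\<^bsub>quotient_alg I\<^esub> a) (graded_piece I i) \<or>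
      (\<lambda>a. residue I l \<otimes>\<^bsub>quotient_alg I\<^esub> a) ` graded_piece I i = graded_piece I (Suc i)"
    using wl unfolding weak_Lefschetz_def Let_def by blast
  have "e' = e"
    using one_notin_if_socle[OF id e'] assms(2) by (simp add: has_hvector_def)
  have hd: "e + 2 + sc.dim (forms d \<inter> annih F G) = (d + 2) choose 2"
    using h[of d] hvec_plateau[of e d] d by simp
  have hd1: "e + 2 + sc.dim (forms (d + 1) \<inter> annih F G) = (d + 1 + 2) choose 2"
    using h[of "d + 1"] hvec_plateau[of e "d + 1"] d by simp
  note nl = not_Lefschetz_degree[OF d(3,4) l hd hd1]
  have "inj_on (\<lambda>a. residue I l \<otimes>\<^bsub>quotient_alg I\<^esub> a) (graded_piece I d) \<or>
      (\<lambda>a. residue I l \<otimes>\<^bsub>quotient_alg I\<^esub> a) ` graded_piece I d = graded_piece I (Suc d)"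
    using wl[of d] d(5) \<open>e' = e\<close> by simp
  then show False
  proof
    assume inj: "inj_on (\<lambda>a. residue I l \<otimes>\<^bsub>quotient_alg I\<^esub> a) (graded_piece I d)"
    obtain f where f: "f \<in> forms d" "f \<notin> I" "l * f \<in> I" using nl(1) I by blast
    have "residue I f \<in> graded_piece I d" "residue I 0 \<in> graded_piece I d"
      using f(1) by (auto simp: graded_piece_def intro!: imageI)
    moreover have "residue I l \<otimes>\<^bsub>quotient_alg I\<^esub> residue I f = residue I l \<otimes>\<^bsub>quotient_alg I\<^esub> residue I 0"
      using f(3) by (simp add: residue_mult[OF id] residue_eq_iff[OF id])
    ultimately have "residue I f = residue I 0" using inj by (auto dest: inj_onD)
    then show False using f(2) by (simp add: residue_eq_iff[OF id])
  next
    assume surj: "(\<lambda>a. residue I l \<otimes>\<^bsub>quotient_alg I\<^esub> a) ` graded_piece I d = graded_piece I (Suc d)"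
    obtain p where p: "p \<in> forms (Suc d)" "\<And>f. f \<in> forms d \<Longrightarrow> p - l * f \<notin> I" using nl(2) I by auto
    have "residue I p \<in> graded_piece I (Suc d)" using p(1) by (auto simp: graded_piece_def)
    then have "residue I p \<in> (\<lambda>a. residue I l \<otimes>\<^bsub>quotient_alg I\<^esub> a) ` graded_piece I d" unfolding surj .
    then obtain x where x: "residue I p = residue I l \<otimes>\<^bsub>quotient_alg I\<^esub> x" "x \<in> graded_piece I d" by (rule imageE)
    from x(2) obtain f where f: "x = residue I f" "f \<in> forms d" unfolding graded_piece_def by (rule imageE)
    have "residue I p = residue I (l * f)" unfolding x(1) f(1) by (rule residue_mult[OF id])
    then have "p - l * f \<in> I" by (rule residue_eq_iff[OF id, THEN iffD1])
    then show False by (rule notE[OF p(2)[OF f(2)]])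
  qed
qed

subsection \<open>Graded algebras of functions\<close>

text \<open>Independence at y of the rows \<open>v r\<close>, whose columns i range over a whole
  type; for finite R it stands in for the nonvanishing of some maximal minor.\<close>

definition indep_at :: "'r set \<Rightarrow> ('r \<Rightarrow> 'c \<Rightarrow> 'y \<Rightarrow> 'k::field) \<Rightarrow> 'y \<Rightarrow> bool" where
  "indep_at R v y \<longleftrightarrow> (\<forall>c. (\<forall>i. (\<Sum>r\<in>R. c r * v r i y) = 0) \<longrightarrow> (\<forall>r\<in>R. c r = 0))"

lemma indep_atD: "indep_at R v y \<Longrightarrow> (\<And>i. (\<Sum>r\<in>R. c r * v r i y) = 0) \<Longrightarrow> r \<in> R \<Longrightarrow> c r = 0"
  unfolding indep_at_def by blast

text \<open>Degrees live in an arbitrary monoid so that one elimination argument serves Pluecker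
  forms and the multigraded functions obtained by adjoining projective lines. For
  \<open>pfun\<close> the degree is only a filtration.\<close>

locale graded_functions =
  fixes H :: "'d::comm_monoid_add \<Rightarrow> ('y \<Rightarrow> 'k::field) set"
  assumes zero: "(\<lambda>y. 0) \<in> H d"
    and add: "f \<in> H d \<Longrightarrow> g \<in> H d \<Longrightarrow> (\<lambda>y. f y + g y) \<in> H d"
    and mult: "f \<in> H d \<Longrightarrow> g \<in> H d' \<Longrightarrow> (\<lambda>y. f y * g y) \<in> H (d + d')"
    and const: "(\<lambda>y. c) \<in> H 0"
begin

lemma scale: "f \<in> H d \<Longrightarrow> (\<lambda>y. c * f y) \<in> H d"
  using mult[OF const, of f d c] by simp

lemma diff: "f \<in> H d \<Longrightarrow> g \<in> H d \<Longrightarrow> (\<lambda>y. f y - g y) \<in> H d"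
  using add[of f d "\<lambda>y. -1 * g y"] scale[of g d "-1"] by simp

lemma sum: "(\<And>a. a \<in> A \<Longrightarrow> f a \<in> H d) \<Longrightarrow> (\<lambda>y. \<Sum>a\<in>A. f a y) \<in> H d"
  by (induction A rule: infinite_finite_induct) (simp_all add: zero add)

lemma prod: "(\<And>a. a \<in> A \<Longrightarrow> f a \<in> H (D a)) \<Longrightarrow> (\<lambda>y. \<Prod>a\<in>A. f a y) \<in> H (\<Sum>a\<in>A. D a)"
  by (induction A rule: infinite_finite_induct) (simp_all add: const mult)

text \<open>By fraction-free Gaussian elimination.\<close>

lemma indep_at_open:
  assumes "finite R" "\<And>r i. r \<in> R \<Longrightarrow> v r i \<in> H (D r)" "indep_at R v y0"
  shows "\<exists>d. \<exists>h\<in>H d. h y0 \<noteq> 0 \<and> (\<forall>y. h y \<noteq> 0 \<longrightarrow> indep_at R v y)"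
  using assms
proof (induction R arbitrary: v D rule: finite_induct)
  case empty
  show ?case using const[of 1] by (intro exI[of _ 0] bexI[of _ "\<lambda>y. 1"]) (simp_all add: indep_at_def)
next
  case (insert r R)
  have ins: "(\<Sum>s\<in>insert r R. c s * v s i y) = c r * v r i y + (\<Sum>s\<in>R. c s * v s i y)" for c i y
    using insert.hyps by simp
  have "\<exists>i. v r i y0 \<noteq> 0"
  proof (rule ccontr)
    assume "\<not> (\<exists>i. v r i y0 \<noteq> 0)"
    then have "(\<Sum>s\<in>insert r R. (if s = r then 1 else 0) * v s i y0) = 0" for i
      by (intro sum.neutral) auto
    then have "(if r = r then 1 else 0 :: 'k) = 0"
      by (rule indep_atD[OF insert.prems(2), where c = "\<lambda>s. if s = r then 1 else 0"]) simp
    then show False by simp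
  qed
  then obtain j where j: "v r j y0 \<noteq> 0" by blast
  \<comment> \<open>Row r is the pivot, at column j. Cross-multiplication clears column j without
    division, so the entries stay in the graded algebra.\<close>
  define w where "w s i y = v r j y * v s i y - v s j y * v r i y" for s i y
  have w_sum: "(\<Sum>s\<in>R. c s * w s i y) = v r j y * (\<Sum>s\<in>R. c s * v s i y) - (\<Sum>s\<in>R. c s * v s j y) * v r i y"
    for c i y
    by (simp add: w_def sum_distrib_left sum_distrib_right sum_subtractf[symmetric] algebra_simps)
  have wH: "w s i \<in> H (D r + D s)" if "s \<in> R" for s i
  proof -
    have "(\<lambda>y. v r j y * v s i y) \<in> H (D r + D s)" "(\<lambda>y. v r i y * v s j y) \<in> H (D r + D s)"
      using insert.prems(1) that by (intro mult; simp)+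
    from diff[OF this] show ?thesis unfolding w_def by (simp add: mult.commute)
  qed
  have "indep_at R w y0"
    unfolding indep_at_def
  proof (intro allI impI)
    fix c assume c: "\<forall>i. (\<Sum>s\<in>R. c s * w s i y0) = 0"
    \<comment> \<open>A relation among the reduced rows, scaled by the pivot entry, extends to a
      relation among the original rows.\<close>
    define c' where "c' s = (if s = r then - (\<Sum>s\<in>R. c s * v s j y0) else c s * v r j y0)" for s
    have "(\<Sum>s\<in>R. c' s * v s i y0) = v r j y0 * (\<Sum>s\<in>R. c s * v s i y0)" for i
      unfolding sum_distrib_left using insert.hyps(2) by (intro sum.cong) (auto simp: c'_def)
    then have "(\<Sum>s\<in>insert r R. c' s * v s i y0) = 0" for i
      using c[rule_format, of i] unfolding ins w_sum by (simp add: c'_def)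
    then have "\<forall>s\<in>insert r R. c' s = 0" using insert.prems(2) unfolding indep_at_def by blast
    then show "\<forall>s\<in>R. c s = 0" using j insert.hyps(2) by (auto simp: c'_def split: if_splits)
  qed
  then obtain d h where h: "h \<in> H d" "h y0 \<noteq> 0" "\<And>y. h y \<noteq> 0 \<Longrightarrow> indep_at R w y"
    using insert.IH[of w "\<lambda>s. D r + D s"] wH by blast
  have "indep_at (insert r R) v y" if y: "h y * v r j y \<noteq> 0" for y
    unfolding indep_at_def
  proof (intro allI impI)
    fix c assume "\<forall>i. (\<Sum>s\<in>insert r R. c s * v s i y) = 0"
    then have c: "(\<Sum>s\<in>R. c s * v s i y) = - c r * v r i y" for i
      unfolding ins by (simp add: eq_neg_iff_add_eq_0 add.commute)
    have "(\<Sum>s\<in>R. c s * w s i y) = 0" for i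
      unfolding w_sum c by simp
    then have R0: "\<forall>s\<in>R. c s = 0" using h(3)[of y] y unfolding indep_at_def by auto
    then have "c r * v r j y = 0" using c[of j] by simp
    then show "\<forall>s\<in>insert r R. c s = 0" using R0 y by simp
  qed
  then show ?case using mult[OF h(1) insert.prems(1)[of r j]] h(2) j
    by (intro exI[of _ "d + D r"] bexI[of _ "\<lambda>y. h y * v r j y"]) simp_all
qed

end

subsection \<open>Elimination of a projective line\<close>

text \<open>Functions homogeneous of the first degree in a pair of new coordinates, with
  coefficients from the old algebra: the functions on the product with a projective line.\<close>

inductive ext_fun :: "('d::comm_monoid_add \<Rightarrow> ('y \<Rightarrow> 'k::field) set) \<Rightarrow> nat \<times> 'd \<Rightarrow> (('k \<times> 'k) \<times> 'y \<Rightarrow> 'k) \<Rightarrow> bool"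
  for H where
  zero: "ext_fun H nd (\<lambda>_. 0)"
| monom: "c \<in> H d \<Longrightarrow> ext_fun H (i + j, d) (\<lambda>uy. fst (fst uy) ^ i * snd (fst uy) ^ j * c (snd uy))"
| add: "ext_fun H nd f \<Longrightarrow> ext_fun H nd g \<Longrightarrow> ext_fun H nd (\<lambda>uy. f uy + g uy)"

definition ext :: "('d::comm_monoid_add \<Rightarrow> ('y \<Rightarrow> 'k::field) set) \<Rightarrow> nat \<times> 'd \<Rightarrow> (('k \<times> 'k) \<times> 'y \<Rightarrow> 'k) set" where
  "ext H nd = {f. ext_fun H nd f}"

context graded_functions begin

lemma ext_mult:
  assumes "ext_fun H nd f" "ext_fun H nd' g"
  shows "ext_fun H (nd + nd') (\<lambda>uy. f uy * g uy)"
  using assms(1)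
proof (induction rule: ext_fun.induct)
  case (zero nd) then show ?case by (simp add: ext_fun.zero)
next
  case (monom c d i j)
  show ?case using assms(2)
  proof (induction rule: ext_fun.induct)
    case (zero nd) then show ?case by (simp add: ext_fun.zero)
  next
    case (monom c' d' i' j')
    have "ext_fun H ((i + i') + (j + j'), d + d')
      (\<lambda>uy. fst (fst uy) ^ (i + i') * snd (fst uy) ^ (j + j') * (c (snd uy) * c' (snd uy)))"
      using mult[OF \<open>c \<in> H d\<close> monom] by (rule ext_fun.monom[of "\<lambda>y. c y * c' y"])
    moreover have "(i + i') + (j + j') = (i + j) + (i' + j')" by simp
    ultimately show ?case by (simp add: power_add mult_ac)
  next
    case (add nd f g) then show ?case by (simp add: distrib_left ext_fun.add)
  qed
next
  case (add nd f g) then show ?case by (simp add: distrib_right ext_fun.add)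
qed

lemma graded_functions_ext: "graded_functions (ext H)"
proof
  fix c :: 'k
  show "(\<lambda>y. c) \<in> ext H 0"
    using ext_fun.monom[where H = H and c = "\<lambda>_. c" and d = 0 and i = 0 and j = 0] const
    by (simp add: ext_def zero_prod_def)
qed (simp_all add: ext_def ext_fun.zero ext_fun.add ext_mult)

lemma ext_base: "c \<in> H d \<Longrightarrow> (\<lambda>uy. c (snd uy)) \<in> ext H (0, d)"
  using ext_fun.monom[where H = H and c = c and i = 0 and j = 0] by (simp add: ext_def)

lemma ext_var: "(\<lambda>uy. fst (fst uy)) \<in> ext H (1, 0)" "(\<lambda>uy. snd (fst uy)) \<in> ext H (1, 0)"
  using ext_fun.monom[where H = H and c = "\<lambda>_. 1" and d = 0 and i = 1 and j = 0]
    ext_fun.monom[where H = H and c = "\<lambda>_. 1" and d = 0 and i = 0 and j = 1] const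
  by (simp_all add: ext_def)

lemma ext_coeffs:
  assumes "ext_fun H nd f"
  shows "\<exists>c. (\<forall>i. c i \<in> H (snd nd)) \<and>
    (\<forall>uy. f uy = (\<Sum>i\<le>fst nd. c i (snd uy) * fst (fst uy) ^ i * snd (fst uy) ^ (fst nd - i)))"
  using assms
proof (induction rule: ext_fun.induct)
  case (zero nd)
  then show ?case by (intro exI[of _ "\<lambda>i y. 0"]) (simp add: graded_functions.zero[OF graded_functions_axioms])
next
  case (monom c d i j)
  have "(\<Sum>k\<le>i + j. (if k = i then c y else 0) * a ^ k * b ^ (i + j - k)) = a ^ i * b ^ j * c y" for a b y
  proof -
    have "(\<Sum>k\<le>i + j. (if k = i then c y else 0) * a ^ k * b ^ (i + j - k))
      = (\<Sum>k\<le>i + j. if k = i then c y * a ^ i * b ^ j else 0)"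
      by (rule sum.cong) auto
    then show ?thesis by simp
  qed
  moreover have "(\<lambda>y. if k = i then c y else 0) \<in> H d" for k
    using monom graded_functions.zero[OF graded_functions_axioms] by (cases "k = i") simp_all
  ultimately show ?case by (intro exI[of _ "\<lambda>k y. if k = i then c y else 0"]) simp
next
  case (add nd f g)
  then obtain c c' where "\<forall>i. c i \<in> H (snd nd)" "\<forall>i. c' i \<in> H (snd nd)"
    "\<forall>uy. f uy = (\<Sum>i\<le>fst nd. c i (snd uy) * fst (fst uy) ^ i * snd (fst uy) ^ (fst nd - i))"
    "\<forall>uy. g uy = (\<Sum>i\<le>fst nd. c' i (snd uy) * fst (fst uy) ^ i * snd (fst uy) ^ (fst nd - i))" by blast
  then show ?case
    by (intro exI[of _ "\<lambda>i y. c i y + c' i y"])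
      (simp add: graded_functions.add[OF graded_functions_axioms] sum.distrib distrib_right)
qed

end

text \<open>Binary forms of degree \<open>n\<close> are written as polynomials of degree at most \<open>n\<close>; \<open>multiples\<close> is the
  degree \<open>N\<close> part of the ideal generated by forms \<open>p f\<close> of degree \<open>n f\<close>.\<close>

interpretation pv: vector_space "smult :: 'k::field \<Rightarrow> 'k poly \<Rightarrow> 'k poly"
  by unfold_locales (simp_all add: smult_add_right smult_add_left)

definition multiples :: "('f \<Rightarrow> nat) \<Rightarrow> ('f \<Rightarrow> 'k::field poly) \<Rightarrow> nat \<Rightarrow> 'k poly set" where
  "multiples n p N = pv.span {monom 1 a * p f | a f. a + n f \<le> N}"

lemma multiples_mono: "M \<le> N \<Longrightarrow> multiples n p M \<subseteq> multiples n p N"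
  unfolding multiples_def by (rule pv.span_mono) (blast intro: le_trans)

lemma multiples_monom:
  assumes "q \<in> multiples n p M"
  shows "monom 1 i * q \<in> multiples n p (M + i)"
  using assms unfolding multiples_def
proof (induction rule: pv.span_induct_alt)
  case base then show ?case by (simp add: pv.span_zero)
next
  case (step c x y)
  obtain a f where x: "x = monom 1 a * p f" "a + n f \<le> M" using step(1) by blast
  have "monom 1 i * x = monom 1 (i + a) * p f" by (simp add: x mult.assoc[symmetric] mult_monom)
  then have "monom 1 i * x \<in> {monom 1 a * p f | a f. a + n f \<le> M + i}" using x(2) by force
  then have "smult c (monom 1 i * x) + monom 1 i * y \<in> pv.span {monom 1 a * p f | a f. a + n f \<le> M + i}"
    by (intro pv.span_add pv.span_scale pv.span_base step.IH)
  then show ?case by (simp add: distrib_left)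
qed

text \<open>The Nullstellensatz for binary forms. Without a common root in the affine chart the
  ideal generated in k[x] contains 1; a member not vanishing at infinity has full degree
  \<open>n f\<close> and reduces high powers to lower ones.\<close>

lemma multiples_eventually_everything:
  fixes p :: "'f \<Rightarrow> 'k::field poly"
  assumes closed: "\<forall>q :: 'k poly. Polynomial.degree q > 0 \<longrightarrow> (\<exists>x. poly q x = 0)"
    and deg: "\<And>f. Polynomial.degree (p f) \<le> n f"
    and no_root: "\<And>x. \<exists>f. poly (p f) x \<noteq> 0" and inf: "\<exists>f. coeff (p f) (n f) \<noteq> 0"
  shows "\<exists>N. \<forall>i\<le>N. monom 1 i \<in> multiples n p N"
proof -
  define J where "J = (\<Union>N. multiples n p N)"
  have sub: "pv.subspace (multiples n p N)" for N unfolding multiples_def by (rule pv.subspace_span)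
  have J_add: "q + r \<in> J" if qr: "q \<in> J" "r \<in> J" for q r
  proof -
    obtain M N where "q \<in> multiples n p M" "r \<in> multiples n p N" using qr by (auto simp: J_def)
    then have "q \<in> multiples n p (max M N)" "r \<in> multiples n p (max M N)"
      using multiples_mono[of M "max M N" n p] multiples_mono[of N "max M N" n p] by auto
    then show ?thesis using pv.subspace_add[OF sub] unfolding J_def by blast
  qed
  have J_smult: "smult c q \<in> J" if "q \<in> J" for c q
    using that pv.subspace_scale[OF sub] unfolding J_def by blast
  have J_0: "0 \<in> J" using pv.subspace_0[OF sub] unfolding J_def by blast
  have J_monom: "monom 1 i * q \<in> J" if "q \<in> J" for i q
    using that multiples_monom unfolding J_def by blast
  have J_mult: "r * q \<in> J" if "q \<in> J" for q r
  proof (induction r)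
    case 0 then show ?case using J_0 by simp
  next
    case (pCons a r)
    have "pCons a r * q = smult a q + monom 1 1 * (r * q)"
      by (simp add: monom_altdef)
    then show ?case using J_add[OF J_smult[OF that] J_monom[OF pCons.IH]] by simp
  qed
  have p_J: "p f \<in> J" for f
  proof -
    have "monom 1 0 * p f \<in> multiples n p (n f)" 
      unfolding multiples_def by (rule pv.span_base, intro CollectI exI[of _ 0] exI[of _ f]) simp
    then show ?thesis unfolding J_def by (auto simp: one_pCons[symmetric] monom_0)
  qed
  have "\<exists>g\<in>J. g \<noteq> 0" using p_J no_root[of 0] by (metis poly_0)
  then have ex: "\<exists>m. \<exists>g\<in>J. g \<noteq> 0 \<and> Polynomial.degree g = m" by blast
  \<comment> \<open>An element of least degree divides all others; were it nonconstant, its root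
    would be common to all \<open>p f\<close>.\<close>
  define m where "m = (LEAST m. \<exists>g\<in>J. g \<noteq> 0 \<and> Polynomial.degree g = m)"
  obtain g where g: "g \<in> J" "g \<noteq> 0" "Polynomial.degree g = m"
    using LeastI_ex[OF ex] unfolding m_def by blast
  have min: "m \<le> Polynomial.degree h" if "h \<in> J" "h \<noteq> 0" for h
    unfolding m_def by (rule Least_le) (use that in blast)
  have dvd: "g dvd h" if h: "h \<in> J" for h
  proof (rule ccontr)
    assume "\<not> g dvd h"
    then have "h mod g \<noteq> 0" by (simp add: dvd_eq_mod_eq_0)
    moreover have "h mod g = h + (- (h div g)) * g" by (simp add: minus_div_mult_eq_mod[symmetric])
    then have "h mod g \<in> J" using J_add[OF h J_mult[OF g(1)], of "- (h div g)"] by (simp only:)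
    ultimately have "m \<le> Polynomial.degree (h mod g)" by (intro min)
    moreover have "Polynomial.degree (h mod g) < m" using degree_mod_less'[OF g(2) \<open>h mod g \<noteq> 0\<close>] g(3) by simp
    ultimately show False by simp
  qed
  have "\<not> Polynomial.degree g > 0"
  proof
    assume "Polynomial.degree g > 0"
    then obtain x where "poly g x = 0" using closed by blast
    then have "poly (p f) x = 0" for f using dvd[OF p_J, of f] by (auto elim!: dvdE)
    then show False using no_root by blast
  qed
  then obtain c where c: "g = [:c:]" using degree_eq_zeroE by blast
  then have "smult (1 / c) g = 1" using g(2) by (simp add: one_pCons)
  then have "1 \<in> J" using J_smult[OF g(1), of "1 / c"] by simp
  then obtain M where M: "1 \<in> multiples n p M" by (auto simp: J_def)
  obtain f where f: "coeff (p f) (n f) \<noteq> 0" using inf by blast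
  \<comment> \<open>Powers below \<open>n f\<close> come from multiplying 1 up from degree M; from
    \<open>n f\<close> on, the leading term of \<open>p f\<close> expresses a power through lower
    ones.\<close>
  let ?N = "M + n f"
  have "monom 1 i \<in> multiples n p ?N" if "i \<le> ?N" for i
    using that
  proof (induction i rule: less_induct)
    case (less i)
    show ?case
    proof (cases "i < n f")
      case True
      have "monom 1 i * 1 \<in> multiples n p (M + i)" by (rule multiples_monom[OF M])
      moreover have "multiples n p (M + i) \<subseteq> multiples n p ?N" by (rule multiples_mono) (use True in simp)
      ultimately show ?thesis by auto
    next
      case False
      define r where "r = i - n f"
      have i: "i = r + n f" using False by (simp add: r_def)
      have "p f = (\<Sum>j\<le>n f. monom (coeff (p f) j) j)"
        using poly_as_sum_of_monoms'[OF deg[of f]] by simp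
      also have "\<dots> = monom (coeff (p f) (n f)) (n f) + (\<Sum>j<n f. monom (coeff (p f) j) j)"
        by (simp add: lessThan_Suc_atMost[symmetric])
      finally have "monom 1 r * p f = monom 1 r * (monom (coeff (p f) (n f)) (n f) + (\<Sum>j<n f. monom (coeff (p f) j) j))"
        by (rule arg_cong)
      also have "\<dots> = monom 1 r * monom (coeff (p f) (n f)) (n f)
          + (\<Sum>j<n f. monom 1 r * monom (coeff (p f) j) j)"
        by (simp only: distrib_left sum_distrib_left)
      also have "\<dots> = smult (coeff (p f) (n f)) (monom 1 i) + (\<Sum>j<n f. smult (coeff (p f) j) (monom 1 (r + j)))"
        by (simp add: mult_monom smult_monom i)
      finally have eq: "smult (coeff (p f) (n f)) (monom 1 i)
        = monom 1 r * p f - (\<Sum>j<n f. smult (coeff (p f) j) (monom 1 (r + j)))" by (simp add: algebra_simps)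
      have "monom 1 r * p f \<in> multiples n p ?N"
        unfolding multiples_def using less.prems i by (intro pv.span_base) force
      moreover have "monom 1 (r + j) \<in> multiples n p ?N" if "j < n f" for j
        using less.IH[of "r + j"] that less.prems i by simp
      ultimately have "smult (coeff (p f) (n f)) (monom 1 i) \<in> multiples n p ?N"
        unfolding eq by (intro pv.subspace_diff[OF sub] pv.subspace_sum[OF sub] pv.subspace_scale[OF sub]) auto
      then have "smult (1 / coeff (p f) (n f)) (smult (coeff (p f) (n f)) (monom 1 i)) \<in> multiples n p ?N"
        by (rule pv.subspace_scale[OF sub])
      then show ?thesis using f by simp
    qed
  qed
  then show ?thesis by blast
qed

context graded_functions begin

text \<open>No common zero over y0 means that in some degree N the multiples span all binary forms.
  This is independence of sufficiently many coefficient vectors, an open condition in y, and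
  spanning over y in turn excludes a common zero there.\<close>

lemma eliminate:
  assumes closed: "\<forall>q :: 'k poly. Polynomial.degree q > 0 \<longrightarrow> (\<exists>x. poly q x = 0)"
    and S: "\<And>f. f \<in> S \<Longrightarrow> \<exists>nd. f \<in> ext H nd"
    and no: "\<And>u. u \<noteq> (0, 0) \<Longrightarrow> \<exists>f\<in>S. f (u, y0) \<noteq> 0"
  shows "\<exists>d. \<exists>h\<in>H d. h y0 \<noteq> 0 \<and> (\<forall>y. h y \<noteq> 0 \<longrightarrow> (\<forall>u. u \<noteq> (0, 0) \<longrightarrow> (\<exists>f\<in>S. f (u, y) \<noteq> 0)))"
proof -
  have "\<forall>f\<in>S. \<exists>x. (\<forall>i. snd x i \<in> H (snd (fst x))) \<and>
    (\<forall>uy. f uy = (\<Sum>i\<le>fst (fst x). snd x i (snd uy) * fst (fst uy) ^ i * snd (fst uy) ^ (fst (fst x) - i)))"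
  proof
    fix f assume "f \<in> S"
    then obtain nd where "f \<in> ext H nd" using S by blast
    then have "ext_fun H nd f" by (simp add: ext_def)
    from ext_coeffs[OF this] obtain c where "\<forall>i. c i \<in> H (snd nd)"
      "\<forall>uy. f uy = (\<Sum>i\<le>fst nd. c i (snd uy) * fst (fst uy) ^ i * snd (fst uy) ^ (fst nd - i))" by blast
    then show "\<exists>x. (\<forall>i. snd x i \<in> H (snd (fst x))) \<and>
      (\<forall>uy. f uy = (\<Sum>i\<le>fst (fst x). snd x i (snd uy) * fst (fst uy) ^ i * snd (fst uy) ^ (fst (fst x) - i)))"
      by (intro exI[of _ "(nd, c)"]) simp
  qed
  from bchoice[OF this] obtain x where x: "\<And>f. f \<in> S \<Longrightarrow> (\<forall>i. snd (x f) i \<in> H (snd (fst (x f)))) \<and>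
    (\<forall>uy. f uy = (\<Sum>i\<le>fst (fst (x f)). snd (x f) i (snd uy) * fst (fst uy) ^ i * snd (fst uy) ^ (fst (fst (x f)) - i)))"
    by blast
  define nd where "nd f = fst (x f)" for f
  define c where "c f = snd (x f)" for f
  have c: "\<And>f i. f \<in> S \<Longrightarrow> c f i \<in> H (snd (nd f))"
    "\<And>f u y. f \<in> S \<Longrightarrow> f (u, y) = (\<Sum>i\<le>fst (nd f). c f i y * fst u ^ i * snd u ^ (fst (nd f) - i))"
    using x by (simp_all add: nd_def c_def)
  obtain f0 where f0: "f0 \<in> S" using no[of "(1, 0)"] by auto
  \<comment> \<open>Functions outside S are replaced by f0, so that a total index type can be used
    without introducing new equations.\<close>
  define rep where "rep f = (if f \<in> S then f else f0)" for f
  have rep: "rep f \<in> S" for f using f0 by (simp add: rep_def)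
  define n where "n f = fst (nd (rep f))" for f
  define p where "p f = (\<Sum>i\<le>n f. monom (c (rep f) i y0) i)" for f
  have coeff_p: "coeff (p f) i = (if i \<le> n f then c (rep f) i y0 else 0)" for f i
    by (simp add: p_def coeff_sum)
  have deg: "Polynomial.degree (p f) \<le> n f" for f
    by (rule degree_le) (simp add: coeff_p)
  have "\<exists>f. poly (p f) x \<noteq> 0" for x
  proof -
    obtain f where f: "f \<in> S" "f ((x, 1), y0) \<noteq> 0" using no[of "(x, 1)"] by auto
    then have "poly (p f) x \<noteq> 0" using c(2)[OF f(1)] by (simp add: p_def poly_sum poly_monom n_def rep_def)
    then show ?thesis by blast
  qed
  moreover have "\<exists>f. coeff (p f) (n f) \<noteq> 0"
  proof -
    obtain f where f: "f \<in> S" "f ((1, 0), y0) \<noteq> 0" using no[of "(1, 0)"] by auto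
    have rf: "rep f = f" using f(1) by (simp add: rep_def)
    have "f ((1, 0), y0) = (\<Sum>i\<le>n f. c f i y0 * 1 ^ i * 0 ^ (n f - i))"
      unfolding n_def rf using c(2)[OF f(1), of "(1, 0)" y0] by (simp only: fst_conv snd_conv)
    also have "\<dots> = (\<Sum>i\<le>n f. if i = n f then c f i y0 else 0)"
      by (rule sum.cong) (auto simp: power_0_left)
    finally have "f ((1, 0), y0) = (\<Sum>i\<le>n f. if i = n f then c f i y0 else 0)" .
    then have "coeff (p f) (n f) \<noteq> 0" using f by (simp add: coeff_p rep_def)
    then show ?thesis by blast
  qed
  ultimately obtain N where N: "\<And>i. i \<le> N \<Longrightarrow> monom 1 i \<in> multiples n p N"
    using multiples_eventually_everything[of p n, OF closed deg] by blast
  define gen where "gen = (\<lambda>(a, f). monom 1 a * p f)"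
  define R0 where "R0 = {(a, f). a + n f \<le> N}"
  have span_gen: "multiples n p N = pv.span (gen ` R0)"
    unfolding multiples_def gen_def R0_def by (rule arg_cong[of _ _ pv.span]) force
  \<comment> \<open>Among the multiples a basis is chosen, so that only finitely many equations take
    part.\<close>
  obtain B where B: "B \<subseteq> gen ` R0" "pv.independent B" "gen ` R0 \<subseteq> pv.span B"
    using pv.maximal_independent_subset by blast
  have degR: "Polynomial.degree q \<le> N" if qR: "q \<in> gen ` R0" for q
  proof -
    obtain a f where q: "q = monom 1 a * p f" "a + n f \<le> N" using qR by (auto simp: gen_def R0_def)
    have "Polynomial.degree q \<le> Polynomial.degree (monom (1::'k) a) + Polynomial.degree (p f)" unfolding q(1) by (rule degree_mult_le)
    also have "\<dots> \<le> a + n f" using deg[of f] by (simp add: degree_monom_eq)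
    finally show ?thesis using q(2) by simp
  qed
  let ?E = "(monom 1) ` {..N} :: 'k poly set"
  have spanE: "q \<in> pv.span ?E" if "Polynomial.degree q \<le> N" for q
  proof -
    have "q = (\<Sum>i\<le>N. smult (coeff q i) (monom 1 i))"
      using poly_as_sum_of_monoms'[OF that] by (simp add: smult_monom)
    also have "\<dots> \<in> pv.span ?E" by (intro pv.span_sum pv.span_scale pv.span_base) auto
    finally show ?thesis .
  qed
  have "finite B \<and> card B \<le> card ?E"
    by (rule pv.independent_span_bound[OF _ B(2)]) (use B(1) degR spanE in auto)
  then have finB: "finite B" by blast
  have "pv.independent ?E"
  proof (rule pv.independent_if_scalars_zero)
    fix u and q :: "'k poly" assume u: "(\<Sum>x\<in>?E. smult (u x) x) = 0" and q: "q \<in> ?E"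
    then obtain j where j: "j \<le> N" "q = monom 1 j" by blast
    have inj: "inj_on (monom (1::'k)) {..N}" by (auto simp: inj_on_def monom_eq_iff')
    have "0 = coeff (\<Sum>x\<in>?E. smult (u x) x) j" using u by simp
    also have "\<dots> = (\<Sum>i\<le>N. if i = j then u (monom 1 i) else 0)"
      unfolding sum.reindex[OF inj] coeff_sum by (rule sum.cong) auto
    also have "\<dots> = u q" using j by simp
    finally show "u q = 0" by simp
  qed simp
  moreover have EB: "?E \<subseteq> pv.span B"
  proof -
    have "?E \<subseteq> multiples n p N" using N by auto
    also have "\<dots> \<subseteq> pv.span B" unfolding span_gen by (rule pv.span_minimal[OF B(3) pv.subspace_span])
    finally show ?thesis .
  qed
  ultimately have cE: "card ?E \<le> card B"
    using pv.independent_span_bound[OF finB] by blast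
  have cardE: "card ?E = Suc N"
    by (subst card_image) (auto simp: inj_on_def monom_eq_iff')
  obtain R where R: "R \<subseteq> R0" "inj_on gen R" "gen ` R = B"
    using subset_image_inj[of B gen R0] B(1) by blast
  have finR: "finite R" using R finB by (metis finite_imageD)
  have cardR: "card R \<ge> Suc N" using cE cardE card_image[OF R(2)] R(3) by simp
  \<comment> \<open>A matrix of Sylvester type: the row of (a, f) is the coefficient vector of f
    shifted by a.\<close>
  define v where "v r i y = (if fst r \<le> i \<and> i - fst r \<le> n (snd r) then c (rep (snd r)) (i - fst r) y else 0)"
    for r and i :: nat and y
  have vH: "v r i \<in> H (snd (nd (rep (snd r))))" for r i
  proof (cases "fst r \<le> i \<and> i - fst r \<le> n (snd r)")
    case True
    then have "v r i = c (rep (snd r)) (i - fst r)" by (simp add: v_def fun_eq_iff)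
    then show ?thesis using c(1)[OF rep] by simp
  next
    case False
    then have "v r i = (\<lambda>y. 0)" by (auto simp: v_def fun_eq_iff)
    then show ?thesis using zero by simp
  qed
  have coeff_gen: "coeff (gen r) i = v r i y0" for r i
    by (cases r) (simp add: gen_def v_def coeff_monom_mult coeff_p)
  have "indep_at R v y0"
    unfolding indep_at_def
  proof (intro allI impI ballI)
    fix u r assume u: "\<forall>i. (\<Sum>r\<in>R. u r * v r i y0) = 0" and r: "r \<in> R"
    define u' where "u' q = u (the_inv_into R gen q)" for q
    have "(\<Sum>q\<in>B. smult (u' q) q) = (\<Sum>r\<in>R. smult (u r) (gen r))"
      unfolding R(3)[symmetric] sum.reindex[OF R(2)] by (rule sum.cong) (auto simp: u'_def the_inv_into_f_f[OF R(2)])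
    also have "\<dots> = 0" by (rule poly_eqI) (simp add: coeff_sum coeff_gen u)
    finally have "u' (gen r) = 0"
      using pv.independentD[OF B(2) finB subset_refl, of u' "gen r"] R(3) r by blast
    then show "u r = 0" using r by (simp add: u'_def the_inv_into_f_f[OF R(2)])
  qed
  then obtain d h where h: "h \<in> H d" "h y0 \<noteq> 0" "\<And>y. h y \<noteq> 0 \<Longrightarrow> indep_at R v y"
    using indep_at_open[of R v "\<lambda>r. snd (nd (rep (snd r)))" y0, OF finR vH] by blast
  have "\<exists>f\<in>S. f (u, y) \<noteq> 0" if y: "h y \<noteq> 0" and u: "u \<noteq> (0, 0)" for u y
  proof (rule ccontr)
    assume "\<not> (\<exists>f\<in>S. f (u, y) \<noteq> 0)"
    then have all0: "f (u, y) = 0" if "f \<in> S" for f using that by blast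
    define g where "g r = (\<Sum>i\<le>N. monom (v r i y) i)" for r
    have cg: "coeff (g r) i = (if i \<le> N then v r i y else 0)" for r i by (simp add: g_def coeff_sum)
    have vN: "v r i y = 0" if "r \<in> R" "i > N" for r i
      using that R(1) by (cases r) (auto simp: v_def R0_def)
    have indg: "\<forall>r\<in>R. w r = 0" if "(\<Sum>r\<in>R. smult (w r) (g r)) = 0" for w
    proof -
      have "(\<Sum>r\<in>R. w r * v r i y) = 0" for i
      proof (cases "i \<le> N")
        case True
        have "(\<Sum>r\<in>R. w r * v r i y) = coeff (\<Sum>r\<in>R. smult (w r) (g r)) i" using True by (simp add: coeff_sum cg)
        then show ?thesis using that by simp
      next
        case False then show ?thesis using vN by (intro sum.neutral) auto
      qed
      then show ?thesis using h(3)[OF y] unfolding indep_at_def by blast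
    qed
    \<comment> \<open>The value at u of the binary form of degree N with these coefficients. A
      common zero u annihilates every \<open>g r\<close>, and then both pure powers of degree
      N.\<close>
    define ev where "ev q = (\<Sum>i\<le>N. coeff q i * fst u ^ i * snd u ^ (N - i))" for q
    have evg: "ev (g r) = 0" if r: "r \<in> R" for r
    proof -
      obtain a f where af: "r = (a, f)" "a + n f \<le> N" using r R(1) by (auto simp: R0_def)
      have "ev (g r) = (\<Sum>i\<le>N. v r i y * fst u ^ i * snd u ^ (N - i))" by (simp add: ev_def cg)
      also have "\<dots> = (\<Sum>i\<in>{a..a + n f}. v r i y * fst u ^ i * snd u ^ (N - i))"
        by (rule sum.mono_neutral_right) (use af in \<open>auto simp: v_def\<close>)
      also have "\<dots> = (\<Sum>j\<le>n f. c (rep f) j y * fst u ^ (j + a) * snd u ^ (N - (j + a)))"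
        by (rule sum.reindex_bij_witness[of _ "\<lambda>j. j + a" "\<lambda>i. i - a"]) (auto simp: v_def af)
      also have "\<dots> = fst u ^ a * snd u ^ (N - a - n f) * (\<Sum>j\<le>n f. c (rep f) j y * fst u ^ j * snd u ^ (n f - j))"
        unfolding sum_distrib_left
      proof (rule sum.cong)
        fix j assume "j \<in> {..n f}"
        then have "N - (j + a) = (N - a - n f) + (n f - j)" using af(2) by auto
        then show "c (rep f) j y * fst u ^ (j + a) * snd u ^ (N - (j + a)) =
          fst u ^ a * snd u ^ (N - a - n f) * (c (rep f) j y * fst u ^ j * snd u ^ (n f - j))"
          by (simp add: power_add mult_ac)
      qed simp
      also have "\<dots> = fst u ^ a * snd u ^ (N - a - n f) * rep f (u, y)" using c(2)[OF rep, of f u y] by (simp add: n_def)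
      finally show ?thesis using all0[OF rep] by simp
    qed
    have inj_g: "inj_on g R"
    proof (rule inj_onI, rule ccontr)
      fix r s assume rs: "r \<in> R" "s \<in> R" "g r = g s" "r \<noteq> s"
      have "(\<Sum>t\<in>R. smult (if t = r then 1 else if t = s then -1 else 0) (g t))
        = (\<Sum>t\<in>{r, s}. smult (if t = r then 1 else if t = s then -1 else 0) (g t))"
        by (rule sum.mono_neutral_right) (use rs finR in auto)
      also have "\<dots> = 0" using rs by simp
      finally have z: "(\<Sum>t\<in>R. smult (if t = r then 1 else if t = s then -1 else 0) (g t)) = 0" .
      from bspec[OF indg[OF z] rs(1)] show False by simp
    qed
    have indgR: "pv.independent (g ` R)"
    proof (rule pv.independent_if_scalars_zero)
      fix w q assume w: "(\<Sum>x\<in>g ` R. smult (w x) x) = 0" and q: "q \<in> g ` R"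
      then have "(\<Sum>r\<in>R. smult (w (g r)) (g r)) = 0" by (simp add: sum.reindex[OF inj_g])
      then show "w q = 0" using indg[of "\<lambda>r. w (g r)"] q by blast
    qed (use finR in simp)
    have degg: "g ` R \<subseteq> pv.span ?E"
    proof
      fix q assume "q \<in> g ` R"
      then have "Polynomial.degree q \<le> N" by (auto simp: cg intro!: degree_le)
      then show "q \<in> pv.span ?E" by (rule spanE)
    qed
    \<comment> \<open>At least N + 1 independent vectors in a space of dimension N + 1 span
      it.\<close>
    have "?E \<subseteq> pv.span (g ` R)"
    proof (rule ccontr)
      assume "\<not> ?E \<subseteq> pv.span (g ` R)"
      then obtain q where q: "q \<in> ?E" "q \<notin> pv.span (g ` R)" by blast
      then have "pv.independent (insert q (g ` R))" using indgR by (simp add: pv.independent_insertI)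
      moreover have "insert q (g ` R) \<subseteq> pv.span ?E" using degg q(1) by (auto intro: pv.span_base)
      ultimately have "card (insert q (g ` R)) \<le> card ?E" using pv.independent_span_bound[of ?E] by blast
      moreover have "q \<notin> g ` R" using q(2) pv.span_base by blast
      ultimately show False using cardR cardE finR card_image[OF inj_g] by simp
    qed
    moreover have ev0: "ev q = 0" if "q \<in> pv.span (g ` R)" for q
    proof -
      have "pv.subspace {q. ev q = 0}"
        by (auto simp: pv.subspace_def ev_def distrib_right sum.distrib mult.assoc sum_distrib_left[symmetric])
      then show ?thesis using pv.span_minimal[of "g ` R" "{q. ev q = 0}"] evg that by blast
    qed
    ultimately have "ev (monom 1 N) = 0" "ev (monom 1 0) = 0" by blast+
    moreover have "ev (monom 1 N) = fst u ^ N" 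
    proof -
      have "ev (monom 1 N) = (\<Sum>i\<le>N. if i = N then fst u ^ N else 0)" unfolding ev_def by (rule sum.cong) auto
      then show ?thesis by simp
    qed
    moreover have "ev (monom 1 0) = snd u ^ N"
    proof -
      have "ev (monom 1 0) = (\<Sum>i\<le>N. if i = 0 then snd u ^ N else 0)" unfolding ev_def by (rule sum.cong) auto
      then show ?thesis by simp
    qed
    ultimately have "fst u = 0" "snd u = 0" by (simp_all add: power_eq_0_iff split: if_splits)
    then show False using u by (simp add: prod_eq_iff)
  qed
  then show ?thesis using h(1,2) by blast
qed

end

subsection \<open>Homogeneous polynomial functions\<close>

definition mval :: "('i \<Rightarrow> 'k::comm_semiring_1) \<Rightarrow> 'i mon \<Rightarrow> 'k" where
  "mval a m = (\<Prod>i\<in>Poly_Mapping.keys m. a i ^ Poly_Mapping.lookup m i)"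

lemma mval_eq_prod:
  "finite A \<Longrightarrow> Poly_Mapping.keys m \<subseteq> A \<Longrightarrow> mval a m = (\<Prod>i\<in>A. a i ^ Poly_Mapping.lookup m i)"
  unfolding mval_def by (rule prod.mono_neutral_left) (auto simp: in_keys_iff)

lemma mval_0 [simp]: "mval a 0 = 1"
  by (simp add: mval_def)

lemma mval_single [simp]: "mval a (Poly_Mapping.single i (Suc 0)) = a i"
  by (simp add: mval_def)

lemma mval_add: "mval a (m + n) = mval a m * mval a n"
proof -
  let ?A = "Poly_Mapping.keys m \<union> Poly_Mapping.keys n"
  have "mval a (m + n) = (\<Prod>i\<in>?A. a i ^ Poly_Mapping.lookup (m + n) i)"
    by (rule mval_eq_prod) (use keys_add[of m n] in auto)
  then show ?thesis
    by (simp add: lookup_add power_add prod.distrib mval_eq_prod[of ?A m] mval_eq_prod[of ?A n])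
qed

lemma mval_scale: "mval (\<lambda>i. c * a i) m = c ^ mdeg m * mval a m"
  by (simp add: mval_def mdeg_def power_mult_distrib prod.distrib power_sum)

lemma eval_mpoly_pair: "eval_mpoly a p = pair p (mval a)"
  by (simp add: eval_mpoly_def pair_def mval_def)

lemma eval_mult: "eval_mpoly a (p * q) = eval_mpoly a p * eval_mpoly a q"
proof -
  have "eval_mpoly a (p * q) = pair p (\<lambda>m. mval a m * pair q (mval a))"
    unfolding eval_mpoly_pair pair_mult mval_add pair_mult_right ..
  then show ?thesis by (simp add: eval_mpoly_pair mult.commute[of _ "pair q _"] pair_mult_right)
qed

lemma eval_add: "eval_mpoly a (p + q) = eval_mpoly a p + eval_mpoly a q"
  by (simp add: eval_mpoly_pair pair_add)

lemma eval_scale: "eval_mpoly a (scale c p) = c * eval_mpoly a p"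
  by (simp add: eval_mpoly_pair pair_scale)

lemma eval_sum: "eval_mpoly a (\<Sum>x\<in>A. f x) = (\<Sum>x\<in>A. eval_mpoly a (f x))"
  by (simp add: eval_mpoly_pair pair_sum)

lemma eval_zero [simp]: "eval_mpoly a 0 = 0"
  by (simp add: eval_mpoly_pair)

lemma eval_single: "eval_mpoly a (Poly_Mapping.single m c) = c * mval a m"
  by (simp add: eval_mpoly_pair)

text \<open>Functions are used instead of polynomials because only values at points enter the
  Zariski topology.\<close>

definition hfun :: "nat \<Rightarrow> (('i \<Rightarrow> 'k::field) \<Rightarrow> 'k) set" where
  "hfun d = {\<lambda>y. eval_mpoly y p | p. p \<in> forms d}"

interpretation hf: graded_functions "hfun :: nat \<Rightarrow> (('i \<Rightarrow> 'k::field) \<Rightarrow> 'k) set"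
proof
  fix d d' :: nat and f g :: "('i \<Rightarrow> 'k) \<Rightarrow> 'k" and c :: 'k
  show "(\<lambda>y. 0) \<in> (hfun d :: (('i \<Rightarrow> 'k) \<Rightarrow> 'k) set)"
    unfolding hfun_def by (intro CollectI exI[of _ 0]) simp
  show "(\<lambda>y. c) \<in> (hfun 0 :: (('i \<Rightarrow> 'k) \<Rightarrow> 'k) set)"
    unfolding hfun_def by (intro CollectI exI[of _ "Poly_Mapping.single 0 c"]) (simp add: eval_single)
  assume "f \<in> hfun d"
  then obtain p where p: "p \<in> forms d" "f = (\<lambda>y. eval_mpoly y p)" by (auto simp: hfun_def)
  show "(\<lambda>y. f y + g y) \<in> hfun d" if g: "g \<in> hfun d"
  proof -
    obtain q where "q \<in> forms d" "g = (\<lambda>y. eval_mpoly y q)" using g by (auto simp: hfun_def)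
    then show ?thesis unfolding hfun_def p(2)
      by (intro CollectI exI[of _ "p + q"]) (simp add: eval_add forms_add p(1))
  qed
  show "(\<lambda>y. f y * g y) \<in> hfun (d + d')" if g: "g \<in> hfun d'"
  proof -
    obtain q where "q \<in> forms d'" "g = (\<lambda>y. eval_mpoly y q)" using g by (auto simp: hfun_def)
    then show ?thesis unfolding hfun_def p(2)
      by (intro CollectI exI[of _ "p * q"]) (simp add: eval_mult forms_mult p(1))
  qed
qed

lemma hfun_coord: "(\<lambda>y. y i) \<in> hfun 1"
  unfolding hfun_def
  by (intro CollectI exI[of _ "Poly_Mapping.single (Poly_Mapping.single i 1) 1"]) (simp add: eval_single)

lemma hfun_homogeneous:
  assumes "f \<in> hfun d" shows "f (\<lambda>i. c * y i) = c ^ d * f y"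
proof -
  obtain p where p: "p \<in> forms d" "f = (\<lambda>y. eval_mpoly y p)" using assms by (auto simp: hfun_def)
  have "pair p (mval (\<lambda>i. c * y i)) = pair p (\<lambda>m. c ^ d * mval y m)"
    by (rule pair_cong) (use forms_keys[OF p(1)] in \<open>simp add: mval_scale\<close>)
  then show ?thesis by (simp add: p(2) eval_mpoly_pair pair_mult_right)
qed

lemma (in graded_functions) power: "f \<in> H d \<Longrightarrow> (\<lambda>y. f y ^ n) \<in> H (\<Sum>i<n. d)"
  using prod[of "{..<n}" "\<lambda>_. f" "\<lambda>_. d"] by simp

lemma hfun_power: "f \<in> hfun d \<Longrightarrow> (\<lambda>y. f y ^ n) \<in> hfun (n * d)"
  using hf.power[of f d n] by simp

section \<open>Polynomial functions of the parameters and the number of their monomials\<close>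

definition box :: "nat \<Rightarrow> nat \<Rightarrow> nat mon set" where
  "box n D = {m. Poly_Mapping.keys m \<subseteq> {..<n} \<and> (\<forall>i. Poly_Mapping.lookup m i \<le> D)}"

text \<open>Exponents are bounded one by one, so the count is an n-th power; this rate of growth
  limits the Krull dimension.\<close>

lemma finite_box: "finite (box n D)" and card_box: "card (box n D) \<le> (D + 1) ^ n"
proof -
  let ?f = "\<lambda>m :: nat mon. restrict (Poly_Mapping.lookup m) {..<n}"
  have inj: "inj_on ?f (box n D)"
  proof (rule inj_onI, rule poly_mapping_eqI)
    fix m m' :: "nat mon" and i assume *: "m \<in> box n D" "m' \<in> box n D" "?f m = ?f m'"
    show "Poly_Mapping.lookup m i = Poly_Mapping.lookup m' i"
    proof (cases "i < n")
      case True then show ?thesis using fun_cong[OF *(3), of i] by simp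
    next
      case False
      then have "i \<notin> Poly_Mapping.keys m" "i \<notin> Poly_Mapping.keys m'" using *(1,2) by (auto simp: box_def)
      then show ?thesis by (simp add: in_keys_iff)
    qed
  qed
  have sub: "?f ` box n D \<subseteq> PiE {..<n} (\<lambda>_. {..D})"
    by (intro image_subsetI) (simp add: box_def PiE_iff)
  have fin: "finite (PiE {..<n} (\<lambda>_. {..D}))" by (intro finite_PiE) auto
  show "finite (box n D)" using finite_imageD[OF finite_subset[OF sub fin] inj] .
  have "card (box n D) = card (?f ` box n D)" by (rule card_image[OF inj, symmetric])
  also have "\<dots> \<le> card (PiE {..<n} (\<lambda>_. {..D}))" by (rule card_mono[OF fin sub])
  also have "\<dots> = (D + 1) ^ n" by (simp add: card_PiE)
  finally show "card (box n D) \<le> (D + 1) ^ n" .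
qed

definition pfun :: "nat \<Rightarrow> nat \<Rightarrow> ((nat \<Rightarrow> 'k::field) \<Rightarrow> 'k) set" where
  "pfun n D = {\<lambda>t. eval_mpoly t p | p. Poly_Mapping.keys p \<subseteq> box n D}"

lemma box_add: "m \<in> box n D \<Longrightarrow> m' \<in> box n D' \<Longrightarrow> m + m' \<in> box n (D + D')"
  unfolding box_def using keys_add[of m m'] by (auto simp: lookup_add add_mono)

interpretation pf: graded_functions "pfun n :: nat \<Rightarrow> ((nat \<Rightarrow> 'k::field) \<Rightarrow> 'k) set" for n
proof
  fix d d' :: nat and f g :: "(nat \<Rightarrow> 'k) \<Rightarrow> 'k" and c :: 'k
  show "(\<lambda>y. 0) \<in> (pfun n d :: ((nat \<Rightarrow> 'k) \<Rightarrow> 'k) set)"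
    unfolding pfun_def by (intro CollectI exI[of _ 0]) simp
  show "(\<lambda>y. c) \<in> (pfun n 0 :: ((nat \<Rightarrow> 'k) \<Rightarrow> 'k) set)"
    unfolding pfun_def by (intro CollectI exI[of _ "Poly_Mapping.single 0 c"]) (simp add: eval_single box_def)
  assume "f \<in> pfun n d"
  then obtain p where p: "Poly_Mapping.keys p \<subseteq> box n d" "f = (\<lambda>y. eval_mpoly y p)" by (auto simp: pfun_def)
  show "(\<lambda>y. f y + g y) \<in> pfun n d" if g: "g \<in> pfun n d"
  proof -
    obtain q where "Poly_Mapping.keys q \<subseteq> box n d" "g = (\<lambda>y. eval_mpoly y q)" using g by (auto simp: pfun_def)
    then show ?thesis unfolding pfun_def p(2) using keys_add[of p q] p(1)
      by (intro CollectI exI[of _ "p + q"]) (auto simp add: eval_add)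
  qed
  show "(\<lambda>y. f y * g y) \<in> pfun n (d + d')" if g: "g \<in> pfun n d'"
  proof -
    obtain q where q: "Poly_Mapping.keys q \<subseteq> box n d'" "g = (\<lambda>y. eval_mpoly y q)" using g by (auto simp: pfun_def)
    have "Poly_Mapping.keys (p * q) \<subseteq> box n (d + d')"
      using keys_mult[of p q] p(1) q(1) box_add by fast
    then show ?thesis unfolding pfun_def p(2) q(2)
      by (intro CollectI exI[of _ "p * q"]) (simp add: eval_mult)
  qed
qed

lemma pfun_mono: "D \<le> D' \<Longrightarrow> pfun n D \<subseteq> pfun n D'"
  unfolding pfun_def box_def by (blast intro: le_trans)

lemma pfun_coord: "i < n \<Longrightarrow> (\<lambda>t. t i) \<in> pfun n 1"
  unfolding pfun_def
  by (intro CollectI exI[of _ "Poly_Mapping.single (Poly_Mapping.single i 1) 1"])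
    (auto simp add: eval_single box_def lookup_single when_def)

lemma hfun_pfun:
  assumes "f \<in> hfun d" and y: "\<And>i. (\<lambda>t. y t i) \<in> pfun n D"
  shows "(\<lambda>t. f (y t)) \<in> pfun n (d * D)"
proof -
  obtain p where p: "p \<in> forms d" "f = (\<lambda>y. eval_mpoly y p)" using assms(1) by (auto simp: hfun_def)
  have "(\<lambda>t. mval (y t) m) \<in> pfun n (d * D)" if "m \<in> Poly_Mapping.keys p" for m
  proof -
    have "(\<lambda>t. y t i ^ k) \<in> pfun n (\<Sum>j<k. D)" for i and k :: nat
      by (rule pf.power[OF y])
    then have "(\<lambda>t. y t i ^ k) \<in> pfun n (k * D)" for i and k :: nat by simp
    then have "(\<lambda>t. \<Prod>i\<in>Poly_Mapping.keys m. y t i ^ Poly_Mapping.lookup m i)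
      \<in> pfun n (\<Sum>i\<in>Poly_Mapping.keys m. Poly_Mapping.lookup m i * D)"
      by (rule pf.prod)
    moreover have "(\<Sum>i\<in>Poly_Mapping.keys m. Poly_Mapping.lookup m i * D) = d * D"
      using forms_keys[OF p(1) that] by (simp add: sum_distrib_right[symmetric] mdeg_def)
    ultimately show ?thesis by (simp add: mval_def)
  qed
  then have "(\<lambda>t. \<Sum>m\<in>Poly_Mapping.keys p. Poly_Mapping.lookup p m * mval (y t) m) \<in> pfun n (d * D)"
    by (intro pf.sum pf.scale)
  then show ?thesis by (simp add: p(2) eval_mpoly_pair pair_def)
qed

lemma eval_mpoly_curve:
  assumes "\<And>i. \<exists>q. \<forall>u. y u i = poly q (u :: 'k::field)"
  shows "\<exists>q. \<forall>u. eval_mpoly (y u) p = poly q u"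
proof -
  obtain q where q: "\<And>i u. y u i = poly (q i) u" using assms by metis
  show ?thesis
    by (intro exI[of _ "\<Sum>m\<in>Poly_Mapping.keys p. smult (Poly_Mapping.lookup p m)
        (\<Prod>i\<in>Poly_Mapping.keys m. q i ^ Poly_Mapping.lookup m i)"])
      (simp add: eval_mpoly_def poly_sum poly_prod poly_power q)
qed

lemma hfun_curve:
  assumes "f \<in> hfun d" "\<And>i. \<exists>q. \<forall>u. y u i = poly q (u :: 'k::field)"
  shows "\<exists>q. \<forall>u. f (y u) = poly q u"
  using assms(1) eval_mpoly_curve[OF assms(2)] by (auto simp: hfun_def)

text \<open>The product of q and r vanishes everywhere, hence is zero because the field is
  infinite.\<close>

lemma poly_vanishing_cofinite:
  fixes q r :: "'k::field_char_0 poly"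
  assumes "\<And>u. poly r u \<noteq> 0 \<Longrightarrow> poly q u = 0" "r \<noteq> 0"
  shows "q = 0"
proof -
  have "poly (q * r) u = 0" for u using assms(1)[of u] by auto
  then have "q * r = 0" by (metis poly_all_0_iff_0)
  then show ?thesis using assms(2) by simp
qed

text \<open>By restriction to the line through a point where \<open>f\<close> is nonzero and one where \<open>g\<close> is.\<close>

lemma pfun_prime:
  fixes f g :: "(nat \<Rightarrow> 'k::field_char_0) \<Rightarrow> 'k"
  assumes f: "f \<in> pfun n D" and g: "g \<in> pfun n D'" and fg: "\<And>t. f t * g t = 0"
  shows "(\<forall>t. f t = 0) \<or> (\<forall>t. g t = 0)"
proof (rule ccontr)
  assume "\<not> ?thesis"
  then obtain s t where st: "f s \<noteq> 0" "g t \<noteq> 0" by blast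
  define y where "y u i = s i + u * (t i - s i)" for u i
  have y: "\<exists>q. \<forall>u. y u i = poly q u" for i
    by (rule exI[of _ "[:s i, t i - s i:]"]) (simp add: y_def)
  obtain a b where ab: "\<And>u. f (y u) = poly a u" "\<And>u. g (y u) = poly b u"
    using f g eval_mpoly_curve[of y, OF y] unfolding pfun_def by blast
  have y01: "y 0 = s" "y 1 = t" by (simp_all add: y_def fun_eq_iff)
  have "poly (a * b) u = 0" for u using fg[of "y u"] ab by simp
  then have "a * b = 0" by (metis poly_all_0_iff_0)
  then have "a = 0 \<or> b = 0" by simp
  then show False using ab(1)[of 0] ab(2)[of 1] st y01 by auto
qed

subsection \<open>Pluecker coordinates\<close>

definition indep2 :: "('i, 'k::field) mpoly \<Rightarrow> ('i, 'k) mpoly \<Rightarrow> bool" where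
  "indep2 F G \<longleftrightarrow> (\<forall>a b. scale a F + scale b G = 0 \<longrightarrow> a = 0 \<and> b = 0)"

lemma span2: "x \<in> sc.span {F, G} \<longleftrightarrow> (\<exists>a b. x = scale a F + scale b G)"
proof
  assume "x \<in> sc.span {F, G}"
  then obtain a b where "x - scale a F - scale b G = 0" by (auto simp: sc.span_insert)
  then have "x = scale a F + scale b G" by (simp add: algebra_simps)
  then show "\<exists>a b. x = scale a F + scale b G" by blast
next
  assume "\<exists>a b. x = scale a F + scale b G"
  then show "x \<in> sc.span {F, G}" by (auto intro!: sc.span_add sc.span_scale intro: sc.span_base)
qed

lemma dim_span2: "sc.dim (sc.span {F, G}) = 2 \<longleftrightarrow> indep2 F G"
proof
  assume *: "sc.dim (sc.span {F, G}) = 2"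
  have one: "\<not> sc.span {F, G} \<subseteq> sc.span {H}" for H
    using sc.dim_le_card[of "sc.span {F, G}" "{H}"] * by auto
  show "indep2 F G"
    unfolding indep2_def
  proof (intro allI impI)
    fix a b assume ab: "scale a F + scale b G = 0"
    show "a = 0 \<and> b = 0"
    proof (rule ccontr)
      assume "\<not> (a = 0 \<and> b = 0)"
      then consider "a \<noteq> 0" | "b \<noteq> 0" by blast
      then show False
      proof cases
        case 1
        have "scale a F = scale (- b) G" using ab by (simp add: eq_neg_iff_add_eq_0)
        then have "scale (1 / a) (scale a F) = scale (1 / a) (scale (- b) G)" by simp
        then have "F = scale (- b / a) G" using 1 by simp
        then have "F \<in> sc.span {G}" by (metis sc.span_scale sc.span_base insertI1)
        then have "{F, G} \<subseteq> sc.span {G}" by (simp add: sc.span_base)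
        then show False using one[of G] sc.span_minimal[OF _ sc.subspace_span] by blast
      next
        case 2
        have "scale b G = scale (- a) F" using ab by (simp add: eq_neg_iff_add_eq_0 add.commute)
        then have "scale (1 / b) (scale b G) = scale (1 / b) (scale (- a) F)" by simp
        then have "G = scale (- a / b) F" using 2 by simp
        then have "G \<in> sc.span {F}" by (metis sc.span_scale sc.span_base insertI1)
        then have "{F, G} \<subseteq> sc.span {F}" by (simp add: sc.span_base)
        then show False using one[of F] sc.span_minimal[OF _ sc.subspace_span] by blast
      qed
    qed
  qed
next
  assume i: "indep2 F G"
  have "F \<noteq> G"
  proof
    assume "F = G"
    then have "scale 1 F + scale (-1) G = 0" by simp
    then show False using i unfolding indep2_def by (metis zero_neq_one)
  qed
  moreover have "sc.independent {F, G}"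
  proof (rule sc.independent_if_scalars_zero)
    fix c x assume "(\<Sum>x\<in>{F, G}. scale (c x) x) = 0" "x \<in> {F, G}"
    then show "c x = 0" using i \<open>F \<noteq> G\<close> unfolding indep2_def by auto
  qed simp
  ultimately show "sc.dim (sc.span {F, G}) = 2" using sc.dim_span_eq_card_independent[of "{F, G}"] by simp
qed

lemma grassmannian_iff:
  "W \<in> grassmannian e \<longleftrightarrow> (\<exists>F\<in>forms e. \<exists>G\<in>forms e. indep2 F G \<and> W = sc.span {F, G})"
proof
  assume W: "W \<in> grassmannian e"
  then have We: "W \<subseteq> forms e" and Ws: "sc.subspace W" and d: "sc.dim W = 2" by (auto simp: grassmannian_def)
  obtain B where B: "B \<subseteq> W" "sc.independent B" "W \<subseteq> sc.span B" "finite B" "card B = 2"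
    using finite_basis_forms[OF We] d by metis
  then obtain F G where FG: "B = {F, G}" by (auto simp: card_2_iff)
  have "W = sc.span {F, G}" using B sc.span_minimal[OF B(1) Ws] by (auto simp: FG)
  then show "\<exists>F\<in>forms e. \<exists>G\<in>forms e. indep2 F G \<and> W = sc.span {F, G}"
    using We B(1) d dim_span2[of F G] by (auto simp: FG)
next
  assume "\<exists>F\<in>forms e. \<exists>G\<in>forms e. indep2 F G \<and> W = sc.span {F, G}"
  then obtain F G where FG: "F \<in> forms e" "G \<in> forms e" "indep2 F G" "W = sc.span {F, G}" by blast
  then have "W \<subseteq> forms e" using sc.span_minimal[OF _ subspace_forms, of "{F, G}" e] by simp
  then show "W \<in> grassmannian e" using FG dim_span2[of F G] by (simp add: grassmannian_def)
qed

lemma plucker_combination: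
  "plucker (scale a F + scale b G) (scale c F + scale d G) = (\<lambda>i. (a * d - b * c) * plucker F G i)"
  for F G :: "'k::field poly3"
  by (auto simp: plucker_def fun_eq_iff lookup_add algebra_simps)

lemma plucker_nonzero:
  fixes F G :: "'k::field poly3"
  assumes "indep2 F G" shows "\<exists>i. plucker F G i \<noteq> 0"
proof (rule ccontr)
  assume "\<not> ?thesis"
  then have *: "Poly_Mapping.lookup F m * Poly_Mapping.lookup G n = Poly_Mapping.lookup F n * Poly_Mapping.lookup G m" for m n
    by (auto simp: plucker_def)
  have "F \<noteq> 0" using assms unfolding indep2_def by (metis add.right_neutral sc.scale_zero_left sc.scale_zero_right zero_neq_one)
  then obtain m where m: "Poly_Mapping.lookup F m \<noteq> 0" by (auto simp: poly_mapping_eq_iff fun_eq_iff)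
  \<comment> \<open>If all minors vanish, those involving a nonzero coefficient of F give a relation
    between F and G.\<close>
  have "scale (- Poly_Mapping.lookup G m) F + scale (Poly_Mapping.lookup F m) G = 0"
  proof (rule poly_mapping_eqI)
    fix k
    show "Poly_Mapping.lookup (scale (- Poly_Mapping.lookup G m) F + scale (Poly_Mapping.lookup F m) G) k = Poly_Mapping.lookup 0 k"
      using *[of m k] by (simp add: lookup_add lookup_minus mult.commute del: sc.scale_minus_left)
  qed
  then show False using assms m unfolding indep2_def by blast
qed

lemma plucker_span_eq:
  fixes F G F' G' :: "'k::field poly3"
  assumes "indep2 F G" "sc.span {F, G} = sc.span {F', G'}"
  shows "\<exists>c. c \<noteq> 0 \<and> plucker F G = (\<lambda>i. c * plucker F' G' i)"
proof -
  have "F \<in> sc.span {F', G'}" "G \<in> sc.span {F', G'}" using assms(2) by (metis insertI1 insertI2 sc.span_base)+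
  then obtain a b c d where "F = scale a F' + scale b G'" "G = scale c F' + scale d G'"
    unfolding span2 by blast
  then have eq: "plucker F G = (\<lambda>i. (a * d - b * c) * plucker F' G' i)" using plucker_combination by metis
  moreover have "a * d - b * c \<noteq> 0" using plucker_nonzero[OF assms(1)] unfolding eq by auto
  ultimately show ?thesis by blast
qed

text \<open>One Pluecker vector per plane, chosen arbitrarily; by \<open>hfun_pl\<close> the
  vanishing of homogeneous functions does not depend on the choice.\<close>

definition pl :: "'k::field poly3 set \<Rightarrow> 3 mon \<times> 3 mon \<Rightarrow> 'k" where
  "pl W = (SOME y. \<exists>F G. W = sc.span {F, G} \<and> y = plucker F G)"

lemma pl_span:
  fixes F G :: "'k::field poly3"
  assumes "indep2 F G"
  shows "\<exists>c. c \<noteq> 0 \<and> plucker F G = (\<lambda>i. c * pl (sc.span {F, G}) i)"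
proof -
  let ?P = "\<lambda>y. \<exists>F' G'. sc.span {F, G} = sc.span {F', G'} \<and> y = plucker F' G'"
  have "?P (plucker F G)" by (intro exI[of _ F] exI[of _ G]) simp
  then have "?P (SOME y. ?P y)" by (rule someI[of ?P])
  then obtain F' G' where FG': "sc.span {F, G} = sc.span {F', G'}" "pl (sc.span {F, G}) = plucker F' G'"
    unfolding pl_def by (elim exE conjE)
  show ?thesis unfolding FG'(2) by (rule plucker_span_eq[OF assms FG'(1)])
qed

lemma hfun_pl:
  assumes "indep2 F G" "f \<in> hfun d"
  shows "f (pl (sc.span {F, G})) = 0 \<longleftrightarrow> f (plucker F G) = 0"
proof -
  obtain c where c: "c \<noteq> 0" "plucker F G = (\<lambda>i. c * pl (sc.span {F, G}) i)" using pl_span[OF assms(1)] by blast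
  show ?thesis unfolding c(2) hfun_homogeneous[OF assms(2)] using c(1) by simp
qed

lemma pl_nonzero:
  assumes "W \<in> grassmannian e" shows "\<exists>i. pl W i \<noteq> 0"
proof -
  obtain F G where FG: "indep2 F G" "W = sc.span {F, G}" using assms unfolding grassmannian_iff by blast
  obtain c where c: "plucker F G = (\<lambda>i. c * pl W i)" using pl_span[OF FG(1)] FG(2) by blast
  show ?thesis using plucker_nonzero[OF FG(1)] unfolding c by auto
qed

subsection \<open>The Zariski topology\<close>

lemma basic_open_iff:
  assumes "p \<in> forms d"
  shows "basic_open e p = {W \<in> grassmannian e. eval_mpoly (pl W) p \<noteq> 0}"
proof -
  have h: "(\<lambda>y. eval_mpoly y p) \<in> hfun d" using assms by (auto simp: hfun_def)
  have "(\<exists>F G. W = sc.span {F, G} \<and> eval_mpoly (plucker F G) p \<noteq> 0) \<longleftrightarrow> eval_mpoly (pl W) p \<noteq> 0"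
    if W: "W \<in> grassmannian e" for W
  proof -
    have "indep2 F G" if "W = sc.span {F, G}" for F G
      using W that dim_span2[of F G] by (simp add: grassmannian_def)
    moreover obtain F G where "W = sc.span {F, G}" using W unfolding grassmannian_iff by blast
    ultimately show ?thesis using hfun_pl[OF _ h] by metis
  qed
  then show ?thesis unfolding basic_open_def by blast
qed

text \<open>Products of homogeneous functions turn intersections of basic open sets into basic open
  sets, so the generating family is a base.\<close>

lemma openin_zariski:
  fixes U :: "'k::field poly3 set set"
  shows "openin (zariski e) U \<longleftrightarrow> U \<subseteq> grassmannian e \<and>
    (\<forall>W\<in>U. \<exists>d. \<exists>f\<in>hfun d. f (pl W) \<noteq> 0 \<and> (\<forall>V\<in>grassmannian e. f (pl V) \<noteq> 0 \<longrightarrow> V \<in> U))"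
    (is "_ \<longleftrightarrow> ?P U")
proof
  let ?S = "{basic_open e p | p d. p \<in> forms d} :: 'k poly3 set set set"
  assume "openin (zariski e) U"
  then have "generate_topology_on ?S U" unfolding zariski_def openin_topology_generated_by_iff .
  then show "?P U"
  proof (induction rule: generate_topology_on.induct)
    case Empty then show ?case by simp
  next
    case (Int a b)
    show ?case
    proof (intro conjI ballI)
      show "a \<inter> b \<subseteq> grassmannian e" using Int.IH by blast
      fix W assume "W \<in> a \<inter> b"
      then obtain d f d' g where f: "f \<in> hfun d" "f (pl W) \<noteq> 0" "\<forall>V\<in>grassmannian e. f (pl V) \<noteq> 0 \<longrightarrow> V \<in> a"
        and g: "g \<in> hfun d'" "g (pl W) \<noteq> 0" "\<forall>V\<in>grassmannian e. g (pl V) \<noteq> 0 \<longrightarrow> V \<in> b"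
        using Int.IH by blast
      show "\<exists>d. \<exists>f\<in>hfun d. f (pl W) \<noteq> 0 \<and> (\<forall>V\<in>grassmannian e. f (pl V) \<noteq> 0 \<longrightarrow> V \<in> a \<inter> b)"
        using f(2,3) g(2,3)
        by (intro exI[of _ "d + d'"] bexI[OF _ hf.mult[OF f(1) g(1)]]) simp
    qed
  next
    case (UN K)
    show ?case
    proof (intro conjI ballI)
      show "\<Union>K \<subseteq> grassmannian e" using UN.IH by blast
      fix W assume "W \<in> \<Union>K"
      then obtain k where "k \<in> K" "W \<in> k" by blast
      then obtain d f where "f \<in> hfun d" "f (pl W) \<noteq> 0" "\<forall>V\<in>grassmannian e. f (pl V) \<noteq> 0 \<longrightarrow> V \<in> k"
        using UN.IH by blast
      then show "\<exists>d. \<exists>f\<in>hfun d. f (pl W) \<noteq> 0 \<and> (\<forall>V\<in>grassmannian e. f (pl V) \<noteq> 0 \<longrightarrow> V \<in> \<Union>K)"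
        using \<open>k \<in> K\<close> by blast
    qed
  next
    case (Basis s)
    then obtain p d where p: "p \<in> forms d" "s = basic_open e p" by blast
    then have "(\<lambda>y. eval_mpoly y p) \<in> hfun d" by (auto simp: hfun_def)
    then show ?case unfolding p(2) basic_open_iff[OF p(1)]
      by (intro conjI ballI exI[of _ d] bexI[of _ "\<lambda>y. eval_mpoly y p"]) auto
  qed
next
  assume U: "?P U"
  let ?K = "{basic_open e p | p d. p \<in> forms d \<and> basic_open e p \<subseteq> U} :: 'k poly3 set set set"
  have eqU: "U = \<Union>?K"
  proof
    show "U \<subseteq> \<Union>?K"
    proof
      fix W assume W: "W \<in> U"
      then obtain d f where f: "f \<in> hfun d" "f (pl W) \<noteq> 0" "\<forall>V\<in>grassmannian e. f (pl V) \<noteq> 0 \<longrightarrow> V \<in> U"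
        using U by blast
      then obtain p where p: "p \<in> forms d" "f = (\<lambda>y. eval_mpoly y p)" by (auto simp: hfun_def)
      have "basic_open e p \<subseteq> U" "W \<in> basic_open e p"
        unfolding basic_open_iff[OF p(1)] using f(2,3) U W p(2) by auto
      then show "W \<in> \<Union>?K" using p(1) by blast
    qed
  qed blast
  have "openin (zariski e) s" if "s \<in> ?K" for s
    unfolding zariski_def by (rule topology_generated_by_Basis) (use that in blast)
  then have "openin (zariski e) (\<Union>?K)" by (rule openin_Union)
  then show "openin (zariski e) U" unfolding eqU[symmetric] .
qed

lemma topspace_zariski: "topspace (zariski e) = (grassmannian e :: 'k::field poly3 set set)"
proof -
  have "openin (zariski e) (grassmannian e :: 'k poly3 set set)"
    unfolding openin_zariski
    by (intro conjI subset_refl ballI exI[of _ 0] bexI[OF _ hf.const[of 1]]) simp_all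
  moreover have "topspace (zariski e) \<subseteq> (grassmannian e :: 'k poly3 set set)"
    using openin_topspace[of "zariski e"] unfolding openin_zariski by (rule conjunct1)
  ultimately show ?thesis using openin_subset[of "zariski e"] by (intro subset_antisym)
qed

definition vanishes :: "((3 mon \<times> 3 mon \<Rightarrow> 'k::field) \<Rightarrow> 'k) \<Rightarrow> 'k poly3 set set \<Rightarrow> bool" where
  "vanishes f Z \<longleftrightarrow> (\<forall>U\<in>Z. f (pl U) = 0)"

lemma closedin_zariski_subtopology:
  fixes V Z :: "'k::field poly3 set set"
  assumes V: "V \<subseteq> grassmannian e"
  shows "closedin (subtopology (zariski e) V) Z \<longleftrightarrow>
    Z \<subseteq> V \<and> (\<forall>W\<in>V - Z. \<exists>d. \<exists>f\<in>hfun d. f (pl W) \<noteq> 0 \<and> vanishes f Z)"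
proof
  assume "closedin (subtopology (zariski e) V) Z"
  then obtain C where C: "closedin (zariski e) C" "Z = C \<inter> V" by (auto simp: closedin_subtopology)
  have "\<exists>d. \<exists>f\<in>hfun d. f (pl W) \<noteq> 0 \<and> vanishes f Z" if "W \<in> V - Z" for W
  proof -
    have "openin (zariski e) (grassmannian e - C)" using C(1) by (simp add: closedin_def topspace_zariski)
    moreover have "W \<in> grassmannian e - C" using that C(2) V by blast
    ultimately obtain d f where "f \<in> hfun d" "f (pl W) \<noteq> 0"
      "\<forall>U\<in>grassmannian e. f (pl U) \<noteq> 0 \<longrightarrow> U \<in> grassmannian e - C" unfolding openin_zariski by blast
    then show ?thesis unfolding vanishes_def using C(2) V by blast
  qed
  then show "Z \<subseteq> V \<and> (\<forall>W\<in>V - Z. \<exists>d. \<exists>f\<in>hfun d. f (pl W) \<noteq> 0 \<and> vanishes f Z)" using C(2) by blast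
next
  assume Z: "Z \<subseteq> V \<and> (\<forall>W\<in>V - Z. \<exists>d. \<exists>f\<in>hfun d. f (pl W) \<noteq> 0 \<and> vanishes f Z)"
  \<comment> \<open>The closure of Z in the Grassmannian: the common zeros of the homogeneous
    functions vanishing on Z.\<close>
  define C where "C = {W \<in> grassmannian e. \<forall>d. \<forall>f\<in>hfun d. vanishes f Z \<longrightarrow> f (pl W) = 0}"
  have "openin (zariski e) (grassmannian e - C)"
    unfolding openin_zariski C_def by blast
  then have "closedin (zariski e) C" by (auto simp: closedin_def topspace_zariski C_def)
  moreover have "Z = C \<inter> V" using Z V unfolding C_def vanishes_def by blast
  ultimately show "closedin (subtopology (zariski e) V) Z" by (auto simp: closedin_subtopology)
qed

text \<open>Primality of the homogeneous vanishing ideal of a nonempty Z, which expresses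
  irreducibility without reference to an ambient set.\<close>

definition prime_set :: "'k::field poly3 set set \<Rightarrow> bool" where
  "prime_set Z \<longleftrightarrow> Z \<noteq> {} \<and> (\<forall>d d'. \<forall>f\<in>hfun d. \<forall>g\<in>hfun d'.
     vanishes (\<lambda>y. f y * g y) Z \<longrightarrow> vanishes f Z \<or> vanishes g Z)"

lemma irreducible_zariski_iff:
  fixes Z :: "'k::field poly3 set set"
  assumes Z: "Z \<subseteq> grassmannian e"
  shows "irreducible_space (subtopology (zariski e) Z) \<longleftrightarrow> prime_set Z"
proof -
  have ts: "topspace (subtopology (zariski e) Z) = Z" using Z by (auto simp: topspace_zariski)
  show ?thesis
  proof
    assume irr: "irreducible_space (subtopology (zariski e) Z)"
    have "vanishes f Z \<or> vanishes g Z"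
      if f: "f \<in> hfun d" and g: "g \<in> hfun d'" and fg: "vanishes (\<lambda>y. f y * g y) Z" for d d' f g
    proof -
      have cl: "closedin (subtopology (zariski e) Z) {W \<in> Z. h (pl W) = 0}" if "h \<in> hfun c" for h c
        unfolding closedin_zariski_subtopology[OF Z] using that by (auto simp: vanishes_def)
      have "{W \<in> Z. f (pl W) = 0} \<union> {W \<in> Z. g (pl W) = 0} = Z" using fg by (auto simp: vanishes_def)
      then have "{W \<in> Z. f (pl W) = 0} = Z \<or> {W \<in> Z. g (pl W) = 0} = Z"
        using irr cl[OF f] cl[OF g] unfolding irreducible_space_def ts by blast
      then show ?thesis unfolding vanishes_def by blast
    qed
    moreover have "Z \<noteq> {}" using irr unfolding irreducible_space_def ts by blast
    ultimately show "prime_set Z" unfolding prime_set_def by blast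
  next
    assume pr: "prime_set Z"
    have "C = Z \<or> D = Z" if C: "closedin (subtopology (zariski e) Z) C" and D: "closedin (subtopology (zariski e) Z) D"
      and CD: "C \<union> D = Z" for C D
    proof (rule ccontr)
      assume "\<not> (C = Z \<or> D = Z)"
      then obtain W W' where W: "W \<in> Z - C" "W' \<in> Z - D" using CD by blast
      obtain d f where f: "f \<in> hfun d" "f (pl W) \<noteq> 0" "vanishes f C"
        using C W(1) unfolding closedin_zariski_subtopology[OF Z] by blast
      obtain d' g where g: "g \<in> hfun d'" "g (pl W') \<noteq> 0" "vanishes g D"
        using D W(2) unfolding closedin_zariski_subtopology[OF Z] by blast
      have "vanishes (\<lambda>y. f y * g y) Z" using f(3) g(3) CD by (auto simp: vanishes_def)
      then have "vanishes f Z \<or> vanishes g Z" using pr f(1) g(1) unfolding prime_set_def by blast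
      then show False using f(2) g(2) W by (auto simp: vanishes_def)
    qed
    then show "irreducible_space (subtopology (zariski e) Z)"
      using pr unfolding irreducible_space_def ts prime_set_def by blast
  qed
qed

definition zclosure :: "'k::field poly3 set set \<Rightarrow> 'k poly3 set set \<Rightarrow> 'k poly3 set set" where
  "zclosure V S = {W \<in> V. \<forall>d. \<forall>f\<in>hfun d. vanishes f S \<longrightarrow> f (pl W) = 0}"

lemma closedin_zclosure:
  assumes V: "V \<subseteq> grassmannian e"
  shows "closedin (subtopology (zariski e) V) (zclosure V S)"
  unfolding closedin_zariski_subtopology[OF V]
proof (intro conjI ballI)
  show "zclosure V S \<subseteq> V" by (auto simp: zclosure_def)
  fix W assume "W \<in> V - zclosure V S"
  then obtain d f where f: "f \<in> hfun d" "vanishes f S" "f (pl W) \<noteq> 0" unfolding zclosure_def by blast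
  then have "vanishes f (zclosure V S)" unfolding vanishes_def[of f "zclosure V S"] by (auto simp: zclosure_def)
  then show "\<exists>d. \<exists>f\<in>hfun d. f (pl W) \<noteq> 0 \<and> vanishes f (zclosure V S)" using f(1,3) by blast
qed

lemma vanishes_zclosure: "S \<subseteq> V \<Longrightarrow> f \<in> hfun d \<Longrightarrow> vanishes f (zclosure V S) \<longleftrightarrow> vanishes f S"
  unfolding vanishes_def zclosure_def by blast

lemma prime_zclosure:
  assumes "S \<subseteq> V" "prime_set S" shows "prime_set (zclosure V S)"
proof -
  have "zclosure V S \<noteq> {}" using assms by (auto simp: prime_set_def zclosure_def vanishes_def)
  moreover have "vanishes f (zclosure V S) \<or> vanishes g (zclosure V S)"
    if fg: "f \<in> hfun d" "g \<in> hfun d'" "vanishes (\<lambda>y. f y * g y) (zclosure V S)" for d d' f g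
  proof -
    have "vanishes (\<lambda>y. f y * g y) S" using fg(3) vanishes_zclosure[OF assms(1) hf.mult[OF fg(1,2)]] by simp
    then have "vanishes f S \<or> vanishes g S" using assms(2) fg(1,2) unfolding prime_set_def by blast
    then show ?thesis using vanishes_zclosure[OF assms(1) fg(1)] vanishes_zclosure[OF assms(1) fg(2)] by blast
  qed
  ultimately show ?thesis unfolding prime_set_def by blast
qed

subsection \<open>An upper bound for the Krull dimension\<close>

lemma prime_setD:
  assumes "prime_set Z" "f \<in> hfun d" "g \<in> hfun d'" "vanishes (\<lambda>y. f y * g y) Z"
  shows "vanishes f Z \<or> vanishes g Z"
  using assms unfolding prime_set_def by blast

text \<open>Homogeneity with factor 0, where \<open>0 ^ 0 = 1\<close>, shows that every value is the
  value at the origin.\<close>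

lemma hfun_0_constant:
  assumes "g \<in> hfun 0" shows "g y = g y'"
  using hfun_homogeneous[OF assms, of 0 y] hfun_homogeneous[OF assms, of 0 y'] by simp

text \<open>The monomial with exponents a in the first j functions F i, homogenized to degree s by
  powers of F0.\<close>

definition chain_term where
  "chain_term F0 F s a j y = F0 y ^ (s - (\<Sum>i<j. a i)) * (\<Prod>i<j. F i y ^ a i)" for j :: nat and a :: "nat \<Rightarrow> nat"

lemma chain_term_hfun:
  assumes "F0 \<in> hfun d" "\<And>i. i < j \<Longrightarrow> F i \<in> hfun d" "(\<Sum>i<j. a i) \<le> s"
  shows "(\<lambda>y. chain_term F0 F s a j y) \<in> hfun (s * d)"
proof -
  have "(\<lambda>y. \<Prod>i<j. F i y ^ a i) \<in> hfun (\<Sum>i<j. a i * d)"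
    by (rule hf.prod) (rule hfun_power[OF assms(2)], simp)
  from hf.mult[OF hfun_power[OF assms(1), of "s - (\<Sum>i<j. a i)"] this]
  have "(\<lambda>y. chain_term F0 F s a j y) \<in> hfun ((s - (\<Sum>i<j. a i)) * d + (\<Sum>i<j. a i) * d)"
    by (simp add: chain_term_def sum_distrib_right)
  then show ?thesis using assms(3) by (simp add: distrib_right[symmetric])
qed

text \<open>The functions \<open>F i\<close> witnessing the strictness of a chain of irreducible closed sets are algebraically
  independent on its top member: cancel from a relation the largest power of \<open>F j\<close> and restrict it to \<open>Z j\<close>.\<close>

lemma chain_independent:
  fixes Z :: "nat \<Rightarrow> 'k::field poly3 set set"
  assumes F0: "F0 \<in> hfun d" "\<not> vanishes F0 (Z 0)"
    and F: "\<And>i. i < N \<Longrightarrow> F i \<in> hfun d" "\<And>i. i < N \<Longrightarrow> vanishes (F i) (Z i)" "\<And>i. i < N \<Longrightarrow> \<not> vanishes (F i) (Z (Suc i))"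
    and Z: "\<And>i. i \<le> N \<Longrightarrow> prime_set (Z i)" "\<And>i. i < N \<Longrightarrow> Z i \<subseteq> Z (Suc i)"
  shows "j \<le> N \<Longrightarrow> finite A \<Longrightarrow> (\<And>a. a \<in> A \<Longrightarrow> (\<Sum>i<j. a i) \<le> s) \<Longrightarrow>
    (\<And>a b. a \<in> A \<Longrightarrow> b \<in> A \<Longrightarrow> (\<And>i. i < j \<Longrightarrow> a i = b i) \<Longrightarrow> a = b) \<Longrightarrow>
    vanishes (\<lambda>y. \<Sum>a\<in>A. c a * chain_term F0 F s a j y) (Z j) \<Longrightarrow> a \<in> A \<Longrightarrow> c a = 0"
proof (induction j arbitrary: A s a)
  case 0
  have "A = {a}" using 0(4)[OF _ 0(6)] 0(6) by blast
  obtain U where U: "U \<in> Z 0" "F0 (pl U) \<noteq> 0" using F0(2) by (auto simp: vanishes_def)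
  then have "c a * chain_term F0 F s a 0 (pl U) = 0" using 0(5) \<open>A = {a}\<close> by (auto simp: vanishes_def)
  then show ?case using U by (simp add: chain_term_def)
next
  case (Suc j)
  show ?case
  proof (rule ccontr)
    assume ca: "c a \<noteq> 0"
    define A1 where "A1 = {a \<in> A. c a \<noteq> 0}"
    have A1: "finite A1" "a \<in> A1" "A1 \<subseteq> A" using Suc.prems ca by (auto simp: A1_def)
    \<comment> \<open>The least exponent of \<open>F j\<close> among the terms present: after
      cancelling \<open>F j ^ b\<close> some term is free of \<open>F j\<close>.\<close>
    define b where "b = Min ((\<lambda>a. a j) ` A1)"
    have b_le: "b \<le> a j" if "a \<in> A1" for a unfolding b_def using that A1(1) by simp
    have "b \<in> (\<lambda>a. a j) ` A1" unfolding b_def by (rule Min_in) (use A1 in auto)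
    then obtain a1 where a1: "a1 \<in> A1" "a1 j = b" by blast
    have jN: "j < N" using Suc.prems(1) by simp
    define a' where "a' a = a(j := a j - b)" for a :: "nat \<Rightarrow> nat"
    have sum_a': "(\<Sum>i<Suc j. a' a i) = (\<Sum>i<j. a i) + (a j - b)" for a by (simp add: a'_def)
    have prod_a': "(\<Prod>i<Suc j. F i y ^ a' a i) = (\<Prod>i<j. F i y ^ a i) * F j y ^ (a j - b)" for a y
      by (simp add: a'_def)
    have le: "(\<Sum>i<j. a i) + a j \<le> s" if "a \<in> A1" for a using Suc.prems(3)[of a] A1(3) that by auto
    have factor: "chain_term F0 F s a (Suc j) y = F j y ^ b * chain_term F0 F (s - b) (a' a) (Suc j) y" if a: "a \<in> A1" for a y
    proof -
      have "s - ((\<Sum>i<j. a i) + a j) = s - b - ((\<Sum>i<j. a i) + (a j - b))" using b_le[OF a] le[OF a] by simp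
      moreover have "F j y ^ a j = F j y ^ b * F j y ^ (a j - b)" using b_le[OF a] by (simp add: power_add[symmetric])
      ultimately show ?thesis unfolding chain_term_def sum_a' prod_a' by (simp add: mult_ac)
    qed
    define R where "R y = (\<Sum>a\<in>A1. c a * chain_term F0 F (s - b) (a' a) (Suc j) y)" for y
    have RH: "R \<in> hfun ((s - b) * d)"
      unfolding R_def[abs_def]
    proof (rule hf.sum, rule hf.scale, rule chain_term_hfun[OF F0(1)])
      fix a assume a: "a \<in> A1"
      show "(\<Sum>i<Suc j. a' a i) \<le> s - b" unfolding sum_a' using le[OF a] b_le[OF a] by simp
    qed (use F(1) jN in simp)
    have "(\<Sum>a\<in>A. c a * chain_term F0 F s a (Suc j) y) = F j y ^ b * R y" for y
    proof -
      have "(\<Sum>a\<in>A. c a * chain_term F0 F s a (Suc j) y) = (\<Sum>a\<in>A1. c a * chain_term F0 F s a (Suc j) y)"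
        by (rule sum.mono_neutral_right) (use Suc.prems(2) in \<open>auto simp: A1_def\<close>)
      also have "\<dots> = F j y ^ b * R y"
        unfolding R_def sum_distrib_left by (rule sum.cong) (auto simp: factor)
      finally show ?thesis .
    qed
    then have "vanishes (\<lambda>y. F j y ^ b * R y) (Z (Suc j))" using Suc.prems(5) by simp
    \<comment> \<open>Primality permits the cancellation, since \<open>F j\<close> does not vanish
      identically on the larger set.\<close>
    then have "vanishes (\<lambda>y. F j y ^ b) (Z (Suc j)) \<or> vanishes R (Z (Suc j))"
      by (rule prime_setD[OF Z(1)[OF Suc.prems(1)] hfun_power[OF F(1)[OF jN]] RH])
    moreover have "\<not> vanishes (\<lambda>y. F j y ^ b) (Z (Suc j))" using F(3)[OF jN] by (auto simp: vanishes_def)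
    ultimately have "vanishes R (Z (Suc j))" by blast
    then have RZ: "vanishes R (Z j)" using Z(2)[OF jN] unfolding vanishes_def by blast
    \<comment> \<open>On \<open>Z j\<close> the function \<open>F j\<close> vanishes, so just the
      terms of least exponent survive. They form a relation in one function fewer, contradicting the
      induction hypothesis.\<close>
    define A2 where "A2 = {a \<in> A1. a j = b}"
    have "R (pl U) = (\<Sum>a\<in>A2. c a * chain_term F0 F (s - b) a j (pl U))" if U: "U \<in> Z j" for U
    proof -
      have Fj: "F j (pl U) = 0" using F(2)[OF jN] U by (simp add: vanishes_def)
      have "R (pl U) = (\<Sum>a\<in>A2. c a * chain_term F0 F (s - b) (a' a) (Suc j) (pl U))"
        unfolding R_def
      proof (rule sum.mono_neutral_right[OF A1(1)])
        show "A2 \<subseteq> A1" by (auto simp: A2_def)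
        show "\<forall>a\<in>A1 - A2. c a * chain_term F0 F (s - b) (a' a) (Suc j) (pl U) = 0"
        proof
          fix a assume "a \<in> A1 - A2"
          then have "a j - b \<noteq> 0" using b_le[of a] by (auto simp: A2_def)
          then show "c a * chain_term F0 F (s - b) (a' a) (Suc j) (pl U) = 0"
            unfolding chain_term_def prod_a' by (simp add: Fj)
        qed
      qed
      also have "\<dots> = (\<Sum>a\<in>A2. c a * chain_term F0 F (s - b) a j (pl U))"
        unfolding chain_term_def sum_a' prod_a' by (rule sum.cong) (auto simp: A2_def)
      finally show ?thesis .
    qed
    then have van: "vanishes (\<lambda>y. \<Sum>a\<in>A2. c a * chain_term F0 F (s - b) a j y) (Z j)"
      using RZ by (simp add: vanishes_def)
    have "c a1 = 0"
    proof (rule Suc.IH[of A2 "s - b" a1])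
      show "j \<le> N" using jN by simp
      show "finite A2" using A1(1) by (simp add: A2_def)
      show "(\<Sum>i<j. a i) \<le> s - b" if "a \<in> A2" for a using le[of a] that by (simp add: A2_def)
      show "a = a'" if aa: "a \<in> A2" "a' \<in> A2" "\<And>i. i < j \<Longrightarrow> a i = a' i" for a a'
      proof (rule Suc.prems(4))
        show "a \<in> A" "a' \<in> A" using aa(1,2) A1(3) by (auto simp: A2_def)
        show "a i = a' i" if "i < Suc j" for i
          using aa that by (cases "i = j") (simp_all add: A2_def)
      qed
      show "a1 \<in> A2" using a1 by (simp add: A2_def)
    qed (rule van)
    then show False using a1(1) by (simp add: A1_def)
  qed
qed

text \<open>A chain of length N yields \<open>(q + 1) ^ N\<close> independent monomials of bounded
  degree in the separating functions. Pulled back along \<psi> they become polynomials in n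
  variables with exponents bounded linearly in q, and there are only about \<open>q ^ n\<close>
  monomials of that kind, up to a constant factor. Hence N cannot exceed n.\<close>

lemma chain_bound:
  fixes Z :: "nat \<Rightarrow> 'k::field poly3 set set"
  assumes V: "V \<subseteq> grassmannian e"
    and \<psi>: "\<And>i. (\<lambda>t. \<psi> t i) \<in> pfun n D"
    and dense: "\<And>d f. f \<in> hfun d \<Longrightarrow> (\<And>t. f (\<psi> t) = 0) \<Longrightarrow> vanishes f V"
    and Z: "\<And>i. i \<le> N \<Longrightarrow> closedin (subtopology (zariski e) V) (Z i)" "\<And>i. i \<le> N \<Longrightarrow> prime_set (Z i)"
      "\<And>i. i < N \<Longrightarrow> Z i \<subset> Z (Suc i)"
  shows "N \<le> n"
proof -
  have ZV: "Z i \<subseteq> V" if "i \<le> N" for i using Z(1)[OF that] unfolding closedin_zariski_subtopology[OF V] by blast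
  have "\<exists>x. snd x \<in> hfun (fst x) \<and> vanishes (snd x) (Z i) \<and> \<not> vanishes (snd x) (Z (Suc i))" if i: "i < N" for i
  proof -
    obtain W where W: "W \<in> Z (Suc i)" "W \<notin> Z i" using Z(3)[OF i] by blast
    have "W \<in> V - Z i" using W ZV[of "Suc i"] i by auto
    moreover have "\<forall>W\<in>V - Z i. \<exists>d. \<exists>f\<in>hfun d. f (pl W) \<noteq> 0 \<and> vanishes f (Z i)"
      using Z(1)[of i] i closedin_zariski_subtopology[OF V, of "Z i"] by simp
    ultimately obtain c f where "f \<in> hfun c" "f (pl W) \<noteq> 0" "vanishes f (Z i)" by blast
    then show ?thesis using W(1) by (intro exI[of _ "(c, f)"]) (auto simp: vanishes_def)
  qed
  then obtain x where x: "\<And>i. i < N \<Longrightarrow> snd (x i) \<in> hfun (fst (x i)) \<and> vanishes (snd (x i)) (Z i) \<and> \<not> vanishes (snd (x i)) (Z (Suc i))"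
    by metis
  have pos: "fst (x i) > 0" if i: "i < N" for i
  proof (rule ccontr)
    assume "\<not> 0 < fst (x i)"
    then have g: "snd (x i) \<in> hfun 0" using x[OF i] by simp
    obtain U where "U \<in> Z i" using Z(2)[of i] i unfolding prime_set_def by auto
    then have "snd (x i) y = 0" for y using x[OF i] hfun_0_constant[OF g, of y "pl U"] by (simp add: vanishes_def)
    then show False using x[OF i] by (simp add: vanishes_def)
  qed
  \<comment> \<open>Powers bring the separating functions to a common degree. Their degrees are
    positive because a function of degree 0 is constant and cannot vanish on one member of the chain
    but not on the next.\<close>
  define d where "d = (\<Prod>i<N. fst (x i))"
  have d0: "d > 0" unfolding d_def by (rule prod_pos) (use pos in simp)
  define F where "F i y = snd (x i) y ^ (d div fst (x i))" for i y
  have FH: "F i \<in> hfun d" if i: "i < N" for i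
  proof -
    have "fst (x i) dvd d" unfolding d_def by (rule dvd_prodI) (use i in auto)
    then show ?thesis using hfun_power[of "snd (x i)" "fst (x i)" "d div fst (x i)"] x[OF i] unfolding F_def[abs_def] by simp
  qed
  have Fv: "vanishes (F i) (Z i)" if i: "i < N" for i
  proof -
    have "fst (x i) \<le> d" unfolding d_def using dvd_imp_le[OF dvd_prodI[of "{..<N}" i "\<lambda>i. fst (x i)"]] i d0 by (simp add: d_def)
    then have "d div fst (x i) > 0" using pos[OF i] by (simp add: div_greater_zero_iff)
    then show ?thesis using x[OF i] by (auto simp: vanishes_def F_def)
  qed
  have Fn: "\<not> vanishes (F i) (Z (Suc i))" if i: "i < N" for i
    using x[OF i] by (auto simp: vanishes_def F_def)
  obtain W0 where W0: "W0 \<in> Z 0" using Z(2)[of 0] unfolding prime_set_def by auto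
  then obtain j where j: "pl W0 j \<noteq> 0" using pl_nonzero ZV[of 0] V by blast
  \<comment> \<open>A Pluecker coordinate that is nonzero at a point of \<open>Z 0\<close>, raised
    to degree d, serves to homogenize.\<close>
  define F0 where "F0 y = y j ^ d" for y :: "3 mon \<times> 3 mon \<Rightarrow> 'k"
  have F0: "F0 \<in> hfun d" using hfun_power[OF hfun_coord[of j], of d] by (simp add: F0_def[abs_def])
  have F0n: "\<not> vanishes F0 (Z 0)" using W0 j by (auto simp: vanishes_def F0_def)
  have count: "(q + 1) ^ N \<le> (N * q * d * D + 1) ^ n" for q
  proof (rule ccontr)
    let ?M = "N * q * d * D"
    assume less: "\<not> (q + 1) ^ N \<le> (?M + 1) ^ n"
    define A where "A = PiE {..<N} (\<lambda>_. {..q})"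
    have finA: "finite A" and cardA: "card A = (q + 1) ^ N" unfolding A_def by (auto simp: card_PiE intro!: finite_PiE)
    have sumA: "(\<Sum>i<N. a i) \<le> N * q" if "a \<in> A" for a
      using sum_bounded_above[of "{..<N}" a q] that by (auto simp: A_def)
    let ?T = "\<lambda>a y. chain_term F0 F (N * q) a N y"
    have TH: "(\<lambda>y. ?T a y) \<in> hfun (N * q * d)" if "a \<in> A" for a
      by (rule chain_term_hfun[OF F0 FH sumA[OF that]])
    have "\<exists>p. Poly_Mapping.keys p \<subseteq> box n ?M \<and> (\<forall>t. ?T a (\<psi> t) = eval_mpoly t p)" if "a \<in> A" for a
      using hfun_pfun[where y = \<psi>, OF TH[OF that] \<psi>] unfolding pfun_def by (auto simp: fun_eq_iff)
    then obtain p where p: "\<And>a. a \<in> A \<Longrightarrow> Poly_Mapping.keys (p a) \<subseteq> box n ?M"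
      "\<And>a t. a \<in> A \<Longrightarrow> ?T a (\<psi> t) = eval_mpoly t (p a)" by metis
    let ?S = "(\<lambda>m. Poly_Mapping.single m (1::'k)) ` box n ?M"
    have "p ` A \<subseteq> sc.span ?S"
    proof
      fix f assume "f \<in> p ` A"
      then have "Poly_Mapping.keys f \<subseteq> box n ?M" using p(1) by blast
      then have "f = (\<Sum>m\<in>box n ?M. Poly_Mapping.single m (Poly_Mapping.lookup f m))"
        by (rule poly_mapping_sum_single[OF finite_box])
      also have "\<dots> = (\<Sum>m\<in>box n ?M. scale (Poly_Mapping.lookup f m) (Poly_Mapping.single m 1))"
        by (rule sum.cong) (auto intro!: poly_mapping_eqI simp: lookup_single when_def)
      also have "\<dots> \<in> sc.span ?S" by (intro sc.span_sum sc.span_scale sc.span_base) auto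
      finally show "f \<in> sc.span ?S" .
    qed
    then have "sc.dim (p ` A) \<le> card ?S" by (rule sc.dim_le_card) (simp add: finite_box)
    also have "\<dots> \<le> card (box n ?M)" by (rule card_image_le[OF finite_box])
    also have "\<dots> \<le> (?M + 1) ^ n" by (rule card_box)
    also have "\<dots> < card A" using less cardA by simp
    finally have lt: "sc.dim (p ` A) < card A" .
    obtain c where c: "\<exists>a\<in>A. c a \<noteq> 0" "(\<Sum>a\<in>A. scale (c a) (p a)) = 0"
      by (rule sc.nontrivial_relation[OF finA lt])
    have "(\<Sum>a\<in>A. c a * ?T a (\<psi> t)) = 0" for t
    proof -
      have "(\<Sum>a\<in>A. c a * ?T a (\<psi> t)) = eval_mpoly t (\<Sum>a\<in>A. scale (c a) (p a))"
        unfolding eval_sum eval_scale by (rule sum.cong) (simp_all add: p(2))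
      then show ?thesis by (simp add: c(2))
    qed
    moreover have "(\<lambda>y. \<Sum>a\<in>A. c a * ?T a y) \<in> hfun (N * q * d)" by (rule hf.sum, rule hf.scale, rule TH)
    ultimately have "vanishes (\<lambda>y. \<Sum>a\<in>A. c a * ?T a y) V" by (rule dense[rotated])
    then have van: "vanishes (\<lambda>y. \<Sum>a\<in>A. c a * ?T a y) (Z N)" using ZV[of N] unfolding vanishes_def by blast
    have "c a = 0" if "a \<in> A" for a
    proof (rule chain_independent[OF F0 F0n FH Fv Fn Z(2) _ le_refl finA sumA _ van that])
      show "Z i \<subseteq> Z (Suc i)" if "i < N" for i using Z(3)[OF that] by blast
      show "a = b" if "a \<in> A" "b \<in> A" "\<And>i. i < N \<Longrightarrow> a i = b i" for a b
        using that unfolding A_def by (intro PiE_ext[of a "{..<N}" "\<lambda>_. {..q}" b]) auto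
    qed
    then show False using c(1) by blast
  qed
  show "N \<le> n"
  proof (rule ccontr)
    assume "\<not> N \<le> n"
    \<comment> \<open>With q = \<open>C ^ n\<close> the estimate for N > n would give q + 1 \<le>
      \<open>C ^ n\<close> = q.\<close>
    define C where "C = N * d * D + 1"
    let ?q = "C ^ n"
    have "(?q + 1) ^ Suc n \<le> (?q + 1) ^ N" by (rule power_increasing) (use \<open>\<not> N \<le> n\<close> in auto)
    also have "\<dots> \<le> (N * ?q * d * D + 1) ^ n" by (rule count)
    also have "\<dots> \<le> (C * (?q + 1)) ^ n" by (rule power_mono) (simp_all add: C_def algebra_simps)
    also have "\<dots> = C ^ n * (?q + 1) ^ n" by (rule power_mult_distrib)
    finally have "(?q + 1) * (?q + 1) ^ n \<le> ?q * (?q + 1) ^ n" by simp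
    then show False by simp
  qed
qed

subsection \<open>Generic Hilbert function\<close>

lemma hat_monf_sum:
  assumes "finite C"
  shows "hat ((\<Sum>m\<in>C. scale (c m) (monf m)) \<circ>\<^sub>d F) n = (\<Sum>m\<in>C. c m * hat F (m + n))"
  unfolding hat_act pair_sum pair_scale by (simp add: monf_def)

lemma plane_cases:
  assumes "W \<in> grassmannian e"
  obtains F G where "F \<in> forms e" "G \<in> forms e" "indep2 F G" "W = sc.span {F, G}" "pl W = plucker F G"
proof -
  let ?P = "\<lambda>y. \<exists>F' G'. W = sc.span {F', G'} \<and> y = plucker F' G'"
  obtain F G where "W = sc.span {F, G}" using assms unfolding grassmannian_iff by blast
  then have "?P (plucker F G)" by blast
  then have "?P (SOME y. ?P y)" by (rule someI[of ?P])
  then obtain F' G' where FG': "W = sc.span {F', G'}" "pl W = plucker F' G'"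
    unfolding pl_def by (elim exE conjE)
  have "F' \<in> W" "G' \<in> W" unfolding FG'(1) by (simp_all add: sc.span_base)
  then have "F' \<in> forms e" "G' \<in> forms e" "indep2 F' G'"
    using assms FG'(1) dim_span2[of F' G'] by (auto simp: grassmannian_def)
  then show ?thesis using that FG' by blast
qed

text \<open>The catalecticant matrix in Pluecker coordinates, with rows m: at
  \<open>plucker F G\<close> the column (n', n) combines the contracted coefficients of F and G,
  weighted by the coefficients of the other form at n.\<close>

definition catalecticant :: "3 mon \<Rightarrow> 3 mon \<times> 3 mon \<Rightarrow> (3 mon \<times> 3 mon \<Rightarrow> 'k::field_char_0) \<Rightarrow> 'k" where
  "catalecticant m i y = mfact (m + fst i) * y (m + fst i, snd i)"

lemma catalecticant_hfun: "catalecticant m i \<in> hfun 1"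
  unfolding catalecticant_def[abs_def] by (rule hf.scale[OF hfun_coord])

text \<open>Independence of F and G lets both contractions be recovered from these combinations, so
  row relations are polynomials in the annihilator.\<close>

lemma indep_at_catalecticant:
  fixes W :: "'k::field_char_0 poly3 set"
  assumes W: "W \<in> grassmannian e" and C: "finite C"
  shows "indep_at C catalecticant (pl W) \<longleftrightarrow>
    (\<forall>c. (\<Sum>m\<in>C. scale (c m) (monf m)) \<in> inverse_system_ideal W \<longrightarrow> (\<forall>m\<in>C. c m = 0))"
proof -
  obtain F G where FG: "indep2 F G" "W = sc.span {F, G}" "pl W = plucker F G" using plane_cases[OF W] by metis
  have "(\<forall>i. (\<Sum>m\<in>C. c m * catalecticant m i (pl W)) = 0) \<longleftrightarrow>
    (\<Sum>m\<in>C. scale (c m) (monf m)) \<in> inverse_system_ideal W" for c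
  proof -
    define f where "f = (\<Sum>m\<in>C. scale (c m) (monf m) :: 'k poly3)"
    have sum_eq: "(\<Sum>m\<in>C. c m * catalecticant m (n', n) (pl W)) =
      hat (f \<circ>\<^sub>d F) n' * Poly_Mapping.lookup G n - hat (f \<circ>\<^sub>d G) n' * Poly_Mapping.lookup F n" for n' n
    proof -
      have "(\<Sum>m\<in>C. c m * catalecticant m (n', n) (pl W)) = (\<Sum>m\<in>C. c m * hat F (m + n') *
          Poly_Mapping.lookup G n - c m * hat G (m + n') * Poly_Mapping.lookup F n)"
        by (rule sum.cong) (simp_all add: FG(3) catalecticant_def plucker_def hat_def algebra_simps)
      then show ?thesis by (simp add: f_def hat_monf_sum[OF C] sum_subtractf sum_distrib_right)
    qed
    show ?thesis
      unfolding f_def[symmetric] FG(2) inverse_system_ideal_span annih_def mem_Collect_eq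
    proof
      assume z: "\<forall>i. (\<Sum>m\<in>C. c m * catalecticant m i (pl (sc.span {F, G}))) = 0"
      have "hat (f \<circ>\<^sub>d F) n' = 0 \<and> hat (f \<circ>\<^sub>d G) n' = 0" for n'
      proof -
        have "scale (- hat (f \<circ>\<^sub>d G) n') F + scale (hat (f \<circ>\<^sub>d F) n') G = 0"
        proof (rule poly_mapping_eqI)
          fix n
          show "Poly_Mapping.lookup (scale (- hat (f \<circ>\<^sub>d G) n') F + scale (hat (f \<circ>\<^sub>d F) n') G) n = Poly_Mapping.lookup 0 n"
            using z[rule_format, of "(n', n)"] sum_eq[of n' n] unfolding FG(2)
            by (simp add: lookup_add lookup_minus)
        qed
        then show ?thesis using FG(1) unfolding indep2_def by (metis neg_equal_0_iff_equal)
      qed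
      then show "f \<circ>\<^sub>d F = 0 \<and> f \<circ>\<^sub>d G = 0" unfolding hat_inject by simp
    next
      assume "f \<circ>\<^sub>d F = 0 \<and> f \<circ>\<^sub>d G = 0"
      then show "\<forall>i. (\<Sum>m\<in>C. c m * catalecticant m i (pl (sc.span {F, G}))) = 0"
        using sum_eq unfolding FG(2) by simp
    qed
  qed
  then show ?thesis unfolding indep_at_def by blast
qed

text \<open>Monomials independent modulo I stay independent in the space of forms when a basis of
  the degree d part of I is added.\<close>

lemma card_le_codim:
  fixes I :: "'k::field_char_0 poly3 set"
  assumes I: "ideal I polyring" and C: "C \<subseteq> mons d"
    and ind: "\<And>c. (\<Sum>m\<in>C. scale (c m) (monf m)) \<in> I \<Longrightarrow> \<forall>m\<in>C. c m = 0"
  shows "card C + sc.dim (forms d \<inter> I) \<le> (d + 2) choose 2"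
proof (rule ccontr)
  assume gt: "\<not> ?thesis"
  have finC: "finite C" by (rule finite_subset[OF C finite_mons])
  obtain B where B: "B \<subseteq> forms d \<inter> I" "sc.independent B" "forms d \<inter> I \<subseteq> sc.span B" "finite B" "card B = sc.dim (forms d \<inter> I)"
    by (rule finite_basis_forms[OF Int_lower1])
  define v where "v = case_sum monf (\<lambda>x. x :: 'k poly3)"
  have "v ` (C <+> B) \<subseteq> forms d" using C B(1) by (auto simp: v_def)
  then have "sc.dim (v ` (C <+> B)) \<le> (d + 2) choose 2" by (rule dim_forms_subset)
  also have "\<dots> < card (C <+> B)" using gt finC B by (simp add: card_Plus)
  finally have lt: "sc.dim (v ` (C <+> B)) < card (C <+> B)" .
  obtain c where c: "\<exists>i\<in>C <+> B. c i \<noteq> 0" "(\<Sum>i\<in>C <+> B. scale (c i) (v i)) = 0"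
    by (rule sc.nontrivial_relation[OF _ lt]) (use finC B(4) in simp)
  have "(\<Sum>i\<in>C <+> B. scale (c i) (v i)) = (\<Sum>m\<in>C. scale (c (Inl m)) (monf m)) + (\<Sum>x\<in>B. scale (c (Inr x)) x)"
    using finC B(4) by (simp add: sum.Plus v_def)
  then have eq: "(\<Sum>m\<in>C. scale (c (Inl m)) (monf m)) = - (\<Sum>x\<in>B. scale (c (Inr x)) x)"
    using c(2) by (simp add: eq_neg_iff_add_eq_0)
  have "(\<Sum>x\<in>B. scale (c (Inr x)) x) \<in> I"
    using B(1) by (intro ideal_sum[OF I] ideal_scale[OF I]) auto
  then have "(\<Sum>m\<in>C. scale (c (Inl m)) (monf m)) \<in> I"
    unfolding eq using ideal_diff[OF I ideal_zero[OF I]] by fastforce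
  then have C0: "\<forall>m\<in>C. c (Inl m) = 0" by (rule ind)
  then have "(\<Sum>x\<in>B. scale (c (Inr x)) x) = 0" using eq by simp
  then have "\<forall>x\<in>B. c (Inr x) = 0" using sc.independentD[OF B(2,4) subset_refl, of "\<lambda>x. c (Inr x)"] by blast
  then show False using c(1) C0 by auto
qed

context
  fixes e :: nat assumes e: "e > 0"
begin

text \<open>The exponents of the sample \<open>F = y\<^sub>1\<^sup>a y\<^sub>2\<^sup>b\<close>, \<open>G = y\<^sub>1\<^sup>p y\<^sub>2\<^sup>q\<^sup>+\<^sup>1 + y\<^sub>1\<^sup>p\<^sup>' y\<^sub>3\<^sup>q\<^sup>'\<^sup>+\<^sup>1\<close> are balanced so that
  derivatives of different summands overlap as little as possible.\<close>

definition "qd = 2 * e div 3"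
definition "pd' = e - 1 - qd"
definition "ad = (2 * e - qd + 1) div 2"
definition "bd = e - ad"
definition "pe = (e - 1) div 2"
definition "qe = e - 1 - pe"

text \<open>These inequalities make the exponent ranges belonging to F and to the first summand of G
  cover all exponents for \<open>d \<le> qd\<close> and be disjoint for
  \<open>d > qd\<close>.\<close>

lemma sample_numbers:
  "qd + pd' = e - 1" "ad + bd = e" "pe + qe = e - 1" "3 * qd \<le> 2 * e" "2 * e \<le> 3 * qd + 2"
  "qd \<le> ad" "ad \<le> qd + 1" "qd \<le> pd' + bd + 1" "pd' + bd \<le> qd" "pe \<le> qe" "qe \<le> pe + 1"
proof -
  have q: "3 * qd \<le> 2 * e" "2 * e \<le> 3 * qd + 2" unfolding qd_def by linarith+
  have a: "2 * ad \<le> 2 * e - qd + 1" "2 * e - qd \<le> 2 * ad" unfolding ad_def by linarith+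
  have p: "2 * pe \<le> e - 1" "e - 1 \<le> 2 * pe + 1" unfolding pe_def by linarith+
  have p': "pd' + qd = e - 1" unfolding pd'_def using q e by linarith
  have b: "ad + bd = e" unfolding bd_def using q a e by linarith
  have qq: "pe + qe = e - 1" unfolding qe_def using p by linarith
  show "qd + pd' = e - 1" "ad + bd = e" "pe + qe = e - 1" "3 * qd \<le> 2 * e" "2 * e \<le> 3 * qd + 2"
    "qd \<le> ad" "ad \<le> qd + 1" "qd \<le> pd' + bd + 1" "pd' + bd \<le> qd" "pe \<le> qe" "qe \<le> pe + 1"
    using q a p p' b qq e by linarith+
qed

definition sampleF :: "'k::field_char_0 poly3" where "sampleF = monf (mon3 ad bd 0)"
definition sampleG :: "'k::field_char_0 poly3" where
  "sampleG = monf (mon3 pd' (qd + 1) 0) + monf (mon3 pe 0 (qe + 1))"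

definition "S1 d = {i. i \<le> d \<and> (d \<le> i + bd \<and> i \<le> ad \<or> d \<le> i + qd \<and> i \<le> pd')}"
definition "S2 d = {i. 1 \<le> i \<and> i \<le> d \<and> i \<le> qe + 1 \<and> d \<le> i + pe}"
definition "sampleC d = (\<lambda>i. mon3 i (d - i) 0) ` S1 d \<union> (\<lambda>i. mon3 (d - i) 0 i) ` S2 d"

lemma finite_S: "finite (S1 d)" "finite (S2 d)"
  unfolding S1_def S2_def by (rule finite_subset[of _ "{..d}"]; auto)+

lemma card_S1: "d \<le> e \<Longrightarrow> min (d + 1) (2 * (e - d) + 1) \<le> card (S1 d)"
proof (cases "d \<le> qd")
  case True
  assume "d \<le> e"
  have "S1 d = {..d}" unfolding S1_def using sample_numbers True by auto
  then show ?thesis by simp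
next
  case False
  assume de: "d \<le> e"
  let ?A = "{d - bd..ad}" and ?B = "{d - qd..pd'}"
  have "?A \<inter> ?B = {}" using sample_numbers False by auto
  then have "card (?A \<union> ?B) = (ad + 1 - (d - bd)) + (pd' + 1 - (d - qd))" by (simp add: card_Un_disjoint)
  also have "\<dots> = 2 * (e - d) + 1" using sample_numbers False de e by simp
  finally have "card (?A \<union> ?B) = 2 * (e - d) + 1" .
  moreover have "?A \<union> ?B \<subseteq> S1 d" unfolding S1_def using sample_numbers False by auto
  then have "card (?A \<union> ?B) \<le> card (S1 d)" by (rule card_mono[OF finite_S(1)])
  ultimately show ?thesis by simp
qed

lemma card_S2: "d \<le> e \<Longrightarrow> min d (e - d + 1) \<le> card (S2 d)"
proof (cases "d \<le> pe + 1")
  case True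
  have "S2 d = {1..d}" unfolding S2_def using sample_numbers(10) True by auto
  then show ?thesis by simp
next
  case False
  assume de: "d \<le> e"
  have "S2 d = {d - pe..qe + 1}" unfolding S2_def using sample_numbers(11) False by auto
  then have "card (S2 d) = qe + 1 + 1 - (d - pe)" by simp
  also have "\<dots> = e - d + 1" using sample_numbers(3) False de e by linarith
  finally have "card (S2 d) = e - d + 1" .
  then show ?thesis by simp
qed

lemma card_sampleC: "d \<le> e \<Longrightarrow> hvec e d \<le> card (sampleC d)"
proof -
  assume d: "d \<le> e"
  have "card (sampleC d) = card ((\<lambda>i. mon3 i (d - i) 0) ` S1 d) + card ((\<lambda>i. mon3 (d - i) 0 i) ` S2 d)"
    unfolding sampleC_def by (rule card_Un_disjoint) (use finite_S in \<open>auto simp: S2_def\<close>)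
  also have "\<dots> = card (S1 d) + card (S2 d)" by (subst (1 2) card_image) (auto simp: inj_on_def)
  also have "\<dots> \<ge> min (d + 1) (2 * (e - d) + 1) + min d (e - d + 1)"
    using card_S1[OF d] card_S2[OF d] by simp
  finally have c: "min (d + 1) (2 * (e - d) + 1) + min d (e - d + 1) \<le> card (sampleC d)" .
  have "hvec e d \<le> 2 * d + 1" "hvec e d \<le> e + 2" "hvec e d \<le> 3 * (e - d) + 2"
    unfolding hvec_def by (intro Min_le; simp)+
  \<comment> \<open>The sum of the two minima is one of the three terms of the h-vector or, only for
    e \<le> 3, the mixed term 2 e - d + 1.\<close>
  then show ?thesis using c d by linarith
qed

lemma sampleC_mons: "sampleC d \<subseteq> mons d"
  by (auto simp: sampleC_def S1_def S2_def)

text \<open>Each coefficient is isolated at a single coefficient of the contracted F or G, taken at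
  the exponent complementary to the chosen monomial.\<close>

lemma sample_independent:
  assumes "(\<Sum>m\<in>sampleC d. scale (c m) (monf m)) \<in> annih (sampleF :: 'k::field_char_0 poly3) sampleG"
  shows "\<forall>m\<in>sampleC d. c m = 0"
proof -
  let ?C = "sampleC d" and ?f = "\<Sum>m\<in>sampleC d. scale (c m) (monf m) :: 'k poly3"
  have fin: "finite ?C" using finite_S by (simp add: sampleC_def)
  have F: "(\<Sum>m\<in>?C. c m * hat sampleF (m + n)) = 0" and G: "(\<Sum>m\<in>?C. c m * hat sampleG (m + n)) = 0" for n
    using assms hat_monf_sum[OF fin, of c "sampleF :: 'k poly3" n] hat_monf_sum[OF fin, of c "sampleG :: 'k poly3" n]
    by (simp_all add: annih_def)
  have hF: "hat sampleF x = (if x = mon3 ad bd 0 then mfact x else (0::'k))" for x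
    by (simp add: sampleF_def hat_def lookup_monf)
  have hG: "hat sampleG x = (if x = mon3 pd' (qd + 1) 0 then mfact x else (0::'k)) + (if x = mon3 pe 0 (qe + 1) then mfact x else 0)" for x
    by (simp add: sampleG_def hat_def lookup_add lookup_monf distrib_left)
  have single: "c m0 = 0" if s: "(\<Sum>m\<in>?C. c m * g m) = 0" "m0 \<in> ?C" "g m0 \<noteq> 0"
    "\<And>m. m \<in> ?C \<Longrightarrow> m \<noteq> m0 \<Longrightarrow> c m * g m = 0" for g m0
  proof -
    have "(\<Sum>m\<in>?C. c m * g m) = (\<Sum>m\<in>{m0}. c m * g m)"
      by (rule sum.mono_neutral_right) (use fin s in auto)
    then show ?thesis using s(1,3) by simp
  qed
  have one: "c (mon3 i (d - i) 0) = 0" if i: "i \<in> S1 d" for i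
  proof (cases "d \<le> i + bd \<and> i \<le> ad")
    case True
    show ?thesis
    proof (rule single[OF F[of "mon3 (ad - i) (bd - (d - i)) 0"]])
      show "mon3 i (d - i) 0 \<in> ?C" using i by (auto simp: sampleC_def)
      show "hat sampleF (mon3 i (d - i) 0 + mon3 (ad - i) (bd - (d - i)) 0) \<noteq> (0::'k)"
        using True i by (simp add: hF mon3_add S1_def)
      fix m assume "m \<in> ?C" and ne: "m \<noteq> mon3 i (d - i) 0"
      obtain x y z where m: "m = mon3 x y z" by (rule mon3_cases)
      have "m + mon3 (ad - i) (bd - (d - i)) 0 \<noteq> mon3 ad bd 0"
        using ne True i by (auto simp: m mon3_add S1_def)
      then show "c m * hat sampleF (m + mon3 (ad - i) (bd - (d - i)) 0) = 0" by (simp add: hF)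
    qed
  next
    case False
    then have i': "i \<le> d" "d \<le> i + qd" "i \<le> pd'" using i by (auto simp: S1_def)
    \<comment> \<open>The complementary exponent still contains y2, so the second summand of G
      cannot interfere.\<close>
    show ?thesis
    proof (rule single[OF G[of "mon3 (pd' - i) (qd + 1 - (d - i)) 0"]])
      show "mon3 i (d - i) 0 \<in> ?C" using i by (auto simp: sampleC_def)
      show "hat sampleG (mon3 i (d - i) 0 + mon3 (pd' - i) (qd + 1 - (d - i)) 0) \<noteq> (0::'k)"
        using i' by (simp add: hG mon3_add)
      fix m assume "m \<in> ?C" and ne: "m \<noteq> mon3 i (d - i) 0"
      obtain x y z where m: "m = mon3 x y z" by (rule mon3_cases)
      have "m + mon3 (pd' - i) (qd + 1 - (d - i)) 0 \<noteq> mon3 pd' (qd + 1) 0"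
        "m + mon3 (pd' - i) (qd + 1 - (d - i)) 0 \<noteq> mon3 pe 0 (qe + 1)"
        using ne i' by (auto simp: m mon3_add)
      then show "c m * hat sampleG (m + mon3 (pd' - i) (qd + 1 - (d - i)) 0) = 0" by (simp add: hG)
    qed
  qed
  have two: "c (mon3 (d - i) 0 i) = 0" if i: "i \<in> S2 d" for i
  proof (rule single[OF G[of "mon3 (pe - (d - i)) 0 (qe + 1 - i)"]])
    have i': "1 \<le> i" "i \<le> d" "i \<le> qe + 1" "d \<le> i + pe" using i by (auto simp: S2_def)
    show "mon3 (d - i) 0 i \<in> ?C" using i by (auto simp: sampleC_def)
    show "hat sampleG (mon3 (d - i) 0 i + mon3 (pe - (d - i)) 0 (qe + 1 - i)) \<noteq> (0::'k)"
      using i' by (simp add: hG mon3_add)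
    fix m assume m: "m \<in> ?C" and ne: "m \<noteq> mon3 (d - i) 0 i"
    show "c m * hat sampleG (m + mon3 (pe - (d - i)) 0 (qe + 1 - i)) = 0"
    proof (cases "m \<in> (\<lambda>i. mon3 i (d - i) 0) ` S1 d")
      \<comment> \<open>Such a monomial might meet the first summand of G, but its coefficient is
        already known to vanish.\<close>
      case True then show ?thesis using one by auto
    next
      case False
      then obtain k where k: "k \<in> S2 d" "m = mon3 (d - k) 0 k" using m by (auto simp: sampleC_def)
      have "m + mon3 (pe - (d - i)) 0 (qe + 1 - i) \<noteq> mon3 pd' (qd + 1) 0"
        "m + mon3 (pe - (d - i)) 0 (qe + 1 - i) \<noteq> mon3 pe 0 (qe + 1)"
        using ne i' by (auto simp: k mon3_add)
      then show ?thesis by (simp add: hG)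
    qed
  qed
  show ?thesis using one two by (auto simp: sampleC_def)
qed

lemma sample_indep2: "indep2 sampleF (sampleG :: 'k::field_char_0 poly3)"
  unfolding indep2_def
proof (intro allI impI)
  fix a b :: 'k assume ab: "scale a sampleF + scale b sampleG = 0"
  have "Poly_Mapping.lookup (scale a sampleF + scale b sampleG) (mon3 pe 0 (qe + 1)) = b"
    by (simp add: lookup_add sampleF_def sampleG_def lookup_monf)
  then have b: "b = 0" using ab by simp
  have "Poly_Mapping.lookup (scale a sampleF + scale b sampleG) (mon3 ad bd 0) = a"
    using b by (simp add: lookup_add sampleF_def lookup_monf)
  then have "a = 0" unfolding ab by simp
  then show "a = 0 \<and> b = 0" using b by simp
qed

lemma sample_family: "sc.span {sampleF, sampleG :: 'k::field_char_0 poly3} \<in> family e"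
proof -
  have F: "sampleF \<in> (forms e :: 'k poly3 set)" and G: "sampleG \<in> (forms e :: 'k poly3 set)"
    unfolding sampleF_def sampleG_def using sample_numbers e by (auto intro!: forms_add monf_in_forms)
  have l: "monf (mon3 0 0 1) \<in> forms 1 - {0 :: 'k poly3}" "monf (mon3 0 1 0) \<in> forms 1 - {0 :: 'k poly3}"
    by (auto simp: poly_mapping_eq_iff fun_eq_iff lookup_monf)
  have "hat (monf (mon3 0 0 1) \<circ>\<^sub>d (sampleF :: 'k poly3)) n = 0" for n
    unfolding hat_act monf_def pair_single sampleF_def
    by (cases n rule: mon3_cases) (simp add: hat_def lookup_single when_def mon3_add)
  then have "monf (mon3 0 0 1) \<circ>\<^sub>d (sampleF :: 'k poly3) = 0" by (simp add: hat_inject)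
  moreover have "hat (monf (mon3 0 1 1) \<circ>\<^sub>d (sampleG :: 'k poly3)) n = 0" for n
    unfolding hat_act monf_def pair_single sampleG_def
    by (cases n rule: mon3_cases) (simp add: hat_def lookup_add lookup_single when_def mon3_add)
  then have "(monf (mon3 0 0 1) * monf (mon3 0 1 0)) \<circ>\<^sub>d (sampleG :: 'k poly3) = 0"
    by (simp add: hat_inject monf_mult mon3_add)
  moreover have "sc.span {sampleF, sampleG :: 'k poly3} \<in> grassmannian e"
    unfolding grassmannian_iff using F G sample_indep2 by blast
  ultimately show ?thesis using F G l unfolding family_def by blast
qed

text \<open>Near the sample the Hilbert function is at least the h-vector;
  \<open>hvec_upper_bound\<close> gives the opposite inequality on the whole family.\<close>

lemma generic_hvector:
  "\<exists>U :: 'k::field_char_0 poly3 set set. openin (subtopology (zariski e) (family e)) U \<and> U \<noteq> {} \<and>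
    (\<forall>W\<in>U. has_hvector (inverse_system_ideal W) e (hvec e))"
proof -
  let ?W0 = "sc.span {sampleF, sampleG :: 'k poly3}"
  have gr: "family e \<subseteq> (grassmannian e :: 'k poly3 set set)" by (auto simp: family_def)
  have W0: "?W0 \<in> grassmannian e" using sample_family gr by blast
  have finC: "finite (sampleC d)" for d using finite_S by (simp add: sampleC_def)
  have "\<exists>x. snd x \<in> hfun (fst x) \<and> snd x (pl ?W0) \<noteq> 0 \<and>
    (\<forall>y. snd x y \<noteq> (0::'k) \<longrightarrow> indep_at (sampleC d) catalecticant y)" for d
  proof -
    have "indep_at (sampleC d) catalecticant (pl ?W0)"
      unfolding indep_at_catalecticant[OF W0 finC] inverse_system_ideal_span using sample_independent by blast
    from hf.indep_at_open[of "sampleC d" catalecticant "\<lambda>_. 1", OF finC catalecticant_hfun this]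
    obtain D h where "h \<in> hfun D" "h (pl ?W0) \<noteq> 0" "\<forall>y. h y \<noteq> 0 \<longrightarrow> indep_at (sampleC d) catalecticant y" by blast
    then show ?thesis by (intro exI[of _ "(D, h)"]) simp
  qed
  then obtain x where x: "\<And>d. snd (x d) \<in> hfun (fst (x d))" "\<And>d. snd (x d) (pl ?W0) \<noteq> 0"
    "\<And>d y. snd (x d) y \<noteq> 0 \<Longrightarrow> indep_at (sampleC d) catalecticant y" by metis
  \<comment> \<open>Only finitely many degrees matter, so one product expresses all the open
    conditions.\<close>
  define h where "h y = (\<Prod>d\<le>e. snd (x d) y)" for y
  have h: "h \<in> hfun (\<Sum>d\<le>e. fst (x d))" unfolding h_def[abs_def] by (rule hf.prod[OF x(1)])
  define U where "U = {W \<in> family e. h (pl W) \<noteq> 0}"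
  have "openin (zariski e) {W \<in> grassmannian e. h (pl W) \<noteq> 0}"
    unfolding openin_zariski using h by blast
  moreover have "U = {W \<in> grassmannian e. h (pl W) \<noteq> 0} \<inter> family e" using gr by (auto simp: U_def)
  ultimately have "openin (subtopology (zariski e) (family e)) U" by (auto simp: openin_subtopology)
  moreover have "?W0 \<in> U" using sample_family x(2) by (simp add: U_def h_def)
  moreover have "has_hvector (inverse_system_ideal W) e (hvec e)" if "W \<in> U" for W
  proof -
    have W: "W \<in> family e" "h (pl W) \<noteq> 0" using that by (auto simp: U_def)
    then obtain F G l1 l2 where FG: "F \<in> forms e" "G \<in> forms e" "W = sc.span {F, G}"
      "l1 \<in> forms 1" "l1 \<noteq> 0" "l2 \<in> forms 1" "l2 \<noteq> 0" "l1 \<circ>\<^sub>d F = 0" "(l1 * l2) \<circ>\<^sub>d G = 0"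
      unfolding family_def by blast
    interpret family_data e F G l1 l2 using FG by unfold_locales
    have I: "inverse_system_ideal W = annih F G" unfolding FG(3) by (rule inverse_system_ideal_span)
    have Wg: "W \<in> grassmannian e" using W(1) gr by blast
    have eq: "hvec e d + sc.dim (forms d \<inter> annih F G) = (d + 2) choose 2" if d: "d \<le> e" for d
    proof -
      have "snd (x d) (pl W) \<noteq> 0" using W(2) d by (simp add: h_def)
      then have "indep_at (sampleC d) catalecticant (pl W)" by (rule x(3))
      then have "card (sampleC d) + sc.dim (forms d \<inter> annih F G) \<le> (d + 2) choose 2"
        unfolding indep_at_catalecticant[OF Wg finC] I
        by (intro card_le_codim[OF ideal_annih sampleC_mons]) blast
      then show ?thesis using card_sampleC[OF d] hvec_upper_bound[OF d] by linarith
    qed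
    have "\<not> forms e \<subseteq> annih F G"
    proof
      assume "forms e \<subseteq> annih F G"
      then have "forms e \<inter> annih F G = forms e" by blast
      then show False using eq[of e] hvec_socle[OF e] by (simp add: dim_forms)
    qed
    moreover have "forms d \<subseteq> annih F G" if "d > e" for d
      using act_forms_eq_0[OF _ FG(1) that] act_forms_eq_0[OF _ FG(2) that] by (auto simp: annih_def)
    ultimately show ?thesis unfolding I has_hvector_iff[OF ideal_annih] using eq by blast
  qed
  ultimately show ?thesis by blast
qed

end

subsection \<open>Closedness of the family over an algebraically closed field\<close>

definition lform :: "(3 \<Rightarrow> 'k::field) \<Rightarrow> 'k poly3" where
  "lform c = (\<Sum>i\<in>UNIV. scale (c i) (monf (Poly_Mapping.single i 1)))"

lemma single_inj3: "Poly_Mapping.single i (1::nat) = Poly_Mapping.single j 1 \<longleftrightarrow> i = j" for i j :: 3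
  by (metis lookup_single_eq lookup_single_not_eq zero_neq_one)

lemma lookup_lform: "Poly_Mapping.lookup (lform c) (Poly_Mapping.single j 1) = c j"
  unfolding lform_def lookup_sum lookup_scale lookup_monf single_inj3 by (simp add: if_distrib cong: if_cong)

lemma lform_forms: "lform c \<in> forms 1"
  unfolding lform_def by (intro forms_sum forms_scale) simp

lemma mons_1: "m \<in> mons 1 \<Longrightarrow> \<exists>i. m = Poly_Mapping.single i 1"
proof -
  assume "m \<in> mons 1"
  moreover obtain i j k where m: "m = mon3 i j k" by (rule mon3_cases)
  ultimately have "i + j + k = 1" by simp
  then consider "i = 1" "j = 0" "k = 0" | "i = 0" "j = 1" "k = 0" | "i = 0" "j = 0" "k = 1" by fastforce
  then show ?thesis by cases (auto simp: m mon3_def)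
qed

lemma lform_of_form:
  fixes l :: "'k::field poly3"
  assumes "l \<in> forms 1" shows "l = lform (\<lambda>i. Poly_Mapping.lookup l (Poly_Mapping.single i 1))"
proof (rule poly_mapping_eqI)
  fix m
  show "Poly_Mapping.lookup l m = Poly_Mapping.lookup (lform (\<lambda>i. Poly_Mapping.lookup l (Poly_Mapping.single i 1))) m"
  proof (cases "mdeg m = 1")
    case True
    then obtain i where m: "m = Poly_Mapping.single i 1" using mons_1[of m] by auto
    show ?thesis unfolding m lookup_lform ..
  next
    case False
    then show ?thesis using assms lform_forms[of "\<lambda>i. Poly_Mapping.lookup l (Poly_Mapping.single i 1)"]
      by (simp add: forms_lookup)
  qed
qed

lemma hat_lform: "hat (lform c \<circ>\<^sub>d F) n = (\<Sum>i\<in>UNIV. c i * hat F (Poly_Mapping.single i 1 + n))"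
  unfolding hat_act lform_def pair_sum pair_scale by (simp add: monf_def)

lemma hat_lform2: "hat ((lform c * lform c') \<circ>\<^sub>d F) n =
    (\<Sum>i\<in>UNIV. \<Sum>j\<in>UNIV. c i * c' j * hat F (Poly_Mapping.single i 1 + Poly_Mapping.single j 1 + n))"
  unfolding act_mult hat_lform by (simp add: sum_distrib_left mult.assoc add_ac)

lemma lform_eq_0: "lform c = 0 \<longleftrightarrow> (\<forall>i. c i = 0)"
proof
  assume "lform c = 0"
  then show "\<forall>i. c i = 0" using lookup_lform[of c] by simp
qed (simp add: lform_def)

text \<open>The coefficients of the product of two binary linear forms with coefficient pairs u and
  v.\<close>

definition lcoef :: "'k::field \<times> 'k \<Rightarrow> 'k \<times> 'k \<Rightarrow> 3 \<Rightarrow> 'k" where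
  "lcoef u v i = (if i = 0 then fst u * fst v else if i = 1 then fst u * snd v + snd u * fst v else snd u * snd v)"

lemma lcoef_nonzero: "u \<noteq> (0, 0) \<Longrightarrow> v \<noteq> (0, 0) \<Longrightarrow> \<exists>i. lcoef u v i \<noteq> 0"
proof (rule ccontr)
  assume u: "u \<noteq> (0, 0)" and v: "v \<noteq> (0, 0)" and "\<not> (\<exists>i. lcoef u v i \<noteq> 0)"
  then have "lcoef u v 0 = 0" "lcoef u v 1 = 0" "lcoef u v 2 = 0" by auto
  then have "fst u * fst v = 0" "fst u * snd v + snd u * fst v = 0" "snd u * snd v = 0"
    by (simp_all add: lcoef_def distinct_3)
  then show False using u v by (cases u; cases v) auto
qed

text \<open>Over an algebraically closed field this presents the projective plane as a symmetric square of the
  projective line, so that linear forms can be eliminated one projective line at a time.\<close>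

lemma lcoef_surj:
  fixes c :: "3 \<Rightarrow> 'k::field"
  assumes closed: "\<forall>q :: 'k poly. Polynomial.degree q > 0 \<longrightarrow> (\<exists>x. poly q x = 0)" and c: "\<exists>i. c i \<noteq> 0"
  shows "\<exists>u v. u \<noteq> (0, 0) \<and> v \<noteq> (0, 0) \<and> c = lcoef u v"
proof -
  have all3: "P i" if "P 0" "P 1" "P 2" for P and i :: 3
  proof -
    have "i \<in> {0, 1, 2}" using UNIV_3_eq by blast
    then show ?thesis using that by auto
  qed
  show ?thesis
  proof (cases "c 0 = 0")
    case True
    have "c = lcoef (0, 1) (c 1, c 2)"
    proof
      fix i show "c i = lcoef (0, 1) (c 1, c 2) i"
        by (rule all3[where P = "\<lambda>i. c i = lcoef (0, 1) (c 1, c 2) i"]) (simp_all add: lcoef_def True distinct_3)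
    qed
    moreover have "(c 1, c 2) \<noteq> (0, 0)"
    proof
      assume "(c 1, c 2) = (0, 0)"
      then have c12: "c 1 = 0" "c 2 = 0" by simp_all
      have "c i = 0" for i by (rule all3[where P = "\<lambda>i. c i = 0"]) (simp_all add: True c12)
      then show False using c by blast
    qed
    moreover have "(0::'k, 1::'k) \<noteq> (0, 0)" by simp
    ultimately show ?thesis by blast
  next
    case False
    \<comment> \<open>A root splits off one linear factor of the binary quadratic form with
      coefficients c; the other factor comes from synthetic division.\<close>
    have "Polynomial.degree [:c 2, c 1, c 0:] > 0" using False by simp
    then obtain x where x: "poly [:c 2, c 1, c 0:] x = 0" using closed by blast
    have "c = lcoef (1, - x) (c 0, c 1 + x * c 0)"
    proof
      fix i show "c i = lcoef (1, - x) (c 0, c 1 + x * c 0) i"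
      proof (rule all3[where P = "\<lambda>i. c i = lcoef (1, - x) (c 0, c 1 + x * c 0) i"])
        show "c 2 = lcoef (1, - x) (c 0, c 1 + x * c 0) 2"
          using x by (simp add: lcoef_def distinct_3 algebra_simps eq_neg_iff_add_eq_0)
      qed (simp_all add: lcoef_def distinct_3)
    qed
    moreover have "(1 :: 'k, - x) \<noteq> (0, 0)" "(c 0, c 1 + x * c 0) \<noteq> (0, 0)" using False by simp_all
    ultimately show ?thesis by blast
  qed
qed

section \<open>Closed sets, projections and equations for the family\<close>

definition hclosed :: "('d \<Rightarrow> ('y \<Rightarrow> 'k::field) set) \<Rightarrow> 'y set \<Rightarrow> bool" where
  "hclosed H Z \<longleftrightarrow> (\<forall>y. y \<notin> Z \<longrightarrow> (\<exists>d. \<exists>h\<in>H d. h y \<noteq> 0 \<and> (\<forall>z\<in>Z. h z = 0)))"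

text \<open>Elimination is applied to the family of all homogeneous functions that vanish on
  Z.\<close>

lemma (in graded_functions) hclosed_projection:
  assumes closed: "\<forall>q :: 'k poly. Polynomial.degree q > 0 \<longrightarrow> (\<exists>x. poly q x = 0)"
    and Z: "hclosed (ext H) Z"
  shows "hclosed H {y. \<exists>u. u \<noteq> (0, 0) \<and> (u, y) \<in> Z}"
  unfolding hclosed_def
proof (intro allI impI)
  fix y0 assume y0: "y0 \<notin> {y. \<exists>u. u \<noteq> (0, 0) \<and> (u, y) \<in> Z}"
  define S where "S = {f. (\<exists>nd. f \<in> ext H nd) \<and> (\<forall>z\<in>Z. f z = 0)}"
  have "\<exists>d. \<exists>h\<in>H d. h y0 \<noteq> 0 \<and> (\<forall>y. h y \<noteq> 0 \<longrightarrow> (\<forall>u. u \<noteq> (0, 0) \<longrightarrow> (\<exists>f\<in>S. f (u, y) \<noteq> 0)))"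
  proof (rule eliminate[OF closed])
    show "\<exists>nd. f \<in> ext H nd" if "f \<in> S" for f using that by (simp add: S_def)
    fix u :: "'k \<times> 'k" assume "u \<noteq> (0, 0)"
    then have "(u, y0) \<notin> Z" using y0 by blast
    then obtain nd h where "h \<in> ext H nd" "h (u, y0) \<noteq> 0" "\<forall>z\<in>Z. h z = 0" using Z unfolding hclosed_def by blast
    then show "\<exists>f\<in>S. f (u, y0) \<noteq> 0" unfolding S_def by blast
  qed
  then obtain d h where h: "h \<in> H d" "h y0 \<noteq> 0" "\<And>y u. h y \<noteq> 0 \<Longrightarrow> u \<noteq> (0, 0) \<Longrightarrow> \<exists>f\<in>S. f (u, y) \<noteq> 0" by blast
  have "h z = 0" if "z \<in> {y. \<exists>u. u \<noteq> (0, 0) \<and> (u, y) \<in> Z}" for z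
    using that h(3)[of z] unfolding S_def by blast
  then show "\<exists>d. \<exists>h\<in>H d. h y0 \<noteq> 0 \<and> (\<forall>z\<in>{y. \<exists>u. u \<noteq> (0, 0) \<and> (u, y) \<in> Z}. h z = 0)" using h(1,2) by blast
qed

text \<open>At a Pluecker vector of independent F, G these equations say that the product of the two
  linear forms kills F and G.\<close>

definition eqn1 where
  "eqn1 n n' c c' y = (\<Sum>i\<in>UNIV. \<Sum>j\<in>UNIV. c i * c' j *
     (mfact (Poly_Mapping.single i 1 + Poly_Mapping.single j 1 + n') * y (Poly_Mapping.single i 1 + Poly_Mapping.single j 1 + n', n)))"

text \<open>The 2 x 2 minors of the coefficient tables of F and G after the linear form has acted;
  they vanish when it kills some nonzero element of the plane.\<close>

definition eqn2 where
  "eqn2 n n' c y = (\<Sum>i\<in>UNIV. \<Sum>j\<in>UNIV. c i * c j *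
     ((mfact (Poly_Mapping.single i 1 + n) * mfact (Poly_Mapping.single j 1 + n')) *
      y (Poly_Mapping.single i 1 + n, Poly_Mapping.single j 1 + n')))"

lemma eqn1_plucker:
  "eqn1 n n' c c' (plucker F G) = hat ((lform c * lform c') \<circ>\<^sub>d F) n' * Poly_Mapping.lookup G n
    - hat ((lform c * lform c') \<circ>\<^sub>d G) n' * Poly_Mapping.lookup F n"
  unfolding eqn1_def hat_lform2 sum_distrib_right sum_subtractf[symmetric]
  by (intro sum.cong refl) (simp add: plucker_def hat_def algebra_simps)

lemma eqn2_plucker:
  "eqn2 n n' c (plucker F G) = hat (lform c \<circ>\<^sub>d F) n * hat (lform c \<circ>\<^sub>d G) n' - hat (lform c \<circ>\<^sub>d F) n' * hat (lform c \<circ>\<^sub>d G) n"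
proof -
  have "hat (lform c \<circ>\<^sub>d F) n' * hat (lform c \<circ>\<^sub>d G) n
    = (\<Sum>i\<in>UNIV. \<Sum>j\<in>UNIV. c i * hat G (Poly_Mapping.single i 1 + n) * (c j * hat F (Poly_Mapping.single j 1 + n')))"
    unfolding hat_lform by (subst mult.commute) (rule sum_product)
  moreover have "hat (lform c \<circ>\<^sub>d F) n * hat (lform c \<circ>\<^sub>d G) n'
    = (\<Sum>i\<in>UNIV. \<Sum>j\<in>UNIV. c i * hat F (Poly_Mapping.single i 1 + n) * (c j * hat G (Poly_Mapping.single j 1 + n')))"
    unfolding hat_lform by (rule sum_product)
  ultimately show ?thesis
    unfolding eqn2_def
    by (simp only: sum_subtractf[symmetric]) (intro sum.cong refl, simp add: plucker_def hat_def algebra_simps)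
qed

definition incidence :: "(3 \<Rightarrow> 'k::field_char_0) \<Rightarrow> (3 \<Rightarrow> 'k) \<Rightarrow> (3 mon \<times> 3 mon \<Rightarrow> 'k) \<Rightarrow> bool" where
  "incidence c c' y \<longleftrightarrow> (\<forall>n n'. eqn1 n n' c c' y = 0 \<and> eqn2 n n' c y = 0)"

text \<open>Membership without a choice of basis: \<open>l1 * l2\<close> kills the plane and
  \<open>l1\<close> kills a nonzero element of it, which can be taken as the first
  generator.\<close>

lemma family_iff_incidence:
  fixes W :: "'k::field_char_0 poly3 set"
  assumes W: "W \<in> grassmannian e"
  shows "W \<in> family e \<longleftrightarrow> (\<exists>c c'. (\<exists>i. c i \<noteq> 0) \<and> (\<exists>i. c' i \<noteq> 0) \<and> incidence c c' (pl W))"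
proof
  assume "W \<in> family e"
  then obtain F G l1 l2 where FG: "F \<in> forms e" "G \<in> forms e" "W = sc.span {F, G}"
    "l1 \<in> forms 1" "l1 \<noteq> 0" "l2 \<in> forms 1" "l2 \<noteq> 0" "l1 \<circ>\<^sub>d F = 0" "(l1 * l2) \<circ>\<^sub>d G = 0"
    unfolding family_def by blast
  have ind: "indep2 F G" using W FG(3) dim_span2[of F G] by (simp add: grassmannian_def)
  obtain c c' where c: "l1 = lform c" "l2 = lform c'" using lform_of_form FG(4,6) by blast
  have "(l1 * l2) \<circ>\<^sub>d F = 0" using FG(8) by (simp add: act_mult act_commute[of l1 l2 F])
  then have z: "eqn1 n n' c c' (plucker F G) = 0" "eqn2 n n' c (plucker F G) = 0" for n n'
    using FG(8,9) unfolding eqn1_plucker eqn2_plucker c by simp_all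
  obtain a where a: "a \<noteq> 0" "plucker F G = (\<lambda>i. a * pl W i)" using pl_span[OF ind] FG(3) by blast
  have "eqn1 n n' c c' (\<lambda>i. a * pl W i) = a * eqn1 n n' c c' (pl W)"
    "eqn2 n n' c (\<lambda>i. a * pl W i) = a * eqn2 n n' c (pl W)" for n n'
    unfolding eqn1_def eqn2_def sum_distrib_left by (simp_all add: mult_ac)
  then have "incidence c c' (pl W)" using z a unfolding incidence_def by simp
  moreover have "\<exists>i. c i \<noteq> 0" "\<exists>i. c' i \<noteq> 0" using FG(5,7) unfolding c lform_eq_0 by blast+
  ultimately show "\<exists>c c'. (\<exists>i. c i \<noteq> 0) \<and> (\<exists>i. c' i \<noteq> 0) \<and> incidence c c' (pl W)" by blast
next
  assume "\<exists>c c'. (\<exists>i. c i \<noteq> 0) \<and> (\<exists>i. c' i \<noteq> 0) \<and> incidence c c' (pl W)"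
  then obtain c c' where c: "\<exists>i. c i \<noteq> 0" "\<exists>i. c' i \<noteq> 0" "incidence c c' (pl W)" by blast
  define l1 where "l1 = lform c"
  define l2 where "l2 = lform c'"
  have l: "l1 \<in> forms 1" "l1 \<noteq> 0" "l2 \<in> forms 1" "l2 \<noteq> 0"
    using c(1,2) lform_forms[of c] lform_forms[of c'] unfolding l1_def l2_def lform_eq_0 by simp_all
  let ?P = "\<lambda>y. \<exists>F' G'. W = sc.span {F', G'} \<and> y = plucker F' G'"
  obtain F0 G0 where "W = sc.span {F0, G0}" using W unfolding grassmannian_iff by blast
  then have "?P (plucker F0 G0)" by blast
  then have "?P (SOME y. ?P y)" by (rule someI[of ?P])
  then obtain F G where FG: "W = sc.span {F, G}" "pl W = plucker F G"
    unfolding pl_def by (elim exE conjE)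
  have ind: "indep2 F G" using W FG(1) dim_span2[of F G] by (simp add: grassmannian_def)
  have forms: "F \<in> forms e" "G \<in> forms e"
    using W unfolding grassmannian_def FG(1) by (auto intro: sc.span_base)
  have Q: "(l1 * l2) \<circ>\<^sub>d F = 0 \<and> (l1 * l2) \<circ>\<^sub>d G = 0"
  proof -
    have "hat ((l1 * l2) \<circ>\<^sub>d F) n' = 0 \<and> hat ((l1 * l2) \<circ>\<^sub>d G) n' = 0" for n'
    proof -
      have "scale (- hat ((l1 * l2) \<circ>\<^sub>d G) n') F + scale (hat ((l1 * l2) \<circ>\<^sub>d F) n') G = 0"
      proof (rule poly_mapping_eqI)
        fix n
        have "eqn1 n n' c c' (plucker F G) = 0" using c(3) by (simp add: incidence_def FG(2))
        then show "Poly_Mapping.lookup (scale (- hat ((l1 * l2) \<circ>\<^sub>d G) n') F + scale (hat ((l1 * l2) \<circ>\<^sub>d F) n') G) n = Poly_Mapping.lookup 0 n"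
          unfolding eqn1_plucker l1_def[symmetric] l2_def[symmetric] by (simp add: lookup_add lookup_minus)
      qed
      then show ?thesis using ind unfolding indep2_def by (metis neg_equal_0_iff_equal)
    qed
    then show ?thesis unfolding hat_inject by simp
  qed
  have minor: "hat (l1 \<circ>\<^sub>d F) n * hat (l1 \<circ>\<^sub>d G) n' = hat (l1 \<circ>\<^sub>d F) n' * hat (l1 \<circ>\<^sub>d G) n" for n n'
    using c(3) unfolding incidence_def FG(2) eqn2_plucker l1_def[symmetric] by simp
  \<comment> \<open>The vanishing minors make the two images under \<open>l1\<close>
    proportional.\<close>
  have "\<exists>s t. (s, t) \<noteq> (0, 0) \<and> l1 \<circ>\<^sub>d (scale s F + scale t G) = 0"
  proof (cases "l1 \<circ>\<^sub>d F = 0")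
    case True
    then show ?thesis by (intro exI[of _ 1] exI[of _ 0]) simp
  next
    case False
    then obtain m where m: "hat (l1 \<circ>\<^sub>d F) m \<noteq> 0" unfolding hat_inject by auto
    have "l1 \<circ>\<^sub>d (scale (- hat (l1 \<circ>\<^sub>d G) m) F + scale (hat (l1 \<circ>\<^sub>d F) m) G) = 0"
      unfolding act_add_right act_scale_right hat_inject hat_add hat_scale hat_zero
      using minor[of m] by (simp add: mult.commute)
    then show ?thesis using m by blast
  qed
  then obtain s t where st: "(s, t) \<noteq> (0, 0)" "l1 \<circ>\<^sub>d (scale s F + scale t G) = 0" by blast
  define F' where "F' = scale s F + scale t G"
  have F'e: "F' \<in> forms e" unfolding F'_def by (intro forms_add forms_scale forms)
  show "W \<in> family e"
  proof (cases "s = 0")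
    case False
    have "F = scale (1 / s) F' + scale (- t / s) G"
      using False by (simp add: F'_def sc.scale_right_distrib)
    then have "F \<in> sc.span {F', G}" unfolding span2 by blast
    then have "{F, G} \<subseteq> sc.span {F', G}" using sc.span_base[of G "{F', G}"] by simp
    moreover have "{F', G} \<subseteq> sc.span {F, G}" using span2[of F' F G] sc.span_base[of G "{F, G}"] F'_def by auto
    ultimately have "W = sc.span {F', G}" unfolding FG(1) by (intro sc.span_eq[THEN iffD2] conjI)
    then show ?thesis using W F'e forms l Q st(2) unfolding family_def F'_def[symmetric] by blast
  next
    case True
    \<comment> \<open>The combination is a multiple of G, so F serves as the second
      generator.\<close>
    then have t: "t \<noteq> 0" using st(1) by simp
    have "G = scale (1 / t) F'" using t True by (simp add: F'_def)
    then have "{F, G} \<subseteq> sc.span {F', F}" using sc.span_scale[OF sc.span_base[of F' "{F', F}"], of "1 / t"] sc.span_base[of F "{F', F}"] by auto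
    moreover have "{F', F} \<subseteq> sc.span {F, G}" using span2[of F' F G] sc.span_base[of F "{F, G}"] F'_def by auto
    ultimately have "W = sc.span {F', F}" unfolding FG(1) by (intro sc.span_eq[THEN iffD2] conjI)
    then show ?thesis using W F'e forms l Q st(2) unfolding family_def F'_def[symmetric] by blast
  qed
qed

context graded_functions begin

lemma lcoef_in:
  assumes u: "(\<lambda>p. fst (u p)) \<in> H a" "(\<lambda>p. snd (u p)) \<in> H a" and v: "(\<lambda>p. fst (v p)) \<in> H b" "(\<lambda>p. snd (v p)) \<in> H b"
  shows "(\<lambda>p. lcoef (u p) (v p) i) \<in> H (a + b)"
proof -
  have "i = 0 \<or> i = 1 \<or> i = 2" using UNIV_3_eq by blast
  then show ?thesis
    using mult[OF u(1) v(1)] add[OF mult[OF u(1) v(2)] mult[OF u(2) v(1)]] mult[OF u(2) v(2)]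
    by (auto simp: lcoef_def distinct_3)
qed

end

lemma eqn1_in:
  fixes H :: "'d::comm_monoid_add \<Rightarrow> ('y \<Rightarrow> 'k::field_char_0) set"
  assumes "graded_functions H" and c: "\<And>i. (\<lambda>p. c p i) \<in> H a" "\<And>i. (\<lambda>p. c' p i) \<in> H b" and y: "\<And>i. (\<lambda>p. y p i) \<in> H g"
  shows "(\<lambda>p. eqn1 n n' (c p) (c' p) (y p)) \<in> H (a + b + g)"
proof -
  interpret graded_functions H by fact
  show ?thesis unfolding eqn1_def by (intro sum mult scale c y)
qed

lemma eqn2_in:
  fixes H :: "'d::comm_monoid_add \<Rightarrow> ('y \<Rightarrow> 'k::field_char_0) set"
  assumes "graded_functions H" and c: "\<And>i. (\<lambda>p. c p i) \<in> H a" and y: "\<And>i. (\<lambda>p. y p i) \<in> H g"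
  shows "(\<lambda>p. eqn2 n n' (c p) (y p)) \<in> H (a + a + g)"
proof -
  interpret graded_functions H by fact
  show ?thesis unfolding eqn2_def by (intro sum mult scale c y)
qed

text \<open>Each linear form contributes two projective lines through \<open>lcoef\<close>. The
  incidence equations are multihomogeneous in these four pairs and the Pluecker coordinates, and
  four projections leave the family.\<close>

lemma closedin_family:
  assumes closed: "\<forall>q :: 'k::field_char_0 poly. Polynomial.degree q > 0 \<longrightarrow> (\<exists>x. poly q x = 0)"
  shows "closedin (zariski e) (family e :: 'k poly3 set set)"
proof -
  let ?H0 = "hfun :: nat \<Rightarrow> ((3 mon \<times> 3 mon \<Rightarrow> 'k) \<Rightarrow> 'k) set"
  let ?H1 = "ext ?H0" let ?H2 = "ext ?H1" let ?H3 = "ext ?H2" let ?H4 = "ext ?H3"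
  interpret h1: graded_functions ?H1 by (rule hf.graded_functions_ext)
  interpret h2: graded_functions ?H2 by (rule h1.graded_functions_ext)
  interpret h3: graded_functions ?H3 by (rule h2.graded_functions_ext)
  interpret h4: graded_functions ?H4 by (rule h3.graded_functions_ext)
  define Z where "Z = {(u, (v, (u', (v', y)))). incidence (lcoef u v) (lcoef u' v') (y :: 3 mon \<times> 3 mon \<Rightarrow> 'k)}"
  define pu where "pu p = fst p" for p :: "('k \<times> 'k) \<times> ('k \<times> 'k) \<times> ('k \<times> 'k) \<times> ('k \<times> 'k) \<times> (3 mon \<times> 3 mon \<Rightarrow> 'k)"
  define pv where "pv p = fst (snd p)" for p :: "('k \<times> 'k) \<times> ('k \<times> 'k) \<times> ('k \<times> 'k) \<times> ('k \<times> 'k) \<times> (3 mon \<times> 3 mon \<Rightarrow> 'k)"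
  define pu' where "pu' p = fst (snd (snd p))" for p :: "('k \<times> 'k) \<times> ('k \<times> 'k) \<times> ('k \<times> 'k) \<times> ('k \<times> 'k) \<times> (3 mon \<times> 3 mon \<Rightarrow> 'k)"
  define pv' where "pv' p = fst (snd (snd (snd p)))" for p :: "('k \<times> 'k) \<times> ('k \<times> 'k) \<times> ('k \<times> 'k) \<times> ('k \<times> 'k) \<times> (3 mon \<times> 3 mon \<Rightarrow> 'k)"
  define py where "py p = snd (snd (snd (snd p)))" for p :: "('k \<times> 'k) \<times> ('k \<times> 'k) \<times> ('k \<times> 'k) \<times> ('k \<times> 'k) \<times> (3 mon \<times> 3 mon \<Rightarrow> 'k)"
  have u: "(\<lambda>p. fst (pu p)) \<in> ?H4 (1, 0)" "(\<lambda>p. snd (pu p)) \<in> ?H4 (1, 0)"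
    unfolding pu_def by (rule h3.ext_var)+
  have v: "(\<lambda>p. fst (pv p)) \<in> ?H4 (0, (1, 0))" "(\<lambda>p. snd (pv p)) \<in> ?H4 (0, (1, 0))"
    unfolding pv_def by (rule h3.ext_base[OF h2.ext_var(1)], rule h3.ext_base[OF h2.ext_var(2)])
  have u': "(\<lambda>p. fst (pu' p)) \<in> ?H4 (0, (0, (1, 0)))" "(\<lambda>p. snd (pu' p)) \<in> ?H4 (0, (0, (1, 0)))"
    unfolding pu'_def by (rule h3.ext_base[OF h2.ext_base[OF h1.ext_var(1)]], rule h3.ext_base[OF h2.ext_base[OF h1.ext_var(2)]])
  have v': "(\<lambda>p. fst (pv' p)) \<in> ?H4 (0, (0, (0, (1, 0))))" "(\<lambda>p. snd (pv' p)) \<in> ?H4 (0, (0, (0, (1, 0))))"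
    unfolding pv'_def by (rule h3.ext_base[OF h2.ext_base[OF h1.ext_base[OF hf.ext_var(1)]]],
      rule h3.ext_base[OF h2.ext_base[OF h1.ext_base[OF hf.ext_var(2)]]])
  have y: "(\<lambda>p. py p i) \<in> ?H4 (0, (0, (0, (0, 1))))" for i
    unfolding py_def by (rule h3.ext_base[OF h2.ext_base[OF h1.ext_base[OF hf.ext_base[OF hfun_coord[of i]]]]])
  note c = h4.lcoef_in[OF u v] and c' = h4.lcoef_in[OF u' v']
  note e1 = eqn1_in[where c = "\<lambda>p. lcoef (pu p) (pv p)" and c' = "\<lambda>p. lcoef (pu' p) (pv' p)" and y = py, OF h4.graded_functions_axioms c c' y]
    and e2 = eqn2_in[where c = "\<lambda>p. lcoef (pu p) (pv p)" and y = py, OF h4.graded_functions_axioms c y]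
  have Z_iff: "p \<in> Z \<longleftrightarrow> (\<forall>n n'. eqn1 n n' (lcoef (pu p) (pv p)) (lcoef (pu' p) (pv' p)) (py p) = 0 \<and>
      eqn2 n n' (lcoef (pu p) (pv p)) (py p) = 0)" for p
    by (cases p) (auto simp: Z_def incidence_def pu_def pv_def pu'_def pv'_def py_def)
  have "hclosed ?H4 Z"
    unfolding hclosed_def
  proof (intro allI impI)
    fix p assume "p \<notin> Z"
    then obtain n n' where "eqn1 n n' (lcoef (pu p) (pv p)) (lcoef (pu' p) (pv' p)) (py p) \<noteq> 0 \<or>
      eqn2 n n' (lcoef (pu p) (pv p)) (py p) \<noteq> 0" unfolding Z_iff by blast
    then show "\<exists>d. \<exists>h\<in>?H4 d. h p \<noteq> 0 \<and> (\<forall>z\<in>Z. h z = 0)"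
    proof
      assume "eqn1 n n' (lcoef (pu p) (pv p)) (lcoef (pu' p) (pv' p)) (py p) \<noteq> 0"
      moreover obtain d where "(\<lambda>p. eqn1 n n' (lcoef (pu p) (pv p)) (lcoef (pu' p) (pv' p)) (py p)) \<in> ?H4 d" using e1[of n n'] by blast
      ultimately show ?thesis by (intro exI[of _ d] bexI[where x = "\<lambda>p. eqn1 n n' (lcoef (pu p) (pv p)) (lcoef (pu' p) (pv' p)) (py p)"] conjI) (simp_all add: Z_iff)
    next
      assume "eqn2 n n' (lcoef (pu p) (pv p)) (py p) \<noteq> 0"
      moreover obtain d where "(\<lambda>p. eqn2 n n' (lcoef (pu p) (pv p)) (py p)) \<in> ?H4 d" using e2[of n n'] by blast
      ultimately show ?thesis by (intro exI[of _ d] bexI[where x = "\<lambda>p. eqn2 n n' (lcoef (pu p) (pv p)) (py p)"] conjI) (simp_all add: Z_iff)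
    qed
  qed
  note hf.hclosed_projection[OF closed h1.hclosed_projection[OF closed h2.hclosed_projection[OF closed
    h3.hclosed_projection[OF closed this]]]]
  then have hc: "hclosed ?H0 {y. \<exists>v'. v' \<noteq> (0, 0) \<and> (\<exists>u'. u' \<noteq> (0, 0) \<and> (\<exists>v. v \<noteq> (0, 0) \<and> (\<exists>u. u \<noteq> (0, 0) \<and>
      incidence (lcoef u v) (lcoef u' v') y)))}"
    by (simp add: Z_def)
  have fam: "W \<in> family e \<longleftrightarrow> pl W \<in> {y. \<exists>v'. v' \<noteq> (0, 0) \<and> (\<exists>u'. u' \<noteq> (0, 0) \<and> (\<exists>v. v \<noteq> (0, 0) \<and> (\<exists>u. u \<noteq> (0, 0) \<and>
      incidence (lcoef u v) (lcoef u' v') y)))}" if W: "W \<in> grassmannian e" for W :: "'k poly3 set"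
    unfolding family_iff_incidence[OF W] mem_Collect_eq
  proof
    assume "\<exists>c c'. (\<exists>i. c i \<noteq> 0) \<and> (\<exists>i. c' i \<noteq> 0) \<and> incidence c c' (pl W)"
    then obtain c c' where cc: "\<exists>i. c i \<noteq> 0" "\<exists>i. c' i \<noteq> 0" "incidence c c' (pl W)" by blast
    \<comment> \<open>Algebraic closedness enters a second time: every nonzero coefficient triple
      comes from two pairs.\<close>
    obtain u v where uv: "u \<noteq> (0, 0)" "v \<noteq> (0, 0)" "c = lcoef u v" using lcoef_surj[OF closed cc(1)] by (elim exE conjE)
    obtain u' v' where uv': "u' \<noteq> (0, 0)" "v' \<noteq> (0, 0)" "c' = lcoef u' v'" using lcoef_surj[OF closed cc(2)] by (elim exE conjE)
    show "\<exists>v'. v' \<noteq> (0, 0) \<and> (\<exists>u'. u' \<noteq> (0, 0) \<and> (\<exists>v. v \<noteq> (0, 0) \<and> (\<exists>u. u \<noteq> (0, 0) \<and>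
      incidence (lcoef u v) (lcoef u' v') (pl W))))"
      by (rule exI[of _ v'] exI[of _ u'] exI[of _ v] exI[of _ u] conjI uv uv' cc(3)[unfolded uv(3) uv'(3)])+
  next
    assume "\<exists>v'. v' \<noteq> (0, 0) \<and> (\<exists>u'. u' \<noteq> (0, 0) \<and> (\<exists>v. v \<noteq> (0, 0) \<and> (\<exists>u. u \<noteq> (0, 0) \<and>
      incidence (lcoef u v) (lcoef u' v') (pl W))))"
    then obtain u v u' v' where uv: "u \<noteq> (0, 0)" "v \<noteq> (0, 0)" "u' \<noteq> (0, 0)" "v' \<noteq> (0, 0)"
      "incidence (lcoef u v) (lcoef u' v') (pl W)" by (elim exE conjE)
    show "\<exists>c c'. (\<exists>i. c i \<noteq> 0) \<and> (\<exists>i. c' i \<noteq> 0) \<and> incidence c c' (pl W)"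
      by (rule exI[of _ "lcoef u v"], rule exI[of _ "lcoef u' v'"]) (intro conjI lcoef_nonzero uv)
  qed
  obtain Y where Y: "hclosed ?H0 Y" "\<And>W. W \<in> grassmannian e \<Longrightarrow> W \<in> family e \<longleftrightarrow> pl W \<in> Y"
    by (rule that[OF hc fam])
  have sub: "subtopology (zariski e) (grassmannian e) = (zariski e :: 'k poly3 set topology)"
    using subtopology_topspace[of "zariski e"] by (simp add: topspace_zariski)
  have gr: "family e \<subseteq> (grassmannian e :: 'k poly3 set set)" by (auto simp: family_def)
  have "closedin (subtopology (zariski e) (grassmannian e)) (family e :: 'k poly3 set set)"
    unfolding closedin_zariski_subtopology[OF subset_refl]
  proof (intro conjI ballI gr)
    fix W :: "'k poly3 set" assume W: "W \<in> grassmannian e - family e"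
    then obtain d h where "h \<in> ?H0 d" "h (pl W) \<noteq> 0"
      and van: "\<forall>z\<in>Y. h z = 0"
      using Y(1) Y(2)[of W] unfolding hclosed_def by blast
    moreover have "vanishes h (family e)"
      unfolding vanishes_def
    proof
      fix U :: "'k poly3 set" assume U: "U \<in> family e"
      then have "U \<in> grassmannian e" using gr by blast
      from bspec[OF van Y(2)[OF this, THEN iffD1, OF U]] show "h (pl U) = 0" .
    qed
    ultimately show "\<exists>d. \<exists>f\<in>hfun d. f (pl W) \<noteq> 0 \<and> vanishes f (family e)" by blast
  qed
  then show ?thesis unfolding sub .
qed

subsection \<open>A rational parametrization\<close>

lemma hat_lform3: "hat (lform c \<circ>\<^sub>d F) (mon3 i k j) =
    c 0 * hat F (mon3 (Suc i) k j) + c 1 * hat F (mon3 i (Suc k) j) + c 2 * hat F (mon3 i k (Suc j))"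
proof -
  have "Poly_Mapping.single 0 1 = mon3 1 0 0" "Poly_Mapping.single 1 1 = mon3 0 1 0" "Poly_Mapping.single 2 1 = mon3 0 0 1"
    by (simp_all add: mon3_def)
  then show ?thesis unfolding hat_lform sum_3 by (simp only: mon3_add) simp
qed

definition of_hat :: "nat \<Rightarrow> (3 mon \<Rightarrow> 'k) \<Rightarrow> 'k::field_char_0 poly3" where
  "of_hat e \<phi> = (\<Sum>m\<in>mons e. Poly_Mapping.single m (\<phi> m / mfact m))"

lemma lookup_of_hat: "Poly_Mapping.lookup (of_hat e \<phi>) m = (if mdeg m = e then \<phi> m / mfact m else 0)"
  unfolding of_hat_def lookup_sum lookup_single by (simp add: when_def if_distrib cong: if_cong)

lemma hat_of_hat: "hat (of_hat e \<phi>) m = (if mdeg m = e then \<phi> m else 0)"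
  by (simp add: hat_def lookup_of_hat)

lemma of_hat_forms: "of_hat e \<phi> \<in> forms e"
  by (simp add: forms_lookup lookup_of_hat)

text \<open>Tables of divided power coefficients; the first index is the exponent of \<open>y\<^sub>3\<close>, the second that of \<open>y\<^sub>2\<close>.\<close>

definition hpol :: "nat \<Rightarrow> (nat \<Rightarrow> nat \<Rightarrow> 'k) \<Rightarrow> 'k::field_char_0 poly3" where
  "hpol e \<phi> = of_hat e (\<lambda>m. \<phi> (Poly_Mapping.lookup m 2) (Poly_Mapping.lookup m 1))"

lemma hpol_forms: "hpol e \<phi> \<in> forms e"
  by (simp add: hpol_def of_hat_forms)

lemma hat_hpol: "hat (hpol e \<phi>) (mon3 i k j) = (if i + k + j = e then \<phi> j k else 0)"
  by (simp add: hpol_def hat_of_hat)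

lemma hpol_zero: "hpol e (\<lambda>_ _. 0) = 0"
proof -
  have "hat (hpol e (\<lambda>_ _. 0)) m = hat 0 m" for m by (rule mon3_cases[of m]) (simp add: hat_hpol)
  then show ?thesis unfolding hat_inject by blast
qed

text \<open>The solution of \<open>(a x\<^sub>1 + b x\<^sub>2 + x\<^sub>3) \<circ> F = K\<close> with prescribed coefficients \<open>g\<close> on the monomials
  free of \<open>y\<^sub>3\<close>.\<close>

primrec tab :: "'k::comm_ring_1 \<Rightarrow> 'k \<Rightarrow> (nat \<Rightarrow> 'k) \<Rightarrow> (nat \<Rightarrow> nat \<Rightarrow> 'k) \<Rightarrow> nat \<Rightarrow> nat \<Rightarrow> 'k" where
  "tab a b g K 0 k = g k"
| "tab a b g K (Suc j) k = K j k - a * tab a b g K j k - b * tab a b g K j (Suc k)"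

lemma act_hpol:
  assumes "c 2 = 1" shows "lform c \<circ>\<^sub>d hpol (Suc e) (tab (c 0) (c 1) g K) = hpol e K"
proof -
  have "hat (lform c \<circ>\<^sub>d hpol (Suc e) (tab (c 0) (c 1) g K)) m = hat (hpol e K) m" for m
    by (rule mon3_cases[of m]) (simp add: hat_lform3 hat_hpol assms)
  then show ?thesis unfolding hat_inject by blast
qed

text \<open>A linear form monic in x3 expresses coefficients of y3-exponent j + 1 through its image
  and coefficients of y3-exponent j, so the image and the part free of y3 determine F.\<close>

lemma act_lform_inject:
  assumes c: "c 2 = 1" and eq: "lform c \<circ>\<^sub>d F = lform c \<circ>\<^sub>d F'"
    and init: "\<And>i k. hat F (mon3 i k 0) = hat F' (mon3 i k 0)"
  shows "F = F'"
proof -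
  have "hat F (mon3 i k j) = hat F' (mon3 i k j)" for i k j
  proof (induction j arbitrary: i k)
    case (Suc j)
    have "hat (lform c \<circ>\<^sub>d F) (mon3 i k j) = hat (lform c \<circ>\<^sub>d F') (mon3 i k j)" by (simp add: eq)
    then show ?case unfolding hat_lform3 Suc c by simp
  qed (rule init)
  then have "hat F m = hat F' m" for m by (cases m rule: mon3_cases) simp
  then show ?thesis unfolding hat_inject by blast
qed

text \<open>Each step in the y3-exponent multiplies by a or b and raises the exponent bound by one;
  the bound \<open>2 + j\<close> on K fits the row \<open>Suc j\<close> that it feeds.\<close>

lemma tab_pfun:
  fixes a b :: "(nat \<Rightarrow> 'k::field) \<Rightarrow> 'k"
  assumes "a \<in> pfun n 1" "b \<in> pfun n 1" "\<And>k. (\<lambda>t. g t k) \<in> pfun n 1" "\<And>j k. (\<lambda>t. K t j k) \<in> pfun n (2 + j)"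
  shows "(\<lambda>t. tab (a t) (b t) (g t) (K t) j k) \<in> pfun n (1 + j)"
proof (induction j arbitrary: k)
  case (Suc j)
  have "(\<lambda>t. K t j k - a t * tab (a t) (b t) (g t) (K t) j k - b t * tab (a t) (b t) (g t) (K t) j (Suc k)) \<in> pfun n (2 + j)"
    using pf.mult[OF assms(1) Suc[of k]] pf.mult[OF assms(2) Suc[of "Suc k"]] by (intro pf.diff assms(4)) simp_all
  then show ?case by simp
qed (use assms(3) in simp)

lemma plucker_pfun:
  fixes \<phi> \<phi>' :: "(nat \<Rightarrow> 'k::field_char_0) \<Rightarrow> nat \<Rightarrow> nat \<Rightarrow> 'k"
  assumes "\<And>j k. (\<lambda>t. \<phi> t j k) \<in> pfun n (1 + j)" "\<And>j k. (\<lambda>t. \<phi>' t j k) \<in> pfun n (1 + j)"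
  shows "(\<lambda>t. plucker (hpol e (\<phi> t)) (hpol e (\<phi>' t)) i) \<in> pfun n ((1 + e) + (1 + e))"
proof -
  have *: "(\<lambda>t. Poly_Mapping.lookup (hpol e (\<phi> t)) m) \<in> pfun n (1 + e)"
    if "\<And>j k. (\<lambda>t. \<phi> t j k) \<in> pfun n (1 + j)" for \<phi> :: "(nat \<Rightarrow> 'k) \<Rightarrow> nat \<Rightarrow> nat \<Rightarrow> 'k" and m
  proof (cases "mdeg m = e")
    case True
    then have "1 + Poly_Mapping.lookup m 2 \<le> 1 + e" by (simp add: mdeg_3)
    from pfun_mono[OF this] that have "(\<lambda>t. \<phi> t (Poly_Mapping.lookup m 2) (Poly_Mapping.lookup m 1)) \<in> pfun n (1 + e)" by blast
    from pf.scale[OF this, of "inverse (mfact m)"] show ?thesis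
      using True by (simp add: hpol_def lookup_of_hat divide_inverse mult.commute)
  next
    case False
    then show ?thesis by (simp add: hpol_def lookup_of_hat pf.zero)
  qed
  obtain m m' where i: "i = (m, m')" by (cases i)
  show ?thesis unfolding i plucker_def prod.case
    by (intro pf.diff pf.mult * assms)
qed

text \<open>The \<open>3 e + 3\<close> parameters are, in this order, the \<open>y\<^sub>3\<close>-free coefficients of \<open>F\<close>, of \<open>G\<close> and of
  \<open>l\<^sub>1 \<circ> G\<close>, normalized to start with \<open>1\<close>, \<open>0\<close> and \<open>1\<close>, followed by two coefficients of \<open>l\<^sub>2\<close> and two
  of \<open>l\<^sub>1\<close>, both monic in \<open>x\<^sub>3\<close>.\<close>

definition tf :: "nat \<Rightarrow> (nat \<Rightarrow> 'k) \<Rightarrow> nat \<Rightarrow> 'k::comm_ring_1" where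
  "tf e t k = (if k = 0 then 1 else if k \<le> e then t (k - 1) else 0)"

definition tg :: "nat \<Rightarrow> (nat \<Rightarrow> 'k) \<Rightarrow> nat \<Rightarrow> 'k::comm_ring_1" where
  "tg e t k = (if k = 0 \<or> e < k then 0 else t (e + k - 1))"

definition th :: "nat \<Rightarrow> (nat \<Rightarrow> 'k) \<Rightarrow> nat \<Rightarrow> 'k::comm_ring_1" where
  "th e t k = (if k = 0 then 1 else if k < e then t (2 * e + k - 1) else 0)"

definition cfst :: "nat \<Rightarrow> (nat \<Rightarrow> 'k) \<Rightarrow> 3 \<Rightarrow> 'k::comm_ring_1" where
  "cfst e t i = (if i = 0 then t (3 * e + 1) else if i = 1 then t (3 * e + 2) else 1)"

definition csnd :: "nat \<Rightarrow> (nat \<Rightarrow> 'k) \<Rightarrow> 3 \<Rightarrow> 'k::comm_ring_1" where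
  "csnd e t i = (if i = 0 then t (3 * e - 1) else if i = 1 then t (3 * e) else 1)"

definition tabF :: "nat \<Rightarrow> (nat \<Rightarrow> 'k) \<Rightarrow> nat \<Rightarrow> nat \<Rightarrow> 'k::comm_ring_1" where
  "tabF e t = tab (t (3 * e + 1)) (t (3 * e + 2)) (tf e t) (\<lambda>_ _. 0)"

definition tabH :: "nat \<Rightarrow> (nat \<Rightarrow> 'k) \<Rightarrow> nat \<Rightarrow> nat \<Rightarrow> 'k::comm_ring_1" where
  "tabH e t = tab (t (3 * e - 1)) (t (3 * e)) (th e t) (\<lambda>_ _. 0)"

definition tabG :: "nat \<Rightarrow> (nat \<Rightarrow> 'k) \<Rightarrow> nat \<Rightarrow> nat \<Rightarrow> 'k::comm_ring_1" where
  "tabG e t = tab (t (3 * e + 1)) (t (3 * e + 2)) (tg e t) (tabH e t)"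

definition parF :: "nat \<Rightarrow> (nat \<Rightarrow> 'k) \<Rightarrow> 'k::field_char_0 poly3" where
  "parF e t = hpol e (tabF e t)"

definition parG :: "nat \<Rightarrow> (nat \<Rightarrow> 'k) \<Rightarrow> 'k::field_char_0 poly3" where
  "parG e t = hpol e (tabG e t)"

lemma cfst_simps: "cfst e t 0 = t (3 * e + 1)" "cfst e t 1 = t (3 * e + 2)" "cfst e t 2 = 1"
  and csnd_simps: "csnd e t 0 = t (3 * e - 1)" "csnd e t 1 = t (3 * e)" "csnd e t 2 = 1"
  by (simp_all add: cfst_def csnd_def distinct_3)

text \<open>The substitution \<tau> makes the bound available for the full parameter space and for
  its coordinate faces.\<close>

lemma plucker_par_pfun:
  fixes \<tau> :: "(nat \<Rightarrow> 'k::field_char_0) \<Rightarrow> nat \<Rightarrow> 'k"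
  assumes "e > 0" and \<tau>: "\<And>i. i < 3 * e + 3 \<Longrightarrow> (\<lambda>t. \<tau> t i) \<in> pfun n 1"
  shows "(\<lambda>t. plucker (parF e (\<tau> t)) (parG e (\<tau> t)) i) \<in> pfun n ((1 + e) + (1 + e))"
proof -
  have init: "(\<lambda>t. tf e (\<tau> t) k) \<in> pfun n 1" "(\<lambda>t. tg e (\<tau> t) k) \<in> pfun n 1" "(\<lambda>t. th e (\<tau> t) k) \<in> pfun n 1" for k
  proof -
    have one: "(\<lambda>t. 1) \<in> pfun n 1" using pfun_mono[of 0 1 n] pf.const[of 1 n] by auto
    have i: "k \<le> e \<Longrightarrow> (\<lambda>t. \<tau> t (k - 1)) \<in> pfun n 1" "k \<le> e \<Longrightarrow> (\<lambda>t. \<tau> t (e + k - 1)) \<in> pfun n 1"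
      "k < e \<Longrightarrow> (\<lambda>t. \<tau> t (2 * e + k - 1)) \<in> pfun n 1"
      by (rule \<tau>, use assms(1) in simp)+
    show "(\<lambda>t. tf e (\<tau> t) k) \<in> pfun n 1"
      using i one pf.zero[of n 1] by (cases "k = 0"; cases "k \<le> e") (simp_all add: tf_def)
    show "(\<lambda>t. tg e (\<tau> t) k) \<in> pfun n 1"
      using i pf.zero[of n 1] by (cases "k = 0"; cases "e < k") (simp_all add: tg_def)
    show "(\<lambda>t. th e (\<tau> t) k) \<in> pfun n 1"
      using i one pf.zero[of n 1] by (cases "k = 0"; cases "k < e") (simp_all add: th_def)
  qed
  have coord: "(\<lambda>t. \<tau> t (3 * e + 1)) \<in> pfun n 1" "(\<lambda>t. \<tau> t (3 * e + 2)) \<in> pfun n 1" "(\<lambda>t. \<tau> t (3 * e - 1)) \<in> pfun n 1"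
    "(\<lambda>t. \<tau> t (3 * e)) \<in> pfun n 1" by (rule \<tau>, simp)+
  have H: "(\<lambda>t. tabH e (\<tau> t) j k) \<in> pfun n (1 + j)" for j k
    unfolding tabH_def by (rule tab_pfun) (intro coord init pf.zero)+
  have "(\<lambda>t. tabH e (\<tau> t) j k) \<in> pfun n (2 + j)" for j k
    using H pfun_mono[of "1 + j" "2 + j" n] by auto
  then have "(\<lambda>t. tabG e (\<tau> t) j k) \<in> pfun n (1 + j)" for j k
    unfolding tabG_def by (intro tab_pfun coord init)
  moreover have "(\<lambda>t. tabF e (\<tau> t) j k) \<in> pfun n (1 + j)" for j k
    unfolding tabF_def by (rule tab_pfun) (intro coord init pf.zero)+
  ultimately show ?thesis unfolding parF_def parG_def by (intro plucker_pfun)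
qed

lemma act_parF: "e > 0 \<Longrightarrow> lform (cfst e t) \<circ>\<^sub>d parF e t = 0"
  using act_hpol[of "cfst e t" "e - 1" "tf e t" "\<lambda>_ _. 0"]
  by (simp add: parF_def tabF_def cfst_simps hpol_zero)

lemma act_parG: "e > 0 \<Longrightarrow> lform (cfst e t) \<circ>\<^sub>d parG e t = hpol (e - 1) (tabH e t)"
  using act_hpol[of "cfst e t" "e - 1" "tg e t" "tabH e t"]
  by (simp add: parG_def tabG_def cfst_simps)

lemma act_parH: "lform (csnd e t) \<circ>\<^sub>d hpol (e - 1) (tabH e t) = 0"
proof (cases "e - 1")
  case 0
  then show ?thesis
    using act_forms_eq_0[OF lform_forms[of "csnd e t"] hpol_forms[of "e - 1" "tabH e t"]] by simp
next
  case (Suc n)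
  show ?thesis unfolding Suc tabH_def
    using act_hpol[of "csnd e t" n "th e t" "\<lambda>_ _. 0"] by (simp add: csnd_simps hpol_zero)
qed

text \<open>\<open>l1\<close> kills F and sends G to a form with leading coefficient 1, which forces
  b = 0; the leading coefficient 1 of F then forces a = 0.\<close>

lemma par_indep2:
  assumes "e > 0" shows "indep2 (parF e t) (parG e t)"
  unfolding indep2_def
proof (intro allI impI)
  fix a b assume ab: "scale a (parF e t) + scale b (parG e t) = 0"
  then have "lform (cfst e t) \<circ>\<^sub>d (scale a (parF e t) + scale b (parG e t)) = 0" by simp
  then have "scale b (hpol (e - 1) (tabH e t)) = 0"
    unfolding act_add_right act_scale_right act_parF[OF assms] act_parG[OF assms] sc.scale_zero_right add_0_left .
  then have "hat (scale b (hpol (e - 1) (tabH e t))) (mon3 (e - 1) 0 0) = 0" by (simp only: hat_zero)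
  then have b: "b = 0" by (simp add: hat_scale hat_hpol tabH_def th_def)
  then have "scale a (parF e t) = 0" using ab by (simp only: sc.scale_zero_left add_0_right)
  then have "hat (scale a (parF e t)) (mon3 e 0 0) = 0" by (simp only: hat_zero)
  then show "a = 0 \<and> b = 0" using b by (simp add: hat_scale parF_def hat_hpol tabF_def tf_def)
qed

lemma par_family:
  assumes "e > 0" shows "sc.span {parF e t, parG e t} \<in> family e"
proof -
  have forms: "parF e t \<in> forms e" "parG e t \<in> forms e" by (simp_all add: parF_def parG_def hpol_forms)
  have nz: "lform (cfst e t) \<in> forms 1 - {0}" "lform (csnd e t) \<in> forms 1 - {0}"
    using lform_forms[of "cfst e t"] lform_forms[of "csnd e t"] cfst_simps(3)[of e t] csnd_simps(3)[of e t]
    by (simp_all add: lform_eq_0) (metis zero_neq_one)+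
  have "(lform (cfst e t) * lform (csnd e t)) \<circ>\<^sub>d parG e t = 0"
    unfolding act_mult act_commute[of "lform (cfst e t)"] act_parG[OF assms] act_parH ..
  moreover have "sc.span {parF e t, parG e t} \<in> grassmannian e"
    unfolding grassmannian_iff using forms par_indep2[OF assms] by blast
  ultimately show ?thesis unfolding family_def using forms nz act_parF[OF assms] by blast
qed

subsection \<open>Density of the parametrized planes\<close>

lemma hpol_unique:
  fixes F :: "'k::field_char_0 poly3"
  assumes "F \<in> forms e" "l = lform c" "c 2 = 1" "l \<circ>\<^sub>d F = hpol (e - 1) K"
    and "\<And>k. k \<le> e \<Longrightarrow> hat F (mon3 (e - k) k 0) = g k" and "e > 0"
  shows "F = hpol e (tab (c 0) (c 1) g K)"
proof (rule act_lform_inject[where c = c, OF assms(3)])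
  show "lform c \<circ>\<^sub>d F = lform c \<circ>\<^sub>d hpol e (tab (c 0) (c 1) g K)"
    using act_hpol[of c "e - 1" g K] assms by simp
  show "hat F (mon3 i k 0) = hat (hpol e (tab (c 0) (c 1) g K)) (mon3 i k 0)" for i k
    using assms(1) assms(5)[of k] by (auto simp: hat_hpol forms_hat)
qed

text \<open>If F and \<open>l1 \<circ>\<^sub>d G\<close> contain the pure power of y1, a change of
  basis of the plane reaches the normalization of the parametrization, and p changes only by a power
  of the determinant.\<close>

lemma vanishes_normalized:
  fixes F G :: "'k::field_char_0 poly3"
  assumes e: "e > 0" and p: "p \<in> hfun D" and van: "\<And>t. p (plucker (parF e t) (parG e t)) = 0"
    and F: "F \<in> forms e" "lform c \<circ>\<^sub>d F = 0" and G: "G \<in> forms e" "lform c' \<circ>\<^sub>d lform c \<circ>\<^sub>d G = 0"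
    and c: "c 2 = 1" "c' 2 = 1"
    and nz: "hat F (mon3 e 0 0) \<noteq> 0" "hat (lform c \<circ>\<^sub>d G) (mon3 (e - 1) 0 0) \<noteq> 0"
  shows "p (plucker F G) = 0"
proof -
  define f0 where "f0 = hat F (mon3 e 0 0)"
  define g0 where "g0 = hat G (mon3 e 0 0)"
  define h0 where "h0 = hat (lform c \<circ>\<^sub>d G) (mon3 (e - 1) 0 0)"
  have nz': "f0 \<noteq> 0" "h0 \<noteq> 0" using nz by (simp_all add: f0_def h0_def)
  define F' where "F' = scale (1 / f0) F + scale 0 G"
  define G' where "G' = scale (- g0 / f0 / h0) F + scale (1 / h0) G"
  have F': "F' \<in> forms e" "lform c \<circ>\<^sub>d F' = 0" "hat F' (mon3 e 0 0) = 1"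
    using F nz' by (simp_all add: F'_def forms_scale act_scale_right hat_scale f0_def)
  have lG': "lform c \<circ>\<^sub>d G' = scale (1 / h0) (lform c \<circ>\<^sub>d G)"
    unfolding G'_def act_add_right act_scale_right F(2) by simp
  have G': "G' \<in> forms e" "lform c' \<circ>\<^sub>d lform c \<circ>\<^sub>d G' = 0" "hat G' (mon3 e 0 0) = 0"
      "hat (lform c \<circ>\<^sub>d G') (mon3 (e - 1) 0 0) = 1"
  proof -
    show "G' \<in> forms e" unfolding G'_def by (intro forms_add forms_scale F G)
    show "lform c' \<circ>\<^sub>d lform c \<circ>\<^sub>d G' = 0" unfolding lG' act_scale_right G by simp
    show "hat G' (mon3 e 0 0) = 0" using nz' unfolding G'_def hat_add hat_scale f0_def[symmetric] g0_def[symmetric] by simp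
    show "hat (lform c \<circ>\<^sub>d G') (mon3 (e - 1) 0 0) = 1" unfolding lG' hat_scale h0_def[symmetric] using nz' by simp
  qed
  \<comment> \<open>Parameters are read off in the order fixed for \<open>tf\<close>,
    \<open>tg\<close>, \<open>th\<close>, \<open>csnd\<close> and \<open>cfst\<close>; the final
    branch is index 3 e + 2.\<close>
  define t where "t i = (if i < e then hat F' (mon3 (e - (i + 1)) (i + 1) 0)
    else if i < 2 * e then hat G' (mon3 (e - (i + 1 - e)) (i + 1 - e) 0)
    else if i < 3 * e - 1 then hat (lform c \<circ>\<^sub>d G') (mon3 (e - 1 - (i + 1 - 2 * e)) (i + 1 - 2 * e) 0)
    else if i = 3 * e - 1 then c' 0 else if i = 3 * e then c' 1 else if i = 3 * e + 1 then c 0 else c 1)" for i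
  have tc: "t (3 * e - 1) = c' 0" "t (3 * e) = c' 1" "t (3 * e + 1) = c 0" "t (3 * e + 2) = c 1"
  proof -
    have "\<not> 3 * e - 1 < e" "\<not> 3 * e - 1 < 2 * e" "\<not> 3 * e < 3 * e - 1" "3 * e \<noteq> 3 * e - 1"
      "\<not> 3 * e + 1 < 3 * e - 1" "3 * e + 1 \<noteq> 3 * e - 1" "\<not> 3 * e + 2 < 3 * e - 1" "3 * e + 2 \<noteq> 3 * e - 1"
      using e by arith+
    then show "t (3 * e - 1) = c' 0" "t (3 * e) = c' 1" "t (3 * e + 1) = c 0" "t (3 * e + 2) = c 1"
      unfolding t_def by simp_all
  qed
  have "F' = parF e t"
    unfolding parF_def tabF_def tc
  proof (rule hpol_unique[where c = c, OF F'(1) refl c(1) _ _ e])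
    show "lform c \<circ>\<^sub>d F' = hpol (e - 1) (\<lambda>_ _. 0)" using F' by (simp add: hpol_zero)
    show "hat F' (mon3 (e - k) k 0) = tf e t k" if "k \<le> e" for k
      using that F' by (cases k) (simp_all add: tf_def t_def)
  qed
  have H: "lform c \<circ>\<^sub>d G' = hpol (e - 1) (tabH e t)"
  proof (cases "e = 1")
    case False
    show ?thesis unfolding tabH_def tc
    proof (rule hpol_unique[where c = c', OF _ refl c(2)])
      show "lform c \<circ>\<^sub>d G' \<in> forms (e - 1)" by (rule act_forms[OF lform_forms G'(1)])
      show "lform c' \<circ>\<^sub>d lform c \<circ>\<^sub>d G' = hpol (e - 1 - 1) (\<lambda>_ _. 0)" using G' by (simp add: hpol_zero)
      show "hat (lform c \<circ>\<^sub>d G') (mon3 (e - 1 - k) k 0) = th e t k" if "k \<le> e - 1" for k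
        using that G' e by (cases k) (auto simp add: th_def t_def)
      show "e - 1 > 0" using False e by simp
    qed
  next
    case True
    \<comment> \<open>For e = 1 this form is a constant, out of reach of \<open>hpol_unique\<close>,
      and equals its normalized value 1.\<close>
    have "hat (lform c \<circ>\<^sub>d G') m = hat (hpol 0 (tabH e t)) m" for m
    proof (cases "mdeg m = 0")
      case m: True
      then have "m = mon3 0 0 0" by (simp add: mon3_def)
      then show ?thesis using G'(4) True by (simp add: hat_hpol tabH_def th_def)
    next
      case False
      then show ?thesis using act_forms[OF lform_forms G'(1), of c] hpol_forms[of 0 "tabH e t"] True by (simp add: forms_hat)
    qed
    then show ?thesis unfolding hat_inject by (simp add: True)
  qed
  have "G' = parG e t"
    unfolding parG_def tabG_def tc
  proof (rule hpol_unique[where c = c, OF G'(1) refl c(1) H _ e])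
    show "hat G' (mon3 (e - k) k 0) = tg e t k" if "k \<le> e" for k
      using that G' by (cases k) (simp_all add: tg_def t_def)
  qed
  then have "p (plucker F' G') = 0" using van[of t] \<open>F' = parF e t\<close> by simp
  then have "((1 / f0) * (1 / h0) - 0 * (- g0 / f0 / h0)) ^ D * p (plucker F G) = 0"
    unfolding F'_def G'_def plucker_combination hfun_homogeneous[OF p] .
  then show ?thesis using nz' by simp
qed

lemma plucker_curve:
  assumes "\<And>m. \<exists>q. \<forall>u. Poly_Mapping.lookup (F u) m = poly q u" "\<And>m. \<exists>q. \<forall>u. Poly_Mapping.lookup (G u) m = poly q (u :: 'k::field)"
  shows "\<exists>q. \<forall>u. plucker (F u) (G u) i = poly q u"
proof -
  obtain q where q: "\<And>m u. Poly_Mapping.lookup (F u) m = poly (q m) u" using assms(1) by metis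
  obtain r where r: "\<And>m u. Poly_Mapping.lookup (G u) m = poly (r m) u" using assms(2) by metis
  show ?thesis
    by (rule exI[of _ "q (fst i) * r (snd i) - q (snd i) * r (fst i)"]) (simp add: plucker_def q r split: prod.split)
qed

text \<open>Along the curve p is a polynomial in u; vanishing off the roots of r makes it zero, in
  particular at u = 0.\<close>

lemma vanishes_cofinite:
  fixes F G :: "'k::field_char_0 \<Rightarrow> 'k poly3"
  assumes p: "p \<in> hfun D"
    and "\<And>m. \<exists>q. \<forall>u. Poly_Mapping.lookup (F u) m = poly q u" "\<And>m. \<exists>q. \<forall>u. Poly_Mapping.lookup (G u) m = poly q u"
    and r: "r \<noteq> 0" "\<And>u. poly r u \<noteq> 0 \<Longrightarrow> p (plucker (F u) (G u)) = 0"
  shows "p (plucker (F 0) (G 0)) = 0"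
proof -
  have "\<exists>q. \<forall>u. p (plucker (F u) (G u)) = poly q u"
    by (rule hfun_curve[OF p]) (rule plucker_curve[OF assms(2,3)])
  then obtain q where q: "\<forall>u. p (plucker (F u) (G u)) = poly q u" by blast
  have "q = 0"
  proof (rule poly_vanishing_cofinite[OF _ r(1)])
    fix u assume "poly r u \<noteq> 0"
    then show "poly q u = 0" using r(2) spec[OF q, of u] by metis
  qed
  then show ?thesis using spec[OF q, of 0] by simp
qed

text \<open>F and G are moved in the direction of a normalized pair F1, G1 for the same linear
  forms; all but finitely many points of this line satisfy the nonvanishing conditions of
  \<open>vanishes_normalized\<close>.\<close>

lemma vanishes_monic:
  fixes F G :: "'k::field_char_0 poly3"
  assumes e: "e > 0" and p: "p \<in> hfun D" and van: "\<And>t. p (plucker (parF e t) (parG e t)) = 0"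
    and F: "F \<in> forms e" "lform c \<circ>\<^sub>d F = 0" and G: "G \<in> forms e" "lform c' \<circ>\<^sub>d lform c \<circ>\<^sub>d G = 0"
    and c: "c 2 = 1" "c' 2 = 1"
  shows "p (plucker F G) = 0"
proof -
  define d where "d k = (if k = 0 then 1 else 0 :: 'k)" for k :: nat
  define F1 where "F1 = hpol e (tab (c 0) (c 1) d (\<lambda>_ _. 0))"
  define H1 where "H1 = hpol (e - 1) (tab (c' 0) (c' 1) d (\<lambda>_ _. 0))"
  define G1 where "G1 = hpol e (tab (c 0) (c 1) (\<lambda>_. 0) (tab (c' 0) (c' 1) d (\<lambda>_ _. 0)))"
  have F1: "F1 \<in> forms e" "lform c \<circ>\<^sub>d F1 = 0" "hat F1 (mon3 e 0 0) = 1"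
    using act_hpol[of c "e - 1" d "\<lambda>_ _. 0"] e c by (simp_all add: F1_def hpol_forms hpol_zero hat_hpol d_def)
  have G1: "G1 \<in> forms e" "lform c \<circ>\<^sub>d G1 = H1" 
    using act_hpol[of c "e - 1" "\<lambda>_. 0" "tab (c' 0) (c' 1) d (\<lambda>_ _. 0)"] e c
    by (simp_all add: G1_def H1_def hpol_forms)
  have H1: "lform c' \<circ>\<^sub>d H1 = 0" "hat H1 (mon3 (e - 1) 0 0) = 1"
  proof -
    show "lform c' \<circ>\<^sub>d H1 = 0"
    proof (cases "e - 1")
      case 0
      then show ?thesis using act_forms_eq_0[OF lform_forms[of c'] hpol_forms[of "e - 1"]] by (simp add: H1_def)
    next
      case (Suc n)
      show ?thesis unfolding H1_def Suc act_hpol[of c' n, OF c(2)] by (rule hpol_zero)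
    qed
  qed (simp add: H1_def hat_hpol d_def)
  have "p (plucker (F + scale 0 F1) (G + scale 0 G1)) = 0"
  proof (rule vanishes_cofinite[OF p])
    show "\<exists>q. \<forall>u. Poly_Mapping.lookup (F + scale u F1) m = poly q u" for m
      by (rule exI[of _ "[: Poly_Mapping.lookup F m, Poly_Mapping.lookup F1 m :]"]) (simp add: lookup_add)
    show "\<exists>q. \<forall>u. Poly_Mapping.lookup (G + scale u G1) m = poly q u" for m
      by (rule exI[of _ "[: Poly_Mapping.lookup G m, Poly_Mapping.lookup G1 m :]"]) (simp add: lookup_add)
    show "[: hat F (mon3 e 0 0), 1 :] * [: hat (lform c \<circ>\<^sub>d G) (mon3 (e - 1) 0 0), 1 :] \<noteq> 0" by simp
    fix u assume "poly ([: hat F (mon3 e 0 0), 1 :] * [: hat (lform c \<circ>\<^sub>d G) (mon3 (e - 1) 0 0), 1 :]) u \<noteq> 0"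
    then have u0: "poly [: hat F (mon3 e 0 0), 1 :] u \<noteq> 0" "poly [: hat (lform c \<circ>\<^sub>d G) (mon3 (e - 1) 0 0), 1 :] u \<noteq> 0"
      unfolding poly_mult by simp_all
    then have u: "hat F (mon3 e 0 0) + u \<noteq> 0" "hat (lform c \<circ>\<^sub>d G) (mon3 (e - 1) 0 0) + u \<noteq> 0" by simp_all
    show "p (plucker (F + scale u F1) (G + scale u G1)) = 0"
    proof (rule vanishes_normalized[where c = c and c' = c', OF e p van _ _ _ _ c])
      show "F + scale u F1 \<in> forms e" "G + scale u G1 \<in> forms e" by (intro forms_add forms_scale F G F1 G1)+
      show "lform c \<circ>\<^sub>d (F + scale u F1) = 0" using F F1 by (simp add: act_add_right act_scale_right)
      show "lform c' \<circ>\<^sub>d lform c \<circ>\<^sub>d (G + scale u G1) = 0"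
        unfolding act_add_right act_scale_right G1 G H1 by simp
      show "hat (F + scale u F1) (mon3 e 0 0) \<noteq> 0" using u F1 by (simp add: hat_add hat_scale)
      show "hat (lform c \<circ>\<^sub>d (G + scale u G1)) (mon3 (e - 1) 0 0) \<noteq> 0"
        unfolding act_add_right act_scale_right G1 hat_add hat_scale H1 using u by simp
    qed
  qed
  then show ?thesis by simp
qed

text \<open>\<open>shear v t e\<close> is the substitution \<open>y\<^sub>3 \<mapsto> y\<^sub>3 + t (y\<^sub>1 + v y\<^sub>2)\<close>; on \<open>R\<close> its transpose sends
  \<open>x\<^sub>1, x\<^sub>2\<close> to \<open>x\<^sub>1 + t x\<^sub>3, x\<^sub>2 + t v x\<^sub>3\<close>.\<close>

definition shear_mon :: "'k::field_char_0 \<Rightarrow> 'k \<Rightarrow> 3 mon \<Rightarrow> 'k poly3" where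
  "shear_mon v t m = (monf (mon3 1 0 0) + scale t (monf (mon3 0 0 1))) ^ Poly_Mapping.lookup m 0 *
     (monf (mon3 0 1 0) + scale (t * v) (monf (mon3 0 0 1))) ^ Poly_Mapping.lookup m 1 *
     monf (mon3 0 0 1) ^ Poly_Mapping.lookup m 2"

definition shear :: "'k::field_char_0 \<Rightarrow> 'k \<Rightarrow> nat \<Rightarrow> 'k poly3 \<Rightarrow> 'k poly3" where
  "shear v t e F = of_hat e (\<lambda>m. pair (shear_mon v t m) (hat F))"

lemma shear_mon_add: "shear_mon v t (m + n) = shear_mon v t m * shear_mon v t n"
  by (simp add: shear_mon_def lookup_add power_add mult_ac)

lemma shear_mon_forms: "shear_mon v t m \<in> forms (mdeg m)"
proof -
  have "shear_mon v t m \<in> forms (Poly_Mapping.lookup m 0 * 1 + Poly_Mapping.lookup m 1 * 1 + Poly_Mapping.lookup m 2 * 1)"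
    unfolding shear_mon_def by (intro forms_mult forms_power forms_add forms_scale) simp_all
  then show ?thesis by (simp add: mdeg_3)
qed

lemma hat_shear:
  assumes "F \<in> forms e" shows "hat (shear v t e F) m = pair (shear_mon v t m) (hat F)"
proof (cases "mdeg m = e")
  case False
  have "pair (shear_mon v t m) (hat F) = pair (shear_mon v t m) (\<lambda>_. 0)"
  proof (rule pair_cong)
    fix n assume "n \<in> Poly_Mapping.keys (shear_mon v t m)"
    then have "mdeg n = mdeg m" by (rule forms_keys[OF shear_mon_forms])
    then show "hat F n = 0" using False assms by (simp add: forms_hat)
  qed
  then show ?thesis using False by (simp add: shear_def hat_of_hat)
qed (simp add: shear_def hat_of_hat)

lemma shear_forms: "shear v t e F \<in> forms e"
  by (simp add: shear_def of_hat_forms)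

lemma monf_power:
  "monf (mon3 1 0 0) ^ n = monf (mon3 n 0 0)" "monf (mon3 0 1 0) ^ n = monf (mon3 0 n 0)"
  "monf (mon3 0 0 1) ^ n = monf (mon3 0 0 n)"
proof -
  have one: "monf (mon3 0 0 0) = 1" by (simp add: monf_def mon3_def)
  show "monf (mon3 1 0 0) ^ n = monf (mon3 n 0 0)" "monf (mon3 0 1 0) ^ n = monf (mon3 0 n 0)"
    "monf (mon3 0 0 1) ^ n = monf (mon3 0 0 n)"
    by (induction n) (simp_all add: one monf_mult mon3_add)
qed

lemma shear_0:
  assumes "F \<in> forms e" shows "shear v 0 e F = F"
proof -
  have "hat (shear v 0 e F) m = hat F m" for m
  proof (cases m rule: mon3_cases)
    case (1 i j k)
    have "shear_mon v 0 m = monf m" by (simp add: 1 shear_mon_def monf_power[simplified] monf_mult mon3_add)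
    then show ?thesis using hat_shear[OF assms] by (simp add: monf_def)
  qed
  then show ?thesis unfolding hat_inject by blast
qed

text \<open>Compatibility of the substitution with contraction: contracting after it with the
  adjusted x3-coefficient equals contracting before it with c.\<close>

lemma shear_shift:
  fixes \<phi> :: "3 mon \<Rightarrow> 'k::field_char_0"
  shows "(\<Sum>i\<in>UNIV. (if i = 2 then c 2 - t * (c 0 + v * c 1) else c i) *
      pair (shear_mon v t (Poly_Mapping.single i 1 + n)) \<phi>) =
    pair (shear_mon v t n) (\<lambda>m. \<Sum>i\<in>UNIV. c i * \<phi> (Poly_Mapping.single i 1 + m))"
proof -
  define x y z where xyz: "x = Poly_Mapping.single (0::3) (1::nat)" "y = Poly_Mapping.single (1::3) (1::nat)"
    "z = Poly_Mapping.single (2::3) (1::nat)"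
  have s: "shear_mon v t x = monf x + scale t (monf z)" "shear_mon v t y = monf y + scale (t * v) (monf z)"
    "shear_mon v t z = monf z"
    by (simp_all add: shear_mon_def mon3_def xyz lookup_single when_def distinct_3)
  define S where "S w = pair (shear_mon v t n) (\<lambda>m. \<phi> (w + m))" for w
  have monf: "pair (monf w * shear_mon v t n) \<phi> = S w" for w
    by (simp add: pair_mult monf_def S_def)
  have p: "pair (shear_mon v t (x + n)) \<phi> = S x + t * S z" "pair (shear_mon v t (y + n)) \<phi> = S y + t * v * S z"
    "pair (shear_mon v t (z + n)) \<phi> = S z"
    unfolding shear_mon_add s by (simp_all add: distrib_right pair_add scale_mult_left pair_scale monf)
  have "pair (shear_mon v t n) (\<lambda>m. \<Sum>i\<in>UNIV. c i * \<phi> (Poly_Mapping.single i 1 + m)) = c 0 * S x + c 1 * S y + c 2 * S z"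
    by (simp add: sum_3 pair_add_right pair_mult_right S_def xyz)
  moreover have "(\<Sum>i\<in>UNIV. (if i = 2 then c 2 - t * (c 0 + v * c 1) else c i) *
      pair (shear_mon v t (Poly_Mapping.single i 1 + n)) \<phi>) =
      c 0 * (S x + t * S z) + c 1 * (S y + t * v * S z) + (c 2 - t * (c 0 + v * c 1)) * S z"
    unfolding sum_3 xyz(1)[symmetric] xyz(2)[symmetric] xyz(3)[symmetric] p by (simp add: distinct_3)
  ultimately show ?thesis by (simp add: algebra_simps)
qed

definition shear_coeff :: "'k::field_char_0 \<Rightarrow> 'k \<Rightarrow> (3 \<Rightarrow> 'k) \<Rightarrow> 3 \<Rightarrow> 'k" where
  "shear_coeff v t c i = (if i = 2 then c 2 - t * (c 0 + v * c 1) else c i)"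

lemma hat_act_shear:
  assumes "\<And>m. hat F' m = pair (shear_mon v t m) (hat F)"
  shows "hat (lform (shear_coeff v t c) \<circ>\<^sub>d F') m = pair (shear_mon v t m) (hat (lform c \<circ>\<^sub>d F))"
  unfolding hat_lform assms shear_coeff_def shear_shift ..

lemma shear_curve:
  assumes "F \<in> forms e" shows "\<exists>q. \<forall>t. Poly_Mapping.lookup (shear v t e F) m = poly q t"
proof -
  \<comment> \<open>Polynomial dependence on t is required against functionals that vary with t
    themselves; in this form it passes to products.\<close>
  define pol where "pol P \<longleftrightarrow> (\<forall>\<Phi>. (\<forall>m. \<exists>q. \<forall>t. \<Phi> t m = poly q t) \<longrightarrow> (\<exists>q. \<forall>t. pair (P t) (\<Phi> t) = poly q t))"
    for P :: "'a \<Rightarrow> 'a poly3"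
  have mult: "pol (\<lambda>t. P t * Q t)" if PQ: "pol P" "pol Q" for P Q
    unfolding pol_def
  proof (intro allI impI)
    fix \<Phi> :: "'a \<Rightarrow> 3 mon \<Rightarrow> 'a" assume \<Phi>: "\<forall>m. \<exists>q. \<forall>t. \<Phi> t m = poly q t"
    have "\<forall>m. \<exists>q. \<forall>t. pair (Q t) (\<lambda>n. \<Phi> t (m + n)) = poly q t"
    proof
      fix m
      have "\<forall>n. \<exists>q. \<forall>t. \<Phi> t (m + n) = poly q t" using \<Phi> by blast
      then show "\<exists>q. \<forall>t. pair (Q t) (\<lambda>n. \<Phi> t (m + n)) = poly q t"
        by (rule PQ(2)[unfolded pol_def, THEN spec, THEN mp])
    qed
    then have "\<exists>q. \<forall>t. pair (P t) (\<lambda>m. pair (Q t) (\<lambda>n. \<Phi> t (m + n))) = poly q t"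
      by (rule PQ(1)[unfolded pol_def, THEN spec, THEN mp])
    then show "\<exists>q. \<forall>t. pair (P t * Q t) (\<Phi> t) = poly q t" by (simp add: pair_mult)
  qed
  have one: "pol (\<lambda>t. 1)" by (simp add: pol_def)
  have pow: "pol (\<lambda>t. P t ^ n)" if "pol P" for P n
    by (induction n) (simp_all add: one mult that)
  have lin: "pol (\<lambda>t. monf m + scale (t * b) (monf n))" for b m n
    unfolding pol_def
  proof (intro allI impI)
    fix \<Phi> :: "'a \<Rightarrow> 3 mon \<Rightarrow> 'a" assume \<Phi>: "\<forall>m. \<exists>q. \<forall>t. \<Phi> t m = poly q t"
    obtain q where "\<And>t. \<Phi> t m = poly q t" using \<Phi> by blast
    moreover obtain r where "\<And>t. \<Phi> t n = poly r t" using \<Phi> by blast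
    ultimately show "\<exists>q. \<forall>t. pair (monf m + scale (t * b) (monf n)) (\<Phi> t) = poly q t"
      by (intro exI[of _ "q + [:0, b:] * r"]) (simp add: pair_add pair_scale monf_def)
  qed
  have "pol (\<lambda>t. monf (mon3 1 0 0) + scale t (monf (mon3 0 0 1)))" "pol (\<lambda>t. monf (mon3 0 0 1))"
    using lin[of "mon3 1 0 0" 1 "mon3 0 0 1"] lin[of "mon3 0 0 1" 0 "mon3 0 0 1"] by simp_all
  then have "pol (\<lambda>t. shear_mon v t m)" unfolding shear_mon_def by (intro mult pow lin)
  moreover have "\<forall>m. \<exists>q. \<forall>t :: 'a. hat F m = poly q t" by (intro allI exI[of _ "[:hat F _:]"]) simp
  ultimately have "\<exists>q. \<forall>t. pair (shear_mon v t m) (hat F) = poly q t"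
    unfolding pol_def by (elim allE[of _ "\<lambda>t. hat F"]) simp
  then obtain q where q: "\<And>t. pair (shear_mon v t m) (hat F) = poly q t" by blast
  show ?thesis
  proof (rule exI[of _ "smult (inverse (mfact m)) q"], rule allI)
    fix t
    have "mfact m * Poly_Mapping.lookup (shear v t e F) m = poly q t"
      using hat_shear[OF assms, of v t m] q by (simp add: hat_def)
    then show "Poly_Mapping.lookup (shear v t e F) m = poly (smult (inverse (mfact m)) q) t"
      using mfact_nonzero[of m, where 'a = 'a] by (simp add: field_simps)
  qed
qed

text \<open>For suitable v the shear makes the x3-coefficients of both linear forms nonzero for all
  but finitely many t. Rescaling reduces these t to the monic case, and t = 0 is the given
  plane.\<close>

lemma vanishes_family:
  fixes p :: "(3 mon \<times> 3 mon \<Rightarrow> 'k::field_char_0) \<Rightarrow> 'k"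
  assumes e: "e > 0" and p: "p \<in> hfun D" and van: "\<And>t. p (plucker (parF e t) (parG e t)) = 0"
  shows "vanishes p (family e)"
  unfolding vanishes_def
proof
  fix W :: "'k poly3 set" assume "W \<in> family e"
  then obtain F G l1 l2 where FG: "F \<in> forms e" "G \<in> forms e" "W = sc.span {F, G}" "W \<in> grassmannian e"
    "l1 \<in> forms 1" "l1 \<noteq> 0" "l2 \<in> forms 1" "l2 \<noteq> 0" "l1 \<circ>\<^sub>d F = 0" "(l1 * l2) \<circ>\<^sub>d G = 0"
    unfolding family_def by blast
  have ind: "indep2 F G" using FG(3,4) dim_span2[of F G] by (simp add: grassmannian_def)
  obtain c c' where l: "l1 = lform c" "l2 = lform c'" using lform_of_form FG(5,7) by blast
  have nz: "\<exists>i. c i \<noteq> 0" "\<exists>i. c' i \<noteq> 0" using FG(6,8) by (simp_all add: l lform_eq_0)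
  \<comment> \<open>If c 0 and c 1 are not both zero, at most one v has to be avoided; if both
    vanish, there is no condition on v.\<close>
  have dir: "\<exists>q. q \<noteq> 0 \<and> (\<forall>v. poly q v \<noteq> 0 \<longrightarrow> (c 0 \<noteq> 0 \<or> c 1 \<noteq> 0) \<longrightarrow> c 0 + v * c 1 \<noteq> 0)" for c :: "3 \<Rightarrow> 'k"
  proof (cases "c 0 \<noteq> 0 \<or> c 1 \<noteq> 0")
    case True
    then show ?thesis by (intro exI[of _ "[:c 0, c 1:]"]) auto
  next
    case False
    then show ?thesis by (intro exI[of _ 1]) auto
  qed
  obtain q where q: "q \<noteq> 0" "\<And>v. poly q v \<noteq> 0 \<Longrightarrow> (c 0 \<noteq> 0 \<or> c 1 \<noteq> 0) \<Longrightarrow> c 0 + v * c 1 \<noteq> 0" using dir[of c] by blast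
  obtain q' where q': "q' \<noteq> 0" "\<And>v. poly q' v \<noteq> 0 \<Longrightarrow> (c' 0 \<noteq> 0 \<or> c' 1 \<noteq> 0) \<Longrightarrow> c' 0 + v * c' 1 \<noteq> 0" using dir[of c'] by blast
  have "q * q' \<noteq> 0" using q q' by simp
  then obtain v where "poly (q * q') v \<noteq> 0" by (metis poly_all_0_iff_0)
  then have v: "(c 0 \<noteq> 0 \<or> c 1 \<noteq> 0) \<Longrightarrow> c 0 + v * c 1 \<noteq> 0" "(c' 0 \<noteq> 0 \<or> c' 1 \<noteq> 0) \<Longrightarrow> c' 0 + v * c' 1 \<noteq> 0"
    using q(2) q'(2) by auto
  have three: "c 2 \<noteq> 0 \<or> m \<noteq> 0" if c: "\<exists>i. c i \<noteq> 0" and m: "(c 0 \<noteq> 0 \<or> c 1 \<noteq> 0) \<Longrightarrow> m \<noteq> 0" for c :: "3 \<Rightarrow> 'k" and m :: 'k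
  proof -
    obtain i where i: "c i \<noteq> 0" using c by blast
    have "i = 0 \<or> i = 1 \<or> i = 2" using UNIV_3_eq by blast
    then show ?thesis using i m by auto
  qed
  have ne: "[:x, - m:] \<noteq> 0" if "x \<noteq> 0 \<or> m \<noteq> 0" for x m :: 'k
    using that by auto
  have "p (plucker (shear v 0 e F) (shear v 0 e G)) = 0"
  proof (rule vanishes_cofinite[OF p shear_curve[OF FG(1)] shear_curve[OF FG(2)]])
    show "[: c 2, - (c 0 + v * c 1) :] * [: c' 2, - (c' 0 + v * c' 1) :] \<noteq> 0"
      using ne[OF three[OF nz(1) v(1)]] ne[OF three[OF nz(2) v(2)]] by (simp only: mult_eq_0_iff simp_thms)
    fix t assume "poly ([: c 2, - (c 0 + v * c 1) :] * [: c' 2, - (c' 0 + v * c' 1) :]) t \<noteq> 0"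
    then have "poly [: c 2, - (c 0 + v * c 1) :] t \<noteq> 0" "poly [: c' 2, - (c' 0 + v * c' 1) :] t \<noteq> 0"
      unfolding poly_mult by simp_all
    then have t: "c 2 - t * (c 0 + v * c 1) \<noteq> 0" "c' 2 - t * (c' 0 + v * c' 1) \<noteq> 0" by (simp_all add: algebra_simps)
    \<comment> \<open>The sheared linear forms, rescaled to be monic in x3.\<close>
    define b where "b i = inverse (c 2 - t * (c 0 + v * c 1)) * shear_coeff v t c i" for i
    define b' where "b' i = inverse (c' 2 - t * (c' 0 + v * c' 1)) * shear_coeff v t c' i" for i
    have lb: "lform b = scale (inverse (c 2 - t * (c 0 + v * c 1))) (lform (shear_coeff v t c))"
      "lform b' = scale (inverse (c' 2 - t * (c' 0 + v * c' 1))) (lform (shear_coeff v t c'))"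
      unfolding lform_def b_def b'_def sc.scale_sum_right sc.scale_scale by (rule refl)+
    show "p (plucker (shear v t e F) (shear v t e G)) = 0"
    proof (rule vanishes_monic[OF e p van shear_forms _ shear_forms])
      show "b 2 = 1" "b' 2 = 1" using t by (simp_all add: b_def b'_def shear_coeff_def)
      have z: "hat 0 = (\<lambda>m. 0 :: 'k)" by (simp add: fun_eq_iff)
      have "hat (lform (shear_coeff v t c) \<circ>\<^sub>d shear v t e F) m = hat 0 m" for m
        unfolding hat_act_shear[OF hat_shear[OF FG(1)]] FG(9)[unfolded l] z by (rule pair_zero_right)
      then have "lform (shear_coeff v t c) \<circ>\<^sub>d shear v t e F = 0" unfolding hat_inject by (rule allI)
      then show "lform b \<circ>\<^sub>d shear v t e F = 0" unfolding lb act_scale_left by (simp only: sc.scale_zero_right)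
      have "lform c' \<circ>\<^sub>d lform c \<circ>\<^sub>d G = 0"
        using FG(10) unfolding l act_mult act_commute[of "lform c'"] .
      then have "hat (lform (shear_coeff v t c') \<circ>\<^sub>d lform (shear_coeff v t c) \<circ>\<^sub>d shear v t e G) m = hat 0 m" for m
        unfolding hat_act_shear[OF hat_act_shear[OF hat_shear[OF FG(2)]]] z by (simp only: z pair_zero_right)
      then have "lform (shear_coeff v t c') \<circ>\<^sub>d lform (shear_coeff v t c) \<circ>\<^sub>d shear v t e G = 0"
        unfolding hat_inject by (rule allI)
      then show "lform b' \<circ>\<^sub>d lform b \<circ>\<^sub>d shear v t e G = 0"
        unfolding lb act_scale_left act_scale_right by (simp only: sc.scale_zero_right)
    qed
  qed
  then have "p (plucker F G) = 0" by (simp add: shear_0 FG)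
  then show "p (pl W) = 0" unfolding FG(3) hfun_pl[OF ind p] .
qed

subsection \<open>Irreducibility and dimension\<close>

text \<open>A Pluecker coordinate rescaled by factorials, so that on parametrized planes it is a 2 x
  2 minor of the tables \<open>tabF\<close> and \<open>tabG\<close>.\<close>

definition pcoord :: "nat \<Rightarrow> nat \<Rightarrow> nat \<Rightarrow> nat \<Rightarrow> nat \<Rightarrow> (3 mon \<times> 3 mon \<Rightarrow> 'k::field_char_0) \<Rightarrow> 'k" where
  "pcoord e j k j' k' y = mfact (mon3 (e - k - j) k j) * mfact (mon3 (e - k' - j') k' j') *
     y (mon3 (e - k - j) k j, mon3 (e - k' - j') k' j')"

lemma pcoord_hfun: "pcoord e j k j' k' \<in> hfun 1"
  using hf.scale[OF hfun_coord] unfolding pcoord_def[abs_def] .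

lemma pcoord_par:
  assumes "k + j \<le> e" "k' + j' \<le> e"
  shows "pcoord e j k j' k' (plucker (parF e t) (parG e t)) = tabF e t j k * tabG e t j' k' - tabF e t j' k' * tabG e t j k"
proof -
  have tabs: "hat (parF e t) (mon3 (e - k - j) k j) = tabF e t j k" "hat (parG e t) (mon3 (e - k - j) k j) = tabG e t j k"
    if "k + j \<le> e" for j k using that by (simp_all add: parF_def parG_def hat_hpol)
  show ?thesis unfolding tabs[OF assms(1), symmetric] tabs[OF assms(2), symmetric]
    by (simp add: pcoord_def plucker_def hat_def algebra_simps)
qed

lemmas tab_simps = tabF_def tabG_def tabH_def

text \<open>The coordinates of the parameter space are switched on one at a time.\<close>

lemma par_strict:
  fixes e :: nat
  assumes e: "e \<ge> 6" and i: "i < 3 * e + 3"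
  shows "\<exists>d. \<exists>p\<in>hfun d. (\<forall>t :: nat \<Rightarrow> 'k::field_char_0. (\<forall>j\<ge>i. t j = 0) \<longrightarrow> p (plucker (parF e t) (parG e t)) = 0) \<and>
    (\<exists>t. (\<forall>j>i. t j = 0) \<and> p (plucker (parF e t) (parG e t)) \<noteq> 0)"
    (is "?P i")
proof -
  have intro: "?P i" if "p \<in> hfun d" "\<And>t :: nat \<Rightarrow> 'k. (\<And>j. i \<le> j \<Longrightarrow> t j = 0) \<Longrightarrow> p (plucker (parF e t) (parG e t)) = 0"
    "\<And>j. i < j \<Longrightarrow> t j = 0" "p (plucker (parF e t) (parG e t)) \<noteq> 0" for p d t
    using that by blast
  define \<delta> where "\<delta> m j = (if j = m then 1 else 0 :: 'k)" for m j :: nat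
  consider "i < e" | "e \<le> i" "i < 2 * e" | "2 * e \<le> i" "i < 3 * e - 1" | "i = 3 * e - 1" | "i = 3 * e" | "i = 3 * e + 1" | "i = 3 * e + 2"
    using i by linarith
  then show ?thesis
  proof cases
    case 1
    \<comment> \<open>In the first four cases the leading entries 1 of the tables turn the minor at
      the chosen point into the new parameter up to sign: row 0 holds the parameters of F and G, row
      1 of G those of \<open>l1 \<circ>\<^sub>d G\<close>, row 2 of G brings in
      \<open>l2\<close>.\<close>
    show ?thesis
    proof (rule intro[where t = "\<delta> i", OF pcoord_hfun[of e 0 "i + 1" "Suc 0" 0]])
      show "pcoord e 0 (i + 1) (Suc 0) 0 (plucker (parF e t) (parG e t)) = 0" if "\<And>j. i \<le> j \<Longrightarrow> t j = 0" for t :: "nat \<Rightarrow> 'k"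
        using 1 that by (subst pcoord_par) (simp_all add: tab_simps tf_def)
      show "pcoord e 0 (i + 1) (Suc 0) 0 (plucker (parF e (\<delta> i)) (parG e (\<delta> i))) \<noteq> 0"
        using 1 by (subst pcoord_par) (simp_all add: tab_simps tf_def tg_def th_def \<delta>_def)
    qed (simp add: \<delta>_def)
  next
    case 2
    show ?thesis
    proof (rule intro[where t = "\<delta> i", OF pcoord_hfun[of e 0 0 0 "i + 1 - e"]])
      show "pcoord e 0 0 0 (i + 1 - e) (plucker (parF e t) (parG e t)) = 0" if "\<And>j. i \<le> j \<Longrightarrow> t j = 0" for t :: "nat \<Rightarrow> 'k"
        using 2 that by (subst pcoord_par) (simp_all add: tab_simps tf_def tg_def)
      show "pcoord e 0 0 0 (i + 1 - e) (plucker (parF e (\<delta> i)) (parG e (\<delta> i))) \<noteq> 0"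
        using 2 by (subst pcoord_par) (auto simp add: tab_simps tf_def tg_def th_def \<delta>_def)
    qed (simp add: \<delta>_def)
  next
    case 3
    show ?thesis
    proof (rule intro[where t = "\<delta> i", OF pcoord_hfun[of e 0 0 "Suc 0" "i + 1 - 2 * e"]])
      show "pcoord e 0 0 (Suc 0) (i + 1 - 2 * e) (plucker (parF e t) (parG e t)) = 0" if "\<And>j. i \<le> j \<Longrightarrow> t j = 0" for t :: "nat \<Rightarrow> 'k"
        using 3 that by (subst pcoord_par) (simp_all add: tab_simps tf_def tg_def th_def)
      show "pcoord e 0 0 (Suc 0) (i + 1 - 2 * e) (plucker (parF e (\<delta> i)) (parG e (\<delta> i))) \<noteq> 0"
        using 3 by (subst pcoord_par) (auto simp add: tab_simps tf_def tg_def th_def \<delta>_def)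
    qed (simp add: \<delta>_def)
  next
    case 4
    show ?thesis
    proof (rule intro[where t = "\<delta> i", OF pcoord_hfun[of e 0 0 "Suc (Suc 0)" 0]])
      show "pcoord e 0 0 (Suc (Suc 0)) 0 (plucker (parF e t) (parG e t)) = 0" if "\<And>j. i \<le> j \<Longrightarrow> t j = 0" for t :: "nat \<Rightarrow> 'k"
        using 4 e that by (subst pcoord_par) (simp_all add: tab_simps tf_def tg_def th_def)
      show "pcoord e 0 0 (Suc (Suc 0)) 0 (plucker (parF e (\<delta> i)) (parG e (\<delta> i))) \<noteq> 0"
        using 4 e by (subst pcoord_par) (auto simp add: tab_simps tf_def tg_def th_def \<delta>_def)
    qed (simp add: \<delta>_def)
  next
    case 5
    \<comment> \<open>Two consecutive entries in row 2 of G are linear in the two coefficients of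
      \<open>l2\<close>. This combination eliminates the first coefficient and leaves the second
      times a Hankel determinant in the coefficients of \<open>l1 \<circ>\<^sub>d G\<close>.\<close>
    define p where "p y = pcoord e 0 0 (Suc (Suc 0)) 0 y * pcoord e 0 0 (Suc 0) 1 y -
      pcoord e 0 0 (Suc (Suc 0)) 1 y * pcoord e 0 0 (Suc 0) 0 (y :: 3 mon \<times> 3 mon \<Rightarrow> 'k)" for y
    have p: "p \<in> hfun (1 + 1)" unfolding p_def[abs_def] by (intro hf.diff hf.mult pcoord_hfun)
    have pp: "p (plucker (parF e t) (parG e t)) = t (3 * e) * (t (2 * e + 1) - t (2 * e) ^ 2)"
      if "t (3 * e + 1) = 0" "t (3 * e + 2) = 0" for t
      unfolding p_def using e that
      by (simp add: pcoord_par tab_simps tf_def tg_def th_def algebra_simps power2_eq_square)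
    show ?thesis
    proof (rule intro[where t = "\<lambda>j. \<delta> (3 * e) j + \<delta> (2 * e + 1) j", OF p])
      show "p (plucker (parF e t) (parG e t)) = 0" if "\<And>j. i \<le> j \<Longrightarrow> t j = 0" for t :: "nat \<Rightarrow> 'k"
        using 5 that by (simp add: pp)
      show "p (plucker (parF e (\<lambda>j. \<delta> (3 * e) j + \<delta> (2 * e + 1) j)) (parG e (\<lambda>j. \<delta> (3 * e) j + \<delta> (2 * e + 1) j))) \<noteq> 0"
        using e by (subst pp) (simp_all add: \<delta>_def)
    qed (use 5 e in \<open>simp add: \<delta>_def\<close>)
  next
    case 6
    \<comment> \<open>Row 1 of F vanishes when both coefficients of \<open>l1\<close> do, so a minor
      within row 1 detects the first of them.\<close>
    show ?thesis
    proof (rule intro[where t = "\<lambda>j. \<delta> (3 * e + 1) j + \<delta> 0 j", OF pcoord_hfun[of e "Suc 0" 0 "Suc 0" 1]])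
      show "pcoord e (Suc 0) 0 (Suc 0) 1 (plucker (parF e t) (parG e t)) = 0" if "\<And>j. i \<le> j \<Longrightarrow> t j = 0" for t :: "nat \<Rightarrow> 'k"
        using 6 e that by (subst pcoord_par) (simp_all add: tab_simps)
      show "pcoord e (Suc 0) 0 (Suc 0) 1 (plucker (parF e (\<lambda>j. \<delta> (3 * e + 1) j + \<delta> 0 j)) (parG e (\<lambda>j. \<delta> (3 * e + 1) j + \<delta> 0 j))) \<noteq> 0"
        using e by (subst pcoord_par) (simp_all add: tab_simps tf_def tg_def th_def \<delta>_def)
    qed (use 6 e in \<open>simp add: \<delta>_def\<close>)
  next
    case 7
    define A where "A k k' y = pcoord e (Suc 0) k (Suc 0) k' (y :: 3 mon \<times> 3 mon \<Rightarrow> 'k)" for k k' y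
    define B where "B k k' y = pcoord e 0 k 0 k' (y :: 3 mon \<times> 3 mon \<Rightarrow> 'k)" for k k' y
    \<comment> \<open>Laplace expansion of a \<open>4 \<times> 4\<close> minor of the matrix of \<open>x\<^sub>3F, x\<^sub>3G, x\<^sub>1F, x\<^sub>1G\<close>; if \<open>b = 0\<close>, then \<open>x\<^sub>3F = -a x\<^sub>1F\<close>.\<close>
    define p where "p y = A 0 1 y * B 2 3 y - A 0 2 y * B 1 3 y + A 0 3 y * B 1 2 y + A 1 2 y * B 0 3 y
      - A 1 3 y * B 0 2 y + A 2 3 y * B 0 1 y" for y
    have AB: "A k k' \<in> hfun 1" "B k k' \<in> hfun 1" for k k'
      using pcoord_hfun unfolding A_def[abs_def] B_def[abs_def] by blast+
    have p: "p \<in> hfun (1 + 1)" unfolding p_def[abs_def] by (intro hf.diff hf.add hf.mult AB)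
    have A: "A k k' (plucker (parF e t) (parG e t)) = tabF e t (Suc 0) k * tabG e t (Suc 0) k' - tabF e t (Suc 0) k' * tabG e t (Suc 0) k"
      and B: "B k k' (plucker (parF e t) (parG e t)) = tf e t k * tg e t k' - tf e t k' * tg e t k"
      if "k \<le> 3" "k' \<le> 3" for k k' t
      unfolding A_def B_def using that e by (simp_all add: pcoord_par) (simp_all add: tab_simps)
    show ?thesis
    proof (rule intro[where t = "\<lambda>j. \<delta> (3 * e + 2) j + \<delta> 1 j + \<delta> (e + 2) j", OF p])
      fix t :: "nat \<Rightarrow> 'k" assume "\<And>j. i \<le> j \<Longrightarrow> t j = 0"
      then have "t (3 * e + 2) = 0" using 7 by simp
      then have "tabF e t (Suc 0) k = - t (3 * e + 1) * tf e t k" for k by (simp add: tab_simps)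
      then show "p (plucker (parF e t) (parG e t)) = 0"
        unfolding p_def by (simp add: A B algebra_simps)
    next
      \<comment> \<open>Besides the second coefficient of \<open>l1\<close> only one coefficient of
        F and one of G are switched on; the resulting value 2 is nonzero in characteristic
        zero.\<close>
      let ?t = "\<lambda>j. \<delta> (3 * e + 2) j + \<delta> 1 j + \<delta> (e + 2) j"
      have f: "tf e ?t 0 = 1" "tf e ?t 1 = 0" "tf e ?t 2 = 1" "tf e ?t 3 = 0" "tf e ?t 4 = 0"
        and g: "tg e ?t 0 = 0" "tg e ?t 1 = 0" "tg e ?t 2 = 0" "tg e ?t 3 = 1" "tg e ?t 4 = 0"
        and h: "th e ?t 0 = 1" "th e ?t 1 = 0" "th e ?t 2 = 0" "th e ?t 3 = 0"
        using e by (simp_all add: tf_def tg_def th_def \<delta>_def)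
      have ab: "?t (3 * e + 1) = 0" "?t (3 * e + 2) = 1" using e by (simp_all add: \<delta>_def)
      have F1: "tabF e ?t (Suc 0) k = - tf e ?t (Suc k)" and G1: "tabG e ?t (Suc 0) k = th e ?t k - tg e ?t (Suc k)" for k
        unfolding tab_simps ab by simp_all
      have S: "Suc 0 = 1" "Suc 1 = 2" "Suc 2 = 3" "Suc 3 = 4" by simp_all
      have F: "tabF e ?t (Suc 0) 0 = 0" "tabF e ?t (Suc 0) 1 = -1" "tabF e ?t (Suc 0) 2 = 0" "tabF e ?t (Suc 0) 3 = 0"
        and G: "tabG e ?t (Suc 0) 0 = 1" "tabG e ?t (Suc 0) 1 = 0" "tabG e ?t (Suc 0) 2 = -1" "tabG e ?t (Suc 0) 3 = 0"
        unfolding F1 G1 unfolding S f g h by simp_all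
      have le: "0 \<le> (3::nat)" "1 \<le> (3::nat)" "2 \<le> (3::nat)" "3 \<le> (3::nat)" by simp_all
      have "p (plucker (parF e ?t) (parG e ?t)) = 2"
        unfolding p_def A[OF le(1) le(2)] A[OF le(1) le(3)] A[OF le(1) le(4)] A[OF le(2) le(3)] A[OF le(2) le(4)] A[OF le(3) le(4)]
          B[OF le(1) le(2)] B[OF le(1) le(3)] B[OF le(1) le(4)] B[OF le(2) le(3)] B[OF le(2) le(4)] B[OF le(3) le(4)]
          F G f g by simp
      then show "p (plucker (parF e ?t) (parG e ?t)) \<noteq> 0" by simp
    qed (use 7 e in \<open>simp add: \<delta>_def\<close>)
  qed
qed

definition par :: "nat \<Rightarrow> (nat \<Rightarrow> 'k) \<Rightarrow> 'k::field_char_0 poly3 set" where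
  "par e t = sc.span {parF e t, parG e t}"

lemma hfun_par: "e > 0 \<Longrightarrow> p \<in> hfun d \<Longrightarrow> p (pl (par e t)) = 0 \<longleftrightarrow> p (plucker (parF e t) (parG e t)) = 0"
  unfolding par_def by (rule hfun_pl[OF par_indep2])

lemma family_subset: "family e \<subseteq> grassmannian e"
  by (auto simp: family_def)

text \<open>Homogeneous functions pull back to polynomial functions of the parameters, where a
  product vanishes only if a factor does.\<close>

lemma prime_set_par:
  fixes \<tau> :: "(nat \<Rightarrow> 'k::field_char_0) \<Rightarrow> nat \<Rightarrow> 'k"
  assumes e: "e > 0" and \<tau>: "\<And>i. i < 3 * e + 3 \<Longrightarrow> (\<lambda>t. \<tau> t i) \<in> pfun n 1"
  shows "prime_set (range (\<lambda>t. par e (\<tau> t)))"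
proof -
  have van: "vanishes f (range (\<lambda>t. par e (\<tau> t))) \<longleftrightarrow> (\<forall>t. f (plucker (parF e (\<tau> t)) (parG e (\<tau> t))) = 0)" if "f \<in> hfun d" for f d
    using hfun_par[OF e that] by (simp add: vanishes_def)
  have pf: "(\<lambda>t. f (plucker (parF e (\<tau> t)) (parG e (\<tau> t)))) \<in> pfun n (d * ((1 + e) + (1 + e)))" if "f \<in> hfun d" for f d
    by (rule hfun_pfun[OF that plucker_par_pfun[OF e \<tau>]])
  have "vanishes f (range (\<lambda>t. par e (\<tau> t))) \<or> vanishes g (range (\<lambda>t. par e (\<tau> t)))"
    if fg: "f \<in> hfun d" "g \<in> hfun d'" "vanishes (\<lambda>y. f y * g y) (range (\<lambda>t. par e (\<tau> t)))" for f g d d'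
    unfolding van[OF fg(1)] van[OF fg(2)]
    by (rule pfun_prime[OF pf[OF fg(1)] pf[OF fg(2)]]) (use fg(3)[unfolded van[OF hf.mult[OF fg(1,2)]]] in blast)
  then show ?thesis unfolding prime_set_def by blast
qed

lemma prime_set_face:
  assumes e: "e > 0" shows "prime_set (par e ` {t :: nat \<Rightarrow> 'k::field_char_0. \<forall>j\<ge>i. t j = 0})"
proof -
  define \<tau> where "\<tau> t j = (if j < i then t j else 0 :: 'k)" for t j
  have \<tau>: "(\<lambda>t. \<tau> t j) \<in> pfun (3 * e + 3) 1" if "j < 3 * e + 3" for j
    using pfun_coord[OF that] pf.zero[of "3 * e + 3" 1] by (cases "j < i") (simp_all add: \<tau>_def)
  have "{t :: nat \<Rightarrow> 'k. \<forall>j\<ge>i. t j = 0} = range \<tau>"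
  proof (intro equalityI subsetI)
    fix t :: "nat \<Rightarrow> 'k" assume "t \<in> {t. \<forall>j\<ge>i. t j = 0}"
    then have "\<tau> t = t" by (auto simp: \<tau>_def fun_eq_iff)
    then show "t \<in> range \<tau>" using rangeI[of \<tau> t] by simp
  qed (auto simp: \<tau>_def)
  then show ?thesis using prime_set_par[OF e \<tau>] by (simp add: image_image)
qed

lemma irreducible_subtopology:
  assumes "V \<subseteq> grassmannian e" "Z \<subseteq> V"
  shows "irreducible_space (subtopology (subtopology (zariski e) V) Z) \<longleftrightarrow> prime_set Z"
proof -
  have "V \<inter> Z = Z" using assms(2) by blast
  then show ?thesis using irreducible_zariski_iff[of Z e] assms by (simp add: subtopology_subtopology)
qed

lemma vanishes_family_iff:
  fixes p :: "(3 mon \<times> 3 mon \<Rightarrow> 'k::field_char_0) \<Rightarrow> 'k"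
  assumes e: "e > 0" and p: "p \<in> hfun d"
  shows "vanishes p (family e) \<longleftrightarrow> vanishes p (range (par e))"
proof
  have "range (par e) \<subseteq> (family e :: 'k poly3 set set)" using par_family[OF e] by (auto simp: par_def)
  then show "vanishes p (family e) \<Longrightarrow> vanishes p (range (par e))" unfolding vanishes_def by blast
  assume "vanishes p (range (par e))"
  then show "vanishes p (family e)" using vanishes_family[OF e p] hfun_par[OF e p] by (simp add: vanishes_def)
qed

text \<open>By density the family has the same vanishing functions as the image of the parameter
  space and inherits its primality.\<close>

lemma prime_set_family:
  assumes e: "e > 0" shows "prime_set (family e :: 'k::field_char_0 poly3 set set)"
proof -
  have p: "prime_set (range (par e :: (nat \<Rightarrow> 'k) \<Rightarrow> _))"
    by (rule prime_set_par[OF e, where \<tau> = "\<lambda>t. t"]) (rule pfun_coord)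
  have "family e \<noteq> ({} :: 'k poly3 set set)" using par_family[OF e] by blast
  moreover have "vanishes f (family e) \<or> vanishes g (family e)"
    if fg: "f \<in> hfun d" "g \<in> hfun d'" "vanishes (\<lambda>y. f y * g y) (family e)" for d d' and f g :: "(3 mon \<times> 3 mon \<Rightarrow> 'k) \<Rightarrow> 'k"
    using fg(3) unfolding vanishes_family_iff[OF e hf.mult[OF fg(1,2)]] vanishes_family_iff[OF e fg(1)] vanishes_family_iff[OF e fg(2)]
    by (rule prime_setD[OF p fg(1,2)])
  ultimately show ?thesis unfolding prime_set_def by blast
qed

lemma krull_dim_family:
  assumes e: "e \<ge> 6"
  shows "krull_dim (subtopology (zariski e) (family e :: 'k::field_char_0 poly3 set set)) = enat (3 * (e + 1))"
proof (rule antisym)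
  let ?V = "family e :: 'k poly3 set set"
  let ?T = "subtopology (zariski e) ?V"
  have e0: "e > 0" using e by simp
  have closed_sub: "Z \<subseteq> ?V" if "closedin ?T Z" for Z using closedin_subset[OF that] by simp
  show "krull_dim ?T \<le> enat (3 * (e + 1))"
    unfolding krull_dim_def
  proof (rule Sup_least)
    fix x assume "x \<in> {enat n | n. \<exists>Z. (\<forall>i\<le>n. closedin ?T (Z i) \<and> irreducible_space (subtopology ?T (Z i))) \<and>
       (\<forall>i<n. Z i \<subset> Z (Suc i))}"
    then obtain n Z where x: "x = enat n" and Z: "\<And>i. i \<le> n \<Longrightarrow> closedin ?T (Z i)"
      "\<And>i. i \<le> n \<Longrightarrow> irreducible_space (subtopology ?T (Z i))" "\<And>i. i < n \<Longrightarrow> Z i \<subset> Z (Suc i)" by blast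
    have "n \<le> 3 * e + 3"
    proof (rule chain_bound[where Z = Z and V = ?V and \<psi> = "\<lambda>t. plucker (parF e t) (parG e t)", OF family_subset _ _ Z(1) _ Z(3)])
      show "(\<lambda>t. plucker (parF e t) (parG e t) i) \<in> pfun (3 * e + 3) ((1 + e) + (1 + e))" for i
        by (rule plucker_par_pfun[OF e0 pfun_coord])
      show "vanishes f (family e)" if "f \<in> hfun d" "\<And>t. f (plucker (parF e t) (parG e t)) = 0" for d and f :: "_ \<Rightarrow> 'k"
        by (rule vanishes_family[OF e0 that])
      show "prime_set (Z i)" if "i \<le> n" for i
        using Z(2)[OF that] irreducible_subtopology[OF family_subset closed_sub[OF Z(1)[OF that]]] by simp
    qed
    then show "x \<le> enat (3 * (e + 1))" by (simp add: x)
  qed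
  define L where "L i = {t :: nat \<Rightarrow> 'k. \<forall>j\<ge>i. t j = 0}" for i :: nat
  \<comment> \<open>Closures of the images of the subspaces with i free coordinates; strictness of
    the inclusions is \<open>par_strict\<close>.\<close>
  define Z where "Z i = zclosure ?V (par e ` L i)" for i
  have sub: "par e ` L i \<subseteq> ?V" for i using par_family[OF e0] by (auto simp: par_def)
  have "closedin ?T (Z i) \<and> irreducible_space (subtopology ?T (Z i))" for i
  proof
    show c: "closedin ?T (Z i)" unfolding Z_def by (rule closedin_zclosure[OF family_subset])
    show "irreducible_space (subtopology ?T (Z i))"
      unfolding irreducible_subtopology[OF family_subset closed_sub[OF c]]
      unfolding Z_def L_def by (rule prime_zclosure[OF sub[unfolded L_def] prime_set_face[OF e0]])
  qed
  moreover have "Z i \<subset> Z (Suc i)" if i: "i < 3 * e + 3" for i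
  proof
    have "L i \<subseteq> L (Suc i)" by (auto simp: L_def)
    then show "Z i \<subseteq> Z (Suc i)" unfolding Z_def zclosure_def vanishes_def by blast
    obtain d p t where p: "p \<in> hfun d" "\<And>t. t \<in> L i \<Longrightarrow> p (plucker (parF e t) (parG e t)) = 0"
      and t: "t \<in> L (Suc i)" "p (plucker (parF e t) (parG e t)) \<noteq> 0"
      using par_strict[OF e i, where 'k = 'k] unfolding L_def mem_Collect_eq Suc_le_eq by blast
    have "vanishes p (par e ` L i)" using p(2) hfun_par[OF e0 p(1)] by (simp add: vanishes_def)
    moreover have "p (pl (par e t)) \<noteq> 0" using t(2) hfun_par[OF e0 p(1)] by simp
    ultimately have "par e t \<notin> Z i" unfolding Z_def zclosure_def using p(1) by blast
    moreover have "par e t \<in> Z (Suc i)" unfolding Z_def zclosure_def using t(1) sub[of "Suc i"] by (auto simp: vanishes_def)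
    ultimately show "Z i \<noteq> Z (Suc i)" by blast
  qed
  ultimately show "enat (3 * (e + 1)) \<le> krull_dim ?T"
    unfolding krull_dim_def by (intro Sup_upper CollectI exI[of _ "3 * (e + 1)"] exI[of _ Z] conjI) simp_all
qed

theorem theorem3p2:
  fixes e :: nat
  assumes "e > 0"
  shows
    "(\<exists>U :: 'k::field_char_0 poly3 set set.
        openin (subtopology (zariski e) (family e)) U \<and> U \<noteq> {} \<and>
        (\<forall>W\<in>U. has_hvector (inverse_system_ideal W) e (hvec e))) \<and>
     (e \<ge> 6 \<longrightarrow>
        (\<forall>I :: 'k poly3 set. artinian_level I \<and> has_hvector I e (hvec e) \<longrightarrow>
           (\<exists>W\<in>family e. I = inverse_system_ideal W)) \<and>
        irreducible_variety_of_dim e (family e :: 'k poly3 set set) (3 * (e + 1))) \<and>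
     ((odd e \<and> e \<ge> 9) \<or> (even e \<and> e \<ge> 12) \<longrightarrow>
        (\<forall>I :: 'k poly3 set. artinian_level I \<and> has_hvector I e (hvec e) \<longrightarrow>
           \<not> weak_Lefschetz I))"
proof (intro conjI impI)
  show "\<exists>U :: 'k poly3 set set. openin (subtopology (zariski e) (family e)) U \<and> U \<noteq> {} \<and>
      (\<forall>W\<in>U. has_hvector (inverse_system_ideal W) e (hvec e))"
    by (rule generic_hvector[OF assms])
next
  assume "e \<ge> 6"
  then show "\<forall>I :: 'k poly3 set. artinian_level I \<and> has_hvector I e (hvec e) \<longrightarrow>
      (\<exists>W\<in>family e. I = inverse_system_ideal W)"
    using level_in_family by blast
next
  assume e: "e \<ge> 6"
  show "irreducible_variety_of_dim e (family e :: 'k poly3 set set) (3 * (e + 1))"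
    unfolding irreducible_variety_of_dim_def
  proof (intro conjI impI)
    show "irreducible_space (subtopology (zariski e) (family e :: 'k poly3 set set))"
      unfolding irreducible_zariski_iff[OF family_subset] by (rule prime_set_family[OF assms])
    show "krull_dim (subtopology (zariski e) (family e :: 'k poly3 set set)) = enat (3 * (e + 1))"
      by (rule krull_dim_family[OF e])
    assume "\<forall>p :: 'k poly. Polynomial.degree p > 0 \<longrightarrow> (\<exists>x. poly p x = 0)"
    then have "closedin (zariski e) (family e :: 'k poly3 set set)" by (rule closedin_family)
    \<comment> \<open>The family is even closed, so the whole Grassmannian serves as the open
      set.\<close>
    then show "locally_closed_in (zariski e) (family e :: 'k poly3 set set)"
      unfolding locally_closed_in_def
      by (intro exI[of _ "topspace (zariski e)"] exI[of _ "family e"]) (use closedin_subset in auto)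
  qed
next
  assume "(odd e \<and> e \<ge> 9) \<or> (even e \<and> e \<ge> 12)"
  then show "\<forall>I :: 'k poly3 set. artinian_level I \<and> has_hvector I e (hvec e) \<longrightarrow> \<not> weak_Lefschetz I"
    using not_weak_Lefschetz by blast
qed

end
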